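(* Let $I\subset\mathbb R$ be an interval unbounded on the right and let $\rho$ be a Vishik–Fursikov measure over $I$. Suppose that the push-forward measure $\Pi_t\rho$ on $H$ does not depend on $t\in I$. Then there exists an invariant Vishik–Fursikov measure $\tilde\rho$ over $I$ such that $\Pi_t\rho=\Pi_t\tilde\rho$ for all $t\in I$. In other words, every Vishik–Fursikov statistical solution whose measures do not change in time is a Vishik–Fursikov stationary statistical solution.
   Context: Setting. $\Omega\subset\mathbb R^3$ is either the box $\prod_{i=1}^3(0,L_i)$ with periodic boundary conditions (all fields having zero mean over $\Omega$), or a bounded domain with smooth boundary with no-slip boundary condition. $H$ is the closure in $L^2(\Omega)^3$ of the smooth divergence-free test fields (periodic with zero mean, resp. compactly supported in $\Omega$), with inner product $(\cdot,\cdot)$ and norm $|\cdot|$; $V$ is their closure in $H^1(\Omega)^3$ with norm $\|u\|=(\sum_i|\partial_i u|^2)^{1/2}$; $V'$ is the dual of $V$. $A$ is the Stokes operator ($\langle Au,v\rangle=((u,v))$), $D(A)=\{u\in V:Au\in H\}$, $\lambda_1>0$ its first eigenvalue. $B(u,v)\in V'$ is given by $\langle B(u,v),w\rangle=\int_\Omega (u\cdot\nabla)v\cdot w$. Fix $\nu>0$ and a time-independent $f\in H$; the Navier–Stokes equations are $u'+\nu Au+B(u,u)=f$. Weak solutions. A (Leray–Hopf) weak solution on an interval $I\subset\mathbb R$ is a function $u:I\to H$ with $u\in L^\infty_{loc}(I;H)\cap L^2_{loc}(I;V)$, $\partial_tu\in L^{4/3}_{loc}(I;V')$, $u$ weakly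 continuous into $H$, satisfying the equation in the distribution sense on $I$ with values in $V'$, such that for almost every $t'\in I$ (the points of strong right-continuity of $u$) the energy inequality $\frac12|u(t)|^2+\nu\int_{t'}^t\|u\|^2\,ds\le\frac12|u(t')|^2+\int_{t'}^t(f,u)\,ds$ holds for all $t\in I$, $t>t'$, and such that, if $I$ is closed and bounded on the left with left endpoint $t_0$, $u(t)\to u(t_0)$ strongly in $H$ as $t\to t_0^+$. Trajectory spaces. $H_w$ is $H$ with its weak topology, $B_H(R)$ the closed ball of radius $R$ in $H$. For an interval $I$, $\mathcal C_{loc}(I,H_w)$ is the space of weakly continuous maps $I\to H$ with the topology of uniform convergence in $H_w$ on compact subintervals of $I$. $\Pi_t u=u(t)$; for $I$ unbounded on the right and $\tau\ge0$, $(\sigma_\tau u)(t)=u(t+\tau)$. $\mathcal U_I^\sharp$ denotes the set of $u\in\mathcal C_{loc}(I,H_w)$ which are weak solutions on the interior of $I$. Vishik–Fursikov measures. A Vishik–Fursikov measure over $I$ is a Borel probability measure $\rho$ on $\mathcal C_{loc}(I,H_w)$ such that (i) $\rho(\mathcal U_I^\sharp)=1$; (ii) $t\mapsto\int|u(t)|^2\,d\rho(u)$ belongs to $L^\infty_{loc}(I)$; (iii) if $I$ is closed and bounded on the left with left endpoint $t_0$, then for every nonnegative increasing $C^1$ function $\psi:[0,\infty)\to\mathbb R$ with bounded derivative, $\lim_{t\to t_0^+}\int\psi(|u(t)|^2)d\rho(u)=\int\psi(|u(t_0)|^2)d\rho(u)<\infty$. $\Pi_t\rho$ denotes the push-forward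 measure $E\mapsto\rho(\Pi_t^{-1}E)$ on $H$. If $I$ is unbounded on the right, $\rho$ is invariant if $\rho(\sigma_\tau^{-1}\mathcal E)=\rho(\mathcal E)$ for all Borel $\mathcal E$ and all $\tau\ge0$. A Vishik–Fursikov stationary statistical solution is a Borel probability measure $\rho_0$ on $H$ with $\rho_0=\Pi_t\rho$ for all $t\in I$, for some invariant Vishik–Fursikov measure $\rho$ over some interval $I$ unbounded on the right. *)

theory Defs
  imports "HOL-Analysis.Analysis" "HOL-Probability.Probability"
begin

fun Ck_on :: "nat \<Rightarrow> 'a::real_normed_vector set \<Rightarrow> ('a \<Rightarrow> 'b::real_normed_vector) \<Rightarrow> bool" where
  "Ck_on 0 U f = continuous_on U f"
| "Ck_on (Suc n) U f = (f differentiable_on U \<and> (\<forall>v. Ck_on n U (\<lambda>x. frechet_derivative f (at x) v)))"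

definition smooth_on :: "'a::real_normed_vector set \<Rightarrow> ('a \<Rightarrow> 'b::real_normed_vector) \<Rightarrow> bool" where
  "smooth_on U f \<longleftrightarrow> (\<forall>n. Ck_on n U f)"

type_synonym point = "real^3"
type_synonym field = "real^3 \<Rightarrow> real^3"

text \<open>Either the periodic box prod (0,L_i), or a bounded smooth domain with no-slip condition.\<close>
datatype ns_dom = Periodic "real^3" | Bounded "(real^3) set"

fun Omega :: "ns_dom \<Rightarrow> (real^3) set" where
  "Omega (Periodic L) = box 0 L"
| "Omega (Bounded W) = W"

definition smooth_boundary :: "(real^3) set \<Rightarrow> bool" where
  "smooth_boundary W \<longleftrightarrow> (\<forall>p\<in>frontier W. \<exists>U (\<phi>::real^3 \<Rightarrow> real).
      open U \<and> p \<in> U \<and> smooth_on U \<phi> \<and> (\<forall>x\<in>U. frechet_derivative \<phi> (at x) \<noteq> (\<lambda>_. 0)) \<and>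
      W \<inter> U = {x\<in>U. \<phi> x < 0})"

fun admissible_dom :: "ns_dom \<Rightarrow> bool" where
  "admissible_dom (Periodic L) = (\<forall>i. L $ i > 0)"
| "admissible_dom (Bounded W) = (open W \<and> bounded W \<and> connected W \<and> W \<noteq> {} \<and> smooth_boundary W)"

definition partial :: "field \<Rightarrow> 3 \<Rightarrow> field" where
  "partial \<phi> i = (\<lambda>x. frechet_derivative \<phi> (at x) (axis i 1))"

definition divergence :: "field \<Rightarrow> point \<Rightarrow> real" where
  "divergence \<phi> x = (\<Sum>i\<in>UNIV. partial \<phi> i x $ i)"

fun test_field :: "ns_dom \<Rightarrow> field \<Rightarrow> bool" where
  "test_field (Periodic L) \<phi> =
     (smooth_on UNIV \<phi> \<and> (\<forall>x i. \<phi> (x + axis i (L $ i)) = \<phi> x) \<and> (\<forall>x. divergence \<phi> x = 0) \<and>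
      integral\<^sup>L (lebesgue_on (box 0 L)) \<phi> = 0)"
| "test_field (Bounded W) \<phi> =
     (smooth_on UNIV \<phi> \<and> compact (closure {x. \<phi> x \<noteq> 0}) \<and> closure {x. \<phi> x \<noteq> 0} \<subseteq> W \<and>
      (\<forall>x. divergence \<phi> x = 0))"

section \<open>The spaces H and V (elements are represented by functions, equality a.e. on Omega)\<close>

definition sq_int :: "ns_dom \<Rightarrow> field \<Rightarrow> bool" where
  "sq_int D u \<longleftrightarrow> u \<in> borel_measurable (lebesgue_on (Omega D)) \<and>
     integrable (lebesgue_on (Omega D)) (\<lambda>x. (norm (u x))\<^sup>2)"

definition l2dist :: "ns_dom \<Rightarrow> field \<Rightarrow> field \<Rightarrow> real" where
  "l2dist D u v = sqrt (\<integral>x. (norm (u x - v x))\<^sup>2 \<partial>lebesgue_on (Omega D))"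

definition Hspace :: "ns_dom \<Rightarrow> field set" where
  "Hspace D = {u. sq_int D u \<and> (\<exists>\<phi>. (\<forall>n. test_field D (\<phi> n)) \<and> (\<lambda>n. l2dist D (\<phi> n) u) \<longlonglongrightarrow> 0)}"

definition inner_H :: "ns_dom \<Rightarrow> field \<Rightarrow> field \<Rightarrow> real" where
  "inner_H D u v = (\<integral>x. u x \<bullet> v x \<partial>lebesgue_on (Omega D))"

definition norm_H :: "ns_dom \<Rightarrow> field \<Rightarrow> real" where
  "norm_H D u = sqrt (inner_H D u u)"

definition V_grad :: "ns_dom \<Rightarrow> field \<Rightarrow> (3 \<Rightarrow> field) \<Rightarrow> bool" where
  "V_grad D u G \<longleftrightarrow> sq_int D u \<and> (\<forall>i. sq_int D (G i)) \<and>
     (\<exists>\<phi>. (\<forall>n. test_field D (\<phi> n)) \<and> (\<lambda>n. l2dist D (\<phi> n) u) \<longlonglongrightarrow> 0 \<and>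
          (\<forall>i. (\<lambda>n. l2dist D (partial (\<phi> n) i) (G i)) \<longlonglongrightarrow> 0))"

definition Vspace :: "ns_dom \<Rightarrow> field set" where
  "Vspace D = {u. \<exists>G. V_grad D u G}"

definition grad :: "ns_dom \<Rightarrow> field \<Rightarrow> 3 \<Rightarrow> field" where
  "grad D u = (SOME G. V_grad D u G)"

definition inner_V :: "ns_dom \<Rightarrow> field \<Rightarrow> field \<Rightarrow> real" where
  "inner_V D u v = (\<Sum>i\<in>UNIV. inner_H D (grad D u i) (grad D v i))"

definition norm_V :: "ns_dom \<Rightarrow> field \<Rightarrow> real" where
  "norm_V D u = sqrt (inner_V D u u)"

definition trilin :: "ns_dom \<Rightarrow> field \<Rightarrow> field \<Rightarrow> field \<Rightarrow> real" where
  "trilin D u v w = (\<integral>x. (\<Sum>j\<in>UNIV. \<Sum>k\<in>UNIV. u x $ j * grad D v j x $ k * w x $ k) \<partial>lebesgue_on (Omega D))"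

text \<open>V'-norm of f - nu A u - B(u,u), i.e. of the time derivative prescribed by the equation.\<close>
definition resid_dual_norm :: "ns_dom \<Rightarrow> real \<Rightarrow> field \<Rightarrow> field \<Rightarrow> ennreal" where
  "resid_dual_norm D \<nu> f u =
     (SUP v\<in>{v\<in>Vspace D. norm_V D v \<le> 1}.
        ennreal \<bar>inner_H D f v - \<nu> * inner_V D u v - trilin D u u v\<bar>)"

definition weak_solution :: "ns_dom \<Rightarrow> real \<Rightarrow> field \<Rightarrow> real set \<Rightarrow> (real \<Rightarrow> field) \<Rightarrow> bool" where
  "weak_solution D \<nu> f J u \<longleftrightarrow>
     \<comment> \<open>u : J -> H, weakly continuous\<close>
     (\<forall>t\<in>J. u t \<in> Hspace D) \<and>
     (\<forall>v\<in>Hspace D. continuous_on J (\<lambda>t. inner_H D (u t) v)) \<and>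
     \<comment> \<open>u in L^infty_loc(J;H)\<close>
     (\<forall>a b. {a..b} \<subseteq> J \<longrightarrow> (\<exists>C. AE t in lebesgue_on {a..b}. norm_H D (u t) \<le> C)) \<and>
     \<comment> \<open>u in L^2_loc(J;V)\<close>
     (AE t in lebesgue_on J. u t \<in> Vspace D) \<and>
     (\<lambda>t. norm_V D (u t)) \<in> borel_measurable (lebesgue_on J) \<and>
     (\<forall>a b. {a..b} \<subseteq> J \<longrightarrow> integrable (lebesgue_on {a..b}) (\<lambda>t. (norm_V D (u t))\<^sup>2)) \<and>
     \<comment> \<open>partial_t u = f - nu A u - B(u,u) in L^{4/3}_loc(J;V')\<close>
     (\<lambda>t. resid_dual_norm D \<nu> f (u t)) \<in> borel_measurable (lebesgue_on J) \<and>
     (AE t in lebesgue_on J. resid_dual_norm D \<nu> f (u t) < \<infinity>) \<and>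
     (\<forall>a b. {a..b} \<subseteq> J \<longrightarrow>
        (\<integral>\<^sup>+ t. ennreal (enn2real (resid_dual_norm D \<nu> f (u t)) powr (4/3)) \<partial>lebesgue_on {a..b}) < \<infinity>) \<and>
     \<comment> \<open>the equation in the sense of distributions on J, tested against every v in V\<close>
     (\<forall>v\<in>Vspace D. \<forall>\<phi>::real \<Rightarrow> real.
        smooth_on UNIV \<phi> \<and> compact (closure {t. \<phi> t \<noteq> 0}) \<and> closure {t. \<phi> t \<noteq> 0} \<subseteq> J \<longrightarrow>
        (let g = (\<lambda>t. - inner_H D (u t) v * deriv \<phi> t
                      + (\<nu> * inner_V D (u t) v + trilin D (u t) (u t) v - inner_H D f v) * \<phi> t)
         in integrable (lebesgue_on J) g \<and> (\<integral>t. g t \<partial>lebesgue_on J) = 0)) \<and>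
     \<comment> \<open>energy inequality for almost every t'\<close>
     (AE t' in lebesgue_on J. \<forall>t\<in>J. t' < t \<longrightarrow>
        (norm_H D (u t))\<^sup>2 / 2 + \<nu> * (\<integral>s. (norm_V D (u s))\<^sup>2 \<partial>lebesgue_on {t'..t})
          \<le> (norm_H D (u t'))\<^sup>2 / 2 + (\<integral>s. inner_H D f (u s) \<partial>lebesgue_on {t'..t}))"

definition borel_of :: "'a topology \<Rightarrow> 'a measure" where
  "borel_of X = sigma (topspace X) {U. openin X U}"

definition Hw :: "ns_dom \<Rightarrow> field topology" where
  "Hw D = subtopology
     (topology_generated_by {{x. inner_H D x v \<in> U} | v U. v \<in> Hspace D \<and> open U}) (Hspace D)"

text \<open>C_loc(I, H_w): weakly continuous maps I -> H (values outside I are irrelevant).\<close>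
definition Traj :: "ns_dom \<Rightarrow> real set \<Rightarrow> (real \<Rightarrow> field) set" where
  "Traj D I = {u. (\<forall>t\<in>I. u t \<in> Hspace D) \<and> (\<forall>v\<in>Hspace D. continuous_on I (\<lambda>t. inner_H D (u t) v))}"

definition TrajTop :: "ns_dom \<Rightarrow> real set \<Rightarrow> (real \<Rightarrow> field) topology" where
  "TrajTop D I = subtopology
     (topology_generated_by
        {{w \<in> Traj D I. \<forall>t\<in>K. \<forall>v\<in>F. \<bar>inner_H D (w t) v - inner_H D (u t) v\<bar> < \<epsilon>}
          | u K F \<epsilon>. u \<in> Traj D I \<and> compact K \<and> K \<subseteq> I \<and> finite F \<and> F \<subseteq> Hspace D \<and> \<epsilon> > 0})
     (Traj D I)"

definition Usharp :: "ns_dom \<Rightarrow> real \<Rightarrow> field \<Rightarrow> real set \<Rightarrow> (real \<Rightarrow> field) set" where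
  "Usharp D \<nu> f I = {u \<in> Traj D I. weak_solution D \<nu> f (interior I) u}"

definition admissible_psi :: "(real \<Rightarrow> real) \<Rightarrow> bool" where
  "admissible_psi \<psi> \<longleftrightarrow> (\<forall>x\<ge>0. \<psi> x \<ge> 0) \<and> mono_on {0..} \<psi> \<and>
     (\<exists>\<psi>'. (\<forall>x\<ge>0. (\<psi> has_real_derivative \<psi>' x) (at x within {0..})) \<and>
           continuous_on {0..} \<psi>' \<and> bounded (\<psi>' ` {0..}))"

definition VF_measure :: "ns_dom \<Rightarrow> real \<Rightarrow> field \<Rightarrow> real set \<Rightarrow> (real \<Rightarrow> field) measure \<Rightarrow> bool" where
  "VF_measure D \<nu> f I \<rho> \<longleftrightarrow>
     sets \<rho> = sets (borel_of (TrajTop D I)) \<and> prob_space \<rho> \<and>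
     \<comment> \<open>(i) rho is carried by the weak solutions\<close>
     (\<exists>E\<in>sets \<rho>. E \<subseteq> Usharp D \<nu> f I \<and> emeasure \<rho> E = 1) \<and>
     \<comment> \<open>(ii) t -> int |u(t)|^2 drho in L^infty_loc(I)\<close>
     (\<lambda>t. \<integral>\<^sup>+ u. ennreal ((norm_H D (u t))\<^sup>2) \<partial>\<rho>) \<in> borel_measurable (lebesgue_on I) \<and>
     (\<forall>K. compact K \<and> K \<subseteq> I \<longrightarrow>
        (\<exists>C. AE t in lebesgue_on K. (\<integral>\<^sup>+ u. ennreal ((norm_H D (u t))\<^sup>2) \<partial>\<rho>) \<le> ennreal C)) \<and>
     \<comment> \<open>(iii) condition at a closed left endpoint\<close>
     (\<forall>t0\<in>I. (\<forall>t\<in>I. t0 \<le> t) \<longrightarrow> (\<forall>\<psi>. admissible_psi \<psi> \<longrightarrow>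
        ((\<lambda>t. \<integral>\<^sup>+ u. ennreal (\<psi> ((norm_H D (u t))\<^sup>2)) \<partial>\<rho>)
           \<longlongrightarrow> (\<integral>\<^sup>+ u. ennreal (\<psi> ((norm_H D (u t0))\<^sup>2)) \<partial>\<rho>)) (at_right t0) \<and>
        (\<integral>\<^sup>+ u. ennreal (\<psi> ((norm_H D (u t0))\<^sup>2)) \<partial>\<rho>) < \<infinity>))"

definition proj_measure :: "ns_dom \<Rightarrow> real \<Rightarrow> (real \<Rightarrow> field) measure \<Rightarrow> field measure" where
  "proj_measure D t \<rho> = distr \<rho> (borel_of (Hw D)) (\<lambda>u. u t)"

definition invariant_measure :: "(real \<Rightarrow> field) measure \<Rightarrow> bool" where
  "invariant_measure \<rho> \<longleftrightarrow> (\<forall>\<tau>\<ge>0. \<forall>E\<in>sets \<rho>.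
     emeasure \<rho> {u \<in> space \<rho>. (\<lambda>t. u (t + \<tau>)) \<in> E} = emeasure \<rho> E)"

end

theory Submission
  imports Defs
begin

text \<open>
  Fix a time \<open>s\<close> in the interior of \<open>I\<close> and cut out of a random trajectory \<open>u\<close> with law \<open>\<rho>\<close> the segment over
  \<open>[s, s + 1]\<close>. Since \<open>u(s)\<close> and \<open>u(s + 1)\<close> have the same law, such segments can be glued end to end to a
  two-sided stationary Markov chain of segments. Concatenation gives a random path on the whole line whose law at every time is
  the common marginal and which is invariant under the shift by \<open>1\<close>; averaging over a uniformly distributed
  phase makes it invariant under all shifts.

  The concatenation of weak solutions is a weak solution as soon as the energy inequality holds from each
  gluing time on. That this is so for almost every \<open>u\<close>, at the prescribed time \<open>s\<close>, follows from the
  constancy of the marginals: the mean of \<open>|u(t)|\<^sup>2\<close> is constant and \<open>|u(t)|\<^sup>2\<close> is lower semicontinuous, hence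
  \<open>|u(t)|\<^sup>2 \<rightarrow> |u(s)|\<^sup>2\<close> in \<open>L\<^sup>1(\<rho>)\<close> as \<open>t \<rightarrow> s\<close>.
\<close>

section \<open>Stationary two-sided Markov chains with prescribed transitions\<close>

text \<open>Averages of time shifts of \<open>\<rho>\<close> have the right marginals, but an
  invariant measure would have to be extracted from them as a limit, with compactness to be proved
  and the energy inequality to be preserved under weak convergence. Gluing takes no limit of
  measures. Its price is that the energy inequality is needed from prescribed times, whereas a weak
  solution provides it only from almost every time.

  The chain is two-sided because \<open>I\<close> may be unbounded on the left. A second obstacle is
  that elements of H are functions and not classes: the Borel structure of the trajectory space sees
  inner products only and cannot separate functions that agree almost everywhere. Identifications
  therefore go through countably many inner products, packed into one real number; this lets the
  chain live on real states, and "same endpoint" becomes equality of codes. Finally the carrier of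
  the new measure must be a Borel set of weak solutions, although weak solutions are not shown to
  form a Borel set and the image of a Borel set under gluing need not be Borel.\<close>

abbreviation unif :: "real measure" where "unif \<equiv> uniform_measure lborel {0..1}"

lemma prob_space_unif: "prob_space unif"
  by (intro prob_space_uniform_measure) auto

lemma emeasure_unif_initial:
  fixes r :: real
  assumes "0 \<le> r" "r \<le> 1"
  shows "emeasure unif {..r} = ennreal r" "emeasure unif {..<r} = ennreal r"
proof -
  have 1: "{0..1} \<inter> {..r} = {0..r}" "{0..1} \<inter> {..<r} = {0..<r}" using assms by auto
  show "emeasure unif {..r} = ennreal r" "emeasure unif {..<r} = ennreal r"
    using assms by (simp_all add: 1 emeasure_uniform_measure divide_ennreal_def)
qed

text \<open>On [0, 1] the union is an initial segment ending at the supremum, with or without that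
  endpoint, which is null; negative \<open>u\<close> carry no mass. For a fixed conditioning value
  this computes the probability that the quantile falls below a level.\<close>

lemma emeasure_unif_Union_initial:
  fixes g :: "'i \<Rightarrow> ennreal"
  assumes g: "\<And>i. i \<in> I \<Longrightarrow> g i \<le> 1" and I: "countable I"
  shows "emeasure unif {u. \<exists>i\<in>I. ennreal u \<le> g i} = (SUP i\<in>I. g i)"
proof -
  define s where "s = (SUP i\<in>I. g i)"
  have s1: "s \<le> 1" unfolding s_def using g by (intro SUP_least) auto
  then obtain r where r: "s = ennreal r" "0 \<le> r" "r \<le> 1"
    by (cases s) (auto simp: top_unique)
  have m: "{u. \<exists>i\<in>I. ennreal u \<le> g i} \<in> sets unif"
  proof -
    have "{u. \<exists>i\<in>I. ennreal u \<le> g i} = (\<Union>i\<in>I. {u. ennreal u \<le> g i})" by auto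
    then show ?thesis using I by auto
  qed
  have "emeasure unif {u. \<exists>i\<in>I. ennreal u \<le> g i} \<le> emeasure unif {..r}"
  proof (rule emeasure_mono)
    show "{u. \<exists>i\<in>I. ennreal u \<le> g i} \<subseteq> {..r}"
    proof
      fix u assume "u \<in> {u. \<exists>i\<in>I. ennreal u \<le> g i}"
      then obtain i where "i \<in> I" "ennreal u \<le> g i" by auto
      then have "ennreal u \<le> ennreal r" unfolding r(1)[symmetric] s_def by (meson SUP_upper order_trans)
      then show "u \<in> {..r}" using r by (cases "0 \<le> u") (auto simp: ennreal_le_iff)
    qed
  qed simp
  moreover have "emeasure unif {..<r} \<le> emeasure unif {u. \<exists>i\<in>I. ennreal u \<le> g i}"
  proof (cases "r = 0")
    case True then show ?thesis using emeasure_unif_initial(2)[of 0] by simp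
  next
    case False
    show ?thesis
    proof (rule emeasure_mono[OF _ m])
      show "{..<r} \<subseteq> {u. \<exists>i\<in>I. ennreal u \<le> g i}"
      proof
        fix u assume "u \<in> {..<r}"
        then have "ennreal u < s" unfolding r(1) using r False by (simp add: ennreal_lessI)
        then obtain i where "i \<in> I" "ennreal u < g i" unfolding s_def less_SUP_iff by auto
        then show "u \<in> {u. \<exists>i\<in>I. ennreal u \<le> g i}" by (auto intro: less_imp_le)
      qed
    qed
  qed
  ultimately show ?thesis
    using emeasure_unif_initial[OF r(2,3)] r(1) unfolding s_def[symmetric] by simp
qed

text \<open>The density of the sub-probability \<open>N(\<alpha> \<in> \<cdot>, Z \<le> q)\<close> is a version of the
  conditional distribution function of \<open>Z\<close> given \<open>\<alpha>\<close>, and only countably many \<open>q\<close> are needed.\<close>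

lemma conditional_quantile:
  fixes N :: "real measure" and \<alpha> :: "real \<Rightarrow> real"
  assumes "prob_space N" and sN: "sets N = sets borel" and N1: "AE z in N. z \<in> {0..1}"
    and \<alpha>[measurable]: "\<alpha> \<in> borel_measurable borel"
  shows "\<exists>F \<in> borel_measurable (borel \<Otimes>\<^sub>M borel).
    distr (distr N borel \<alpha> \<Otimes>\<^sub>M unif) (borel \<Otimes>\<^sub>M borel) (\<lambda>(s, u). (s, F (s, u)))
      = distr N (borel \<Otimes>\<^sub>M borel) (\<lambda>z. (\<alpha> z, z))"
proof -
  interpret N: prob_space N by fact
  note [measurable_cong] = sN
  define \<mu> where "\<mu> = distr N borel \<alpha>"
  interpret \<mu>: prob_space \<mu> unfolding \<mu>_def by (rule N.prob_space_distr) simp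
  interpret U: prob_space unif by (rule prob_space_unif)
  interpret P: pair_prob_space \<mu> unif ..
  have s\<mu>[measurable_cong]: "sets \<mu> = sets borel" unfolding \<mu>_def by simp
  define Nq where "Nq q = distr (density N (indicator {..real_of_rat q})) borel \<alpha>" for q
  have Nq_em: "emeasure (Nq q) A = emeasure N {z. \<alpha> z \<in> A \<and> z \<le> real_of_rat q}" if A[measurable]: "A \<in> sets borel" for q A
  proof -
    have "emeasure (Nq q) A = (\<integral>\<^sup>+z. indicator {..real_of_rat q} z * indicator (\<alpha> -` A \<inter> space N) z \<partial>N)"
      unfolding Nq_def by (subst emeasure_distr) (auto simp: emeasure_density)
    also have "\<dots> = (\<integral>\<^sup>+z. indicator {z. \<alpha> z \<in> A \<and> z \<le> real_of_rat q} z \<partial>N)"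
      by (intro nn_integral_cong) (auto simp: indicator_def)
    finally show ?thesis by simp
  qed
  have \<mu>_em: "emeasure \<mu> A = emeasure N {z. \<alpha> z \<in> A}" if A[measurable]: "A \<in> sets borel" for A
    unfolding \<mu>_def using sets_eq_imp_space_eq[OF sN] by (subst emeasure_distr) (auto simp: vimage_def)
  have Nq_le: "emeasure (Nq q) A \<le> emeasure \<mu> A" if A[measurable]: "A \<in> sets borel" for q A
    by (simp add: Nq_em \<mu>_em) (intro emeasure_mono, auto)
  define G where "G q = RN_deriv \<mu> (Nq q)" for q
  have G[measurable]: "G q \<in> borel_measurable borel" for q
    unfolding G_def using borel_measurable_RN_deriv[of \<mu> "Nq q"] measurable_cong_sets[OF s\<mu> refl] by blast
  have dG: "density \<mu> (G q) = Nq q" for q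
    unfolding G_def
  proof (rule \<mu>.density_RN_deriv)
    show "sets (Nq q) = sets \<mu>" by (simp add: Nq_def s\<mu>)
    show "absolutely_continuous \<mu> (Nq q)"
      unfolding absolutely_continuous_def
    proof
      fix A assume A: "A \<in> null_sets \<mu>"
      then have "A \<in> sets borel" using s\<mu> by auto
      then show "A \<in> null_sets (Nq q)" using Nq_le[of A q] A by (auto simp: null_sets_def Nq_def)
    qed
  qed
  have iG: "(\<integral>\<^sup>+s\<in>A. G q s \<partial>\<mu>) = emeasure N {z. \<alpha> z \<in> A \<and> z \<le> real_of_rat q}" if A[measurable]: "A \<in> sets borel" for q A
    using emeasure_density[of "G q" \<mu> A] dG[of q] Nq_em[OF A] by simp
  \<comment> \<open>A comparison of integrals over all Borel sets becomes pointwise by testing on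
    the set where it fails; finiteness of the larger integral makes the subtraction legitimate. It
    is applied to the densities \<open>G q\<close>.\<close>
  have ae_le: "AE s in \<mu>. f s \<le> g s"
    if [measurable]: "f \<in> borel_measurable borel" "g \<in> borel_measurable borel"
      and fg: "\<And>A. A \<in> sets borel \<Longrightarrow> (\<integral>\<^sup>+s\<in>A. f s \<partial>\<mu>) \<le> (\<integral>\<^sup>+s\<in>A. g s \<partial>\<mu>)"
      and fin: "(\<integral>\<^sup>+s. g s \<partial>\<mu>) < \<infinity>" for f g :: "real \<Rightarrow> ennreal"
  proof -
    have fin': "(\<integral>\<^sup>+s. f s \<partial>\<mu>) < \<infinity>" using fg[of UNIV] fin by (auto intro: le_less_trans)
    let ?A = "{s. g s < f s}"
    have A[measurable]: "?A \<in> sets borel" by measurable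
    have "(\<integral>\<^sup>+s\<in>?A. g s \<partial>\<mu>) \<le> (\<integral>\<^sup>+s\<in>?A. f s \<partial>\<mu>)"
      by (intro nn_integral_mono) (auto simp: indicator_def)
    then have eq: "(\<integral>\<^sup>+s\<in>?A. g s \<partial>\<mu>) = (\<integral>\<^sup>+s\<in>?A. f s \<partial>\<mu>)" using fg[OF A] by auto
    have fA: "(\<integral>\<^sup>+s\<in>?A. f s \<partial>\<mu>) \<noteq> \<infinity>"
    proof -
      have "(\<integral>\<^sup>+s\<in>?A. f s \<partial>\<mu>) \<le> (\<integral>\<^sup>+s. f s \<partial>\<mu>)"
        by (intro nn_integral_mono) (auto simp: indicator_def)
      then show ?thesis using fin' by auto
    qed
    have "(\<integral>\<^sup>+s. (f s - g s) * indicator ?A s \<partial>\<mu>) = (\<integral>\<^sup>+s. f s * indicator ?A s - g s * indicator ?A s \<partial>\<mu>)"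
      by (intro nn_integral_cong) (auto simp: indicator_def)
    also have "\<dots> = (\<integral>\<^sup>+s\<in>?A. f s \<partial>\<mu>) - (\<integral>\<^sup>+s\<in>?A. g s \<partial>\<mu>)"
      using fA eq by (intro nn_integral_diff) (auto simp: indicator_def)
    also have "\<dots> = 0" using eq fA by simp
    finally have "AE s in \<mu>. (f s - g s) * indicator ?A s = 0"
      by (subst (asm) nn_integral_0_iff_AE) auto
    moreover have "AE s in \<mu>. f s \<noteq> \<infinity>"
      using fin' by (intro nn_integral_noteq_infinite) auto
    ultimately show ?thesis
    proof eventually_elim
      case (elim s)
      then show ?case
        by (cases "g s < f s") (auto simp: not_less diff_eq_0_iff_ennreal)
    qed
  qed
  have N_le_1: "emeasure N A \<le> 1" for A by (rule N.emeasure_le_1)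
  have G1: "AE s in \<mu>. G q s \<le> 1" for q
  proof (rule ae_le)
    fix A :: "real set" assume A[measurable]: "A \<in> sets borel"
    have "(\<integral>\<^sup>+s\<in>A. G q s \<partial>\<mu>) \<le> emeasure \<mu> A" using Nq_le[OF A, of q] iG[OF A] Nq_em[OF A] by simp
    also have "\<dots> = (\<integral>\<^sup>+s\<in>A. 1 \<partial>\<mu>)" by simp
    finally show "(\<integral>\<^sup>+s\<in>A. G q s \<partial>\<mu>) \<le> (\<integral>\<^sup>+s\<in>A. 1 \<partial>\<mu>)" .
  qed (auto simp: \<mu>.emeasure_space_1)
  have Gmono: "AE s in \<mu>. G q s \<le> G r s" if "q \<le> r" for q r
  proof (rule ae_le)
    fix A :: "real set" assume A[measurable]: "A \<in> sets borel"
    show "(\<integral>\<^sup>+s\<in>A. G q s \<partial>\<mu>) \<le> (\<integral>\<^sup>+s\<in>A. G r s \<partial>\<mu>)"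
      unfolding iG[OF A] using that
      by (intro emeasure_mono) (auto simp: order_trans[OF _ of_rat_less_eq[THEN iffD2]])
  next
    show "(\<integral>\<^sup>+s. G r s \<partial>\<mu>) < \<infinity>"
      using iG[of UNIV r] N_le_1[of "{z. z \<le> real_of_rat r}"] by (simp add: le_less_trans)
  qed auto
  have AEall: "AE s in \<mu>. \<forall>q r. G q s \<le> 1 \<and> (q \<le> r \<longrightarrow> G q s \<le> G r s)"
    unfolding AE_all_countable using G1 Gmono by auto
  \<comment> \<open>\<open>F (s, u)\<close> is the generalised inverse, the infimum of all q with
    \<open>u \<le> G q s\<close>, clamped to [0, 1]. A q that does not qualify contributes 1, which
    settles the case that none qualifies.\<close>
  define \<phi> where "\<phi> q x = (if ennreal (snd x) \<le> G q (fst x) then min 1 (max 0 (real_of_rat q)) else 1)" for q and x :: "real \<times> real"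
  define F where "F x = (INF q. \<phi> q x)" for x
  have \<phi>m[measurable]: "\<phi> q \<in> borel_measurable (borel \<Otimes>\<^sub>M borel)" for q
    unfolding \<phi>_def by measurable
  have bdd: "bdd_below (range (\<lambda>q. \<phi> q x))" for x by (rule bdd_belowI[of _ 0]) (auto simp: \<phi>_def)
  have Fm[measurable]: "F \<in> borel_measurable (borel \<Otimes>\<^sub>M borel)"
    unfolding F_def using bdd by (intro borel_measurable_cINF) auto
  have Fless: "F x < y \<longleftrightarrow> (\<exists>q. \<phi> q x < y)" for x y
    unfolding F_def by (subst cINF_less_iff[OF _ bdd]) auto
  have F1: "F x \<le> 1" for x
    unfolding F_def by (rule order_trans[OF cINF_lower[OF bdd, of 0]]) (auto simp: \<phi>_def)
  have F0: "0 \<le> F x" for x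
    unfolding F_def by (rule cINF_greatest) (auto simp: \<phi>_def)
  \<comment> \<open>Strict levels are used because an infimum is below \<open>y\<close> exactly when
    one member of the family is. Levels outside (0, 1] are trivial, since \<open>F\<close> and
    almost every \<open>z\<close> lie in [0, 1].\<close>
  have main: "emeasure (\<mu> \<Otimes>\<^sub>M unif) {x. fst x \<in> A \<and> F x < y} = emeasure N {z. \<alpha> z \<in> A \<and> z < y}"
    if A[measurable]: "A \<in> sets borel" for A y
  proof -
    consider "y \<le> 0" | "y > 1" | "0 < y" "y \<le> 1" by linarith
    then show ?thesis
    proof cases
      case 1
      have e: "{x. fst x \<in> A \<and> F x < y} = {}" using F0 1 by (auto simp: not_less intro: order_trans)
      have "AE z in N. z \<notin> {z. \<alpha> z \<in> A \<and> z < y}" using N1 by eventually_elim (use 1 in auto)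
      then have "emeasure N {z. \<alpha> z \<in> A \<and> z < y} = 0"
        by (subst (asm) AE_iff_measurable[OF _ refl]) (auto simp: sets_eq_imp_space_eq[OF sN])
      then show ?thesis by (simp only: e) simp
    next
      case 2
      have e: "{x. fst x \<in> A \<and> F x < y} = A \<times> UNIV" using F1 2 by (auto intro: le_less_trans)
      have u1: "emeasure unif UNIV = 1" using U.emeasure_space_1 by simp
      have "emeasure (\<mu> \<Otimes>\<^sub>M unif) (A \<times> UNIV) = emeasure \<mu> A * emeasure unif UNIV"
        by (intro U.emeasure_pair_measure_Times) (auto simp: s\<mu>)
      also have "\<dots> = emeasure N {z. \<alpha> z \<in> A}" unfolding u1 by (simp add: \<mu>_em)
      also have "\<dots> = emeasure N {z. \<alpha> z \<in> A \<and> z < y}"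
        by (intro emeasure_eq_AE AE_mp[OF N1 AE_I2]) (use 2 in auto)
      finally show ?thesis by (simp only: e)
    next
      case 3
      define R where "R = {q. real_of_rat q < y}"
      have Rne: "R \<noteq> {}" using of_rat_dense[of "y - 1" y] by (auto simp: R_def)
      have cR: "countable R" by simp
      have F_iff: "F x < y \<longleftrightarrow> (\<exists>q\<in>R. ennreal (snd x) \<le> G q (fst x))" for x
        unfolding Fless R_def \<phi>_def using 3 by (auto split: if_splits simp: min_less_iff_disj)
      define e where "e = from_nat_into R"
      have re: "range e = R" unfolding e_def using range_from_nat_into[OF Rne cR] .
      \<comment> \<open>The enumeration \<open>e\<close> of the admissible rationals is not
        monotone; its running maxima increase and dominate every \<open>e n\<close>, so monotone
        convergence applies.\<close>
      define q where "q n = Max (e ` {..n})" for n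
      have qR: "q n \<in> R" for n
      proof -
        have "q n \<in> e ` {..n}" unfolding q_def by (intro Max_in) auto
        then show ?thesis using re by blast
      qed
      have qinc: "incseq q" unfolding q_def by (intro incseq_SucI Max_mono) auto
      have qe: "e n \<le> q n" for n unfolding q_def by (intro Max_ge) auto
      have set[measurable]: "{x. fst x \<in> A \<and> F x < y} \<in> sets (borel \<Otimes>\<^sub>M borel)"
      proof -
        have "{x \<in> space (borel \<Otimes>\<^sub>M borel). fst x \<in> A \<and> F x < y} \<in> sets (borel \<Otimes>\<^sub>M borel)" by measurable
        then show ?thesis by (simp add: space_pair_measure)
      qed
      have "emeasure (\<mu> \<Otimes>\<^sub>M unif) {x. fst x \<in> A \<and> F x < y}
        = (\<integral>\<^sup>+s. emeasure unif (Pair s -` {x. fst x \<in> A \<and> F x < y}) \<partial>\<mu>)"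
        by (rule U.emeasure_pair_measure_alt) measurable
      also have "\<dots> = (\<integral>\<^sup>+s. (SUP n. G (q n) s * indicator A s) \<partial>\<mu>)"
      proof (rule nn_integral_cong_AE)
        show "AE s in \<mu>. emeasure unif (Pair s -` {x. fst x \<in> A \<and> F x < y}) = (SUP n. G (q n) s * indicator A s)"
          using AEall
        proof eventually_elim
          case (elim s)
          have "emeasure unif (Pair s -` {x. fst x \<in> A \<and> F x < y})
             = emeasure unif {u. \<exists>i\<in>R. ennreal u \<le> G i s * indicator A s}" if "s \<in> A"
            using that by (intro arg_cong[where f="emeasure unif"]) (auto simp: F_iff)
          also have "\<dots> = (SUP i\<in>R. G i s * indicator A s)"
            using elim by (intro emeasure_unif_Union_initial) (auto simp: indicator_def)
          also have "\<dots> = (SUP n. G (q n) s * indicator A s)"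
          proof (rule antisym)
            show "(SUP i\<in>R. G i s * indicator A s) \<le> (SUP n. G (q n) s * indicator A s)"
            proof (rule SUP_least)
              fix i assume "i \<in> R"
              then obtain n where "i = e n" using re by auto
              then have "G i s \<le> G (q n) s" using elim qe by auto
              then show "G i s * indicator A s \<le> (SUP n. G (q n) s * indicator A s)"
                by (intro SUP_upper2[of n]) (auto simp: indicator_def)
            qed
            show "(SUP n. G (q n) s * indicator A s) \<le> (SUP i\<in>R. G i s * indicator A s)"
              using qR by (intro SUP_mono) auto
          qed
          finally have "s \<in> A \<Longrightarrow> ?case" .
          moreover have "?case" if "s \<notin> A" using that by (auto simp: vimage_def)
          ultimately show ?case by blast
        qed
      qed
      also have "\<dots> = (SUP n. \<integral>\<^sup>+s. G (q n) s * indicator A s \<partial>\<mu>)"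
      proof (rule nn_integral_monotone_convergence_SUP_AE)
        fix n
        show "AE s in \<mu>. G (q n) s * indicator A s \<le> G (q (Suc n)) s * indicator A s"
          using AEall by eventually_elim (use qinc in \<open>auto simp: indicator_def incseq_Suc_iff\<close>)
      qed measurable
      also have "\<dots> = (SUP n. emeasure N {z. \<alpha> z \<in> A \<and> z \<le> real_of_rat (q n)})"
        by (simp add: iG[OF A])
      also have "\<dots> = emeasure N (\<Union>n. {z. \<alpha> z \<in> A \<and> z \<le> real_of_rat (q n)})"
      proof (rule SUP_emeasure_incseq)
        show "incseq (\<lambda>n. {z. \<alpha> z \<in> A \<and> z \<le> real_of_rat (q n)})"
          using qinc by (auto simp: incseq_def) (meson of_rat_less_eq order_trans)
      qed auto
      also have "(\<Union>n. {z. \<alpha> z \<in> A \<and> z \<le> real_of_rat (q n)}) = {z. \<alpha> z \<in> A \<and> z < y}"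
      proof safe
        fix z n assume "z \<le> real_of_rat (q n)"
        then show "z < y" using qR[of n] by (auto simp: R_def)
      next
        fix z assume "z < y" and zA: "\<alpha> z \<in> A"
        then obtain i where i: "z < real_of_rat i" "real_of_rat i < y" using of_rat_dense by blast
        then obtain n where "i = e n" using re by (auto simp: R_def)
        then have "real_of_rat i \<le> real_of_rat (q n)" using qe by (simp add: of_rat_less_eq)
        then show "z \<in> (\<Union>n. {z. \<alpha> z \<in> A \<and> z \<le> real_of_rat (q n)})" using i zA by (intro UN_I[of n]) auto
      qed
      finally show ?thesis .
    qed
  qed
  let ?L = "distr (\<mu> \<Otimes>\<^sub>M unif) (borel \<Otimes>\<^sub>M borel) (\<lambda>(s, u). (s, F (s, u)))"
  let ?R = "distr N (borel \<Otimes>\<^sub>M borel) (\<lambda>z. (\<alpha> z, z))"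
  let ?E = "{a \<times> b |a b. a \<in> sets borel \<and> b \<in> range (\<lambda>y::real. {..<y})} :: (real \<times> real) set set"
  have sE: "sets (borel \<Otimes>\<^sub>M borel) = sigma_sets UNIV ?E"
  proof -
    have "sets (borel \<Otimes>\<^sub>M borel :: (real \<times> real) measure)
        = sets (sigma (space borel \<times> space borel) {a \<times> b |a b. a \<in> sets borel \<and> b \<in> range (\<lambda>y::real. {..<y})})"
    proof (rule sets_pair_eq[where Ca="{UNIV}" and Cb="range (\<lambda>n::nat. {..<real n})"])
      show "sets borel = sigma_sets (space borel) (range (\<lambda>y::real. {..<y}))"
        by (subst borel_Iio) simp
      show "\<Union> (range (\<lambda>n::nat. {..<real n})) = space borel"
        using reals_Archimedean2 by auto
    qed (auto simp: sets.sigma_sets_eq[of borel, simplified])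
    then show ?thesis by simp
  qed
  have "?L = ?R"
  proof (rule measure_eqI_generator_eq[where E="?E" and \<Omega>=UNIV and A="\<lambda>n. UNIV \<times> {..<real n}"])
    show "Int_stable ?E"
    proof (rule Int_stableI)
      fix X Y assume "X \<in> ?E" "Y \<in> ?E"
      then obtain a b c d where *: "X = a \<times> {..<b}" "Y = c \<times> {..<d}" "a \<in> sets borel" "c \<in> sets borel" by blast
      then have "X \<inter> Y = (a \<inter> c) \<times> {..<min b d}" by auto
      then show "X \<inter> Y \<in> ?E" using * by blast
    qed
    show "emeasure ?L X = emeasure ?R X" if "X \<in> ?E" for X
    proof -
      obtain A y where X: "X = A \<times> {..<y}" and A[measurable]: "A \<in> sets borel" using \<open>X \<in> ?E\<close> by blast
      have "emeasure ?L X = emeasure (\<mu> \<Otimes>\<^sub>M unif) {x. fst x \<in> A \<and> F x < y}"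
        unfolding X by (subst emeasure_distr)
          (auto intro!: arg_cong[where f="emeasure (\<mu> \<Otimes>\<^sub>M unif)"] simp: space_pair_measure sets_eq_imp_space_eq[OF s\<mu>])
      also have "\<dots> = emeasure ?R X"
        unfolding main[OF A] X by (subst emeasure_distr)
          (auto intro!: arg_cong[where f="emeasure N"] simp: sets_eq_imp_space_eq[OF sN])
      finally show ?thesis .
    qed
    show "sets ?L = sigma_sets UNIV ?E" "sets ?R = sigma_sets UNIV ?E" using sE by auto
    have "UNIV \<times> {..<real n} \<in> ?E" for n
      by (rule CollectI, rule exI[of _ UNIV], rule exI[of _ "{..<real n}"]) simp
    then show "range (\<lambda>n. UNIV \<times> {..<real n}) \<subseteq> ?E" by blast
    show "(\<Union>n. UNIV \<times> {..<real n}) = (UNIV :: (real \<times> real) set)" using reals_Archimedean2 by auto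
    interpret L: prob_space ?L by (rule P.prob_space_distr) measurable
    show "emeasure ?L (UNIV \<times> {..<real n}) \<noteq> \<infinity>" for n by simp
  qed auto
  then show ?thesis using Fm unfolding \<mu>_def by blast
qed


text \<open>The next state is the conditional quantile, given \<open>\<alpha> = \<beta> z\<close>, at a fresh uniform variable. This makes the pair of
  the state and the stream of unused uniform variables evolve by a measure-preserving map \<open>T\<close>, so the finite-dimensional
  laws of the chain started at time \<open>-n\<close> are consistent.\<close>

lemma stationary_chain:
  fixes N :: "real measure" and \<alpha> \<beta> :: "real \<Rightarrow> real"
  assumes N: "prob_space N" and sN: "sets N = sets borel" and N1: "AE z in N. z \<in> {0..1}"
    and \<alpha>[measurable]: "\<alpha> \<in> borel_measurable borel" and \<beta>[measurable]: "\<beta> \<in> borel_measurable borel"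
    and eq: "distr N borel \<alpha> = distr N borel \<beta>"
  obtains P :: "(int \<Rightarrow> real) measure" where "prob_space P" "sets P = sets borel"
    "\<And>k. distr P borel (\<lambda>\<omega>. \<omega> k) = N" "AE \<omega> in P. \<forall>k. \<beta> (\<omega> k) = \<alpha> (\<omega> (k + 1))"
    "distr P borel (\<lambda>\<omega> k. \<omega> (k + 1)) = P"
proof -
  interpret N: prob_space N by fact
  note [measurable_cong] = sN
  have spN: "space N = UNIV" using sets_eq_imp_space_eq[OF sN] by simp
  interpret U: prob_space unif by (rule prob_space_unif)
  obtain F where F[measurable]: "F \<in> borel_measurable (borel \<Otimes>\<^sub>M borel)"
    and Fd: "distr (distr N borel \<alpha> \<Otimes>\<^sub>M unif) (borel \<Otimes>\<^sub>M borel) (\<lambda>(s, u). (s, F (s, u)))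
      = distr N (borel \<Otimes>\<^sub>M borel) (\<lambda>z. (\<alpha> z, z))"
    using conditional_quantile[OF N sN N1 \<alpha>] by blast
  define \<mu> where "\<mu> = distr N borel \<alpha>"
  have \<mu>b: "\<mu> = distr N borel \<beta>" unfolding \<mu>_def eq ..
  have s\<mu>[measurable_cong]: "sets \<mu> = sets borel" unfolding \<mu>_def by simp
  have sp\<mu>: "space \<mu> = UNIV" unfolding \<mu>_def by simp
  interpret \<mu>: prob_space \<mu> unfolding \<mu>_def by (rule N.prob_space_distr) simp
  interpret S: sequence_space unif
    by (simp add: sequence_space_def product_prob_space_def product_prob_space_axioms_def
        product_sigma_finite_def prob_space_unif prob_space_imp_sigma_finite)
  let ?S = "Pi\<^sub>M (UNIV::nat set) (\<lambda>_. unif)"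
  have prS: "prob_space ?S" by (rule prob_space_PiM) (rule prob_space_unif)
  have sfS: "sigma_finite_measure ?S" by (rule prob_space_imp_sigma_finite[OF prS])
  have stl: "(\<lambda>\<omega> n. \<omega> (Suc n)) \<in> Pi\<^sub>M (UNIV::nat set) (\<lambda>_. borel :: real measure) \<rightarrow>\<^sub>M Pi\<^sub>M UNIV (\<lambda>_. borel)"
    by (intro measurable_PiM_single') (auto simp: space_PiM)
  have stl': "(\<lambda>w n. snd w (Suc n)) \<in> (borel :: real measure) \<Otimes>\<^sub>M Pi\<^sub>M (UNIV::nat set) (\<lambda>_. borel :: real measure) \<rightarrow>\<^sub>M Pi\<^sub>M UNIV (\<lambda>_. borel)"
    by (rule measurable_compose[OF measurable_snd stl])
  define \<Omega> where "\<Omega> = N \<Otimes>\<^sub>M ?S"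
  interpret pp: pair_prob_space N ?S ..
  interpret \<Omega>: prob_space \<Omega> unfolding \<Omega>_def by unfold_locales
  have s\<Omega>[measurable_cong]: "sets \<Omega> = sets (borel \<Otimes>\<^sub>M Pi\<^sub>M (UNIV::nat set) (\<lambda>_. borel))"
    unfolding \<Omega>_def by (intro sets_pair_measure_cong sN sets_PiM_cong) auto
  have sp\<Omega>: "space \<Omega> = UNIV" using sets_eq_imp_space_eq[OF s\<Omega>] by (simp add: space_pair_measure space_PiM)
  have spS: "space ?S = UNIV" by (simp add: space_PiM)
  have sS[measurable_cong]: "sets ?S = sets (Pi\<^sub>M (UNIV::nat set) (\<lambda>_. borel :: real measure))"
    by (intro sets_PiM_cong) auto
  define T where "T w = (F (\<beta> (fst w), snd w 0), (\<lambda>n. snd w (Suc n)))" for w :: "real \<times> (nat \<Rightarrow> real)"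
  have T[measurable]: "T \<in> \<Omega> \<rightarrow>\<^sub>M \<Omega>" unfolding T_def
    by (rule measurable_Pair[THEN measurable_cong_sets[OF refl s\<Omega>, THEN equalityD2, THEN subsetD]])
      (use stl' in \<open>simp_all add: measurable_cong_sets[OF s\<Omega> refl]\<close>)
  have split: "emeasure ?S {\<omega>. \<omega> 0 \<in> C \<and> (\<lambda>n. \<omega> (Suc n)) \<in> B} = emeasure unif C * emeasure ?S B"
    if C[measurable]: "C \<in> sets borel" and B[measurable]: "B \<in> sets ?S" for B C
  proof -
    have m[measurable]: "{\<omega>. \<omega> 0 \<in> C \<and> (\<lambda>n. \<omega> (Suc n)) \<in> B} \<in> sets ?S"
    proof -
      have 1: "(\<lambda>\<omega>. \<omega> 0) -` C \<inter> space ?S \<in> sets ?S" by (rule measurable_sets[OF _ C]) measurable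
      have 2: "(\<lambda>\<omega> n. \<omega> (Suc n)) -` B \<inter> space ?S \<in> sets ?S"
        by (rule measurable_sets[OF _ B]) (use stl in \<open>simp add: measurable_cong_sets[OF sS sS]\<close>)
      show ?thesis using sets.Int[OF 1 2] by (simp add: spS vimage_def Collect_conj_eq)
    qed
    have "emeasure ?S {\<omega>. \<omega> 0 \<in> C \<and> (\<lambda>n. \<omega> (Suc n)) \<in> B}
      = emeasure (distr (unif \<Otimes>\<^sub>M ?S) ?S (\<lambda>(s, \<omega>). case_nat s \<omega>)) {\<omega>. \<omega> 0 \<in> C \<and> (\<lambda>n. \<omega> (Suc n)) \<in> B}"
      by (simp add: S.PiM_iter)
    also have "\<dots> = emeasure (unif \<Otimes>\<^sub>M ?S) (C \<times> B)"
      by (subst emeasure_distr)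
        (auto intro!: arg_cong[where f="emeasure (unif \<Otimes>\<^sub>M ?S)"] simp: space_pair_measure spS)
    also have "\<dots> = emeasure unif C * emeasure ?S B"
      by (rule sigma_finite_measure.emeasure_pair_measure_Times[OF sfS]) auto
    finally show ?thesis .
  qed
  have FN: "emeasure (\<mu> \<Otimes>\<^sub>M unif) {x. (fst x, F x) \<in> D} = emeasure N {z. (\<alpha> z, z) \<in> D}"
    if D[measurable]: "D \<in> sets (borel \<Otimes>\<^sub>M borel)" for D
  proof -
    have "emeasure (\<mu> \<Otimes>\<^sub>M unif) {x. (fst x, F x) \<in> D}
      = emeasure (distr (distr N borel \<alpha> \<Otimes>\<^sub>M unif) (borel \<Otimes>\<^sub>M borel) (\<lambda>(s, u). (s, F (s, u)))) D"
      unfolding \<mu>_def by (subst emeasure_distr)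
        (auto intro!: arg_cong[where f="emeasure (distr N borel \<alpha> \<Otimes>\<^sub>M unif)"] simp: space_pair_measure)
    also have "\<dots> = emeasure N {z. (\<alpha> z, z) \<in> D}"
      unfolding Fd by (subst emeasure_distr) (auto intro!: arg_cong[where f="emeasure N"] simp: spN)
    finally show ?thesis .
  qed
  \<comment> \<open>Equality of the laws of \<open>\<alpha>\<close> and \<open>\<beta>\<close>
    enters here: \<open>\<beta> z\<close> paired with a fresh uniform variable has law
    \<open>\<mu> \<Otimes>\<^sub>M unif\<close>, which \<open>F\<close> pushes forward to
    \<open>N\<close>, and the rest of the stream is independent of both.\<close>
  have Tinv: "distr \<Omega> \<Omega> T = \<Omega>"
  proof -
    have "N \<Otimes>\<^sub>M ?S = distr \<Omega> \<Omega> T"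
    proof (rule pair_measure_eqI)
      show "sigma_finite_measure N" "sigma_finite_measure ?S" by unfold_locales
      show "sets (N \<Otimes>\<^sub>M ?S) = sets (distr \<Omega> \<Omega> T)" by (simp add: \<Omega>_def)
      fix A B assume A': "A \<in> sets N" and B[measurable]: "B \<in> sets ?S"
      have A[measurable]: "A \<in> sets borel" using A' sN by simp
      have m[measurable]: "{w. F (\<beta> (fst w), snd w 0) \<in> A \<and> (\<lambda>n. snd w (Suc n)) \<in> B} \<in> sets \<Omega>"
      proof -
        have "T -` (A \<times> B) \<inter> space \<Omega> \<in> sets \<Omega>"
          by (rule measurable_sets[OF T]) (use A' in \<open>auto simp: \<Omega>_def\<close>)
        then show ?thesis by (simp add: sp\<Omega> T_def vimage_def)
      qed
      have "emeasure (distr \<Omega> \<Omega> T) (A \<times> B) = emeasure \<Omega> {w. F (\<beta> (fst w), snd w 0) \<in> A \<and> (\<lambda>n. snd w (Suc n)) \<in> B}"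
        by (subst emeasure_distr[OF T]) (use A' in \<open>auto simp: sp\<Omega> T_def \<Omega>_def[symmetric] vimage_def intro: pair_measureI[of A N B ?S, folded \<Omega>_def]\<close>)
      also have "\<dots> = (\<integral>\<^sup>+z. emeasure ?S (Pair z -` {w. F (\<beta> (fst w), snd w 0) \<in> A \<and> (\<lambda>n. snd w (Suc n)) \<in> B}) \<partial>N)"
        unfolding \<Omega>_def by (rule sigma_finite_measure.emeasure_pair_measure_alt[OF sfS]) (use m in \<open>simp add: \<Omega>_def\<close>)
      also have "\<dots> = (\<integral>\<^sup>+z. emeasure unif {u. F (\<beta> z, u) \<in> A} * emeasure ?S B \<partial>N)"
      proof (rule nn_integral_cong)
        fix z
        have "emeasure ?S (Pair z -` {w. F (\<beta> (fst w), snd w 0) \<in> A \<and> (\<lambda>n. snd w (Suc n)) \<in> B})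
          = emeasure ?S {\<omega>. \<omega> 0 \<in> {u. F (\<beta> z, u) \<in> A} \<and> (\<lambda>n. \<omega> (Suc n)) \<in> B}"
          by (simp add: vimage_def)
        also have "\<dots> = emeasure unif {u. F (\<beta> z, u) \<in> A} * emeasure ?S B"
          by (rule split) auto
        finally show "emeasure ?S (Pair z -` {w. F (\<beta> (fst w), snd w 0) \<in> A \<and> (\<lambda>n. snd w (Suc n)) \<in> B})
          = emeasure unif {u. F (\<beta> z, u) \<in> A} * emeasure ?S B" .
      qed
      also have "\<dots> = (\<integral>\<^sup>+z. emeasure unif {u. F (\<beta> z, u) \<in> A} \<partial>N) * emeasure ?S B"
      proof (rule nn_integral_multc)
        have "(\<lambda>s. emeasure unif (Pair s -` {x. F x \<in> A})) \<in> borel_measurable borel"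
        proof (rule U.measurable_emeasure_Pair)
          have "{x \<in> space (borel \<Otimes>\<^sub>M borel). F x \<in> A} \<in> sets (borel \<Otimes>\<^sub>M borel)" by measurable
          then show "{x. F x \<in> A} \<in> sets (borel \<Otimes>\<^sub>M unif)"
            using sets_pair_measure_cong[of borel borel unif borel] by (simp add: space_pair_measure)
        qed
        then have "(\<lambda>s. emeasure unif {u. F (s, u) \<in> A}) \<in> borel_measurable borel" by (simp add: vimage_def)
        then show "(\<lambda>z. emeasure unif {u. F (\<beta> z, u) \<in> A}) \<in> borel_measurable N" by measurable
      qed
      also have "(\<integral>\<^sup>+z. emeasure unif {u. F (\<beta> z, u) \<in> A} \<partial>N) = emeasure N A"
      proof -
        have mm[measurable]: "{x. F x \<in> A} \<in> sets (\<mu> \<Otimes>\<^sub>M unif)"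
        proof -
          have "{x \<in> space (\<mu> \<Otimes>\<^sub>M unif). F x \<in> A} \<in> sets (\<mu> \<Otimes>\<^sub>M unif)" by measurable
          then show ?thesis by (simp add: space_pair_measure sp\<mu>)
        qed
        have "(\<lambda>s. emeasure unif (Pair s -` {x. F x \<in> A})) \<in> borel_measurable \<mu>"
          by (rule U.measurable_emeasure_Pair) measurable
        then have "(\<integral>\<^sup>+z. emeasure unif (Pair (\<beta> z) -` {x. F x \<in> A}) \<partial>N) = (\<integral>\<^sup>+s. emeasure unif (Pair s -` {x. F x \<in> A}) \<partial>\<mu>)"
          unfolding \<mu>b by (subst nn_integral_distr) auto
        also have "\<dots> = emeasure (\<mu> \<Otimes>\<^sub>M unif) {x. F x \<in> A}"
          by (rule U.emeasure_pair_measure_alt[symmetric]) measurable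
        also have "\<dots> = emeasure N {z. z \<in> A}" using FN[of "UNIV \<times> A"] by auto
        finally show ?thesis by (simp add: vimage_def)
      qed
      finally show "emeasure N A * emeasure ?S B = emeasure (distr \<Omega> \<Omega> T) (A \<times> B)" by simp
    qed
    then show ?thesis by (simp add: \<Omega>_def)
  qed
  have Tn[measurable]: "(T ^^ n) \<in> \<Omega> \<rightarrow>\<^sub>M \<Omega>" for n
    by (induction n) (auto simp: T id_def[symmetric] intro: measurable_comp simp del: o_apply)
  have Tninv: "distr \<Omega> \<Omega> (T ^^ n) = \<Omega>" for n
  proof (induction n)
    case 0 then show ?case by (simp add: id_def distr_id2)
  next
    case (Suc n)
    have "distr \<Omega> \<Omega> (T ^^ Suc n) = distr (distr \<Omega> \<Omega> (T ^^ n)) \<Omega> T"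
      by (subst distr_distr) (auto simp: o_def)
    then show ?case unfolding Suc Tinv .
  qed
  define Z where "Z n w = fst ((T ^^ n) w)" for n w
  have fst\<Omega>[measurable]: "fst \<in> borel_measurable \<Omega>" by measurable
  have Zm[measurable]: "Z n \<in> borel_measurable \<Omega>" for n
    unfolding Z_def by measurable
  have Z_Suc: "Z (Suc n) w = Z n (T w)" for n w
    unfolding Z_def funpow_Suc_right by simp
  have Z_shift: "Z (n + m) w = Z n ((T ^^ m) w)" for n m w
    unfolding Z_def funpow_add by simp
  \<comment> \<open>Law of the coordinates in \<open>J\<close> for the chain started at time
    \<open>-n\<close>. The truncation by \<open>nat\<close> spoils it when some
    \<open>j < -n\<close>, so the later uses ask for \<open>j + int n \<ge> 0\<close>.\<close>
  define L where "L n J = distr \<Omega> (Pi\<^sub>M J (\<lambda>_. borel)) (\<lambda>w. \<lambda>j\<in>J. Z (nat (j + int n)) w)" for n :: nat and J :: "int set"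
  have Lm[measurable]: "(\<lambda>w. \<lambda>j\<in>J. Z (nat (j + int n)) w) \<in> \<Omega> \<rightarrow>\<^sub>M Pi\<^sub>M J (\<lambda>_. borel)" for n and J :: "int set"
    by (intro measurable_restrict) measurable
  have L_Suc: "L (Suc n) J = L n J" if "\<forall>j\<in>J. j + int n \<ge> 0" for n J
  proof -
    have *: "(\<lambda>w. \<lambda>j\<in>J. Z (nat (j + int (Suc n))) w) = (\<lambda>w. \<lambda>j\<in>J. Z (nat (j + int n)) w) \<circ> T"
    proof (rule ext)
      fix w
      have "Z (nat (j + int (Suc n))) w = Z (nat (j + int n)) (T w)" if "j \<in> J" for j
      proof -
        have "nat (j + int (Suc n)) = Suc (nat (j + int n))" using \<open>\<forall>j\<in>J. j + int n \<ge> 0\<close> that by auto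
        then show ?thesis by (simp only: Z_Suc)
      qed
      then show "(\<lambda>j\<in>J. Z (nat (j + int (Suc n))) w) = ((\<lambda>w. \<lambda>j\<in>J. Z (nat (j + int n)) w) \<circ> T) w"
        by (auto simp: restrict_def fun_eq_iff)
    qed
    have "L n J = distr (distr \<Omega> \<Omega> T) (Pi\<^sub>M J (\<lambda>_. borel)) (\<lambda>w. \<lambda>j\<in>J. Z (nat (j + int n)) w)"
      unfolding L_def Tinv ..
    also have "\<dots> = L (Suc n) J" unfolding L_def * by (rule distr_distr) auto
    finally show ?thesis ..
  qed
  have L_ge: "L (n + k) J = L n J" if "\<forall>j\<in>J. j + int n \<ge> 0" for n k J
  proof (induction k)
    case (Suc k)
    have "L (Suc (n + k)) J = L (n + k) J" using that by (intro L_Suc) auto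
    then show ?case using Suc by simp
  qed simp
  define nn where "nn J = nat (Max (insert 0 (abs ` J)))" for J :: "int set"
  have nn: "\<forall>j\<in>J. j + int (nn J) \<ge> 0" if "finite J" for J
  proof
    fix j assume "j \<in> J"
    then have "\<bar>j\<bar> \<le> Max (insert 0 (abs ` J))" using that by (intro Max_ge) auto
    then show "j + int (nn J) \<ge> 0" unfolding nn_def by auto
  qed
  define P where "P J = L (nn J) J" for J
  have LP: "L n J = P J" if "finite J" "\<forall>j\<in>J. j + int n \<ge> 0" for n J
    using L_ge[OF that(2), of "nn J"] L_ge[OF nn[OF that(1)], of n] unfolding P_def by (simp add: add.commute)
  \<comment> \<open>Kolmogorov extension. By \<open>LP\<close> every sufficiently early start gives
    the same law on a finite index set, and this is the consistency required.\<close>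
  interpret PP: polish_projective "UNIV :: int set" P
  proof (unfold polish_projective_def, rule projective_family.intro)
    fix J H :: "int set" assume JH: "J \<subseteq> H" "finite H"
    then have fJ: "finite J" by (rule finite_subset)
    have "distr (P H) (Pi\<^sub>M J (\<lambda>_. borel)) (\<lambda>f. restrict f J) = distr \<Omega> (Pi\<^sub>M J (\<lambda>_. borel)) ((\<lambda>f. restrict f J) \<circ> (\<lambda>w. \<lambda>j\<in>H. Z (nat (j + int (nn H))) w))"
      unfolding P_def L_def using JH by (intro distr_distr measurable_restrict_subset) auto
    also have "\<dots> = L (nn H) J"
      unfolding L_def using JH by (intro distr_cong) (auto simp: o_def restrict_def fun_eq_iff)
    also have "\<dots> = P J" using nn[OF JH(2)] JH fJ by (intro LP) auto
    finally show "P J = distr (P H) (Pi\<^sub>M J (\<lambda>_. borel)) (\<lambda>f. restrict f J)" ..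
  next
    fix J :: "int set"
    show "prob_space (P J)" unfolding P_def L_def by (rule \<Omega>.prob_space_distr) auto
  qed
  let ?P = "PP.lim"
  have sP: "sets ?P = sets borel" by (simp add: sets_PiM_equal_borel)
  have spP: "space ?P = UNIV" by (simp add: space_PiM)
  have cyl: "emeasure ?P {\<omega>. restrict \<omega> J \<in> X} = emeasure \<Omega> {w. (\<lambda>j\<in>J. Z (nat (j + int n)) w) \<in> X}"
    if J: "finite J" "\<forall>j\<in>J. j + int n \<ge> 0" and X: "X \<in> sets (Pi\<^sub>M J (\<lambda>_. borel))" for J n X
  proof -
    have "{\<omega>. restrict \<omega> J \<in> X} = PP.emb UNIV J X" by (auto simp: prod_emb_def)
    then have "emeasure ?P {\<omega>. restrict \<omega> J \<in> X} = emeasure (P J) X"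
      using PP.emeasure_lim_emb[OF subset_UNIV J(1) X] by simp
    also have "\<dots> = emeasure (L n J) X" using LP[OF J] by simp
    also have "\<dots> = emeasure \<Omega> {w. (\<lambda>j\<in>J. Z (nat (j + int n)) w) \<in> X}"
      unfolding L_def using X by (subst emeasure_distr) (auto simp: sp\<Omega> vimage_def)
    finally show ?thesis .
  qed
  have box: "emeasure ?P {\<omega>. \<forall>j\<in>J. \<omega> j \<in> A j} = emeasure \<Omega> {w. \<forall>j\<in>J. Z (nat (j + int n)) w \<in> A j}"
    if J: "finite J" "\<forall>j\<in>J. j + int n \<ge> 0" and A: "\<And>j. j \<in> J \<Longrightarrow> A j \<in> sets borel" for J n A
    using cyl[OF J sets_PiM_I_finite[OF J(1), of A]] A by (simp add: PiE_iff)
  have pP: "prob_space ?P" by unfold_locales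
  have law: "distr ?P borel (\<lambda>\<omega>. \<omega> k) = N" for k
  proof (rule measure_eqI)
    show "sets (distr ?P borel (\<lambda>\<omega>. \<omega> k)) = sets N" using sN by simp
    fix A assume "A \<in> sets (distr ?P borel (\<lambda>\<omega>. \<omega> k))"
    then have A[measurable]: "A \<in> sets borel" by simp
    have mk: "(\<lambda>\<omega>. \<omega> k) \<in> borel_measurable ?P"
      using measurable_component_singleton[of k UNIV "\<lambda>_. borel :: real measure"]
      by (simp add: measurable_cong_sets[OF PP.sets_lim refl])
    have "emeasure (distr ?P borel (\<lambda>\<omega>. \<omega> k)) A = emeasure ?P {\<omega>. \<forall>j\<in>{k}. \<omega> j \<in> A}"
      by (subst emeasure_distr[OF mk A]) (simp add: spP vimage_def del: PP.space_lim)
    also have "\<dots> = emeasure \<Omega> {w. Z (nat (k + int (nat \<bar>k\<bar>))) w \<in> A}"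
      using box[of "{k}" "nat \<bar>k\<bar>" "\<lambda>_. A"] by simp
    also have "\<dots> = emeasure (distr \<Omega> \<Omega> (T ^^ (nat (k + int (nat \<bar>k\<bar>))))) {w. fst w \<in> A}"
    proof (subst emeasure_distr)
      have "{w \<in> space \<Omega>. fst w \<in> A} \<in> sets \<Omega>" by measurable
      then show "{w. fst w \<in> A} \<in> sets \<Omega>" by (simp add: sp\<Omega>)
    qed (auto simp: sp\<Omega> Z_def vimage_def)
    also have "\<dots> = emeasure \<Omega> (A \<times> UNIV)"
      unfolding Tninv by (intro arg_cong[where f="emeasure \<Omega>"]) auto
    also have "\<dots> = emeasure N A * emeasure ?S UNIV"
      unfolding \<Omega>_def using sets.top[of ?S] sN A by (intro sigma_finite_measure.emeasure_pair_measure_Times[OF sfS]) (auto simp: spS)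
    finally show "emeasure (distr ?P borel (\<lambda>\<omega>. \<omega> k)) A = emeasure N A"
      using prob_space.emeasure_space_1[OF prS] by (simp add: spS)
  qed
  \<comment> \<open>The law of \<open>(\<alpha> z, z)\<close> sits on the graph of
    \<open>\<alpha>\<close>, hence \<open>\<alpha> (F (s, u)) = s\<close> for almost all
    \<open>(s, u)\<close>; then \<open>s = \<beta> z\<close> may be inserted, because its law is
    \<open>\<mu>\<close>.\<close>
  have glue0: "AE w in \<Omega>. \<beta> (fst w) = \<alpha> (fst (T w))"
  proof -
    have Dm[measurable]: "{x::real \<times> real. fst x = \<alpha> (snd x)} \<in> sets (borel \<Otimes>\<^sub>M borel)"
    proof -
      have "{x::real \<times> real \<in> space (borel \<Otimes>\<^sub>M borel). fst x = \<alpha> (snd x)} \<in> sets (borel \<Otimes>\<^sub>M borel)" by measurable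
      then show ?thesis by (simp add: space_pair_measure)
    qed
    interpret MU: pair_prob_space \<mu> unif ..
    have "emeasure (\<mu> \<Otimes>\<^sub>M unif) {x. fst x = \<alpha> (F x)} = 1"
      using FN[OF Dm] N.emeasure_space_1 by (simp add: spN)
    then have "AE x in \<mu> \<Otimes>\<^sub>M unif. x \<in> {x. fst x = \<alpha> (F x)}"
      by (intro MU.AE_prob_1) (simp add: measure_def)
    then have "AE x in \<mu> \<Otimes>\<^sub>M unif. fst x = \<alpha> (F x)" by simp
    then have "AE s in \<mu>. AE u in unif. s = \<alpha> (F (s, u))"
      using MU.AE_pair[of "\<lambda>x. fst x = \<alpha> (F x)"] by simp
    then have "AE z in N. AE u in unif. \<beta> z = \<alpha> (F (\<beta> z, u))"
      unfolding \<mu>b by (rule AE_distrD[rotated]) simp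
    then have "AE z in N. AE \<omega> in ?S. \<beta> z = \<alpha> (F (\<beta> z, \<omega> 0))"
    proof eventually_elim
      case (elim z)
      have c: "distr ?S unif (\<lambda>\<omega>. \<omega> 0) = unif" using S.PiM_component[of 0] by simp
      have "AE u in distr ?S unif (\<lambda>\<omega>. \<omega> 0). \<beta> z = \<alpha> (F (\<beta> z, u))"
        unfolding c by (rule elim)
      then show ?case
        by (rule AE_distrD[rotated]) measurable
    qed
    then have "AE w in N \<Otimes>\<^sub>M ?S. \<beta> (fst w) = \<alpha> (F (\<beta> (fst w), snd w 0))"
      by (intro pp.AE_pair_measure) auto
    then show ?thesis unfolding \<Omega>_def T_def by simp
  qed
  have glue: "AE \<omega> in ?P. \<beta> (\<omega> k) = \<alpha> (\<omega> (k + 1))" for k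
  proof -
    define n where "n = nat \<bar>k\<bar>"
    define m where "m = nat (k + int n)"
    have m1: "nat (k + 1 + int n) = Suc m" unfolding m_def n_def by auto
    let ?X = "{f \<in> space (Pi\<^sub>M {k, k+1} (\<lambda>_. borel)). \<beta> (f k) = \<alpha> (f (k + 1))}"
    have Xm: "?X \<in> sets (Pi\<^sub>M {k, k+1} (\<lambda>_. borel))" by measurable
    have "AE w in distr \<Omega> \<Omega> (T ^^ m). \<beta> (fst w) = \<alpha> (fst (T w))"
      unfolding Tninv by (rule glue0)
    then have "AE w in \<Omega>. \<beta> (fst ((T ^^ m) w)) = \<alpha> (fst (T ((T ^^ m) w)))"
      by (rule AE_distrD[rotated]) measurable
    then have "AE w in \<Omega>. w \<in> {w. \<beta> (Z m w) = \<alpha> (Z (Suc m) w)}"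
      unfolding Z_def by simp
    then have "emeasure \<Omega> {w. \<beta> (Z m w) = \<alpha> (Z (Suc m) w)} = 1"
    proof (rule \<Omega>.emeasure_eq_1_AE[rotated])
      have "{w \<in> space \<Omega>. \<beta> (Z m w) = \<alpha> (Z (Suc m) w)} \<in> sets \<Omega>" by measurable
      then show "{w. \<beta> (Z m w) = \<alpha> (Z (Suc m) w)} \<in> sets \<Omega>" by (simp add: sp\<Omega>)
    qed
    also have "{w. \<beta> (Z m w) = \<alpha> (Z (Suc m) w)} = {w. (\<lambda>j\<in>{k, k+1}. Z (nat (j + int n)) w) \<in> ?X}"
      using m1 by (auto simp: space_PiM m_def)
    also have "emeasure \<Omega> \<dots> = emeasure ?P {\<omega>. restrict \<omega> {k, k+1} \<in> ?X}"
      by (rule cyl[symmetric]) (use Xm in \<open>auto simp: n_def\<close>)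
    also have "{\<omega>. restrict \<omega> {k, k+1} \<in> ?X} = {\<omega>. \<beta> (\<omega> k) = \<alpha> (\<omega> (k + 1))}"
      by (auto simp: space_PiM)
    finally have "AE \<omega> in ?P. \<omega> \<in> {\<omega>. \<beta> (\<omega> k) = \<alpha> (\<omega> (k + 1))}"
      by (intro PP.P.AE_prob_1) (simp add: measure_def)
    then show ?thesis by simp
  qed
  \<comment> \<open>A cylinder shifted by one place is the same cylinder for a chain started one
    step earlier, and the starting time does not affect the law. \<open>n\<close> is taken early
    enough for both index sets.\<close>
  have inv: "distr ?P borel (\<lambda>\<omega> k. \<omega> (k + 1)) = ?P"
  proof -
    have sh: "(\<lambda>\<omega> k. \<omega> (k + 1)) \<in> ?P \<rightarrow>\<^sub>M Pi\<^sub>M (UNIV :: int set) (\<lambda>_. borel :: real measure)"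
      unfolding measurable_cong_sets[OF PP.sets_lim refl]
      by (intro measurable_PiM_single') (auto simp: space_PiM)
    have "distr ?P borel (\<lambda>\<omega> k. \<omega> (k + 1)) = distr ?P (Pi\<^sub>M UNIV (\<lambda>_. borel)) (\<lambda>\<omega> k. \<omega> (k + 1))"
      by (intro distr_cong) (auto simp: sets_PiM_equal_borel)
    also have "\<dots> = ?P"
    proof (rule measure_eqI_PiM_infinite[where I=UNIV and M="\<lambda>_. borel"])
      fix A and J :: "int set" assume J: "finite J" and A: "\<And>i. i \<in> J \<Longrightarrow> A i \<in> sets (borel :: real measure)"
      define n where "n = nn (J \<union> (\<lambda>j. j + 1) ` J)"
      have n: "\<forall>j\<in>J \<union> (\<lambda>j. j + 1) ` J. j + int n \<ge> 0" unfolding n_def by (rule nn) (use J in auto)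
      have e: "prod_emb UNIV (\<lambda>_. borel) J (Pi\<^sub>E J A) = {\<omega>. \<forall>j\<in>J. \<omega> j \<in> A j}"
        by (auto simp: prod_emb_def PiE_iff)
      have em: "{\<omega>. \<forall>j\<in>J. \<omega> j \<in> A j} \<in> sets (Pi\<^sub>M UNIV (\<lambda>_. borel))"
        unfolding e[symmetric] using J A by (intro sets_PiM_I) auto
      have "emeasure (distr ?P (Pi\<^sub>M UNIV (\<lambda>_. borel)) (\<lambda>\<omega> k. \<omega> (k + 1))) {\<omega>. \<forall>j\<in>J. \<omega> j \<in> A j}
        = emeasure ?P {\<omega>. \<forall>j\<in>J. \<omega> (j + 1) \<in> A j}"
        by (subst emeasure_distr[OF sh em]) (simp add: spP vimage_def del: PP.space_lim)
      also have "{\<omega>. \<forall>j\<in>J. \<omega> (j + 1) \<in> A j} = {\<omega>. \<forall>j\<in>(\<lambda>j. j + 1) ` J. \<omega> j \<in> A (j - 1)}" by auto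
      also have "emeasure ?P \<dots> = emeasure \<Omega> {w. \<forall>j\<in>(\<lambda>j. j + 1) ` J. Z (nat (j + int n)) w \<in> A (j - 1)}"
        using n J A by (intro box) auto
      also have "{w. \<forall>j\<in>(\<lambda>j. j + 1) ` J. Z (nat (j + int n)) w \<in> A (j - 1)} = {w. \<forall>j\<in>J. Z (nat (j + int (Suc n))) w \<in> A j}"
        by (auto simp: algebra_simps)
      also have "emeasure \<Omega> \<dots> = emeasure ?P {\<omega>. \<forall>j\<in>J. \<omega> j \<in> A j}"
      proof (rule box[symmetric])
        show "\<forall>j\<in>J. j + int (Suc n) \<ge> 0"
        proof
          fix j assume "j \<in> J"
          then have "j + int n \<ge> 0" using n by blast
          then show "j + int (Suc n) \<ge> 0" by simp
        qed
      qed (use J A in auto)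
      finally show "emeasure (distr ?P (Pi\<^sub>M UNIV (\<lambda>_. borel)) (\<lambda>\<omega> k. \<omega> (k + 1))) (prod_emb UNIV (\<lambda>_. borel) J (Pi\<^sub>E J A))
        = emeasure ?P (prod_emb UNIV (\<lambda>_. borel) J (Pi\<^sub>E J A))" unfolding e .
    next
      show "finite_measure (distr ?P (Pi\<^sub>M UNIV (\<lambda>_. borel)) (\<lambda>\<omega> k. \<omega> (k + 1)))"
        using PP.P.prob_space_distr[OF sh] by (simp add: prob_space_def)
    qed auto
    finally show ?thesis .
  qed
  show ?thesis
    by (rule that[of ?P]) (use pP sP law glue inv in \<open>auto simp: AE_all_countable\<close>)
qed

section \<open>Coding sequences of reals by a real number\<close>

text \<open>Ternary expansions with digits 0 and 2: a first digit 2 gives a value of at least 2/3, a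
  first digit 0 one of at most 1/3, so the threshold 1/2 in \<open>cantor_rem\<close> reads the
  digits off unambiguously.\<close>

definition cantor :: "(nat \<Rightarrow> bool) \<Rightarrow> real" where
  "cantor b = (\<Sum>n. (if b n then 2 else 0) / 3 ^ Suc n)"

primrec cantor_rem :: "real \<Rightarrow> nat \<Rightarrow> real" where
  "cantor_rem x 0 = x"
| "cantor_rem x (Suc n) = 3 * cantor_rem x n - (if cantor_rem x n \<ge> 1/2 then 2 else 0)"

lemma cantor_sums: "(\<lambda>n. 2 / 3 ^ Suc n) sums (1::real)"
proof -
  have "(\<lambda>n. (2/3) * (1/3::real) ^ n) sums ((2/3) * (1 / (1 - 1/3)))"
    by (intro sums_mult geometric_sums) auto
  then show ?thesis by (simp add: power_divide)
qed

lemma cantor_summable: "summable (\<lambda>n. (if b n then 2 else 0) / 3 ^ Suc n :: real)"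
  by (rule summable_comparison_test'[OF sums_summable[OF cantor_sums], of 0]) auto

lemma cantor_nonneg: "0 \<le> cantor b"
  unfolding cantor_def by (intro suminf_nonneg cantor_summable) auto

lemma cantor_le_1: "cantor b \<le> 1"
proof -
  have "cantor b \<le> (\<Sum>n. 2 / 3 ^ Suc n)"
    unfolding cantor_def
    by (intro suminf_le cantor_summable sums_summable[OF cantor_sums]) auto
  then show ?thesis using sums_unique[OF cantor_sums] by simp
qed

lemma cantor_split: "cantor b = (if b 0 then 2/3 else 0) + cantor (\<lambda>n. b (Suc n)) / 3"
proof -
  have "cantor b = (if b 0 then 2 else 0) / 3 ^ Suc 0 + (\<Sum>n. (if b (Suc n) then 2 else 0) / 3 ^ Suc (Suc n))"
    unfolding cantor_def using suminf_split_head[OF cantor_summable, of b] by simp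
  also have "(\<Sum>n. (if b (Suc n) then 2 else 0) / 3 ^ Suc (Suc n)) = cantor (\<lambda>n. b (Suc n)) / 3"
    unfolding cantor_def using suminf_divide[OF cantor_summable[of "\<lambda>n. b (Suc n)"], of 3]
    by (simp add: mult.commute)
  finally show ?thesis by auto
qed

lemma cantor_ge_half: "cantor b \<ge> 1/2 \<longleftrightarrow> b 0"
  using cantor_split[of b] cantor_nonneg[of "\<lambda>n. b (Suc n)"] cantor_le_1[of "\<lambda>n. b (Suc n)"]
  by auto

lemma cantor_rem_cantor: "cantor_rem (cantor b) n = cantor (\<lambda>k. b (k + n))"
proof (induction n)
  case (Suc n)
  then show ?case
    using cantor_split[of "\<lambda>k. b (k + n)"] cantor_ge_half[of "\<lambda>k. b (k + n)"]
    by (simp only: cantor_rem.simps) (simp split: if_splits)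
qed simp

lemma cantor_digit: "cantor_rem (cantor b) n \<ge> 1/2 \<longleftrightarrow> b n"
  using cantor_ge_half[of "\<lambda>k. b (k + n)"] by (simp add: cantor_rem_cantor)

text \<open>The digit with index (k, j) records whether y k lies below the j-th rational number.\<close>

definition seq_encode :: "(nat \<Rightarrow> real) \<Rightarrow> real" where
  "seq_encode y = cantor (\<lambda>m. y (fst (prod_decode m)) < real_of_rat (from_nat (snd (prod_decode m))))"

text \<open>A number is the infimum of the rationals above it. Taking this infimum in
  \<open>ereal\<close> makes decoding total and Borel on all reals, also on those that code no
  sequence.\<close>

definition seq_decode :: "real \<Rightarrow> nat \<Rightarrow> real" where
  "seq_decode x k = real_of_ereal (INF j. if cantor_rem x (prod_encode (k, j)) \<ge> 1/2
     then ereal (real_of_rat (from_nat j)) else \<infinity>)"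

lemma INF_rat_above: "(INF j. if y < real_of_rat (from_nat j) then ereal (real_of_rat (from_nat j)) else \<infinity>) = ereal y"
proof (rule INF_eqI)
  fix z :: ereal
  assume z: "\<And>j. j \<in> UNIV \<Longrightarrow> z \<le> (if y < real_of_rat (from_nat j) then ereal (real_of_rat (from_nat j)) else \<infinity>)"
  have "z \<le> ereal r" if yr: "y < r" for r
  proof -
    obtain q where q: "q \<in> \<rat>" "y < q" "q < r" using Rats_dense_in_real[OF yr] by blast
    then obtain q' where q': "q = real_of_rat q'" by (auto simp: Rats_def)
    have "from_nat (to_nat q') = q'" by simp
    with z[of "to_nat q'"] q q' have "z \<le> ereal q" by auto
    also have "\<dots> \<le> ereal r" using q by simp
    finally show ?thesis .
  qed
  moreover have "\<exists>r. ereal y < ereal r \<and> ereal r < z" if "ereal y < z"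
    using ereal_dense2[OF that] .
  ultimately show "z \<le> ereal y"
    by (meson leD leI less_ereal.simps(1))
qed auto

lemma seq_decode_encode: "seq_decode (seq_encode y) = y"
proof
  fix k
  show "seq_decode (seq_encode y) k = y k"
    unfolding seq_decode_def seq_encode_def cantor_digit
    using INF_rat_above[of "y k"] by simp
qed

lemma seq_encode_inj: "seq_encode x = seq_encode y \<Longrightarrow> x = y"
  by (metis seq_decode_encode)

lemma seq_encode_range: "seq_encode y \<in> {0..1}"
  unfolding seq_encode_def using cantor_nonneg cantor_le_1 by auto

lemma measurable_coord[measurable]: "(\<lambda>y::'i::countable \<Rightarrow> real. y k) \<in> borel_measurable borel"
  by (intro borel_measurable_continuous_onI continuous_on_product_coordinates)

lemma measurable_seq_encode[measurable]: "seq_encode \<in> borel_measurable borel"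
  unfolding seq_encode_def cantor_def by measurable

lemma measurable_cantor_rem[measurable]: "(\<lambda>x. cantor_rem x n) \<in> borel_measurable borel"
  by (induction n) auto

lemma measurable_seq_decode[measurable]: "seq_decode \<in> borel \<rightarrow>\<^sub>M borel"
proof (rule measurable_coordinatewise_then_product)
  fix k
  show "(\<lambda>x. seq_decode x k) \<in> borel_measurable borel"
    unfolding seq_decode_def by measurable
qed

section \<open>Smooth functions\<close>

lemma Ck_on_lincomb:
  fixes f g :: "'a::real_normed_vector \<Rightarrow> 'b::real_normed_vector"
  assumes "Ck_on n UNIV f" "Ck_on n UNIV g"
  shows "Ck_on n UNIV (\<lambda>x. a *\<^sub>R f x + b *\<^sub>R g x)"
  using assms
proof (induction n arbitrary: f g)
  case 0
  then show ?case by (auto intro!: continuous_intros)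
next
  case (Suc n)
  have fd: "(f has_derivative frechet_derivative f (at x)) (at x)"
    and gd: "(g has_derivative frechet_derivative g (at x)) (at x)" for x
    using Suc.prems by (auto simp: differentiable_on_def frechet_derivative_works)
  have h: "((\<lambda>x. a *\<^sub>R f x + b *\<^sub>R g x) has_derivative
      (\<lambda>v. a *\<^sub>R frechet_derivative f (at x) v + b *\<^sub>R frechet_derivative g (at x) v)) (at x)" for x
    by (intro derivative_intros fd gd)
  have e: "frechet_derivative (\<lambda>x. a *\<^sub>R f x + b *\<^sub>R g x) (at x) v
      = a *\<^sub>R frechet_derivative f (at x) v + b *\<^sub>R frechet_derivative g (at x) v" for x v
    using frechet_derivative_at[OF h[of x]] by (simp add: fun_eq_iff)
  have "(\<lambda>x. a *\<^sub>R f x + b *\<^sub>R g x) differentiable_on UNIV"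
    unfolding differentiable_on_def using h differentiableI by blast
  then show ?case
    using Suc.IH Suc.prems by (auto simp: e)
qed

lemma smooth_on_lincomb:
  fixes f g :: "'a::real_normed_vector \<Rightarrow> 'b::real_normed_vector"
  shows "smooth_on UNIV f \<Longrightarrow> smooth_on UNIV g \<Longrightarrow> smooth_on UNIV (\<lambda>x. a *\<^sub>R f x + b *\<^sub>R g x)"
  unfolding smooth_on_def using Ck_on_lincomb by blast

lemma Ck_on_const: "Ck_on n UNIV (\<lambda>x. c)"
  by (induction n arbitrary: c) auto

lemma frechet_derivative_real:
  fixes f :: "real \<Rightarrow> real"
  assumes "f differentiable (at x)"
  shows "frechet_derivative f (at x) v = deriv f x * v"
proof -
  have "(f has_real_derivative deriv f x) (at x)"
    using assms DERIV_deriv_iff_real_differentiable by blast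
  then have "(f has_derivative (\<lambda>v. deriv f x * v)) (at x)"
    by (simp add: has_field_derivative_def)
  then show ?thesis using frechet_derivative_at by (metis (no_types, lifting))
qed

text \<open>In one dimension every directional derivative is a multiple of \<open>deriv f\<close>,
  so only one derivative has to be followed.\<close>

lemma Ck_on_Suc_real:
  fixes f :: "real \<Rightarrow> real"
  shows "Ck_on (Suc n) UNIV f \<longleftrightarrow> (\<forall>x. f differentiable (at x)) \<and> Ck_on n UNIV (deriv f)"
proof (cases "\<forall>x. f differentiable (at x)")
  case True
  have e: "(\<lambda>x. frechet_derivative f (at x) v) = (\<lambda>x. v *\<^sub>R deriv f x + 0 *\<^sub>R deriv f x)" for v
    using True by (auto simp: frechet_derivative_real)
  have "Ck_on (Suc n) UNIV f \<longleftrightarrow> (\<forall>v. Ck_on n UNIV (\<lambda>x. v *\<^sub>R deriv f x + 0 *\<^sub>R deriv f x))"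
    using True unfolding Ck_on.simps e by (simp add: differentiable_on_def)
  also have "\<dots> \<longleftrightarrow> Ck_on n UNIV (deriv f)"
  proof
    assume "\<forall>v. Ck_on n UNIV (\<lambda>x. v *\<^sub>R deriv f x + 0 *\<^sub>R deriv f x)"
    from this[rule_format, of 1] show "Ck_on n UNIV (deriv f)" by simp
  qed (use Ck_on_lincomb in blast)
  finally show ?thesis using True by simp
qed (auto simp: differentiable_on_def)

lemma Ck_on_SucI:
  fixes f :: "real \<Rightarrow> real"
  assumes "\<And>x. (f has_real_derivative f' x) (at x)" "Ck_on n UNIV f'"
  shows "Ck_on (Suc n) UNIV f"
proof -
  have "deriv f = f'" using assms(1) by (auto intro: DERIV_imp_deriv)
  then show ?thesis unfolding Ck_on_Suc_real
    using assms by (auto simp: real_differentiable_def)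
qed

lemma Ck_on_SucD:
  fixes f :: "real \<Rightarrow> real"
  assumes "Ck_on (Suc n) UNIV f"
  shows "(f has_real_derivative deriv f x) (at x)" "Ck_on n UNIV (deriv f)"
  using assms unfolding Ck_on_Suc_real by (auto simp: DERIV_deriv_iff_real_differentiable)

lemma Ck_on_mono:
  fixes f :: "real \<Rightarrow> real"
  shows "Ck_on (Suc n) UNIV f \<Longrightarrow> Ck_on n UNIV f"
proof (induction n arbitrary: f)
  case 0
  then show ?case using Ck_on_SucD(1)[OF 0]
    by (auto intro!: continuous_at_imp_continuous_on DERIV_isCont)
next
  case (Suc n)
  show ?case using Ck_on_SucD[OF Suc.prems] Suc.IH by (intro Ck_on_SucI[where f'="deriv f"]) auto
qed

lemma Ck_on_mult:
  fixes f g :: "real \<Rightarrow> real"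
  shows "Ck_on n UNIV f \<Longrightarrow> Ck_on n UNIV g \<Longrightarrow> Ck_on n UNIV (\<lambda>x. f x * g x)"
proof (induction n arbitrary: f g)
  case 0 then show ?case by (auto intro!: continuous_intros)
next
  case (Suc n)
  note f = Ck_on_SucD[OF Suc.prems(1)] and g = Ck_on_SucD[OF Suc.prems(2)]
  show ?case
  proof (rule Ck_on_SucI)
    show "((\<lambda>x. f x * g x) has_real_derivative deriv f x * g x + deriv g x * f x) (at x)" for x
      by (rule DERIV_mult[OF f(1) g(1)])
    have "Ck_on n UNIV (\<lambda>x. 1 *\<^sub>R (deriv f x * g x) + 1 *\<^sub>R (deriv g x * f x))"
      using f g Suc.IH Suc.prems Ck_on_mono by (intro Ck_on_lincomb) blast+
    then show "Ck_on n UNIV (\<lambda>x. deriv f x * g x + deriv g x * f x)" by simp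
  qed
qed

lemma Ck_on_inverse:
  fixes g :: "real \<Rightarrow> real"
  shows "Ck_on n UNIV g \<Longrightarrow> (\<And>x. g x \<noteq> 0) \<Longrightarrow> Ck_on n UNIV (\<lambda>x. inverse (g x))"
proof (induction n)
  case 0 then show ?case by (auto intro!: continuous_intros)
next
  case (Suc n)
  note g = Ck_on_SucD[OF Suc.prems(1)]
  have i: "Ck_on n UNIV (\<lambda>x. inverse (g x))" using Suc Ck_on_mono by blast
  show ?case
  proof (rule Ck_on_SucI)
    show "((\<lambda>x. inverse (g x)) has_real_derivative - (inverse (g x) * deriv g x * inverse (g x))) (at x)" for x
      by (rule DERIV_inverse'[OF g(1)]) (rule Suc.prems)
    have "Ck_on n UNIV (\<lambda>x. (-1) *\<^sub>R (inverse (g x) * deriv g x * inverse (g x)) + 0 *\<^sub>R 0)"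
      by (intro Ck_on_lincomb Ck_on_mult i g Ck_on_const)
    then show "Ck_on n UNIV (\<lambda>x. - (inverse (g x) * deriv g x * inverse (g x)))" by simp
  qed
qed

lemma Ck_on_affine:
  fixes f :: "real \<Rightarrow> real"
  shows "Ck_on n UNIV f \<Longrightarrow> Ck_on n UNIV (\<lambda>x. f (a * x + b))"
proof (induction n arbitrary: f)
  case 0
  then show ?case by (auto intro!: continuous_on_compose2[of UNIV f] continuous_intros)
next
  case (Suc n)
  note f = Ck_on_SucD[OF Suc.prems(1)]
  show ?case
  proof (rule Ck_on_SucI)
    show "((\<lambda>x. f (a * x + b)) has_real_derivative deriv f (a * x + b) * a) (at x)" for x
      by (rule DERIV_chain2[OF f(1)]) (auto intro!: derivative_eq_intros)
    show "Ck_on n UNIV (\<lambda>x. deriv f (a * x + b) * a)"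
      by (intro Ck_on_mult Ck_on_const Suc.IH f)
  qed
qed

text \<open>For \<open>m = 0\<close> the usual flat function exp(-1/x). With the powers of 1/x the
  family is closed under differentiation up to linear combinations, and smoothness follows by
  induction for all \<open>m\<close> at once.\<close>

definition bump :: "nat \<Rightarrow> real \<Rightarrow> real" where
  "bump m x = (if x > 0 then inverse x ^ m * exp (- inverse x) else 0)"

lemma bump_tendsto_0: "((\<lambda>x. bump m x) \<longlongrightarrow> 0) (at_right 0)"
proof -
  have "((\<lambda>y::real. y ^ m / exp y) \<longlongrightarrow> 0) at_top" by (rule tendsto_power_div_exp_0)
  then have "((\<lambda>x::real. inverse x ^ m / exp (inverse x)) \<longlongrightarrow> 0) (at_right 0)"
    by (rule filterlim_compose[OF _ filterlim_inverse_at_top_right])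
  then show ?thesis
  proof (rule Lim_transform_eventually)
    show "\<forall>\<^sub>F x in at_right 0. inverse x ^ m / exp (inverse x) = bump m x"
      by (auto simp: eventually_at_right_field bump_def exp_minus field_simps intro!: exI[of _ 1])
  qed
qed

lemma DERIV_bump: "(bump m has_real_derivative bump (m + 2) x - m * bump (m + 1) x) (at x)"
proof -
  consider "x > 0" | "x < 0" | "x = 0" by linarith
  then show ?thesis
  proof cases
    case 1
    have "((\<lambda>x. inverse x ^ m * exp (- inverse x)) has_real_derivative bump (m + 2) x - m * bump (m + 1) x) (at x)"
    proof (cases m)
      case 0
      then show ?thesis using 1
        by (auto intro!: derivative_eq_intros simp: bump_def field_simps power2_eq_square)
    next
      case (Suc k)
      have pw: "x ^ i \<noteq> x * x ^ (i - Suc 0) \<Longrightarrow> i = 0" for i by (cases i) auto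
      show ?thesis using 1 Suc
        by (cases k) (auto intro!: derivative_eq_intros intro: pw simp: bump_def field_simps power2_eq_square)
    qed
    then show ?thesis
      by (rule DERIV_cong_ev[THEN iffD1, OF refl _ refl, rotated])
         (use 1 in \<open>auto simp: bump_def intro!: eventually_mono[OF eventually_nhds_in_open[of "{0<..}"]]\<close>)
  next
    case 2
    have "((\<lambda>x. 0) has_real_derivative bump (m + 2) x - m * bump (m + 1) x) (at x)"
      using 2 by (auto simp: bump_def)
    then show ?thesis
      by (rule DERIV_cong_ev[THEN iffD1, OF refl _ refl, rotated])
         (use 2 in \<open>auto simp: bump_def intro!: eventually_mono[OF eventually_nhds_in_open[of "{..<0}"]]\<close>)
  next
    case 3
    have "((\<lambda>h. (bump m (0 + h) - bump m 0) / h) \<longlongrightarrow> 0) (at 0)"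
      unfolding filterlim_split_at
    proof (rule filterlim_split_at)
      show "((\<lambda>h. (bump m (0 + h) - bump m 0) / h) \<longlongrightarrow> 0) (at_right 0)"
        by (rule Lim_transform_eventually[OF bump_tendsto_0[of "Suc m"]])
          (auto simp: eventually_at_right_field bump_def field_simps intro!: exI[of _ 1])
      show "((\<lambda>h. (bump m (0 + h) - bump m 0) / h) \<longlongrightarrow> 0) (at_left 0)"
        by (rule tendsto_eventually) (auto simp: eventually_at_left_field bump_def intro!: exI[of _ "-1"])
    qed
    then show ?thesis using 3 by (simp add: DERIV_def bump_def)
  qed
qed

lemma Ck_on_bump: "Ck_on n UNIV (bump m)"
proof (induction n arbitrary: m)
  case 0
  have "isCont (bump m) x" for x by (rule DERIV_isCont[OF DERIV_bump])
  then show ?case by (simp add: continuous_at_imp_continuous_on)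
next
  case (Suc n)
  show ?case
  proof (rule Ck_on_SucI[OF DERIV_bump])
    show "Ck_on n UNIV (\<lambda>x. bump (m + 2) x - m * bump (m + 1) x)"
      using Ck_on_lincomb[OF Suc.IH Suc.IH, of 1 "m + 2" "- real m" "m + 1"] by simp
  qed
qed

text \<open>A smooth transition from 0 to 1 across [0, 1]; the denominator is positive because
  \<open>x\<close> and \<open>1 - x\<close> are never both nonpositive.\<close>

definition smooth_step :: "real \<Rightarrow> real" where
  "smooth_step x = bump 0 x * inverse (bump 0 x + bump 0 (1 - x))"

lemma smooth_step_0: "x \<le> 0 \<Longrightarrow> smooth_step x = 0"
  by (simp add: smooth_step_def bump_def)

lemma smooth_step_1: "x \<ge> 1 \<Longrightarrow> smooth_step x = 1"
  by (simp add: smooth_step_def bump_def)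

lemma smooth_step_bounds: "0 \<le> smooth_step x" "smooth_step x \<le> 1"
  by (auto simp: smooth_step_def bump_def divide_inverse[symmetric] divide_le_eq_1 add_pos_pos add_nonneg_nonneg)

lemma Ck_on_smooth_step: "Ck_on n UNIV smooth_step"
  unfolding smooth_step_def
proof (intro Ck_on_mult Ck_on_inverse Ck_on_bump)
  have "Ck_on n UNIV (\<lambda>x. 1 *\<^sub>R bump 0 x + 1 *\<^sub>R bump 0 ((-1) * x + 1))"
    by (intro Ck_on_lincomb Ck_on_affine Ck_on_bump)
  then show "Ck_on n UNIV (\<lambda>x. bump 0 x + bump 0 (1 - x))" by simp
  show "bump 0 x + bump 0 (1 - x) \<noteq> 0" for x
    by (auto simp: bump_def add_nonneg_eq_0_iff)
qed

lemma smooth_on_mult: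
  fixes f g :: "real \<Rightarrow> real"
  shows "smooth_on UNIV f \<Longrightarrow> smooth_on UNIV g \<Longrightarrow> smooth_on UNIV (\<lambda>x. f x * g x)"
  unfolding smooth_on_def using Ck_on_mult by blast

lemma smooth_on_smooth_step_affine: "smooth_on UNIV (\<lambda>x. smooth_step (a * x + b))"
  unfolding smooth_on_def using Ck_on_affine Ck_on_smooth_step by blast

lemma smooth_on_real_has_derivative:
  fixes f :: "real \<Rightarrow> real"
  assumes "smooth_on UNIV f"
  shows "(f has_real_derivative deriv f x) (at x)" "continuous_on UNIV (deriv f)"
  using assms Ck_on_SucD[of 0 f] unfolding smooth_on_def by (auto dest: spec[of _ "Suc 0"] simp del: Ck_on.simps(2))

section \<open>Separable semi-Hilbert spaces\<close>

text \<open>The elements of the carrier are only identified when all their inner products agree, so that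
  functions can represent classes modulo null sets; \<open>lin a x b y\<close> stands for \<open>a x + b y\<close>.\<close>

locale semi_inner_space =
  fixes C :: "'a set" and ip :: "'a \<Rightarrow> 'a \<Rightarrow> real" and lin :: "real \<Rightarrow> 'a \<Rightarrow> real \<Rightarrow> 'a \<Rightarrow> 'a"
  assumes lin_closed: "x \<in> C \<Longrightarrow> y \<in> C \<Longrightarrow> lin a x b y \<in> C"
    and ip_lin: "x \<in> C \<Longrightarrow> y \<in> C \<Longrightarrow> z \<in> C \<Longrightarrow> ip (lin a x b y) z = a * ip x z + b * ip y z"
    and ip_sym: "x \<in> C \<Longrightarrow> y \<in> C \<Longrightarrow> ip x y = ip y x"
    and ip_nonneg: "x \<in> C \<Longrightarrow> ip x x \<ge> 0"
begin

definition nrm :: "'a \<Rightarrow> real" where "nrm x = sqrt (ip x x)"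

definition df :: "'a \<Rightarrow> 'a \<Rightarrow> 'a" where "df x y = lin 1 x (-1) y"

lemma df_closed[simp]: "x \<in> C \<Longrightarrow> y \<in> C \<Longrightarrow> df x y \<in> C"
  unfolding df_def by (rule lin_closed)

lemma ip_df: "x \<in> C \<Longrightarrow> y \<in> C \<Longrightarrow> z \<in> C \<Longrightarrow> ip (df x y) z = ip x z - ip y z"
  unfolding df_def by (simp add: ip_lin)

lemma ip_lin_right: "x \<in> C \<Longrightarrow> y \<in> C \<Longrightarrow> z \<in> C \<Longrightarrow> ip z (lin a x b y) = a * ip z x + b * ip z y"
  by (metis ip_lin ip_sym lin_closed)

lemma ip_df_right: "x \<in> C \<Longrightarrow> y \<in> C \<Longrightarrow> z \<in> C \<Longrightarrow> ip z (df x y) = ip z x - ip z y"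
  unfolding df_def by (simp add: ip_lin_right)

lemma nrm_nonneg: "x \<in> C \<Longrightarrow> 0 \<le> nrm x"
  unfolding nrm_def using ip_nonneg by simp

lemma nrm_sq: "x \<in> C \<Longrightarrow> (nrm x)\<^sup>2 = ip x x"
  unfolding nrm_def using ip_nonneg by simp

lemma ip_lin_lin: "x \<in> C \<Longrightarrow> y \<in> C \<Longrightarrow>
  ip (lin a x b y) (lin a x b y) = a\<^sup>2 * ip x x + 2 * a * b * ip x y + b\<^sup>2 * ip y y"
  by (simp add: ip_lin ip_lin_right lin_closed ip_sym[of y x] power2_eq_square algebra_simps)

text \<open>The form is only semidefinite. When \<open>ip y y = 0\<close>, the quadratic in the
  second coefficient degenerates to an affine function bounded below, so \<open>ip x y\<close>
  vanishes; otherwise the usual choice of coefficients works.\<close>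

lemma cauchy_schwarz_sq:
  assumes "x \<in> C" "y \<in> C"
  shows "(ip x y)\<^sup>2 \<le> ip x x * ip y y"
proof (cases "ip y y = 0")
  case True
  have *: "0 \<le> ip x x + 2 * b * ip x y" for b
    using ip_nonneg[OF lin_closed[OF assms, of 1 b]] ip_lin_lin[OF assms, of 1 b] True by simp
  have "ip x y = 0"
  proof (rule ccontr)
    assume n: "ip x y \<noteq> 0"
    then show False using *[of "- (ip x x + 1) / (2 * ip x y)"] by (simp add: field_simps)
  qed
  then show ?thesis using True by simp
next
  case False
  then have p: "ip y y > 0" using ip_nonneg[OF assms(2)] by simp
  have "0 \<le> (ip y y)\<^sup>2 * ip x x + 2 * ip y y * (- ip x y) * ip x y + (- ip x y)\<^sup>2 * ip y y"
    using ip_nonneg[OF lin_closed[OF assms, of "ip y y" "- ip x y"]] ip_lin_lin[OF assms] by simp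
  also have "\<dots> = ip y y * (ip x x * ip y y - (ip x y)\<^sup>2)"
    by (simp add: power2_eq_square algebra_simps)
  finally show ?thesis using p by (simp add: zero_le_mult_iff)
qed

lemma cauchy_schwarz: "x \<in> C \<Longrightarrow> y \<in> C \<Longrightarrow> \<bar>ip x y\<bar> \<le> nrm x * nrm y"
  using real_sqrt_le_mono[OF cauchy_schwarz_sq[of x y]] unfolding nrm_def
  by (simp add: real_sqrt_mult)

lemma nrm_triangle:
  assumes "x \<in> C" "y \<in> C" "z \<in> C"
  shows "nrm (df x z) \<le> nrm (df x y) + nrm (df y z)"
proof (cases "nrm (df x z) = 0")
  case True
  then show ?thesis using assms nrm_nonneg[of "df x y"] nrm_nonneg[of "df y z"] by simp
next
  case False
  then have p: "nrm (df x z) > 0" using assms nrm_nonneg[of "df x z"] by simp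
  have "nrm (df x z) * nrm (df x z) = ip (df x y) (df x z) + ip (df y z) (df x z)"
    using assms nrm_sq[of "df x z"] by (simp add: power2_eq_square ip_df)
  also have "\<dots> \<le> nrm (df x y) * nrm (df x z) + nrm (df y z) * nrm (df x z)"
    using assms cauchy_schwarz[of "df x y" "df x z"] cauchy_schwarz[of "df y z" "df x z"] by auto
  finally show ?thesis using p by (simp add: distrib_right[symmetric])
qed

lemma nrm_df_sym: "x \<in> C \<Longrightarrow> y \<in> C \<Longrightarrow> nrm (df x y) = nrm (df y x)"
  unfolding nrm_def by (simp add: ip_df ip_df_right ip_sym)

lemma nrm_lin_le:
  assumes "x \<in> C" "y \<in> C" "x' \<in> C" "y' \<in> C"
  shows "nrm (df (lin a x b y) (lin a x' b y')) \<le> \<bar>a\<bar> * nrm (df x x') + \<bar>b\<bar> * nrm (df y y')"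
proof (cases "nrm (df (lin a x b y) (lin a x' b y')) = 0")
  case True
  then show ?thesis using assms nrm_nonneg[of "df x x'"] nrm_nonneg[of "df y y'"] by simp
next
  case False
  let ?d = "df (lin a x b y) (lin a x' b y')"
  have d: "?d \<in> C" using assms by (simp add: lin_closed)
  have p: "nrm ?d > 0" using False nrm_nonneg[OF d] by simp
  have "nrm ?d * nrm ?d = a * ip (df x x') ?d + b * ip (df y y') ?d"
    using assms nrm_sq[OF d] d by (simp add: power2_eq_square ip_df ip_lin lin_closed algebra_simps)
  also have "\<dots> \<le> \<bar>a\<bar> * (nrm (df x x') * nrm ?d) + \<bar>b\<bar> * (nrm (df y y') * nrm ?d)"
  proof -
    have *: "c * ip z ?d \<le> \<bar>c\<bar> * (nrm z * nrm ?d)" if "z \<in> C" for c z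
    proof -
      have "c * ip z ?d \<le> \<bar>c\<bar> * \<bar>ip z ?d\<bar>" by (metis abs_ge_self abs_mult)
      also have "\<dots> \<le> \<bar>c\<bar> * (nrm z * nrm ?d)" using cauchy_schwarz[OF that d] by (rule mult_left_mono) simp
      finally show ?thesis .
    qed
    show ?thesis using assms by (intro add_mono *) auto
  qed
  finally show ?thesis using p by (simp add: mult.assoc[symmetric] distrib_right[symmetric])
qed

end

text \<open>The dense sequence belongs to the structure: the numbers \<open>ip x (v k)\<close>
  determine \<open>x\<close> up to identification and serve as its coordinates.\<close>

locale semi_hilbert = semi_inner_space C ip lin
  for C :: "'a set" and ip :: "'a \<Rightarrow> 'a \<Rightarrow> real" and lin :: "real \<Rightarrow> 'a \<Rightarrow> real \<Rightarrow> 'a \<Rightarrow> 'a" +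
  fixes v :: "nat \<Rightarrow> 'a"
  assumes complete: "(\<And>n::nat. X n \<in> C) \<Longrightarrow>
      (\<And>e. e > 0 \<Longrightarrow> \<exists>N. \<forall>m\<ge>N. \<forall>n\<ge>N. nrm (df (X m) (X n)) < e) \<Longrightarrow>
      \<exists>x\<in>C. (\<lambda>n. nrm (df (X n) x)) \<longlonglongrightarrow> 0"
    and v_in: "v n \<in> C"
    and v_dense: "x \<in> C \<Longrightarrow> e > 0 \<Longrightarrow> \<exists>n. nrm (df x (v n)) < e"
begin

lemma nrm_complete:
  assumes X: "\<And>n::nat. X n \<in> C" and c: "\<And>e. e > 0 \<Longrightarrow> \<exists>N. \<forall>m\<ge>N. \<forall>n\<ge>N. nrm (df (X m) (X n)) < e"
  obtains x where "x \<in> C" "(\<lambda>n. nrm (df (X n) x)) \<longlonglongrightarrow> 0"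
  using complete[OF assms] by blast

lemma v_approx:
  assumes "x \<in> C" "e > 0" obtains n where "nrm (df x (v n)) < e"
  using v_dense[OF assms] by blast

lemma ip_eq_of_v:
  assumes "x \<in> C" "y \<in> C" "\<And>k. ip x (v k) = ip y (v k)" "z \<in> C"
  shows "ip x z = ip y z"
proof -
  have "\<bar>ip (df x y) z\<bar> \<le> 0"
  proof (rule field_le_epsilon)
    fix e :: real assume e: "e > 0"
    define e' where "e' = e / (nrm (df x y) + 1)"
    have p: "nrm (df x y) + 1 > 0" using assms nrm_nonneg[of "df x y"] by simp
    then have "e' > 0" unfolding e'_def using e by simp
    then obtain n where n: "nrm (df z (v n)) < e'" using v_approx assms by blast
    have "\<bar>ip (df x y) z\<bar> = \<bar>ip (df x y) (df z (v n))\<bar>"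
      using assms v_in by (simp add: ip_df ip_df_right)
    also have "\<dots> \<le> nrm (df x y) * nrm (df z (v n))" using assms v_in by (intro cauchy_schwarz) auto
    also have "\<dots> \<le> (nrm (df x y) + 1) * e'"
      using n assms v_in nrm_nonneg by (intro mult_mono) (auto intro: less_imp_le add_nonneg_nonneg)
    also have "\<dots> = e" unfolding e'_def using p by simp
    finally show "\<bar>ip (df x y) z\<bar> \<le> 0 + e" by simp
  qed
  then show ?thesis using assms by (simp add: ip_df)
qed

lemma nrm_eq_of_ip: 
  assumes "x \<in> C" "y \<in> C" "\<And>z. z \<in> C \<Longrightarrow> ip x z = ip y z"
  shows "nrm x = nrm y"
  unfolding nrm_def using assms by (metis ip_sym)

text \<open>The representing element minimises \<open>ip x x - 2 * \<phi> x\<close>. A minimising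
  sequence is Cauchy by the parallelogram law, and the vanishing first variation at the minimum is
  the representation.\<close>

lemma riesz:
  assumes \<phi>: "\<And>x y a b. x \<in> C \<Longrightarrow> y \<in> C \<Longrightarrow> \<phi> (lin a x b y) = a * \<phi> x + b * \<phi> y"
    and M: "\<And>x. x \<in> C \<Longrightarrow> \<bar>\<phi> x\<bar> \<le> M * nrm x"
  obtains h where "h \<in> C" "\<And>y. y \<in> C \<Longrightarrow> \<phi> y = ip h y"
proof -
  define J where "J x = ip x x - 2 * \<phi> x" for x
  have J_ge: "J x \<ge> - M\<^sup>2" if "x \<in> C" for x
  proof -
    have "J x \<ge> (nrm x)\<^sup>2 - 2 * (M * nrm x)" using M[OF that] nrm_sq[OF that] unfolding J_def by auto
    moreover have "(nrm x)\<^sup>2 - 2 * (M * nrm x) + M\<^sup>2 \<ge> 0"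
      using zero_le_power2[of "nrm x - M"] by (simp add: power2_diff algebra_simps)
    ultimately show ?thesis by linarith
  qed
  define I where "I = (INF x\<in>C. J x)"
  have bdd: "bdd_below (J ` C)" using J_ge by (intro bdd_belowI2) auto
  have ne: "C \<noteq> {}" using v_in by auto
  have I_le: "I \<le> J x" if "x \<in> C" for x unfolding I_def using bdd that by (rule cINF_lower)
  have "\<exists>x\<in>C. J x < I + 1 / real (Suc n)" for n
  proof -
    have "I < I + 1 / real (Suc n)" by simp
    then show ?thesis unfolding I_def cINF_less_iff[OF ne bdd] by blast
  qed
  then obtain X where X: "\<And>n. X n \<in> C" "\<And>n. J (X n) < I + 1 / real (Suc n)" by metis
  \<comment> \<open>The parallelogram law; the linear parts of \<open>J\<close> cancel against the
    midpoint.\<close>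
  have para: "(nrm (df x y))\<^sup>2 = 2 * (J x + J y - 2 * J (lin (1/2) x (1/2) y))" if "x \<in> C" "y \<in> C" for x y
  proof -
    have "(nrm (df x y))\<^sup>2 = ip x x - 2 * ip x y + ip y y"
      using nrm_sq[of "df x y"] that ip_lin_lin[OF that, of 1 "-1"] unfolding df_def by (simp add: lin_closed)
    then show ?thesis
      using that unfolding J_def by (simp add: ip_lin_lin \<phi> power2_eq_square field_simps)
  qed
  have close: "(nrm (df (X m) (X n)))\<^sup>2 \<le> 2 * (1 / real (Suc m) + 1 / real (Suc n))" for m n
    using para[of "X m" "X n"] X[of m] X[of n] I_le[OF lin_closed[of "X m" "X n" "1/2" "1/2"]] by auto
  obtain h where h: "h \<in> C" "(\<lambda>n. nrm (df (X n) h)) \<longlonglongrightarrow> 0"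
  proof (rule nrm_complete[of X])
    fix e :: real assume e: "e > 0"
    obtain N where N: "1 / real (Suc N) < e\<^sup>2 / 4" using nat_approx_posE[of "e\<^sup>2 / 4"] e by auto
    have "nrm (df (X m) (X n)) < e" if "m \<ge> N" "n \<ge> N" for m n
    proof -
      have "1 / real (Suc m) \<le> 1 / real (Suc N)" "1 / real (Suc n) \<le> 1 / real (Suc N)"
        using that by (auto simp: frac_le)
      then have "2 * (1 / real (Suc m) + 1 / real (Suc n)) \<le> 2 * (1 / real (Suc N) + 1 / real (Suc N))"
        by (intro mult_left_mono add_mono) auto
      also have "\<dots> < e\<^sup>2" using N by simp
      finally have "(nrm (df (X m) (X n)))\<^sup>2 < e\<^sup>2" using close[of m n] by (rule le_less_trans[rotated])
      then show ?thesis using e by (meson less_imp_le power2_less_imp_less)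
    qed
    then show "\<exists>N. \<forall>m\<ge>N. \<forall>n\<ge>N. nrm (df (X m) (X n)) < e" by blast
  qed (use X in auto)
  have Jh: "J h = I"
  proof (rule antisym)
    show "I \<le> J h" using I_le h by auto
    have "J h \<le> J (X n) + nrm (df (X n) h) * (2 * nrm h + 2 * \<bar>M\<bar>)" for n
    proof -
      let ?d = "df (X n) h"
      have "\<phi> ?d = \<phi> (X n) - \<phi> h" unfolding df_def using \<phi> X h by simp
      moreover have "ip (X n) (X n) = ip h h + 2 * ip ?d h + ip ?d ?d"
        using X h ip_sym[OF h(1) X(1)[of n]] by (simp add: ip_df ip_df_right)
      moreover have "\<bar>\<phi> ?d\<bar> \<le> \<bar>M\<bar> * nrm ?d"
        using M[of ?d] X h nrm_nonneg[of ?d] by (meson abs_ge_self df_closed mult_right_mono order_trans)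
      moreover have "\<bar>ip ?d h\<bar> \<le> nrm ?d * nrm h" using X h by (intro cauchy_schwarz) auto
      moreover have "ip ?d ?d \<ge> 0" using X h by (intro ip_nonneg) auto
      ultimately show ?thesis unfolding J_def by (simp add: algebra_simps)
    qed
    then have le: "J h \<le> I + 1 / real (Suc n) + nrm (df (X n) h) * (2 * nrm h + 2 * \<bar>M\<bar>)" for n
      using X(2)[of n] by (smt (verit))
    have "(\<lambda>n. I + 1 / real (Suc n) + nrm (df (X n) h) * (2 * nrm h + 2 * \<bar>M\<bar>)) \<longlonglongrightarrow> I + 0 + 0 * (2 * nrm h + 2 * \<bar>M\<bar>)"
      by (intro tendsto_intros h(2) LIMSEQ_Suc[OF lim_1_over_n])
    then show "J h \<le> I" using le by (intro LIMSEQ_le_const) auto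
  qed
  have "\<phi> y = ip h y" if y: "y \<in> C" for y
  proof (rule ccontr)
    assume ne: "\<phi> y \<noteq> ip h y"
    define c where "c = ip h y - \<phi> y"
    \<comment> \<open>Adding 1 keeps \<open>q\<close> positive for null \<open>y\<close>; the
      increment \<open>t = - c / q\<close> then makes the variation negative unless
      \<open>c = 0\<close>.\<close>
    define q where "q = ip y y + 1"
    have q: "q > 0" unfolding q_def using ip_nonneg[OF y] by simp
    have "0 \<le> 2 * t * c + t\<^sup>2 * ip y y" for t
    proof -
      have "J (lin 1 h t y) = J h + 2 * t * c + t\<^sup>2 * ip y y"
        unfolding J_def c_def using h y by (simp add: ip_lin_lin \<phi> algebra_simps)
      then show ?thesis using I_le[OF lin_closed[OF h(1) y, of 1 t]] Jh by simp
    qed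
    from this[of "- c / q"] have "0 \<le> - 2 * c\<^sup>2 / q + c\<^sup>2 / q\<^sup>2 * ip y y"
      by (simp add: power2_eq_square power_divide)
    also have "\<dots> \<le> - 2 * c\<^sup>2 / q + c\<^sup>2 / q\<^sup>2 * q"
      by (intro add_left_mono mult_left_mono) (auto simp: q_def)
    also have "\<dots> = - c\<^sup>2 / q" using q by (simp add: power2_eq_square field_simps)
    finally have "c\<^sup>2 \<le> 0" using q by (simp add: field_simps)
    then show False using ne unfolding c_def by simp
  qed
  then show ?thesis using that h by blast
qed

lemma nrm_le_of_weak_limit:
  assumes "\<And>n. X n \<in> C" "\<And>n. nrm (X n) \<le> M" "h \<in> C" "(\<lambda>n::nat. ip (X n) h) \<longlonglongrightarrow> ip h h"
  shows "nrm h \<le> M"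
proof -
  have "ip h h \<le> M * nrm h"
  proof (rule LIMSEQ_le_const2[OF assms(4)], intro exI allI impI)
    fix n
    have "ip (X n) h \<le> nrm (X n) * nrm h" using cauchy_schwarz[of "X n" h] assms by auto
    also have "\<dots> \<le> M * nrm h" using assms nrm_nonneg by (intro mult_right_mono) auto
    finally show "ip (X n) h \<le> M * nrm h" .
  qed
  then have *: "nrm h * nrm h \<le> M * nrm h" using nrm_sq[OF assms(3)] by (simp add: power2_eq_square)
  have "0 \<le> M" using assms(1,2)[of 0] nrm_nonneg[of "X 0"] by simp
  then show ?thesis using * nrm_nonneg[OF assms(3)] by (cases "nrm h = 0") auto
qed

text \<open>Boundedness extends convergence of the coordinates to all test elements; the limit
  functional is bounded by \<open>M\<close>, and \<open>riesz\<close> yields its element.\<close>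

lemma weak_limit:
  assumes X: "\<And>n. X n \<in> C" and M: "\<And>n. nrm (X n) \<le> M"
    and conv: "\<And>k. convergent (\<lambda>n::nat. ip (X n) (v k))"
  obtains h where "h \<in> C" "nrm h \<le> M" "\<And>y. y \<in> C \<Longrightarrow> (\<lambda>n. ip (X n) y) \<longlonglongrightarrow> ip h y"
proof -
  have M0: "0 \<le> M" using M[of 0] X nrm_nonneg[of "X 0"] by simp
  have cv: "convergent (\<lambda>n. ip (X n) y)" if y: "y \<in> C" for y
  proof (rule Cauchy_convergent, rule metric_CauchyI)
    fix e :: real assume e: "e > 0"
    define e' where "e' = e / (4 * (M + 1))"
    have e': "e' > 0" "M * e' \<le> e / 4" unfolding e'_def using e M0 by (auto simp: field_simps)
    obtain k where k: "nrm (df y (v k)) < e'" using v_approx[OF y e'(1)] .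
    have "Cauchy (\<lambda>n. ip (X n) (v k))" using conv convergent_Cauchy by blast
    then obtain N where N: "\<forall>m\<ge>N. \<forall>n\<ge>N. dist (ip (X m) (v k)) (ip (X n) (v k)) < e / 2"
      using e unfolding Cauchy_def by (meson half_gt_zero)
    have d: "\<bar>ip (X n) y - ip (X n) (v k)\<bar> \<le> e / 4" for n
    proof -
      have "\<bar>ip (X n) y - ip (X n) (v k)\<bar> = \<bar>ip (X n) (df y (v k))\<bar>" using X y v_in by (simp add: ip_df_right)
      also have "\<dots> \<le> nrm (X n) * nrm (df y (v k))" using X y v_in by (intro cauchy_schwarz) auto
      also have "\<dots> \<le> M * e'" using M k X y v_in nrm_nonneg M0 by (intro mult_mono) auto
      finally show ?thesis using e' by linarith
    qed
    have "dist (ip (X m) y) (ip (X n) y) < e" if "m \<ge> N" "n \<ge> N" for m n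
      using N[rule_format, OF that] d[of m] d[of n] unfolding dist_real_def by linarith
    then show "\<exists>N. \<forall>m\<ge>N. \<forall>n\<ge>N. dist (ip (X m) y) (ip (X n) y) < e" by blast
  qed
  define \<phi> where "\<phi> y = lim (\<lambda>n. ip (X n) y)" for y
  have \<phi>: "(\<lambda>n. ip (X n) y) \<longlonglongrightarrow> \<phi> y" if "y \<in> C" for y
    unfolding \<phi>_def using cv[OF that] convergent_LIMSEQ_iff by blast
  obtain h where h: "h \<in> C" "\<And>y. y \<in> C \<Longrightarrow> \<phi> y = ip h y"
  proof (rule riesz[of \<phi> M])
    fix x y a b assume xy: "x \<in> C" "y \<in> C"
    have "(\<lambda>n. ip (X n) (lin a x b y)) \<longlonglongrightarrow> a * \<phi> x + b * \<phi> y"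
      using xy X by (simp add: ip_lin_right) (intro tendsto_intros \<phi>)
    then show "\<phi> (lin a x b y) = a * \<phi> x + b * \<phi> y"
      using \<phi>[OF lin_closed[OF xy]] LIMSEQ_unique by blast
  next
    fix x assume x: "x \<in> C"
    show "\<bar>\<phi> x\<bar> \<le> M * nrm x"
    proof (rule LIMSEQ_le_const2[OF tendsto_rabs[OF \<phi>[OF x]]], intro exI allI impI)
      fix n
      have "\<bar>ip (X n) x\<bar> \<le> nrm (X n) * nrm x" using X x by (intro cauchy_schwarz)
      also have "\<dots> \<le> M * nrm x" using M x nrm_nonneg by (intro mult_right_mono) auto
      finally show "\<bar>ip (X n) x\<bar> \<le> M * nrm x" .
    qed
  qed blast
  have "nrm h \<le> M" using nrm_le_of_weak_limit[OF X M h(1)] \<phi>[OF h(1)] h by simp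
  then show ?thesis using that[OF h(1)] \<phi> h(2) by simp
qed

text \<open>Makes a norm bound a countable family of conditions on coordinates, whence the
  measurability of the norm. For the converse, \<open>x\<close> itself is approximated by some
  \<open>v k\<close>.\<close>

lemma nrm_le_iff_v:
  assumes "x \<in> C" "0 \<le> M"
  shows "nrm x \<le> M \<longleftrightarrow> (\<forall>k. \<bar>ip x (v k)\<bar> \<le> M * nrm (v k))"
proof
  assume M: "nrm x \<le> M"
  show "\<forall>k. \<bar>ip x (v k)\<bar> \<le> M * nrm (v k)"
  proof
    fix k
    have "\<bar>ip x (v k)\<bar> \<le> nrm x * nrm (v k)" using assms v_in by (intro cauchy_schwarz)
    also have "\<dots> \<le> M * nrm (v k)" using M nrm_nonneg[OF v_in] by (intro mult_right_mono)
    finally show "\<bar>ip x (v k)\<bar> \<le> M * nrm (v k)" .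
  qed
next
  assume *: "\<forall>k. \<bar>ip x (v k)\<bar> \<le> M * nrm (v k)"
  have nx: "0 \<le> nrm x" using nrm_nonneg assms by simp
  have "nrm x * nrm x \<le> M * nrm x"
  proof (rule field_le_epsilon)
    fix e :: real assume e: "e > 0"
    define e' where "e' = e / (nrm x + M + 1)"
    have p: "nrm x + M + 1 > 0" using nx assms by simp
    then have e': "e' > 0" unfolding e'_def using e by simp
    obtain k where k: "nrm (df x (v k)) < e'" using v_approx[OF assms(1) e'] .
    have nv: "nrm (v k) \<le> nrm x + e'"
    proof -
      have "(nrm (v k))\<^sup>2 = ip x (v k) - ip (df x (v k)) (v k)" using assms v_in by (simp add: nrm_sq ip_df)
      also have "\<dots> \<le> nrm x * nrm (v k) + nrm (df x (v k)) * nrm (v k)"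
        using cauchy_schwarz[OF assms(1) v_in[of k]] cauchy_schwarz[of "df x (v k)" "v k"] assms v_in by fastforce
      also have "\<dots> \<le> (nrm x + e') * nrm (v k)"
        using k nrm_nonneg[OF v_in[of k]] by (simp add: distrib_right mult_right_mono)
      finally have "nrm (v k) * nrm (v k) \<le> (nrm x + e') * nrm (v k)" by (simp add: power2_eq_square)
      then show ?thesis using nrm_nonneg[OF v_in[of k]] nx e' by (cases "nrm (v k) = 0") auto
    qed
    have "nrm x * nrm x = ip x (v k) + ip x (df x (v k))"
      using assms v_in nrm_sq[OF assms(1)] by (simp add: ip_df_right power2_eq_square)
    also have "\<dots> \<le> M * nrm (v k) + nrm x * nrm (df x (v k))"
      using *[rule_format, of k] cauchy_schwarz[of x "df x (v k)"] assms v_in by fastforce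
    also have "\<dots> \<le> M * (nrm x + e') + nrm x * e'"
      using nv k nx assms by (intro add_mono mult_left_mono) auto
    also have "\<dots> \<le> M * nrm x + (nrm x + M + 1) * e'" using e' by (simp add: algebra_simps)
    also have "\<dots> = M * nrm x + e" unfolding e'_def using p by simp
    finally show "nrm x * nrm x \<le> M * nrm x + e" .
  qed
  then show "nrm x \<le> M" using nx assms by (cases "nrm x = 0") auto
qed

text \<open>The gliding hump: \<open>x\<^sub>n\<close> moves by \<open>3\<^sup>-\<^sup>n\<close> in the direction of an element of norm
  \<open>> 4\<^sup>n\<close>.\<close>

lemma uniform_boundedness:
  assumes S: "S \<subseteq> C" and bd: "\<And>y. y \<in> C \<Longrightarrow> \<exists>B. \<forall>x\<in>S. \<bar>ip x y\<bar> \<le> B"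
  shows "\<exists>B. \<forall>x\<in>S. nrm x \<le> B"
proof (rule ccontr)
  assume "\<not> ?thesis"
  then have "\<exists>x\<in>S. nrm x > 4 ^ n" for n :: nat by (meson not_le)
  then obtain T where T: "\<And>n. T n \<in> S" "\<And>n::nat. nrm (T n) > 4 ^ n" by metis
  have TC: "T n \<in> C" for n using T S by auto
  have Tp: "nrm (T n) > 0" for n using T(2)[of n] by (meson less_trans zero_less_numeral zero_less_power)
  \<comment> \<open>The sign is that of the current pairing with \<open>T (Suc n)\<close>, so the
    new term increases its absolute value to at least
    \<open>(1/3) ^ Suc n * nrm (T (Suc n))\<close>.\<close>
  define x where "x = rec_nat (v 0) (\<lambda>n y. lin 1 y ((if ip (T (Suc n)) y \<ge> 0 then 1 else -1) * (1/3) ^ Suc n / nrm (T (Suc n))) (T (Suc n)))"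
  have x_Suc: "x (Suc n) = lin 1 (x n) ((if ip (T (Suc n)) (x n) \<ge> 0 then 1 else -1) * (1/3) ^ Suc n / nrm (T (Suc n))) (T (Suc n))" for n
    unfolding x_def by simp
  have xC: "x n \<in> C" for n
    by (induction n) (auto simp: x_Suc intro!: lin_closed TC v_in simp: x_def[THEN fun_cong, of 0])
  have step: "nrm (df (x (Suc n)) (x n)) = (1/3) ^ Suc n" for n
  proof -
    define c where "c = (if ip (T (Suc n)) (x n) \<ge> 0 then 1 else -1) * (1/3::real) ^ Suc n / nrm (T (Suc n))"
    have xs: "x (Suc n) = lin 1 (x n) c (T (Suc n))" unfolding x_Suc c_def ..
    have i: "ip (df (x (Suc n)) (x n)) z = c * ip (T (Suc n)) z" if "z \<in> C" for z
      using that xC[of n] xC[of "Suc n"] TC by (simp add: ip_df) (simp add: xs ip_lin)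
    have "ip (df (x (Suc n)) (x n)) (df (x (Suc n)) (x n)) = c * ip (df (x (Suc n)) (x n)) (T (Suc n))"
      using i[of "df (x (Suc n)) (x n)"] xC TC ip_sym[of "T (Suc n)"] by simp
    also have "\<dots> = c\<^sup>2 * (nrm (T (Suc n)))\<^sup>2" using i[OF TC, of "Suc n"] nrm_sq[OF TC[of "Suc n"]] by (simp add: power2_eq_square)
    finally have "nrm (df (x (Suc n)) (x n)) = \<bar>c\<bar> * nrm (T (Suc n))"
      using Tp[of "Suc n"] unfolding nrm_def[of "df _ _"] by (simp add: real_sqrt_mult)
    also have "\<dots> = (1/3) ^ Suc n" unfolding c_def using Tp[of "Suc n"] by (auto simp: abs_mult)
    finally show ?thesis .
  qed
  have big: "\<bar>ip (T (Suc n)) (x (Suc n))\<bar> \<ge> (1/3) ^ Suc n * nrm (T (Suc n))" for n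
  proof -
    have e: "nrm (T (Suc n)) * (nrm (T (Suc n)) / nrm (T (Suc n))) = nrm (T (Suc n))" using Tp[of "Suc n"] by simp
    have "ip (T (Suc n)) (x (Suc n)) = ip (T (Suc n)) (x n) + (if ip (T (Suc n)) (x n) \<ge> 0 then 1 else -1) * ((1/3) ^ Suc n * nrm (T (Suc n)))"
      using xC TC Tp[of "Suc n"] nrm_sq[OF TC[of "Suc n"]]
      by (simp add: x_Suc ip_lin_right power2_eq_square field_simps del: power_Suc)
    moreover have "(1/3::real) ^ Suc n * nrm (T (Suc n)) > 0" using Tp[of "Suc n"] by simp
    ultimately show ?thesis by (auto split: if_splits)
  qed
  \<comment> \<open>All later moves together amount to at most (1/3)^n / 2, half of the move into
    \<open>x n\<close>. Hence half of the hump survives in the limit, and (4/3)^n / 2 is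
    unbounded.\<close>
  have tail: "nrm (df (x (n + m)) (x n)) \<le> ((1/3) ^ n - (1/3) ^ (n + m)) / 2" for n m
  proof (induction m)
    case 0
    then show ?case using xC[of n] by (simp add: nrm_def ip_df ip_df_right)
  next
    case (Suc m)
    have "nrm (df (x (n + Suc m)) (x n)) \<le> nrm (df (x (Suc (n + m))) (x (n + m))) + nrm (df (x (n + m)) (x n))"
      using nrm_triangle[OF xC xC xC] by simp
    moreover have "(1/3::real) ^ (n + Suc m) = (1/3) ^ (n + m) / 3" by simp
    ultimately show ?case using Suc step[of "n + m"] by simp
  qed
  have tail': "nrm (df (x m) (x n)) \<le> (1/3) ^ n / 2" if "n \<le> m" for n m
  proof -
    have "nrm (df (x m) (x n)) \<le> ((1/3) ^ n - (1/3) ^ m) / 2" using tail[of n "m - n"] that by simp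
    also have "\<dots> \<le> (1/3) ^ n / 2" by (simp add: divide_right_mono)
    finally show ?thesis .
  qed
  obtain y where y: "y \<in> C" "(\<lambda>n. nrm (df (x n) y)) \<longlonglongrightarrow> 0"
  proof (rule nrm_complete[of x])
    fix e :: real assume e: "e > 0"
    obtain N where N: "(1/3::real) ^ N < e" using real_arch_pow_inv[OF e, of "1/3"] by auto
    have "nrm (df (x m) (x n)) < e" if "m \<ge> N" "n \<ge> N" for m n
    proof -
      have "nrm (df (x m) (x n)) \<le> nrm (df (x m) (x N)) + nrm (df (x n) (x N))"
        using nrm_triangle[OF xC[of m] xC[of N] xC[of n]] nrm_df_sym[OF xC[of n] xC[of N]] by simp
      then show ?thesis using tail'[OF that(1)] tail'[OF that(2)] N by linarith
    qed
    then show "\<exists>N. \<forall>m\<ge>N. \<forall>n\<ge>N. nrm (df (x m) (x n)) < e" by blast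
  qed (use xC in auto)
  have lim: "nrm (df y (x n)) \<le> (1/3) ^ n / 2" for n
  proof -
    have "(\<lambda>m. nrm (df (x m) y) + (1/3) ^ n / 2) \<longlonglongrightarrow> 0 + (1/3) ^ n / 2" by (intro tendsto_intros y)
    moreover have "nrm (df y (x n)) \<le> nrm (df (x m) y) + (1/3) ^ n / 2" if "m \<ge> n" for m
      using nrm_triangle[OF y(1) xC[of m] xC[of n]] nrm_df_sym[OF xC[of m] y(1)] tail'[OF that] by simp
    ultimately show ?thesis by (intro LIMSEQ_le_const[where X="\<lambda>m. nrm (df (x m) y) + (1/3) ^ n / 2"]) auto
  qed
  have "\<bar>ip (T (Suc n)) y\<bar> \<ge> (4/3) ^ Suc n / 2" for n
  proof -
    have "ip (T (Suc n)) (x (Suc n)) = ip (T (Suc n)) y - ip (T (Suc n)) (df y (x (Suc n)))"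
      using TC xC y by (simp add: ip_df_right)
    moreover have "\<bar>ip (T (Suc n)) (df y (x (Suc n)))\<bar> \<le> nrm (T (Suc n)) * nrm (df y (x (Suc n)))"
      using TC xC y by (intro cauchy_schwarz) auto
    moreover have "nrm (T (Suc n)) * nrm (df y (x (Suc n))) \<le> nrm (T (Suc n)) * ((1/3) ^ Suc n / 2)"
      using lim Tp[of "Suc n"] by (intro mult_left_mono) (auto simp del: power_Suc)
    ultimately have "\<bar>ip (T (Suc n)) y\<bar> \<ge> (1/3) ^ Suc n * nrm (T (Suc n)) / 2"
      using big[of n] by (simp del: power_Suc add: mult.commute)
    moreover have "(1/3::real) ^ Suc n * 4 ^ Suc n \<le> (1/3) ^ Suc n * nrm (T (Suc n))"
      using T(2)[of "Suc n"] by (intro mult_left_mono) (auto simp del: power_Suc)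
    moreover have "(1/3::real) ^ Suc n * 4 ^ Suc n = (4/3) ^ Suc n" by (simp add: power_mult_distrib[symmetric] del: power_Suc)
    ultimately show ?thesis by linarith
  qed
  moreover obtain B where B: "\<forall>x\<in>S. \<bar>ip x y\<bar> \<le> B" using bd[OF y(1)] by blast
  ultimately have le: "(4/3::real) ^ Suc n \<le> 2 * B" for n using T(1) by (smt (verit) field_sum_of_halves)
  obtain n where "2 * B < (4/3::real) ^ n" using real_arch_pow[of "4/3" "2 * B"] by auto
  also have "(4/3::real) ^ n \<le> (4/3) ^ Suc n" by simp
  finally show False using le[of n] by simp
qed

end

section \<open>The space H\<close>

definition flin :: "real \<Rightarrow> field \<Rightarrow> real \<Rightarrow> field \<Rightarrow> field" where
  "flin a u b w = (\<lambda>x. a *\<^sub>R u x + b *\<^sub>R w x)"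

lemma sq_int_measurable: "sq_int D u \<Longrightarrow> u \<in> borel_measurable (lebesgue_on (Omega D))"
  by (simp add: sq_int_def)

lemma sq_int_integrable: "sq_int D u \<Longrightarrow> integrable (lebesgue_on (Omega D)) (\<lambda>x. (norm (u x))\<^sup>2)"
  by (simp add: sq_int_def)

lemma sq_int_inner_integrable:
  assumes "sq_int D u" "sq_int D w"
  shows "integrable (lebesgue_on (Omega D)) (\<lambda>x. u x \<bullet> w x)"
proof (rule Bochner_Integration.integrable_bound)
  note [measurable] = sq_int_measurable[OF assms(1)] sq_int_measurable[OF assms(2)]
  show "integrable (lebesgue_on (Omega D)) (\<lambda>x. (norm (u x))\<^sup>2 + (norm (w x))\<^sup>2)"
    using assms by (intro Bochner_Integration.integrable_add sq_int_integrable)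
  show "(\<lambda>x. u x \<bullet> w x) \<in> borel_measurable (lebesgue_on (Omega D))" by measurable
  show "AE x in lebesgue_on (Omega D). norm (u x \<bullet> w x) \<le> norm ((norm (u x))\<^sup>2 + (norm (w x))\<^sup>2)"
  proof (rule AE_I2)
    fix x
    have "norm (u x \<bullet> w x) \<le> norm (u x) * norm (w x)" using Cauchy_Schwarz_ineq2 by simp
    also have "2 * (norm (u x) * norm (w x)) \<le> (norm (u x))\<^sup>2 + (norm (w x))\<^sup>2"
      using sum_squares_bound[of "norm (u x)" "norm (w x)"] by (simp add: mult.assoc)
    finally show "norm (u x \<bullet> w x) \<le> norm ((norm (u x))\<^sup>2 + (norm (w x))\<^sup>2)"
      using norm_ge_zero[of "u x \<bullet> w x"] by (smt (verit) mult_nonneg_nonneg norm_ge_zero real_norm_def)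
  qed
qed

lemma sq_int_flin:
  assumes "sq_int D u" "sq_int D w"
  shows "sq_int D (flin a u b w)"
proof -
  note [measurable] = sq_int_measurable[OF assms(1)] sq_int_measurable[OF assms(2)]
  have "(\<lambda>x. (norm (flin a u b w x))\<^sup>2) = (\<lambda>x. a\<^sup>2 * (norm (u x))\<^sup>2 + 2 * a * b * (u x \<bullet> w x) + b\<^sup>2 * (norm (w x))\<^sup>2)"
    unfolding flin_def power2_norm_eq_inner
    by (auto simp: inner_add_left inner_add_right inner_commute power2_eq_square algebra_simps)
  moreover have "integrable (lebesgue_on (Omega D)) (\<lambda>x. a\<^sup>2 * (norm (u x))\<^sup>2 + 2 * a * b * (u x \<bullet> w x) + b\<^sup>2 * (norm (w x))\<^sup>2)"
    using assms by (intro Bochner_Integration.integrable_add integrable_mult_right sq_int_integrable sq_int_inner_integrable)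
  moreover have "flin a u b w \<in> borel_measurable (lebesgue_on (Omega D))"
    unfolding flin_def by measurable
  ultimately show ?thesis by (simp add: sq_int_def)
qed

interpretation L2: semi_inner_space "{u. sq_int D u}" "inner_H D" flin for D
proof
  fix x y z a b assume "x \<in> {u. sq_int D u}" "y \<in> {u. sq_int D u}" "z \<in> {u. sq_int D u}"
  then have xyz: "sq_int D x" "sq_int D y" "sq_int D z" by auto
  have "inner_H D (flin a x b y) z = (\<integral>t. a * (x t \<bullet> z t) + b * (y t \<bullet> z t) \<partial>lebesgue_on (Omega D))"
    unfolding inner_H_def flin_def by (simp add: inner_add_left)
  also have "\<dots> = a * inner_H D x z + b * inner_H D y z"
    unfolding inner_H_def using xyz
    by (simp add: Bochner_Integration.integral_add integrable_mult_right sq_int_inner_integrable)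
  finally show "inner_H D (flin a x b y) z = a * inner_H D x z + b * inner_H D y z" .
qed (auto simp: sq_int_flin inner_H_def inner_commute)

lemma l2dist_nrm: "l2dist D u w = L2.nrm D (L2.df u w)"
  unfolding l2dist_def L2.nrm_def L2.df_def inner_H_def flin_def by (simp add: power2_norm_eq_inner)

lemma l2dist_sq: "sq_int D u \<Longrightarrow> sq_int D w \<Longrightarrow>
  ennreal ((l2dist D u w)\<^sup>2) = (\<integral>\<^sup>+x. ennreal ((norm (u x - w x))\<^sup>2) \<partial>lebesgue_on (Omega D))"
proof -
  assume a: "sq_int D u" "sq_int D w"
  have "integrable (lebesgue_on (Omega D)) (\<lambda>x. (norm (u x - w x))\<^sup>2)"
    using sq_int_integrable[OF sq_int_flin[OF a, of 1 "-1"]] by (simp add: flin_def)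
  then show ?thesis unfolding l2dist_def by (subst nn_integral_eq_integral) auto
qed

lemma Omega_open_bounded:
  assumes "admissible_dom D" shows "open (Omega D)" "bounded (Omega D)"
  using assms by (cases D; auto)+

lemma finite_measure_Omega:
  assumes "admissible_dom D" shows "finite_measure (lebesgue_on (Omega D))"
proof (rule finite_measure_lebesgue_on)
  show "Omega D \<in> lmeasurable" using Omega_open_bounded[OF assms] by (simp add: lmeasurable_open)
qed

lemma L2_complete:
  assumes D: "admissible_dom D" and X: "\<And>n. sq_int D (X n)"
    and c: "\<And>e. e > 0 \<Longrightarrow> \<exists>N. \<forall>m\<ge>N. \<forall>n\<ge>N. l2dist D (X m) (X n) < e"
  obtains u where "sq_int D u" "(\<lambda>n. l2dist D (X n) u) \<longlonglongrightarrow> 0"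
proof -
  let ?M = "lebesgue_on (Omega D)"
  interpret finite_measure ?M by (rule finite_measure_Omega[OF D])
  note Xm[measurable] = sq_int_measurable[OF X]
  have "\<forall>k. \<exists>N. \<forall>m\<ge>N. \<forall>n\<ge>N. l2dist D (X m) (X n) < (1/2) ^ k" using c by simp
  then obtain N where N: "\<And>k m n. m \<ge> N k \<Longrightarrow> n \<ge> N k \<Longrightarrow> l2dist D (X m) (X n) < (1/2) ^ k" by metis
  define r where "r k = (\<Sum>i\<le>k. N i)" for k
  have rN: "r k \<ge> N k" for k unfolding r_def by (simp add: sum.remove[of _ k] member_le_sum)
  have rS: "r (Suc k) \<ge> r k" for k unfolding r_def by simp
  define g where "g k x = norm (X (r (Suc k)) x - X (r k) x)" for k x
  have gm[measurable]: "g k \<in> borel_measurable ?M" for k unfolding g_def by measurable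
  \<comment> \<open>The inequality g \<le> 2^k g^2 + 2^-k takes the place of Hoelder: the first term
    integrates to at most 2^-k, the second to 2^-k times the finite measure of the domain.\<close>
  have g_int: "(\<integral>\<^sup>+x. ennreal (g k x) \<partial>?M) \<le> ennreal ((1/2) ^ k * (1 + measure ?M (space ?M)))" for k
  proof -
    have d: "l2dist D (X (r (Suc k))) (X (r k)) \<le> (1/2) ^ k"
      using N[of k "r (Suc k)" "r k"] rN[of k] rS[of k] by simp
    have "(\<integral>\<^sup>+x. ennreal (g k x) \<partial>?M) \<le> (\<integral>\<^sup>+x. ennreal (2 ^ k) * ennreal ((g k x)\<^sup>2) + ennreal ((1/2) ^ k) \<partial>?M)"
    proof (rule nn_integral_mono)
      fix x
      have g0: "0 \<le> g k x" by (simp add: g_def)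
      have p: "(2::real) ^ k * (1/2) ^ k = 1" by (simp add: power_mult_distrib[symmetric])
      have "0 \<le> 2 ^ k * (g k x - (1/2) ^ k)\<^sup>2" by simp
      also have "\<dots> = 2 ^ k * (g k x)\<^sup>2 - 2 * g k x * (2 ^ k * (1/2) ^ k) + (2 ^ k * (1/2) ^ k) * (1/2) ^ k"
        by (simp add: power2_eq_square algebra_simps)
      finally have "g k x \<le> 2 ^ k * (g k x)\<^sup>2 + (1/2) ^ k" using g0 unfolding p by simp
      then have "ennreal (g k x) \<le> ennreal (2 ^ k * (g k x)\<^sup>2 + (1/2) ^ k)" by (rule ennreal_leI)
      also have "\<dots> = ennreal (2 ^ k) * ennreal ((g k x)\<^sup>2) + ennreal ((1/2) ^ k)"
        by (simp add: ennreal_plus ennreal_mult)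
      finally show "ennreal (g k x) \<le> ennreal (2 ^ k) * ennreal ((g k x)\<^sup>2) + ennreal ((1/2) ^ k)" .
    qed
    also have "\<dots> = ennreal (2 ^ k) * (\<integral>\<^sup>+x. ennreal ((g k x)\<^sup>2) \<partial>?M) + ennreal ((1/2) ^ k) * emeasure ?M (space ?M)"
      by (simp add: nn_integral_add nn_integral_cmult)
    also have "(\<integral>\<^sup>+x. ennreal ((g k x)\<^sup>2) \<partial>?M) = ennreal ((l2dist D (X (r (Suc k))) (X (r k)))\<^sup>2)"
      unfolding g_def by (rule l2dist_sq[OF X X, symmetric])
    also have "ennreal (2 ^ k) * ennreal ((l2dist D (X (r (Suc k))) (X (r k)))\<^sup>2) + ennreal ((1/2) ^ k) * emeasure ?M (space ?M)
        = ennreal (2 ^ k * (l2dist D (X (r (Suc k))) (X (r k)))\<^sup>2 + (1/2) ^ k * measure ?M (space ?M))"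
      by (simp add: emeasure_eq_measure ennreal_plus ennreal_mult)
    also have "\<dots> \<le> ennreal (2 ^ k * ((1/2) ^ k)\<^sup>2 + (1/2) ^ k * measure ?M (space ?M))"
      using d by (intro ennreal_leI add_mono mult_left_mono power_mono) (auto simp: l2dist_def)
    also have "(2::real) ^ k * ((1/2) ^ k)\<^sup>2 = (1/2) ^ k"
      by (simp add: power2_eq_square power_divide)
    finally show ?thesis by (simp add: distrib_left)
  qed
  have "AE x in ?M. (\<Sum>k. ennreal (g k x)) \<noteq> \<infinity>"
  proof (rule nn_integral_noteq_infinite)
    have "(\<integral>\<^sup>+x. (\<Sum>k. ennreal (g k x)) \<partial>?M) = (\<Sum>k. \<integral>\<^sup>+x. ennreal (g k x) \<partial>?M)"
      by (rule nn_integral_suminf) measurable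
    also have "\<dots> \<le> (\<Sum>k. ennreal ((1/2) ^ k * (1 + measure ?M (space ?M))))"
      using g_int by (intro suminf_le) auto
    also have "\<dots> = ennreal (\<Sum>k. (1/2) ^ k * (1 + measure ?M (space ?M)))"
      by (intro suminf_ennreal_eq[OF _ summable_sums]) (auto intro!: summable_mult2 summable_geometric)
    also have "\<dots> < \<infinity>" by simp
    finally show "(\<integral>\<^sup>+x. (\<Sum>k. ennreal (g k x)) \<partial>?M) \<noteq> \<infinity>" by simp
  qed measurable
  then have conv: "AE x in ?M. convergent (\<lambda>k. X (r k) x)"
  proof eventually_elim
    case (elim x)
    have "summable (\<lambda>k. g k x)"
      using elim by (intro summable_suminf_not_top) (auto simp: g_def)
    then have "summable (\<lambda>k. X (r (Suc k)) x - X (r k) x)" unfolding g_def by (rule summable_norm_cancel)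
    then have "convergent (\<lambda>n. \<Sum>k<n. X (r (Suc k)) x - X (r k) x)" by (simp add: summable_iff_convergent)
    then have "convergent (\<lambda>n. X (r n) x - X (r 0) x)"
      unfolding sum_lessThan_telescope[of "\<lambda>k. X (r k) x"] .
    then obtain L where "(\<lambda>n. X (r n) x - X (r 0) x) \<longlonglongrightarrow> L" by (auto simp: convergent_def)
    from tendsto_add[OF this tendsto_const[of "X (r 0) x"]] show ?case by (auto simp: convergent_def)
  qed
  define u where "u x = lim (\<lambda>k. X (r k) x)" for x
  have um[measurable]: "u \<in> borel_measurable ?M" unfolding u_def by measurable
  have lim_u: "AE x in ?M. (\<lambda>k. X (r k) x) \<longlonglongrightarrow> u x"
    using conv by eventually_elim (simp add: u_def convergent_LIMSEQ_iff)
  \<comment> \<open>Only almost everywhere convergence of the subsequence is known; Fatou carries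
    the Cauchy bound over to the limit \<open>u\<close>.\<close>
  have fatou: "(\<integral>\<^sup>+x. ennreal ((norm (X n x - u x))\<^sup>2) \<partial>?M) \<le> ennreal (((1/2) ^ k)\<^sup>2)" if n: "n \<ge> N k" for n k
  proof -
    have "(\<integral>\<^sup>+x. ennreal ((norm (X n x - u x))\<^sup>2) \<partial>?M) = (\<integral>\<^sup>+x. liminf (\<lambda>j. ennreal ((norm (X n x - X (r j) x))\<^sup>2)) \<partial>?M)"
    proof (rule nn_integral_cong_AE)
      show "AE x in ?M. ennreal ((norm (X n x - u x))\<^sup>2) = liminf (\<lambda>j. ennreal ((norm (X n x - X (r j) x))\<^sup>2))"
        using lim_u
      proof eventually_elim
        case (elim x)
        have "(\<lambda>j. ennreal ((norm (X n x - X (r j) x))\<^sup>2)) \<longlonglongrightarrow> ennreal ((norm (X n x - u x))\<^sup>2)"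
          by (intro tendsto_intros elim)
        then show ?case using lim_imp_Liminf[OF sequentially_bot] by (metis (no_types, lifting))
      qed
    qed
    also have "\<dots> \<le> liminf (\<lambda>j. \<integral>\<^sup>+x. ennreal ((norm (X n x - X (r j) x))\<^sup>2) \<partial>?M)"
      by (rule nn_integral_liminf) measurable
    also have "\<dots> \<le> ennreal (((1/2) ^ k)\<^sup>2)"
    proof (rule Liminf_le)
      show "\<forall>\<^sub>F j in sequentially. (\<integral>\<^sup>+x. ennreal ((norm (X n x - X (r j) x))\<^sup>2) \<partial>?M) \<le> ennreal (((1/2) ^ k)\<^sup>2)"
      proof (rule eventually_sequentiallyI)
        fix j assume j: "k \<le> j"
        have "incseq r" using rS by (rule incseq_SucI)
        then have "r j \<ge> N k" using rN[of k] j by (meson incseqD le_trans)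
        then have "l2dist D (X n) (X (r j)) \<le> (1/2) ^ k" using N[OF n] by (simp add: less_imp_le)
        then show "(\<integral>\<^sup>+x. ennreal ((norm (X n x - X (r j) x))\<^sup>2) \<partial>?M) \<le> ennreal (((1/2) ^ k)\<^sup>2)"
          unfolding l2dist_sq[OF X X, symmetric] by (intro ennreal_leI power_mono) (auto simp: l2dist_def)
      qed
    qed simp
    finally show ?thesis .
  qed
  have "sq_int D (flin 1 (X (N 0)) (-1) u)"
    unfolding sq_int_def
  proof (intro conjI integrableI_bounded)
    have "(\<integral>\<^sup>+x. ennreal (norm ((norm (flin 1 (X (N 0)) (-1) u x))\<^sup>2)) \<partial>?M) \<le> ennreal (((1/2) ^ 0)\<^sup>2)"
      using fatou[of 0 "N 0"] by (simp add: flin_def)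
    also have "\<dots> < \<infinity>" by simp
    finally show "(\<integral>\<^sup>+x. ennreal (norm ((norm (flin 1 (X (N 0)) (-1) u x))\<^sup>2)) \<partial>?M) < \<infinity>" .
  qed (auto simp: flin_def)
  from sq_int_flin[OF X[of "N 0"] this, of 1 "-1"] have su: "sq_int D u"
    by (simp add: flin_def)
  have "(\<lambda>n. l2dist D (X n) u) \<longlonglongrightarrow> 0"
  proof (rule LIMSEQ_I)
    fix e :: real assume "e > 0"
    then obtain k where k: "(1/2::real) ^ k < e" using real_arch_pow_inv[of e "1/2"] by auto
    have "l2dist D (X n) u \<le> (1/2) ^ k" if "n \<ge> N k" for n
    proof -
      have "ennreal ((l2dist D (X n) u)\<^sup>2) \<le> ennreal (((1/2) ^ k)\<^sup>2)"
        using fatou[OF that] l2dist_sq[OF X su] by simp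
      then have "(l2dist D (X n) u)\<^sup>2 \<le> ((1/2) ^ k)\<^sup>2" by (simp add: ennreal_le_iff)
      then show ?thesis by (rule power2_le_imp_le) simp
    qed
    then show "\<exists>no. \<forall>n\<ge>no. norm (l2dist D (X n) u - 0) < e"
      using k by (intro exI[of _ "N k"]) (auto simp: l2dist_def intro: le_less_trans)
  qed
  then show ?thesis using that su by blast
qed

section \<open>Test fields, and H as a closed linear subspace of L^2\<close>

lemma sq_int_bounded:
  assumes "admissible_dom D" "u \<in> borel_measurable (lebesgue_on (Omega D))" "\<And>x. x \<in> Omega D \<Longrightarrow> norm (u x) \<le> B"
  shows "sq_int D u"
  unfolding sq_int_def
proof
  interpret finite_measure "lebesgue_on (Omega D)" by (rule finite_measure_Omega[OF assms(1)])
  note [measurable] = assms(2)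
  show "integrable (lebesgue_on (Omega D)) (\<lambda>x. (norm (u x))\<^sup>2)"
    by (rule integrable_const_bound[where B="B\<^sup>2"])
      (use assms(3) in \<open>auto intro!: AE_I2 power_mono simp: space_restrict_space\<close>)
qed fact

lemma test_field_smooth: "test_field D \<phi> \<Longrightarrow> smooth_on UNIV \<phi>"
  by (cases D) auto

lemma smooth_on_continuous: "smooth_on U f \<Longrightarrow> continuous_on U f"
  unfolding smooth_on_def by (metis Ck_on.simps(1))

lemma smooth_on_differentiable: "smooth_on UNIV f \<Longrightarrow> (f has_derivative frechet_derivative f (at x)) (at x)"
  unfolding smooth_on_def using Ck_on.simps(2)[of 0 UNIV f]
  by (auto simp: differentiable_on_def frechet_derivative_works dest: spec[of _ "Suc 0"])

lemma continuous_sq_int: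
  assumes "admissible_dom D" "continuous_on UNIV (\<phi> :: field)"
  shows "sq_int D \<phi>"
proof -
  have "compact (closure (Omega D))" using Omega_open_bounded[OF assms(1)] by (simp add: compact_closure)
  then have "bounded (\<phi> ` closure (Omega D))"
    using assms(2) by (meson compact_continuous_image compact_imp_bounded continuous_on_subset subset_UNIV)
  then obtain B where B: "\<And>x. x \<in> closure (Omega D) \<Longrightarrow> norm (\<phi> x) \<le> B" by (auto simp: bounded_iff)
  have "\<phi> \<in> borel_measurable (lebesgue_on (Omega D))"
    using borel_measurable_continuous_onI[OF assms(2)]
    by (intro measurable_restrict_space1) (simp add: measurable_completion)
  then show ?thesis using B closure_subset by (intro sq_int_bounded[OF assms(1)]) blast+
qed

lemma test_field_sq_int: "admissible_dom D \<Longrightarrow> test_field D \<phi> \<Longrightarrow> sq_int D \<phi>"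
  by (intro continuous_sq_int smooth_on_continuous test_field_smooth)

lemma Hspace_sq_int: "u \<in> Hspace D \<Longrightarrow> sq_int D u"
  by (simp add: Hspace_def)

lemma partial_flin:
  assumes "smooth_on UNIV \<phi>" "smooth_on UNIV \<psi>"
  shows "partial (flin a \<phi> b \<psi>) i x = a *\<^sub>R partial \<phi> i x + b *\<^sub>R partial \<psi> i x"
proof -
  have "((\<lambda>x. a *\<^sub>R \<phi> x + b *\<^sub>R \<psi> x) has_derivative
      (\<lambda>v. a *\<^sub>R frechet_derivative \<phi> (at x) v + b *\<^sub>R frechet_derivative \<psi> (at x) v)) (at x)"
    by (intro derivative_intros smooth_on_differentiable assms)
  from frechet_derivative_at[OF this] show ?thesis
    unfolding partial_def flin_def by (simp add: fun_eq_iff)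
qed

lemma test_field_flin:
  assumes D: "admissible_dom D" and \<phi>: "test_field D \<phi>" and \<psi>: "test_field D \<psi>"
  shows "test_field D (flin a \<phi> b \<psi>)"
proof -
  note sm = test_field_smooth[OF \<phi>] test_field_smooth[OF \<psi>]
  have s: "smooth_on UNIV (flin a \<phi> b \<psi>)" unfolding flin_def by (rule smooth_on_lincomb[OF sm])
  have dv: "divergence (flin a \<phi> b \<psi>) x = a * divergence \<phi> x + b * divergence \<psi> x" for x
    unfolding divergence_def partial_flin[OF sm] by (simp add: sum.distrib sum_distrib_left)
  show ?thesis
  proof (cases D)
    case (Periodic L)
    have int: "integrable (lebesgue_on (box 0 L)) \<theta>" if "continuous_on UNIV \<theta>" for \<theta> :: field
    proof -
      interpret finite_measure "lebesgue_on (box 0 L)" using finite_measure_Omega[OF D] Periodic by simp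
      have c: "compact (closure (box 0 L))" by (simp add: compact_closure)
      then have "bounded (\<theta> ` closure (box 0 L))"
        using that by (meson compact_continuous_image compact_imp_bounded continuous_on_subset subset_UNIV)
      then obtain B where B: "\<And>x. x \<in> closure (box 0 L) \<Longrightarrow> norm (\<theta> x) \<le> B" by (auto simp: bounded_iff)
      have "\<theta> \<in> borel_measurable (lebesgue_on (box 0 L))"
        using borel_measurable_continuous_onI[OF that]
        by (intro measurable_restrict_space1) (simp add: measurable_completion)
      then show ?thesis using B closure_subset[of "box 0 L"]
        by (intro integrable_const_bound[where B=B] AE_I2) (auto simp: space_restrict_space)
    qed
    have "integral\<^sup>L (lebesgue_on (box 0 L)) (flin a \<phi> b \<psi>) = 0"
      using \<phi> \<psi> int[OF smooth_on_continuous[OF sm(1)]] int[OF smooth_on_continuous[OF sm(2)]]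
      unfolding Periodic flin_def by (simp add: Bochner_Integration.integral_add)
    then show ?thesis using \<phi> \<psi> s dv unfolding Periodic by (simp add: flin_def)
  next
    case (Bounded W)
    have sub: "{x. flin a \<phi> b \<psi> x \<noteq> 0} \<subseteq> {x. \<phi> x \<noteq> 0} \<union> {x. \<psi> x \<noteq> 0}" by (auto simp: flin_def)
    then have cl: "closure {x. flin a \<phi> b \<psi> x \<noteq> 0} \<subseteq> closure {x. \<phi> x \<noteq> 0} \<union> closure {x. \<psi> x \<noteq> 0}"
      using closure_mono[OF sub] by (simp add: closure_Un)
    have "compact (closure {x. \<phi> x \<noteq> 0} \<union> closure {x. \<psi> x \<noteq> 0})"
      using \<phi> \<psi> Bounded by (intro compact_Un) auto
    then have "compact (closure {x. flin a \<phi> b \<psi> x \<noteq> 0})"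
      using cl by (metis closed_closure compact_Int_closed inf.absorb_iff2)
    then show ?thesis using \<phi> \<psi> s dv cl unfolding Bounded by auto
  qed
qed

lemma l2dist_triangle:
  "sq_int D u \<Longrightarrow> sq_int D w \<Longrightarrow> sq_int D z \<Longrightarrow> l2dist D u z \<le> l2dist D u w + l2dist D w z"
  unfolding l2dist_nrm by (rule L2.nrm_triangle) auto

lemma l2dist_sym: "l2dist D u w = l2dist D w u"
  unfolding l2dist_def by (simp add: norm_minus_commute)

lemma Hspace_flin:
  assumes D: "admissible_dom D" and u: "u \<in> Hspace D" and w: "w \<in> Hspace D"
  shows "flin a u b w \<in> Hspace D"
proof -
  obtain \<phi> where \<phi>: "\<And>n. test_field D (\<phi> n)" "(\<lambda>n. l2dist D (\<phi> n) u) \<longlonglongrightarrow> 0" using u by (auto simp: Hspace_def)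
  obtain \<psi> where \<psi>: "\<And>n. test_field D (\<psi> n)" "(\<lambda>n. l2dist D (\<psi> n) w) \<longlonglongrightarrow> 0" using w by (auto simp: Hspace_def)
  have "(\<lambda>n. l2dist D (flin a (\<phi> n) b (\<psi> n)) (flin a u b w)) \<longlonglongrightarrow> 0"
  proof (rule tendsto_sandwich[OF _ _ tendsto_const])
    show "(\<lambda>n. \<bar>a\<bar> * l2dist D (\<phi> n) u + \<bar>b\<bar> * l2dist D (\<psi> n) w) \<longlonglongrightarrow> 0"
      using tendsto_add[OF tendsto_mult_right_zero[OF \<phi>(2)] tendsto_mult_right_zero[OF \<psi>(2)]] by simp
    show "\<forall>\<^sub>F n in sequentially. l2dist D (flin a (\<phi> n) b (\<psi> n)) (flin a u b w) \<le> \<bar>a\<bar> * l2dist D (\<phi> n) u + \<bar>b\<bar> * l2dist D (\<psi> n) w"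
      unfolding l2dist_nrm using test_field_sq_int[OF D \<phi>(1)] test_field_sq_int[OF D \<psi>(1)] Hspace_sq_int[OF u] Hspace_sq_int[OF w]
      by (intro always_eventually allI L2.nrm_lin_le) auto
    show "\<forall>\<^sub>F n in sequentially. 0 \<le> l2dist D (flin a (\<phi> n) b (\<psi> n)) (flin a u b w)" by (simp add: l2dist_def)
  qed
  then show ?thesis unfolding Hspace_def
    using sq_int_flin[OF Hspace_sq_int[OF u] Hspace_sq_int[OF w]] test_field_flin[OF D \<phi>(1) \<psi>(1)]
    by (auto intro!: exI[of _ "\<lambda>n. flin a (\<phi> n) b (\<psi> n)"])
qed

lemma Hspace_closed:
  assumes D: "admissible_dom D" and X: "\<And>n. X n \<in> Hspace D" and u: "sq_int D u" "(\<lambda>n. l2dist D (X n) u) \<longlonglongrightarrow> 0"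
  shows "u \<in> Hspace D"
proof -
  have "\<exists>\<phi>. test_field D \<phi> \<and> l2dist D \<phi> (X n) < 1 / real (Suc n)" for n
  proof -
    obtain \<phi> where \<phi>: "\<And>k. test_field D (\<phi> k)" "(\<lambda>k. l2dist D (\<phi> k) (X n)) \<longlonglongrightarrow> 0" using X[of n] by (auto simp: Hspace_def)
    have "\<forall>\<^sub>F k in sequentially. l2dist D (\<phi> k) (X n) < 1 / real (Suc n)"
      using order_tendstoD(2)[OF \<phi>(2), of "1 / real (Suc n)"] by simp
    then show ?thesis using \<phi>(1) by (auto simp: eventually_sequentially)
  qed
  then obtain \<phi> where \<phi>: "\<And>n. test_field D (\<phi> n)" "\<And>n. l2dist D (\<phi> n) (X n) < 1 / real (Suc n)" by metis
  have "(\<lambda>n. l2dist D (\<phi> n) u) \<longlonglongrightarrow> 0"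
  proof (rule tendsto_sandwich[OF _ _ tendsto_const])
    show "(\<lambda>n. 1 / real (Suc n) + l2dist D (X n) u) \<longlonglongrightarrow> 0"
      using tendsto_add[OF LIMSEQ_Suc[OF lim_1_over_n] u(2)] by simp
    show "\<forall>\<^sub>F n in sequentially. l2dist D (\<phi> n) u \<le> 1 / real (Suc n) + l2dist D (X n) u"
    proof (rule always_eventually, rule allI)
      fix n
      show "l2dist D (\<phi> n) u \<le> 1 / real (Suc n) + l2dist D (X n) u"
        using l2dist_triangle[OF test_field_sq_int[OF D \<phi>(1)[of n]] Hspace_sq_int[OF X[of n]] u(1)] \<phi>(2)[of n] by linarith
    qed
    show "\<forall>\<^sub>F n in sequentially. 0 \<le> l2dist D (\<phi> n) u" by (simp add: l2dist_def)
  qed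
  then show ?thesis unfolding Hspace_def using u \<phi> by auto
qed

section \<open>Separability of H by rational step fields\<close>

definition cell :: "nat \<Rightarrow> real^3 \<Rightarrow> 3 \<Rightarrow> int" where
  "cell n x = (\<lambda>i. \<lfloor>real n * x $ i\<rfloor>)"

text \<open>Constant on cubes of side 1/n. The values are rational and given by a finite list, with
  zero on unlisted cubes, so that the parameters form a countable type.\<close>

definition step_field :: "nat \<times> ((3 \<Rightarrow> int) \<times> (3 \<Rightarrow> rat)) list \<Rightarrow> field" where
  "step_field p x = (case map_of (snd p) (cell (fst p) x) of None \<Rightarrow> 0 | Some r \<Rightarrow> (\<chi> i. real_of_rat (r i)))"

lemma measurable_cell: "cell n \<in> borel \<rightarrow>\<^sub>M count_space UNIV"
proof (subst measurable_count_space_eq2_countable)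
  show "cell n \<in> space borel \<rightarrow> UNIV \<and> (\<forall>a\<in>UNIV. cell n -` {a} \<inter> space borel \<in> sets borel)"
  proof (intro conjI ballI)
    fix a :: "3 \<Rightarrow> int"
    have "cell n -` {a} \<inter> space borel = {x \<in> space borel. \<forall>i\<in>UNIV. \<lfloor>real n * x $ i\<rfloor> = a i}" by (auto simp: cell_def)
    also have "\<dots> \<in> sets borel"
      by (intro sets.sets_Collect_finite_All) auto
    finally show "cell n -` {a} \<inter> space borel \<in> sets borel" .
  qed auto
qed

lemma step_field_sq_int:
  assumes "admissible_dom D" shows "sq_int D (step_field p)"
proof -
  let ?h = "\<lambda>c. case map_of (snd p) c of None \<Rightarrow> 0 | Some r \<Rightarrow> ((\<chi> i. real_of_rat (r i)) :: real^3)"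
  have "(\<lambda>x. ?h (cell (fst p) x)) \<in> borel_measurable borel"
    by (rule measurable_compose[OF measurable_cell]) simp
  then have m: "step_field p \<in> borel_measurable borel" unfolding step_field_def[abs_def] .
  have "range ?h \<subseteq> insert 0 ((\<lambda>r. \<chi> i. real_of_rat (r i)) ` ran (map_of (snd p)))"
  proof (rule image_subsetI)
    fix c
    show "?h c \<in> insert 0 ((\<lambda>r. \<chi> i. real_of_rat (r i)) ` ran (map_of (snd p)))"
      by (cases "map_of (snd p) c") (auto intro: ranI)
  qed
  then have "finite (range ?h)" using finite_ran[OF finite_dom_map_of, of "snd p"] by (meson finite.insertI finite_imageI finite_subset)
  then have "finite (norm ` range ?h)" by simp
  then have B: "norm (step_field p x) \<le> Max (norm ` range ?h)" for x
    unfolding step_field_def by (intro Max_ge) auto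
  show ?thesis
    by (rule sq_int_bounded[OF assms _ B]) (use m in \<open>auto intro!: measurable_restrict_space1 simp: measurable_completion\<close>)
qed

lemma cell_dist:
  assumes "cell n x = cell n y" "n > 0" shows "dist x y \<le> 3 / real n"
proof -
  have "\<bar>x $ i - y $ i\<bar> \<le> 1 / real n" for i
  proof -
    have e: "\<lfloor>real n * x $ i\<rfloor> = \<lfloor>real n * y $ i\<rfloor>" using fun_cong[OF assms(1), of i] by (simp add: cell_def)
    have "\<bar>real n * x $ i - real n * y $ i\<bar> \<le> 1"
      using floor_correct[of "real n * x $ i"] floor_correct[of "real n * y $ i"] e by linarith
    then have "real n * \<bar>x $ i - y $ i\<bar> \<le> 1" by (simp add: abs_mult[symmetric] right_diff_distrib[symmetric])
    then show ?thesis using assms(2) by (simp add: field_simps)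
  qed
  then have "(\<Sum>i\<in>UNIV. \<bar>(x - y) $ i\<bar>) \<le> (\<Sum>i\<in>(UNIV::3 set). 1 / real n)" by (intro sum_mono) auto
  then show ?thesis using norm_le_l1_cart[of "x - y"] by (simp add: dist_norm)
qed

lemma step_field_approx:
  assumes D: "admissible_dom D" and \<phi>: "continuous_on UNIV \<phi>" and e: "e > 0"
  obtains p where "\<And>x. x \<in> Omega D \<Longrightarrow> norm (\<phi> x - step_field p x) < e"
proof -
  have K: "compact (closure (Omega D))" using Omega_open_bounded[OF D] by (simp add: compact_closure)
  obtain B where B: "\<And>x. x \<in> closure (Omega D) \<Longrightarrow> norm x \<le> B" using compact_imp_bounded[OF K] by (auto simp: bounded_iff)
  have "uniformly_continuous_on (closure (Omega D)) \<phi>"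
    using compact_uniformly_continuous[OF continuous_on_subset[OF \<phi>] K] by simp
  then obtain d where d: "d > 0" "\<And>x y. x \<in> closure (Omega D) \<Longrightarrow> y \<in> closure (Omega D) \<Longrightarrow> dist x y < d \<Longrightarrow> dist (\<phi> x) (\<phi> y) < e / 2"
    using e unfolding uniformly_continuous_on_def by (metis dist_commute half_gt_zero)
  obtain n where n: "n > 0" "3 / real n < d"
  proof -
    obtain n :: nat where "n > 0" "inverse (real n) < d / 3" using ex_inverse_of_nat_less[of "d / 3"] d by auto
    then show ?thesis using that[of n] by (simp add: field_simps)
  qed
  have fin: "finite (cell n ` Omega D)"
  proof (rule finite_subset)
    have "\<bar>cell n x i\<bar> \<le> \<lceil>real n * B\<rceil> + 1" if "x \<in> Omega D" for x i
    proof -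
      have "\<bar>x $ i\<bar> \<le> B" using B[of x] that closure_subset component_le_norm_cart[of x i] by (meson order_trans subsetD)
      then have "\<bar>real n * x $ i\<bar> \<le> real n * B" by (simp add: abs_mult mult_left_mono)
      then show ?thesis unfolding cell_def by linarith
    qed
    then show "cell n ` Omega D \<subseteq> {f. \<forall>i. (i \<in> UNIV \<longrightarrow> f i \<in> {-(\<lceil>real n * B\<rceil> + 1)..\<lceil>real n * B\<rceil> + 1}) \<and> (i \<notin> UNIV \<longrightarrow> f i = 0)}"
      by (auto simp: abs_le_iff) (smt (verit))+
    show "finite {f::3 \<Rightarrow> int. \<forall>i. (i \<in> UNIV \<longrightarrow> f i \<in> {-(\<lceil>real n * B\<rceil> + 1)..\<lceil>real n * B\<rceil> + 1}) \<and> (i \<notin> UNIV \<longrightarrow> f i = 0)}"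
      by (rule finite_set_of_finite_funs) auto
  qed
  have ex_r: "\<exists>r::3 \<Rightarrow> rat. norm (y - (\<chi> i. real_of_rat (r i))) < e / 2" for y :: "real^3"
  proof -
    have "\<exists>q. \<bar>y $ i - real_of_rat q\<bar> < e / 6" for i
    proof -
      obtain q where "y $ i - e / 6 < real_of_rat q" "real_of_rat q < y $ i + e / 6"
        using of_rat_dense[of "y $ i - e / 6" "y $ i + e / 6"] e by auto
      then have "\<bar>y $ i - real_of_rat q\<bar> < e / 6" by linarith
      then show ?thesis by blast
    qed
    then obtain r where r: "\<And>i. \<bar>y $ i - real_of_rat (r i)\<bar> < e / 6" by metis
    have "norm (y - (\<chi> i. real_of_rat (r i))) \<le> (\<Sum>i\<in>UNIV. \<bar>(y - (\<chi> i. real_of_rat (r i))) $ i\<bar>)" by (rule norm_le_l1_cart)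
    also have "\<dots> < (\<Sum>i\<in>(UNIV::3 set). e / 6)" using r by (intro sum_strict_mono) auto
    also have "\<dots> = e / 2" by simp
    finally show ?thesis by blast
  qed
  define pt where "pt c = (SOME x. x \<in> Omega D \<and> cell n x = c)" for c
  have pt: "pt (cell n x) \<in> Omega D \<and> cell n (pt (cell n x)) = cell n x" if "x \<in> Omega D" for x
    unfolding pt_def by (rule someI[of _ x]) (use that in auto)
  define rr where "rr c = (SOME r::3 \<Rightarrow> rat. norm (\<phi> (pt c) - (\<chi> i. real_of_rat (r i))) < e / 2)" for c
  have rr: "norm (\<phi> (pt c) - (\<chi> i. real_of_rat (rr c i))) < e / 2" for c
    unfolding rr_def by (rule someI_ex[OF ex_r])
  obtain cs where cs: "set cs = cell n ` Omega D" using finite_list[OF fin] by auto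
  define p where "p = (n, map (\<lambda>c. (c, rr c)) cs)"
  have "norm (\<phi> x - step_field p x) < e" if x: "x \<in> Omega D" for x
  proof -
    let ?c = "cell n x"
    have "map_of (map (\<lambda>c. (c, rr c)) cs) ?c = Some (rr ?c)"
      using cs x by (simp add: map_of_map_restrict)
    then have s: "step_field p x = (\<chi> i. real_of_rat (rr ?c i))" unfolding step_field_def p_def by simp
    have "dist x (pt ?c) < d" using cell_dist[of n x "pt ?c"] pt[OF x] n by auto
    then have "dist (\<phi> x) (\<phi> (pt ?c)) < e / 2" using d(2) x pt[OF x] closure_subset by blast
    then have "norm (\<phi> x - \<phi> (pt ?c)) < e / 2" by (simp add: dist_norm)
    then have "norm ((\<phi> x - \<phi> (pt ?c)) + (\<phi> (pt ?c) - step_field p x)) < e / 2 + e / 2"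
      unfolding s using rr[of ?c] by (rule norm_add_less)
    then show ?thesis by simp
  qed
  then show ?thesis using that by blast
qed

lemma l2dist_le_uniform:
  assumes D: "admissible_dom D" and u: "sq_int D u" and w: "sq_int D w"
    and e: "0 \<le> e" "\<And>x. x \<in> Omega D \<Longrightarrow> norm (u x - w x) \<le> e"
  shows "l2dist D u w \<le> e * sqrt (measure lebesgue (Omega D))"
proof -
  interpret finite_measure "lebesgue_on (Omega D)" by (rule finite_measure_Omega[OF D])
  have O: "Omega D \<in> sets lebesgue" using Omega_open_bounded[OF D] by simp
  have i: "integrable (lebesgue_on (Omega D)) (\<lambda>x. (norm (u x - w x))\<^sup>2)"
    using sq_int_integrable[OF sq_int_flin[OF u w, of 1 "-1"]] by (simp add: flin_def)
  have "(\<integral>x. (norm (u x - w x))\<^sup>2 \<partial>lebesgue_on (Omega D)) \<le> (\<integral>x. e\<^sup>2 \<partial>lebesgue_on (Omega D))"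
    by (rule integral_mono[OF i]) (use e in \<open>auto intro!: power_mono simp: space_restrict_space\<close>)
  also have "\<dots> = e\<^sup>2 * measure lebesgue (Omega D)"
    using O by (simp add: space_restrict_space measure_restrict_space mult.commute)
  finally have "l2dist D u w \<le> sqrt (e\<^sup>2 * measure lebesgue (Omega D))" unfolding l2dist_def by simp
  then show ?thesis using e(1) by (simp add: real_sqrt_mult)
qed

lemma zero_in_Hspace:
  assumes D: "admissible_dom D" shows "(\<lambda>x. 0) \<in> Hspace D"
proof -
  have sm: "smooth_on UNIV (\<lambda>x::real^3. 0::real^3)" unfolding smooth_on_def by (auto intro: Ck_on_const)
  have dv: "divergence (\<lambda>x. 0) x = 0" for x unfolding divergence_def partial_def by simp
  have "test_field D (\<lambda>x. 0)" using sm dv by (cases D) auto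
  then show ?thesis unfolding Hspace_def using test_field_sq_int[OF D]
    by (auto simp: l2dist_def intro!: exI[of _ "\<lambda>n x. 0"])
qed

text \<open>Step fields approximate every element of H but need not lie in H. For each step field
  and each tolerance an element of H within that tolerance is picked if there is one; by the
  triangle inequality these countably many picks are dense.\<close>

lemma Hspace_separable:
  assumes D: "admissible_dom D"
  shows "\<exists>v::nat \<Rightarrow> field. (\<forall>n. v n \<in> Hspace D) \<and> (\<forall>u\<in>Hspace D. \<forall>e>0. \<exists>n. l2dist D u (v n) < e)"
proof -
  define pr where "pr n = (from_nat n :: (nat \<times> ((3 \<Rightarrow> int) \<times> (3 \<Rightarrow> rat)) list) \<times> nat)" for n
  define P where "P n w \<longleftrightarrow> w \<in> Hspace D \<and> l2dist D w (step_field (fst (pr n))) < 1 / real (Suc (snd (pr n)))" for n w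
  define v where "v n = (if \<exists>w. P n w then SOME w. P n w else (\<lambda>x. 0))" for n
  have v: "v n \<in> Hspace D" for n
  proof (cases "\<exists>w. P n w")
    case True
    then have "P n (v n)" unfolding v_def by (simp add: someI_ex)
    then show ?thesis by (simp add: P_def)
  qed (simp add: v_def zero_in_Hspace[OF D])
  have "\<exists>n. l2dist D u (v n) < e" if u: "u \<in> Hspace D" and e: "e > 0" for u e
  proof -
    obtain j where j: "1 / real (Suc j) < e / 2" using nat_approx_posE[of "e / 2"] e by auto
    define d where "d = 1 / real (Suc j)"
    have d0: "d > 0" unfolding d_def by simp
    obtain \<phi> where \<phi>: "\<And>k. test_field D (\<phi> k)" "(\<lambda>k. l2dist D (\<phi> k) u) \<longlonglongrightarrow> 0" using u by (auto simp: Hspace_def)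
    obtain k where k: "l2dist D (\<phi> k) u < d / 2"
      using order_tendstoD(2)[OF \<phi>(2), of "d / 2"] d0 by (auto simp: eventually_sequentially)
    define m where "m = sqrt (measure lebesgue (Omega D))"
    have m0: "m \<ge> 0" unfolding m_def by simp
    obtain p where p: "\<And>x. x \<in> Omega D \<Longrightarrow> norm (\<phi> k x - step_field p x) < d / (2 * (m + 1))"
      using step_field_approx[OF D smooth_on_continuous[OF test_field_smooth[OF \<phi>(1)[of k]]], of "d / (2 * (m + 1))"] d0 m0 by auto
    have sq: "sq_int D (\<phi> k)" "sq_int D (step_field p)" "sq_int D u"
      using test_field_sq_int[OF D \<phi>(1)] step_field_sq_int[OF D] Hspace_sq_int[OF u] by auto
    have "l2dist D (\<phi> k) (step_field p) \<le> d / (2 * (m + 1)) * m"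
      unfolding m_def by (rule l2dist_le_uniform[OF D sq(1,2)]) (use p d0 m0 in \<open>auto simp: m_def less_imp_le\<close>)
    also have "\<dots> < d / 2" using d0 m0 by (simp add: field_simps)
    finally have up: "l2dist D u (step_field p) < d"
      using l2dist_triangle[OF sq(3,1,2)] k by (simp add: l2dist_sym[of D u])
    define n where "n = to_nat (p, j)"
    have prn: "pr n = (p, j)" unfolding pr_def n_def by simp
    have "P n u" unfolding P_def prn using u up by (simp add: d_def)
    then have "P n (v n)" unfolding v_def by (metis (mono_tags, lifting) someI_ex)
    then have "l2dist D (v n) (step_field p) < d" unfolding P_def prn by (simp add: d_def)
    then have "l2dist D u (v n) < d + d"
      using l2dist_triangle[OF sq(3,2) Hspace_sq_int[OF v[of n]]] up by (simp add: l2dist_sym[of D "step_field p"])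
    then show ?thesis using j unfolding d_def by (intro exI[of _ n]) linarith
  qed
  then show ?thesis using v by blast
qed

definition dense_seq :: "ns_dom \<Rightarrow> nat \<Rightarrow> field" where
  "dense_seq D = (SOME v. (\<forall>n. v n \<in> Hspace D) \<and> (\<forall>u\<in>Hspace D. \<forall>e>0. \<exists>n. l2dist D u (v n) < e))"

locale ns_space =
  fixes D :: ns_dom
  assumes dom: "admissible_dom D"
begin

sublocale semi_inner_space "Hspace D" "inner_H D" flin
proof
  fix x y z a b assume "x \<in> Hspace D" "y \<in> Hspace D" "z \<in> Hspace D"
  then have "sq_int D x" "sq_int D y" "sq_int D z" by (auto simp: Hspace_sq_int)
  then show "inner_H D (flin a x b y) z = a * inner_H D x z + b * inner_H D y z"
    using L2.ip_lin[of x D y z a b] by simp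
qed (auto simp: Hspace_flin[OF dom] inner_H_def inner_commute)

lemma norm_H_eq: "norm_H D u = nrm u"
  unfolding norm_H_def nrm_def ..

lemma l2dist_eq: "l2dist D u w = nrm (df u w)"
  unfolding l2dist_def nrm_def df_def inner_H_def flin_def by (simp add: power2_norm_eq_inner)

sublocale semi_hilbert "Hspace D" "inner_H D" flin "dense_seq D"
proof
  fix X :: "nat \<Rightarrow> field"
  assume X: "\<And>n. X n \<in> Hspace D" and c: "\<And>e. e > 0 \<Longrightarrow> \<exists>N. \<forall>m\<ge>N. \<forall>n\<ge>N. nrm (df (X m) (X n)) < e"
  obtain u where u: "sq_int D u" "(\<lambda>n. l2dist D (X n) u) \<longlonglongrightarrow> 0"
    by (rule L2_complete[OF dom, of X]) (use Hspace_sq_int[OF X] c in \<open>auto simp: l2dist_eq\<close>)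
  then show "\<exists>x\<in>Hspace D. (\<lambda>n. nrm (df (X n) x)) \<longlonglongrightarrow> 0"
    using Hspace_closed[OF dom X u] by (auto simp: l2dist_eq)
next
  have *: "(\<forall>n. dense_seq D n \<in> Hspace D) \<and> (\<forall>u\<in>Hspace D. \<forall>e>0. \<exists>n. l2dist D u (dense_seq D n) < e)"
    unfolding dense_seq_def by (rule someI_ex[OF Hspace_separable[OF dom]])
  then show "dense_seq D n \<in> Hspace D" for n by blast
  show "\<exists>n. nrm (df x (dense_seq D n)) < e" if "x \<in> Hspace D" "e > 0" for x e
    using * that by (simp add: l2dist_eq)
qed

text \<open>Links the Borel structure, which sees inner products only, with notions that are
  invariant under almost everywhere equality, such as the weak gradient.\<close>

lemma AE_eq_of_ip:
  assumes "u \<in> Hspace D" "w \<in> Hspace D" "\<And>z. z \<in> Hspace D \<Longrightarrow> inner_H D u z = inner_H D w z"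
  shows "AE x in lebesgue_on (Omega D). u x = w x"
proof -
  note sq = Hspace_sq_int[OF assms(1)] Hspace_sq_int[OF assms(2)]
  note [measurable] = sq_int_measurable[OF sq(1)] sq_int_measurable[OF sq(2)]
  have "inner_H D (df u w) (df u w) = 0" using assms by (simp add: ip_df)
  then have "l2dist D u w = 0" by (simp add: l2dist_eq nrm_def)
  then have "(\<integral>\<^sup>+x. ennreal ((norm (u x - w x))\<^sup>2) \<partial>lebesgue_on (Omega D)) = 0"
    using l2dist_sq[OF sq] by simp
  then show ?thesis by (subst (asm) nn_integral_0_iff_AE) auto
qed

end

section \<open>The Borel structure of the trajectory space\<close>

lemma space_borel_of: "space (borel_of X) = topspace X"
  unfolding borel_of_def by (rule space_measure_of) (auto dest: openin_subset)

lemma sets_borel_of: "sets (borel_of X) = sigma_sets (topspace X) {U. openin X U}"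
  unfolding borel_of_def by (rule sets_measure_of) (auto dest: openin_subset)

lemma borel_of_open: "openin X U \<Longrightarrow> U \<in> sets (borel_of X)"
  unfolding sets_borel_of by auto

lemma measurable_borel_ofI:
  assumes "\<And>x. x \<in> space M \<Longrightarrow> f x \<in> topspace X" "\<And>U. openin X U \<Longrightarrow> {x \<in> space M. f x \<in> U} \<in> sets M"
  shows "f \<in> M \<rightarrow>\<^sub>M borel_of X"
  unfolding borel_of_def
proof (rule measurable_measure_of)
  fix U assume "U \<in> {U. openin X U}"
  moreover have "f -` U \<inter> space M = {x \<in> space M. f x \<in> U}" by auto
  ultimately show "f -` U \<inter> space M \<in> sets M" using assms(2) by simp
qed (use assms in \<open>auto dest: openin_subset[THEN subsetD]\<close>)

context ns_space
begin

lemma topspace_Hw: "topspace (Hw D) = Hspace D"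
proof -
  have "\<Union> {{x. inner_H D x v \<in> U} | v U. v \<in> Hspace D \<and> open U} = UNIV"
    using zero_in_Hspace[OF dom] by (auto intro!: exI[of _ UNIV] exI[of _ "\<lambda>x. 0"])
  then show ?thesis unfolding Hw_def by (simp add: topology_generated_by_topspace)
qed

lemma measurable_inner_Hw:
  assumes "v \<in> Hspace D"
  shows "(\<lambda>h. inner_H D h v) \<in> borel_measurable (borel_of (Hw D))"
proof (rule borel_measurableI)
  fix S :: "real set" assume "open S"
  then have "openin (topology_generated_by {{x. inner_H D x v \<in> U} | v U. v \<in> Hspace D \<and> open U}) {x. inner_H D x v \<in> S}"
    using assms by (intro topology_generated_by_Basis) auto
  then have "openin (Hw D) ({x. inner_H D x v \<in> S} \<inter> Hspace D)" unfolding Hw_def by (auto simp: openin_subtopology)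
  moreover have "(\<lambda>h. inner_H D h v) -` S \<inter> space (borel_of (Hw D)) = {x. inner_H D x v \<in> S} \<inter> Hspace D"
    by (auto simp: space_borel_of topspace_Hw)
  ultimately show "(\<lambda>h. inner_H D h v) -` S \<inter> space (borel_of (Hw D)) \<in> sets (borel_of (Hw D))"
    by (simp add: borel_of_open)
qed

lemma measurable_norm_Hw: "(\<lambda>h. norm_H D h) \<in> borel_measurable (borel_of (Hw D))"
proof (rule borel_measurable_iff_le[THEN iffD2], rule allI)
  fix M :: real
  show "{h \<in> space (borel_of (Hw D)). norm_H D h \<le> M} \<in> sets (borel_of (Hw D))"
  proof (cases "0 \<le> M")
    case True
    have "{h \<in> space (borel_of (Hw D)). norm_H D h \<le> M}
      = {h \<in> space (borel_of (Hw D)). \<forall>k. \<bar>inner_H D h (dense_seq D k)\<bar> \<le> M * nrm (dense_seq D k)}"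
      using nrm_le_iff_v[OF _ True] by (auto simp: norm_H_eq space_borel_of topspace_Hw)
    also have "\<dots> \<in> sets (borel_of (Hw D))"
      using measurable_inner_Hw[OF v_in] by measurable
    finally show ?thesis .
  next
    case False
    then have "{h \<in> space (borel_of (Hw D)). norm_H D h \<le> M} = {}"
      using nrm_nonneg by (auto simp: norm_H_eq space_borel_of topspace_Hw) (meson nrm_nonneg order_trans)
    then show ?thesis using sets.empty_sets by metis
  qed
qed

end

section \<open>Open sets, evaluation and shift on the trajectory space\<close>

locale ns_traj = ns_space D for D +
  fixes I :: "real set"
  assumes I_nonempty: "I \<noteq> {}" and I_up: "t \<in> I \<Longrightarrow> t \<le> s \<Longrightarrow> s \<in> I"
begin

lemma Icc_subset: "p \<in> I \<Longrightarrow> {p..r} \<subseteq> I"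
  using I_up by auto

lemma TrajD: "u \<in> Traj D I \<Longrightarrow> t \<in> I \<Longrightarrow> u t \<in> Hspace D"
  "u \<in> Traj D I \<Longrightarrow> z \<in> Hspace D \<Longrightarrow> continuous_on I (\<lambda>t. inner_H D (u t) z)"
  by (auto simp: Traj_def)

text \<open>Weak continuity bounds each functional separately on \<open>K\<close>; uniform
  boundedness upgrades this to the norm. The reductions to countably many coordinates rest on this
  bound.\<close>

lemma Traj_bounded:
  assumes "u \<in> Traj D I" "compact K" "K \<subseteq> I"
  obtains B where "\<And>t. t \<in> K \<Longrightarrow> nrm (u t) \<le> B"
proof -
  have "\<exists>B. \<forall>x\<in>u ` K. nrm x \<le> B"
  proof (rule uniform_boundedness)
    show "u ` K \<subseteq> Hspace D" using assms TrajD by auto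
    fix y assume "y \<in> Hspace D"
    then have "continuous_on K (\<lambda>t. inner_H D (u t) y)" using assms TrajD continuous_on_subset by blast
    then have "bounded ((\<lambda>t. inner_H D (u t) y) ` K)"
      using assms(2) compact_continuous_image compact_imp_bounded by blast
    then show "\<exists>B. \<forall>x\<in>u ` K. \<bar>inner_H D x y\<bar> \<le> B" by (auto simp: bounded_iff)
  qed
  then show ?thesis using that by blast
qed

definition tball :: "(real \<Rightarrow> field) \<Rightarrow> real set \<Rightarrow> field set \<Rightarrow> real \<Rightarrow> (real \<Rightarrow> field) set" where
  "tball u K F \<epsilon> = {w \<in> Traj D I. \<forall>t\<in>K. \<forall>v\<in>F. \<bar>inner_H D (w t) v - inner_H D (u t) v\<bar> < \<epsilon>}"

lemma TrajTop_alt: "TrajTop D I = subtopology (topology_generated_by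
   {tball u K F \<epsilon> | u K F \<epsilon>. u \<in> Traj D I \<and> compact K \<and> K \<subseteq> I \<and> finite F \<and> F \<subseteq> Hspace D \<and> \<epsilon> > 0}) (Traj D I)"
  unfolding TrajTop_def tball_def ..

lemma openin_tball:
  assumes "u \<in> Traj D I" "compact K" "K \<subseteq> I" "finite F" "F \<subseteq> Hspace D" "\<epsilon> > 0"
  shows "openin (TrajTop D I) (tball u K F \<epsilon>)"
proof -
  have "openin (topology_generated_by
   {tball u K F \<epsilon> | u K F \<epsilon>. u \<in> Traj D I \<and> compact K \<and> K \<subseteq> I \<and> finite F \<and> F \<subseteq> Hspace D \<and> \<epsilon> > 0}) (tball u K F \<epsilon>)"
    by (rule topology_generated_by_Basis) (use assms in blast)
  moreover have "tball u K F \<epsilon> = tball u K F \<epsilon> \<inter> Traj D I" by (auto simp: tball_def)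
  ultimately show ?thesis unfolding TrajTop_alt openin_subtopology by blast
qed

lemma tball_self: "u \<in> Traj D I \<Longrightarrow> \<epsilon> > 0 \<Longrightarrow> u \<in> tball u K F \<epsilon>"
  by (auto simp: tball_def)

lemma topspace_TrajTop: "topspace (TrajTop D I) = Traj D I"
proof
  show "topspace (TrajTop D I) \<subseteq> Traj D I" unfolding TrajTop_alt by simp
  show "Traj D I \<subseteq> topspace (TrajTop D I)"
  proof
    fix u assume u: "u \<in> Traj D I"
    have "openin (TrajTop D I) (tball u {} {} 1)" by (rule openin_tball) (use u in auto)
    then show "u \<in> topspace (TrajTop D I)" using openin_subset tball_self[OF u, of 1] by (metis subsetD zero_less_one)
  qed
qed

text \<open>The generating balls are centred at arbitrary trajectories. A generator containing
  \<open>w\<close> contains a ball around \<open>w\<close> with the same \<open>K\<close> and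
  \<open>F\<close>, because strict inequalities between continuous functions leave a positive margin
  on compact \<open>K\<close>.\<close>

lemma openin_TrajTop_tball:
  assumes "openin (TrajTop D I) U" "w \<in> U"
  obtains K F \<epsilon> where "compact K" "K \<subseteq> I" "finite F" "F \<subseteq> Hspace D" "\<epsilon> > 0" "tball w K F \<epsilon> \<subseteq> U"
proof -
  let ?G = "{tball u K F \<epsilon> | u K F \<epsilon>. u \<in> Traj D I \<and> compact K \<and> K \<subseteq> I \<and> finite F \<and> F \<subseteq> Hspace D \<and> \<epsilon> > 0}"
  obtain V where V: "openin (topology_generated_by ?G) V" "U = V \<inter> Traj D I"
    using assms(1) unfolding TrajTop_alt openin_subtopology by blast
  have wT: "w \<in> Traj D I" "w \<in> V" using assms V by auto
  have "generate_topology_on ?G V" using V(1) by (simp add: openin_topology_generated_by_iff)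
  then have "w \<in> V \<Longrightarrow> \<exists>K F \<epsilon>. compact K \<and> K \<subseteq> I \<and> finite F \<and> F \<subseteq> Hspace D \<and> \<epsilon> > 0 \<and> tball w K F \<epsilon> \<subseteq> V"
  proof induction
    case (Int a b)
    then obtain K F \<epsilon> K' F' \<epsilon>' where *: "compact K" "K \<subseteq> I" "finite F" "F \<subseteq> Hspace D" "\<epsilon> > 0" "tball w K F \<epsilon> \<subseteq> a"
      "compact K'" "K' \<subseteq> I" "finite F'" "F' \<subseteq> Hspace D" "\<epsilon>' > 0" "tball w K' F' \<epsilon>' \<subseteq> b" by auto
    have "tball w (K \<union> K') (F \<union> F') (min \<epsilon> \<epsilon>') \<subseteq> a \<inter> b" using * by (auto simp: tball_def)
    moreover have "compact (K \<union> K')" "K \<union> K' \<subseteq> I" "finite (F \<union> F')" "F \<union> F' \<subseteq> Hspace D" "min \<epsilon> \<epsilon>' > 0" using * by auto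
    ultimately show ?case by blast
  next
    case (UN \<K>)
    then obtain k where "k \<in> \<K>" "w \<in> k" by auto
    with UN show ?case by (meson Union_upper subset_trans)
  next
    case (Basis s)
    then obtain u K F \<epsilon> where s: "s = tball u K F \<epsilon>" "u \<in> Traj D I" "compact K" "K \<subseteq> I" "finite F" "F \<subseteq> Hspace D" "\<epsilon> > 0" by blast
    have "\<exists>\<delta>>0. \<forall>t\<in>K. \<bar>inner_H D (w t) v - inner_H D (u t) v\<bar> \<le> \<epsilon> - \<delta>" if v: "v \<in> F" for v
    proof (cases "K = {}")
      case False
      have "continuous_on K (\<lambda>t. \<bar>inner_H D (w t) v - inner_H D (u t) v\<bar>)"
        using s v wT by (intro continuous_intros continuous_on_subset[OF TrajD(2)]) auto
      then obtain t0 where t0: "t0 \<in> K" "\<forall>t\<in>K. \<bar>inner_H D (w t) v - inner_H D (u t) v\<bar> \<le> \<bar>inner_H D (w t0) v - inner_H D (u t0) v\<bar>"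
        using continuous_attains_sup[OF s(3) False] by blast
      have "\<bar>inner_H D (w t0) v - inner_H D (u t0) v\<bar> < \<epsilon>" using Basis(2) s(1) t0(1) v by (auto simp: tball_def)
      then show ?thesis using t0 by (intro exI[of _ "\<epsilon> - \<bar>inner_H D (w t0) v - inner_H D (u t0) v\<bar>"]) auto
    qed (auto intro: exI[of _ 1])
    then obtain \<delta> where \<delta>: "\<And>v. v \<in> F \<Longrightarrow> \<delta> v > 0" "\<And>v t. v \<in> F \<Longrightarrow> t \<in> K \<Longrightarrow> \<bar>inner_H D (w t) v - inner_H D (u t) v\<bar> \<le> \<epsilon> - \<delta> v" by metis
    define e where "e = Min (insert 1 (\<delta> ` F))"
    have e: "e > 0" "\<And>v. v \<in> F \<Longrightarrow> e \<le> \<delta> v" unfolding e_def using s(5) \<delta>(1) by (auto intro: Min_le)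
    have "tball w K F e \<subseteq> s"
    proof
      fix x assume x: "x \<in> tball w K F e"
      have "\<bar>inner_H D (x t) v - inner_H D (u t) v\<bar> < \<epsilon>" if "t \<in> K" "v \<in> F" for t v
      proof -
        have "\<bar>inner_H D (x t) v - inner_H D (w t) v\<bar> < e" using x that by (auto simp: tball_def)
        then show ?thesis using \<delta>(2)[OF that(2,1)] e(2)[OF that(2)] by linarith
      qed
      then show "x \<in> s" using x unfolding s(1) tball_def by auto
    qed
    then show ?case using s e by blast
  qed simp
  then obtain K F \<epsilon> where *: "compact K" "K \<subseteq> I" "finite F" "F \<subseteq> Hspace D" "\<epsilon> > 0" "tball w K F \<epsilon> \<subseteq> V" using wT by blast
  then have "tball w K F \<epsilon> \<subseteq> U" unfolding V(2) by (auto simp: tball_def)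
  then show ?thesis using that * by blast
qed

lemma openin_TrajTopI:
  assumes "\<And>w. w \<in> U \<Longrightarrow> w \<in> Traj D I \<and> (\<exists>K F \<epsilon>. compact K \<and> K \<subseteq> I \<and> finite F \<and> F \<subseteq> Hspace D \<and> \<epsilon> > 0 \<and> tball w K F \<epsilon> \<subseteq> U)"
  shows "openin (TrajTop D I) U"
proof (subst openin_subopen, intro ballI)
  fix w assume "w \<in> U"
  from assms[OF this] obtain K F \<epsilon> where *: "w \<in> Traj D I" "compact K" "K \<subseteq> I" "finite F" "F \<subseteq> Hspace D" "\<epsilon> > 0" "tball w K F \<epsilon> \<subseteq> U" by blast
  then show "\<exists>T. openin (TrajTop D I) T \<and> w \<in> T \<and> T \<subseteq> U"
    by (intro exI[of _ "tball w K F \<epsilon>"]) (auto intro: openin_tball tball_self)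
qed

lemma measurable_eval:
  assumes t: "t \<in> I"
  shows "(\<lambda>u. u t) \<in> borel_of (TrajTop D I) \<rightarrow>\<^sub>M borel_of (Hw D)"
proof (rule measurable_borel_ofI)
  fix u assume "u \<in> space (borel_of (TrajTop D I))"
  then show "u t \<in> topspace (Hw D)" using TrajD t by (simp add: space_borel_of topspace_TrajTop topspace_Hw)
next
  fix U assume "openin (Hw D) U"
  then obtain V where V: "openin (topology_generated_by {{x. inner_H D x v \<in> U} | v U. v \<in> Hspace D \<and> open U}) V" "U = V \<inter> Hspace D"
    unfolding Hw_def openin_subtopology by blast
  have "generate_topology_on {{x. inner_H D x v \<in> U} | v U. v \<in> Hspace D \<and> open U} V"
    using V(1) by (simp add: openin_topology_generated_by_iff)
  then have "openin (TrajTop D I) {u \<in> Traj D I. u t \<in> V}"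
  proof induction
    case (Int a b)
    have "{u \<in> Traj D I. u t \<in> a \<inter> b} = {u \<in> Traj D I. u t \<in> a} \<inter> {u \<in> Traj D I. u t \<in> b}" by auto
    then show ?case using Int by auto
  next
    case (UN \<K>)
    have "{u \<in> Traj D I. u t \<in> \<Union>\<K>} = (\<Union>k\<in>\<K>. {u \<in> Traj D I. u t \<in> k})" by auto
    then show ?case using UN by auto
  next
    case (Basis s)
    then obtain v U where s: "s = {x. inner_H D x v \<in> U}" "v \<in> Hspace D" "open U" by blast
    show ?case
    proof (rule openin_TrajTopI, intro conjI)
      fix w assume w: "w \<in> {u \<in> Traj D I. u t \<in> s}"
      then show "w \<in> Traj D I" by simp
      have "inner_H D (w t) v \<in> U" using w s by simp
      then obtain e where e: "e > 0" "ball (inner_H D (w t) v) e \<subseteq> U" using s(3) open_contains_ball by blast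
      have "tball w {t} {v} e \<subseteq> {u \<in> Traj D I. u t \<in> s}"
        using e(2) unfolding s(1) tball_def by (auto simp: dist_real_def subset_iff abs_minus_commute)
      then show "\<exists>K F \<epsilon>. compact K \<and> K \<subseteq> I \<and> finite F \<and> F \<subseteq> Hspace D \<and> \<epsilon> > 0 \<and> tball w K F \<epsilon> \<subseteq> {u \<in> Traj D I. u t \<in> s}"
        using e t s(2) by (intro exI[of _ "{t}"] exI[of _ "{v}"] exI[of _ e]) auto
    qed
  qed simp
  moreover have "{x \<in> space (borel_of (TrajTop D I)). x t \<in> U} = {u \<in> Traj D I. u t \<in> V}"
    using V(2) TrajD(1) t by (auto simp: space_borel_of topspace_TrajTop)
  ultimately show "{x \<in> space (borel_of (TrajTop D I)). x t \<in> U} \<in> sets (borel_of (TrajTop D I))"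
    by (simp add: borel_of_open)
qed

lemma measurable_eval_inner:
  "t \<in> I \<Longrightarrow> v \<in> Hspace D \<Longrightarrow> (\<lambda>u. inner_H D (u t) v) \<in> borel_measurable (borel_of (TrajTop D I))"
  using measurable_compose[OF measurable_eval measurable_inner_Hw] .

lemma Traj_shift:
  assumes "u \<in> Traj D I" "\<tau> \<ge> 0" shows "(\<lambda>t. u (t + \<tau>)) \<in> Traj D I"
proof -
  have "continuous_on I (\<lambda>t. inner_H D (u (t + \<tau>)) v)" if "v \<in> Hspace D" for v
    by (rule continuous_on_compose2[OF TrajD(2)[OF assms(1) that]])
      (use I_up assms in \<open>auto intro!: continuous_intros\<close>)
  moreover have "u (t + \<tau>) \<in> Hspace D" if "t \<in> I" for t using TrajD(1)[OF assms(1)] I_up[OF that, of "t + \<tau>"] assms(2) by simp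
  ultimately show ?thesis unfolding Traj_def by auto
qed

lemma measurable_shift:
  assumes \<tau>: "\<tau> \<ge> 0"
  shows "(\<lambda>u t. u (t + \<tau>)) \<in> borel_of (TrajTop D I) \<rightarrow>\<^sub>M borel_of (TrajTop D I)"
proof (rule measurable_borel_ofI)
  fix u assume "u \<in> space (borel_of (TrajTop D I))"
  then show "(\<lambda>t. u (t + \<tau>)) \<in> topspace (TrajTop D I)"
    using Traj_shift \<tau> by (simp add: space_borel_of topspace_TrajTop)
next
  fix U assume U: "openin (TrajTop D I) U"
  have "openin (TrajTop D I) {u \<in> Traj D I. (\<lambda>t. u (t + \<tau>)) \<in> U}"
  proof (rule openin_TrajTopI, intro conjI)
    fix w assume w: "w \<in> {u \<in> Traj D I. (\<lambda>t. u (t + \<tau>)) \<in> U}"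
    then show "w \<in> Traj D I" by simp
    obtain K F \<epsilon> where *: "compact K" "K \<subseteq> I" "finite F" "F \<subseteq> Hspace D" "\<epsilon> > 0" "tball (\<lambda>t. w (t + \<tau>)) K F \<epsilon> \<subseteq> U"
      using openin_TrajTop_tball[OF U] w by blast
    have "tball w ((\<lambda>t. t + \<tau>) ` K) F \<epsilon> \<subseteq> {u \<in> Traj D I. (\<lambda>t. u (t + \<tau>)) \<in> U}"
    proof
      fix x assume x: "x \<in> tball w ((\<lambda>t. t + \<tau>) ` K) F \<epsilon>"
      then have "(\<lambda>t. x (t + \<tau>)) \<in> tball (\<lambda>t. w (t + \<tau>)) K F \<epsilon>" using Traj_shift \<tau> by (auto simp: tball_def)
      then show "x \<in> {u \<in> Traj D I. (\<lambda>t. u (t + \<tau>)) \<in> U}" using * x by (auto simp: tball_def)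
    qed
    moreover have "compact ((\<lambda>t. t + \<tau>) ` K)" using *(1) by (intro compact_continuous_image continuous_intros)
    moreover have "(\<lambda>t. t + \<tau>) ` K \<subseteq> I"
    proof (rule image_subsetI)
      fix t assume "t \<in> K" then show "t + \<tau> \<in> I" using *(2) I_up[of t "t + \<tau>"] \<tau> by auto
    qed
    ultimately show "\<exists>K F \<epsilon>. compact K \<and> K \<subseteq> I \<and> finite F \<and> F \<subseteq> Hspace D \<and> \<epsilon> > 0 \<and> tball w K F \<epsilon> \<subseteq> {u \<in> Traj D I. (\<lambda>t. u (t + \<tau>)) \<in> U}"
      using * by blast
  qed
  then show "{x \<in> space (borel_of (TrajTop D I)). (\<lambda>t. x (t + \<tau>)) \<in> U} \<in> sets (borel_of (TrajTop D I))"
    by (simp add: borel_of_open space_borel_of topspace_TrajTop)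
qed

definition traj_eq :: "(real \<Rightarrow> field) \<Rightarrow> (real \<Rightarrow> field) \<Rightarrow> bool" where
  "traj_eq u w \<longleftrightarrow> (\<forall>t\<in>I. \<forall>v\<in>Hspace D. inner_H D (u t) v = inner_H D (w t) v)"

text \<open>Open sets are described by inner products alone, and saturation passes through
  complements and countable unions. This is why decoding a trajectory up to \<open>traj_eq\<close>
  suffices.\<close>

lemma Borel_saturated:
  assumes "E \<in> sets (borel_of (TrajTop D I))" "u \<in> Traj D I" "w \<in> Traj D I" "traj_eq u w"
  shows "u \<in> E \<longleftrightarrow> w \<in> E"
  using assms(1) unfolding sets_borel_of
proof induction
  case (Basic U)
  have "w \<in> U" if "u \<in> U" "w \<in> Traj D I" "traj_eq u w" for u w
  proof -
    obtain K F \<epsilon> where *: "compact K" "K \<subseteq> I" "finite F" "F \<subseteq> Hspace D" "\<epsilon> > 0" "tball u K F \<epsilon> \<subseteq> U"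
      using openin_TrajTop_tball Basic \<open>u \<in> U\<close> by blast
    have "w \<in> tball u K F \<epsilon>" using * that by (auto simp: tball_def traj_eq_def subset_iff)
    then show ?thesis using * by blast
  qed
  moreover have "traj_eq w u" using assms(4) by (auto simp: traj_eq_def)
  ultimately show ?case using assms by blast
qed (use assms in \<open>auto simp: topspace_TrajTop\<close>)

text \<open>\<open>Inf I\<close> is included so that a left endpoint belonging to \<open>I\<close>,
  possibly irrational, can begin a covering interval. If \<open>I\<close> has no least element, the
  intersection with \<open>I\<close> makes the extra point harmless.\<close>

definition Q :: "real set" where "Q = I \<inter> insert (Inf I) \<rat>"

lemma Q_sub: "Q \<subseteq> I" and Q_countable: "countable Q"
  unfolding Q_def by (auto simp: countable_rat)

lemma Q_rat: "t \<in> I \<Longrightarrow> q \<in> \<rat> \<Longrightarrow> t \<le> q \<Longrightarrow> q \<in> Q"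
  unfolding Q_def using I_up by blast

lemma Q_infinite: "infinite Q"
proof
  assume fin: "finite Q"
  obtain t where t: "t \<in> I" using I_nonempty by blast
  obtain q where q: "q \<in> \<rat>" "max t (Max Q) < q" "q < max t (Max Q) + 1" using Rats_dense_in_real[of "max t (Max Q)" "max t (Max Q) + 1"] by auto
  have "q \<in> Q" using Q_rat[OF t q(1)] q(2) by simp
  then have "q \<le> Max Q" using fin by simp
  then show False using q(2) by simp
qed

lemma Q_all: "(\<forall>q\<in>Q. P q) \<longleftrightarrow> (\<forall>i. P (from_nat_into Q i))"
proof -
  have "Q \<noteq> {}" using Q_infinite by auto
  from range_from_nat_into[OF this Q_countable] show ?thesis by (metis rangeE rangeI)
qed

lemma Q_cover:
  assumes "compact K" "K \<subseteq> I"
  obtains p r where "p \<in> Q" "r \<in> Q" "p < r" "K \<subseteq> {p..r}"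
proof -
  obtain a where a: "a \<in> I" using I_nonempty by blast
  define K' where "K' = insert a K"
  have K': "compact K'" "K' \<subseteq> I" "K' \<noteq> {}" using assms a by (auto simp: K'_def compact_insert)
  obtain m where m: "m \<in> K'" "\<forall>t\<in>K'. m \<le> t" using compact_attains_inf[OF K'(1,3)] by blast
  obtain b where b: "b \<in> K'" "\<forall>t\<in>K'. t \<le> b" using compact_attains_sup[OF K'(1,3)] by blast
  obtain r where r: "r \<in> \<rat>" "b < r" using Rats_dense_in_real[of b "b + 1"] by auto
  have rQ: "r \<in> Q" using Q_rat[of b r] K' b r by auto
  have "\<exists>p\<in>Q. p \<le> m"
  proof (cases "\<exists>x\<in>I. x < m")
    case True
    then obtain x q where "x \<in> I" "q \<in> \<rat>" "x < q" "q < m" using Rats_dense_in_real by blast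
    then show ?thesis using Q_rat[of x q] by (intro bexI[of _ q]) auto
  next
    case False
    then have "Inf I = m" using m K' by (intro cInf_eq_minimum) (auto simp: not_less)
    then show ?thesis unfolding Q_def using m K' by auto
  qed
  then obtain p where p: "p \<in> Q" "p \<le> m" by blast
  have "p \<le> b" using p(2) m(2) b(1) by auto
  then have "p < r" using r(2) by simp
  moreover have "K \<subseteq> {p..r}" using p m b r by (fastforce simp: K'_def)
  ultimately show ?thesis using that[of p r] p rQ by blast
qed

lemma Q_seq:
  assumes "p \<in> I" "p < r" "t \<in> {p..r}"
  obtains q :: "nat \<Rightarrow> real" where "\<And>n. q n \<in> Q" "\<And>n. q n \<in> {p..r}" "q \<longlonglongrightarrow> t"
proof -
  have "\<exists>q\<in>\<rat>. max p (t - 1 / real (Suc n)) < q \<and> q < min r (t + 1 / real (Suc n))" for n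
  proof (rule Rats_dense_in_real)
    have *: "max p (t - d) < min r (t + d)" if "d > 0" for d using assms that by auto
    show "max p (t - 1 / real (Suc n)) < min r (t + 1 / real (Suc n))" by (rule *) simp
  qed
  then obtain q where q: "\<And>n. q n \<in> \<rat>" "\<And>n. max p (t - 1 / real (Suc n)) < q n" "\<And>n. q n < min r (t + 1 / real (Suc n))" by metis
  have "q \<longlonglongrightarrow> t"
  proof (rule tendsto_sandwich)
    show "\<forall>\<^sub>F n in sequentially. t - 1 / real (Suc n) \<le> q n" "\<forall>\<^sub>F n in sequentially. q n \<le> t + 1 / real (Suc n)"
      using q(2,3) by (auto intro!: always_eventually simp: less_imp_le)
    show "(\<lambda>n. t - 1 / real (Suc n)) \<longlonglongrightarrow> t" using tendsto_diff[OF tendsto_const LIMSEQ_Suc[OF lim_1_over_n]] by fastforce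
    show "(\<lambda>n. t + 1 / real (Suc n)) \<longlonglongrightarrow> t" using tendsto_add[OF tendsto_const LIMSEQ_Suc[OF lim_1_over_n]] by fastforce
  qed
  moreover have "q n \<in> {p..r}" "q n \<in> Q" for n using q(2,3)[of n] Q_rat[OF assms(1) q(1)[of n]] by auto
  ultimately show ?thesis using that by blast
qed

lemma Traj_coords_le:
  assumes "p \<in> I" "p < r" "continuous_on {p..r} f" "\<And>q. q \<in> Q \<Longrightarrow> q \<in> {p..r} \<Longrightarrow> f q \<le> (c::real)" "t \<in> {p..r}"
  shows "f t \<le> c"
proof -
  obtain q where q: "\<And>n. q n \<in> Q" "\<And>n. q n \<in> {p..r}" "q \<longlonglongrightarrow> t" using Q_seq[OF assms(1,2,5)] by blast
  have "(\<lambda>n. f (q n)) \<longlonglongrightarrow> f t"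
    using continuous_on_tendsto_compose[OF assms(3) q(3)] assms(5) q(2) by auto
  then show ?thesis using assms(4) q by (intro LIMSEQ_le_const2) auto
qed

lemma Traj_nrm_le:
  assumes "u \<in> Traj D I" "p \<in> I" "p < r" "\<And>q. q \<in> Q \<Longrightarrow> q \<in> {p..r} \<Longrightarrow> nrm (u q) \<le> M" "t \<in> {p..r}"
  shows "nrm (u t) \<le> M"
proof -
  obtain q where q: "\<And>n. q n \<in> Q" "\<And>n. q n \<in> {p..r}" "q \<longlonglongrightarrow> t" using Q_seq[OF assms(2,3,5)] by blast
  have sub: "{p..r} \<subseteq> I" using Icc_subset assms by auto
  have tI: "u t \<in> Hspace D" using TrajD(1)[OF assms(1)] assms(5) sub by blast
  have lim: "(\<lambda>n. inner_H D (u (q n)) (u t)) \<longlonglongrightarrow> inner_H D (u t) (u t)"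
    using continuous_on_tendsto_compose[OF continuous_on_subset[OF TrajD(2)[OF assms(1) tI] sub] q(3)] assms(5) q(2) by auto
  have uq: "u (q n) \<in> Hspace D" for n using TrajD(1)[OF assms(1)] q(2)[of n] sub by blast
  have nq: "nrm (u (q n)) \<le> M" for n using assms(4) q by blast
  show ?thesis by (rule nrm_le_of_weak_limit[OF uq nq tI lim])
qed

text \<open>A countable family of cylinder sets which, by local boundedness, is fine enough to cover every open set.
  The list entries are the values of step functions approximating the coordinates of a trajectory.\<close>

definition cyl :: "nat \<times> nat \<times> nat \<times> nat \<times> nat \<times> nat \<times> rat list list \<Rightarrow> (real \<Rightarrow> field) set" where
  "cyl = (\<lambda>(i, i', M, n, j, m, ls). {w \<in> Traj D I. \<forall>q\<in>Q. from_nat_into Q i \<le> q \<longrightarrow> q \<le> from_nat_into Q i' \<longrightarrow>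
     nrm (w q) \<le> real M \<and>
     (\<forall>k<n. \<bar>inner_H D (w q) (dense_seq D k) - real_of_rat (ls ! k ! nat \<lfloor>real m * (q - from_nat_into Q i)\<rfloor>)\<bar> \<le> 1 / real (Suc j))})"

text \<open>Under a common norm bound, closeness against finitely many members of the dense sequence
  controls the pairings with \<open>F\<close>, and conditions at times in \<open>Q\<close> extend to
  all times by weak continuity. The cylinders need not be open; it is enough that countably many of
  them exhaust every open set.\<close>

lemma cyl_basis:
  assumes U: "openin (TrajTop D I) U" and w: "w \<in> U"
  shows "\<exists>x. w \<in> cyl x \<and> cyl x \<subseteq> U"
proof -
  have wT: "w \<in> Traj D I" using openin_subset[OF U] w topspace_TrajTop by blast
  obtain K F \<epsilon> where K: "compact K" "K \<subseteq> I" "finite F" "F \<subseteq> Hspace D" and e: "\<epsilon> > 0" and sub: "tball w K F \<epsilon> \<subseteq> U"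
    using openin_TrajTop_tball[OF U w] .
  obtain p r where pr: "p \<in> Q" "r \<in> Q" "p < r" "K \<subseteq> {p..r}" using Q_cover[OF K(1,2)] .
  have pI: "p \<in> I" using pr Q_sub by auto
  have prI: "{p..r} \<subseteq> I" using Icc_subset[OF pI] .
  obtain B where B: "\<And>t. t \<in> {p..r} \<Longrightarrow> nrm (w t) \<le> B" using Traj_bounded[OF wT compact_Icc prI] by blast
  obtain M :: nat where M: "B \<le> real M" using real_arch_simple by blast
  \<comment> \<open>Error budget: replacing an element of \<open>F\<close> by its approximant costs
    \<open>real M * \<eta> \<le> \<epsilon> / 4\<close> for each of \<open>w\<close> and
    \<open>w'\<close>, and their coordinates differ by at most
    \<open>2 * d < \<epsilon> / 4\<close>.\<close>
  define \<eta> where "\<eta> = \<epsilon> / (4 * (real M + 1))"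
  have \<eta>: "\<eta> > 0" unfolding \<eta>_def using e by simp
  have "\<exists>k. nrm (df z (dense_seq D k)) < \<eta>" if "z \<in> F" for z using v_dense[of z \<eta>] \<eta> K that by auto
  then obtain \<kappa> where \<kappa>: "\<And>z. z \<in> F \<Longrightarrow> nrm (df z (dense_seq D (\<kappa> z))) < \<eta>" by metis
  define n where "n = Suc (Max (insert 0 (\<kappa> ` F)))"
  have n: "\<kappa> z < n" if "z \<in> F" for z unfolding n_def using K(3) that by (simp add: less_Suc_eq_le)
  obtain j where j: "1 / real (Suc j) < \<epsilon> / 8" using nat_approx_posE[of "\<epsilon> / 8"] e by auto
  define d where "d = 1 / real (Suc j)"
  have d: "d > 0" unfolding d_def by simp
  define f where "f k t = inner_H D (w t) (dense_seq D k)" for k t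
  have "\<exists>\<delta>>0. \<forall>s\<in>{p..r}. \<forall>t\<in>{p..r}. dist t s < \<delta> \<longrightarrow> dist (f k t) (f k s) < d / 2" for k
  proof -
    have "continuous_on {p..r} (f k)" unfolding f_def using continuous_on_subset[OF TrajD(2)[OF wT v_in] prI] .
    then have "uniformly_continuous_on {p..r} (f k)" by (rule compact_uniformly_continuous) simp
    then show ?thesis using d unfolding uniformly_continuous_on_def by (meson half_gt_zero)
  qed
  then obtain \<delta> where \<delta>: "\<And>k. \<delta> k > 0" "\<And>k s t. s \<in> {p..r} \<Longrightarrow> t \<in> {p..r} \<Longrightarrow> dist t s < \<delta> k \<Longrightarrow> dist (f k t) (f k s) < d / 2" by metis
  define \<delta>0 where "\<delta>0 = Min (insert 1 (\<delta> ` {..<n}))"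
  have \<delta>0: "\<delta>0 > 0" "\<And>k. k < n \<Longrightarrow> \<delta>0 \<le> \<delta> k" unfolding \<delta>0_def using \<delta>(1) by (auto intro: Min_le)
  obtain m :: nat where m: "m > 0" "inverse (real m) < \<delta>0" using ex_inverse_of_nat_less[OF \<delta>0(1)] by auto
  have "\<exists>c. \<bar>x - real_of_rat c\<bar> < d / 2" for x
  proof -
    obtain c where "x - d / 2 < real_of_rat c" "real_of_rat c < x + d / 2" using of_rat_dense[of "x - d / 2" "x + d / 2"] d by auto
    then have "\<bar>x - real_of_rat c\<bar> < d / 2" by linarith
    then show ?thesis by blast
  qed
  then obtain c where c: "\<And>x. \<bar>x - real_of_rat (c x)\<bar> < d / 2" by metis
  \<comment> \<open>One entry beyond the rounded length, so that the lookup at \<open>t = r\<close>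
    is still in range.\<close>
  define L where "L = nat \<lfloor>real m * (r - p)\<rfloor> + 1"
  define ls where "ls = map (\<lambda>k. map (\<lambda>i. c (f k (p + real i / real m))) [0..<L]) [0..<n]"
  have near: "\<bar>f k t - real_of_rat (ls ! k ! nat \<lfloor>real m * (t - p)\<rfloor>)\<bar> \<le> d" if t: "t \<in> {p..r}" and k: "k < n" for t k
  proof -
    define i where "i = nat \<lfloor>real m * (t - p)\<rfloor>"
    have fl: "real i \<le> real m * (t - p)" "real m * (t - p) < real i + 1"
      unfolding i_def using t m by (auto simp: of_nat_nat)
    have "i < L" unfolding i_def L_def using t m
      by (auto intro!: nat_mono floor_mono mult_left_mono simp: less_Suc_eq_le)
    then have l: "ls ! k ! i = c (f k (p + real i / real m))" unfolding ls_def using k by simp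
    have s: "p + real i / real m \<le> t" "t - (p + real i / real m) < inverse (real m)"
    proof -
      show "p + real i / real m \<le> t" using fl m(1) by (auto simp: field_simps)
      have "t - p < (real i + 1) / real m" using fl m(1) by (simp add: pos_less_divide_eq mult.commute)
      then show "t - (p + real i / real m) < inverse (real m)" by (simp add: add_divide_distrib inverse_eq_divide)
    qed
    then have "p + real i / real m \<in> {p..r}" using t by (auto simp: m(1))
    moreover have "dist t (p + real i / real m) < \<delta> k" using s m(2) \<delta>0(2)[OF k] by (simp add: dist_real_def)
    ultimately have "dist (f k t) (f k (p + real i / real m)) < d / 2" using \<delta>(2) t by blast
    then show ?thesis unfolding i_def[symmetric] l using c[of "f k (p + real i / real m)"] unfolding dist_real_def by linarith
  qed
  define x where "x = (to_nat_on Q p, to_nat_on Q r, M, n, j, m, ls)"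
  have pq: "from_nat_into Q (to_nat_on Q p) = p" "from_nat_into Q (to_nat_on Q r) = r" using pr Q_countable by auto
  have cx: "cyl x = {w \<in> Traj D I. \<forall>q\<in>Q. p \<le> q \<longrightarrow> q \<le> r \<longrightarrow> nrm (w q) \<le> real M \<and>
     (\<forall>k<n. \<bar>inner_H D (w q) (dense_seq D k) - real_of_rat (ls ! k ! nat \<lfloor>real m * (q - p)\<rfloor>)\<bar> \<le> d)}"
    unfolding cyl_def x_def prod.case pq d_def ..
  have wx: "w \<in> cyl x" unfolding cx using wT near B M by (auto simp: f_def intro: order_trans)
  have "cyl x \<subseteq> tball w K F \<epsilon>"
  proof
    fix w' assume w': "w' \<in> cyl x"
    then have w'T: "w' \<in> Traj D I" unfolding cx by simp
    have nb: "nrm (w' t) \<le> real M" "nrm (w t) \<le> real M" if "t \<in> {p..r}" for t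
      using Traj_nrm_le[OF w'T pI pr(3) _ that, of "real M"] w' B[OF that] M unfolding cx by auto
    have cl: "\<bar>inner_H D (w' t) (dense_seq D k) - inner_H D (w t) (dense_seq D k)\<bar> \<le> 2 * d" if t: "t \<in> {p..r}" and k: "k < n" for t k
    proof (rule Traj_coords_le[OF pI pr(3) _ _ t, where f="\<lambda>t. \<bar>inner_H D (w' t) (dense_seq D k) - inner_H D (w t) (dense_seq D k)\<bar>"])
      show "continuous_on {p..r} (\<lambda>t. \<bar>inner_H D (w' t) (dense_seq D k) - inner_H D (w t) (dense_seq D k)\<bar>)"
        by (intro continuous_intros continuous_on_subset[OF TrajD(2) prI] w'T wT v_in)
      fix q assume q: "q \<in> Q" "q \<in> {p..r}"
      have "\<bar>inner_H D (w' q) (dense_seq D k) - real_of_rat (ls ! k ! nat \<lfloor>real m * (q - p)\<rfloor>)\<bar> \<le> d"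
        using w' q k unfolding cx by auto
      then show "\<bar>inner_H D (w' q) (dense_seq D k) - inner_H D (w q) (dense_seq D k)\<bar> \<le> 2 * d"
        using near[OF q(2) k] unfolding f_def by linarith
    qed
    have "\<bar>inner_H D (w' t) z - inner_H D (w t) z\<bar> < \<epsilon>" if t: "t \<in> K" and z: "z \<in> F" for t z
    proof -
      have t': "t \<in> {p..r}" "t \<in> I" using t pr K by auto
      have H: "w' t \<in> Hspace D" "w t \<in> Hspace D" "z \<in> Hspace D" using TrajD w'T wT t' K z by auto
      let ?e = "dense_seq D (\<kappa> z)"
      have b: "\<bar>inner_H D y (df z ?e)\<bar> \<le> real M * \<eta>" if "y \<in> Hspace D" "nrm y \<le> real M" for y
      proof -
        have "\<bar>inner_H D y (df z ?e)\<bar> \<le> nrm y * nrm (df z ?e)" using that H v_in by (intro cauchy_schwarz) auto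
        also have "\<dots> \<le> real M * \<eta>" using that \<kappa>[OF z] nrm_nonneg[OF df_closed[OF H(3) v_in]] by (intro mult_mono) auto
        finally show ?thesis .
      qed
      have "\<bar>inner_H D (w' t) (df z ?e)\<bar> \<le> real M * \<eta>" "\<bar>inner_H D (w t) (df z ?e)\<bar> \<le> real M * \<eta>"
        using b H nb[OF t'(1)] by auto
      moreover have "inner_H D (w' t) (df z ?e) = inner_H D (w' t) z - inner_H D (w' t) ?e"
        "inner_H D (w t) (df z ?e) = inner_H D (w t) z - inner_H D (w t) ?e" using H v_in by (auto simp: ip_df_right)
      moreover have "real M * \<eta> \<le> \<epsilon> / 4" unfolding \<eta>_def using e by (simp add: field_simps)
      moreover have "2 * d < \<epsilon> / 4" using j unfolding d_def by simp
      ultimately show ?thesis using cl[OF t'(1) n[OF z]] by linarith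
    qed
    then show "w' \<in> tball w K F \<epsilon>" using w'T by (simp add: tball_def)
  qed
  then show ?thesis using wx sub by blast
qed

text \<open>Every open set is a countable union of cylinders, and the preimage of a cylinder is
  given by countably many conditions on coordinates at times in \<open>Q\<close>, the norm condition
  being rewritten by \<open>nrm_le_iff_v\<close>.\<close>

lemma measurable_TrajI:
  assumes T: "\<And>\<omega>. \<omega> \<in> space M \<Longrightarrow> \<Phi> \<omega> \<in> Traj D I"
    and m: "\<And>t k. t \<in> Q \<Longrightarrow> (\<lambda>\<omega>. inner_H D (\<Phi> \<omega> t) (dense_seq D k)) \<in> borel_measurable M"
  shows "\<Phi> \<in> M \<rightarrow>\<^sub>M borel_of (TrajTop D I)"
proof (rule measurable_borel_ofI)
  fix U assume U: "openin (TrajTop D I) U"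
  have cylm: "{\<omega> \<in> space M. \<Phi> \<omega> \<in> cyl x} \<in> sets M" for x
  proof -
    obtain i i' N n j l ls where x: "x = (i, i', N, n, j, l, ls)" by (cases x) auto
    have "{\<omega> \<in> space M. \<Phi> \<omega> \<in> cyl x} = {\<omega> \<in> space M. \<forall>q\<in>Q. from_nat_into Q i \<le> q \<longrightarrow> q \<le> from_nat_into Q i' \<longrightarrow>
       (\<forall>k. \<bar>inner_H D (\<Phi> \<omega> q) (dense_seq D k)\<bar> \<le> real N * nrm (dense_seq D k)) \<and>
       (\<forall>k<n. \<bar>inner_H D (\<Phi> \<omega> q) (dense_seq D k) - real_of_rat (ls ! k ! nat \<lfloor>real l * (q - from_nat_into Q i)\<rfloor>)\<bar> \<le> 1 / real (Suc j))}"
      unfolding x cyl_def prod.case using T Q_sub TrajD(1) nrm_le_iff_v[of _ "real N"] by (auto simp: subset_iff)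
    also have "\<dots> \<in> sets M"
      unfolding Q_all
    proof (intro sets.sets_Collect_countable_All sets.sets_Collect_imp sets.sets_Collect_conj)
      fix q'
      have q: "from_nat_into Q q' \<in> Q" using Q_infinite by (intro from_nat_into) auto
      note [measurable] = m[OF q]
      show "{\<omega> \<in> space M. \<bar>inner_H D (\<Phi> \<omega> (from_nat_into Q q')) (dense_seq D k)\<bar> \<le> real N * nrm (dense_seq D k)} \<in> sets M" for k
        by measurable
      show "{\<omega> \<in> space M. \<bar>inner_H D (\<Phi> \<omega> (from_nat_into Q q')) (dense_seq D k) - real_of_rat (ls ! k ! nat \<lfloor>real l * (from_nat_into Q q' - from_nat_into Q i)\<rfloor>)\<bar> \<le> 1 / real (Suc j)} \<in> sets M" for k
        by measurable
    qed auto
    finally show ?thesis .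
  qed
  have "{\<omega> \<in> space M. \<Phi> \<omega> \<in> U} = (\<Union>x\<in>{x. cyl x \<subseteq> U}. {\<omega> \<in> space M. \<Phi> \<omega> \<in> cyl x})"
    using cyl_basis[OF U] by blast
  also have "\<dots> \<in> sets M" by (intro sets.countable_UN'' cylm) auto
  finally show "{\<omega> \<in> space M. \<Phi> \<omega> \<in> U} \<in> sets M" .
qed (use T topspace_TrajTop in auto)

end

section \<open>Coding trajectories\<close>

context ns_traj
begin

definition coords :: "(real \<Rightarrow> field) \<Rightarrow> nat \<Rightarrow> real" where
  "coords u n = inner_H D (u (from_nat_into Q (fst (prod_decode n)))) (dense_seq D (snd (prod_decode n)))"

definition idx :: "real \<Rightarrow> nat \<Rightarrow> nat" where
  "idx q k = prod_encode (to_nat_on Q q, k)"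

lemma coords_idx: "q \<in> Q \<Longrightarrow> coords u (idx q k) = inner_H D (u q) (dense_seq D k)"
  unfolding coords_def idx_def using Q_countable by simp

lemma idx_surj: "\<exists>q\<in>Q. \<exists>k. n = idx q k"
proof -
  define q where "q = from_nat_into Q (fst (prod_decode n))"
  have "q \<in> Q" unfolding q_def using Q_infinite by (intro from_nat_into) auto
  moreover have "to_nat_on Q q = fst (prod_decode n)"
    unfolding q_def using Q_countable Q_infinite by (rule to_nat_on_from_nat_into_infinite)
  then have "n = idx q (snd (prod_decode n))" unfolding idx_def by simp
  ultimately show ?thesis by blast
qed

lemma measurable_coords: "coords \<in> borel_of (TrajTop D I) \<rightarrow>\<^sub>M borel"
proof (rule measurable_coordinatewise_then_product)
  fix n
  have "from_nat_into Q (fst (prod_decode n)) \<in> I"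
    using Q_infinite Q_sub from_nat_into[of Q] by (metis finite.emptyI subsetD)
  then show "(\<lambda>u. coords u n) \<in> borel_measurable (borel_of (TrajTop D I))"
    unfolding coords_def by (intro measurable_eval_inner v_in)
qed

lemma traj_eq_of_coords:
  assumes u: "u \<in> Traj D I" and w: "w \<in> Traj D I" and c: "coords u = coords w"
  shows "traj_eq u w"
  unfolding traj_eq_def
proof (intro ballI)
  fix t z assume t: "t \<in> I" and z: "z \<in> Hspace D"
  have k: "inner_H D (u t) (dense_seq D k) = inner_H D (w t) (dense_seq D k)" for k
  proof -
    have tr: "t < t + 1" "t \<in> {t..t+1}" by auto
    obtain q where q: "\<And>n. q n \<in> Q" "\<And>n. q n \<in> {t..t+1}" "q \<longlonglongrightarrow> t" using Q_seq[OF t tr] by blast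
    have l: "(\<lambda>n. inner_H D (x (q n)) (dense_seq D k)) \<longlonglongrightarrow> inner_H D (x t) (dense_seq D k)" if "x \<in> Traj D I" for x
      by (rule continuous_on_tendsto_compose[OF TrajD(2)[OF that v_in] q(3) t]) (use q Q_sub in \<open>auto intro!: always_eventually\<close>)
    have "inner_H D (u (q n)) (dense_seq D k) = inner_H D (w (q n)) (dense_seq D k)" for n
      using fun_cong[OF c, of "idx (q n) k"] q(1)[of n] by (simp add: coords_idx)
    then show ?thesis using l[OF u] l[OF w] LIMSEQ_unique by fastforce
  qed
  show "inner_H D (u t) z = inner_H D (w t) z"
    by (rule ip_eq_of_v[OF TrajD(1)[OF u t] TrajD(1)[OF w t] k z])
qed

definition wball :: "real \<Rightarrow> (nat \<Rightarrow> real) set" where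
  "wball M = {x. \<exists>h\<in>Hspace D. nrm h \<le> M \<and> (\<forall>k. inner_H D h (dense_seq D k) = x k)}"

text \<open>A coordinatewise limit of points of a ball comes from the same ball by
  \<open>weak_limit\<close>. Membership thereby becomes a Borel condition on sequences.\<close>

lemma closed_wball: "closed (wball M)"
  unfolding closed_sequential_limits
proof (intro allI impI, elim conjE)
  fix X x assume X: "\<forall>n. X n \<in> wball M" and lim: "X \<longlonglongrightarrow> x"
  have lk: "(\<lambda>n. X n k) \<longlonglongrightarrow> x k" for k
    by (rule continuous_on_tendsto_compose[OF continuous_on_product_coordinates[of k] lim]) auto
  obtain h where h: "\<And>n. h n \<in> Hspace D" "\<And>n. nrm (h n) \<le> M" "\<And>n k. inner_H D (h n) (dense_seq D k) = X n k"
    using X unfolding wball_def by (simp add: Bex_def) metis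
  have "convergent (\<lambda>n. inner_H D (h n) (dense_seq D k))" for k
    unfolding h(3) convergent_def using lk by blast
  then obtain g where g: "g \<in> Hspace D" "nrm g \<le> M" "\<And>y. y \<in> Hspace D \<Longrightarrow> (\<lambda>n. inner_H D (h n) y) \<longlonglongrightarrow> inner_H D g y"
    using weak_limit[of h M] h(1,2) by blast
  have "inner_H D g (dense_seq D k) = x k" for k
    using g(3)[OF v_in[of k]] lk[of k] unfolding h(3) by (rule LIMSEQ_unique)
  then show "x \<in> wball M" unfolding wball_def using g by blast
qed

text \<open>Characterises the coordinate sequences of trajectories on [p, r]: values in a common
  ball, and uniform continuity of every coordinate. All quantifiers run over countable sets, so the
  condition is Borel in \<open>y\<close>.\<close>

definition good_on :: "(nat \<Rightarrow> real) \<Rightarrow> real \<Rightarrow> real \<Rightarrow> bool" where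
  "good_on y p r \<longleftrightarrow> (\<exists>M::nat. \<forall>q\<in>Q. p \<le> q \<longrightarrow> q \<le> r \<longrightarrow> (\<lambda>k. y (idx q k)) \<in> wball (real M)) \<and>
    (\<forall>k. \<forall>e::nat. \<exists>d::nat. \<forall>q\<in>Q. \<forall>q'\<in>Q. p \<le> q \<longrightarrow> q \<le> r \<longrightarrow> p \<le> q' \<longrightarrow> q' \<le> r \<longrightarrow>
       \<bar>q' - q\<bar> < 1 / real (Suc d) \<longrightarrow> \<bar>y (idx q' k) - y (idx q k)\<bar> \<le> 1 / real (Suc e))"

lemma good_on_coords:
  assumes u: "u \<in> Traj D I" and pr: "p \<in> Q" "r \<in> Q"
  shows "good_on (coords u) p r"
  unfolding good_on_def
proof (intro conjI allI)
  have sub: "{p..r} \<subseteq> I" using Icc_subset pr Q_sub by blast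
  obtain B where B: "\<And>t. t \<in> {p..r} \<Longrightarrow> nrm (u t) \<le> B" using Traj_bounded[OF u compact_Icc sub] by blast
  obtain M :: nat where M: "B \<le> real M" using real_arch_simple by blast
  have "(\<lambda>k. coords u (idx q k)) \<in> wball (real M)" if "q \<in> Q" "p \<le> q" "q \<le> r" for q
    unfolding wball_def coords_idx[OF that(1)]
    using TrajD(1)[OF u] that Q_sub B[of q] M by (intro CollectI bexI[of _ "u q"]) auto
  then show "\<exists>M::nat. \<forall>q\<in>Q. p \<le> q \<longrightarrow> q \<le> r \<longrightarrow> (\<lambda>k. coords u (idx q k)) \<in> wball (real M)" by blast
  fix k and e :: nat
  have "continuous_on {p..r} (\<lambda>t. inner_H D (u t) (dense_seq D k))" using continuous_on_subset[OF TrajD(2)[OF u v_in] sub] .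
  then have "uniformly_continuous_on {p..r} (\<lambda>t. inner_H D (u t) (dense_seq D k))" by (rule compact_uniformly_continuous) simp
  then obtain \<delta> where \<delta>: "\<delta> > 0" "\<And>s t. s \<in> {p..r} \<Longrightarrow> t \<in> {p..r} \<Longrightarrow> dist t s < \<delta> \<Longrightarrow> dist (inner_H D (u t) (dense_seq D k)) (inner_H D (u s) (dense_seq D k)) < 1 / real (Suc e)"
    unfolding uniformly_continuous_on_def by (metis of_nat_0_less_iff zero_less_Suc zero_less_divide_1_iff)
  obtain d where d: "1 / real (Suc d) < \<delta>" using nat_approx_posE[OF \<delta>(1)] by blast
  have "\<bar>coords u (idx q' k) - coords u (idx q k)\<bar> \<le> 1 / real (Suc e)"
    if "q \<in> Q" "q' \<in> Q" "p \<le> q" "q \<le> r" "p \<le> q'" "q' \<le> r" "\<bar>q' - q\<bar> < 1 / real (Suc d)" for q q'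
    unfolding coords_idx[OF that(1)] coords_idx[OF that(2)]
    using \<delta>(2)[of q q'] that d by (auto simp: dist_real_def)
  then show "\<exists>d::nat. \<forall>q\<in>Q. \<forall>q'\<in>Q. p \<le> q \<longrightarrow> q \<le> r \<longrightarrow> p \<le> q' \<longrightarrow> q' \<le> r \<longrightarrow>
       \<bar>q' - q\<bar> < 1 / real (Suc d) \<longrightarrow> \<bar>coords u (idx q' k) - coords u (idx q k)\<bar> \<le> 1 / real (Suc e)" by blast
qed

text \<open>Uniform continuity extends each coordinate from the dense set
  \<open>Q \<inter> {p..r}\<close> to the whole interval; at each time the extended coordinates are
  limits of coordinates of points of one ball, hence belong to an element of H.\<close>

lemma good_on_extend:
  assumes y: "good_on y p r" and pr: "p \<in> Q" "r \<in> Q" "p < r"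
  obtains u M where "\<And>t. t \<in> {p..r} \<Longrightarrow> u t \<in> Hspace D" "\<And>t. t \<in> {p..r} \<Longrightarrow> nrm (u t) \<le> M"
    "\<And>k. continuous_on {p..r} (\<lambda>t. inner_H D (u t) (dense_seq D k))"
    "\<And>q k. q \<in> Q \<Longrightarrow> q \<in> {p..r} \<Longrightarrow> inner_H D (u q) (dense_seq D k) = y (idx q k)"
proof -
  have pI: "p \<in> I" using pr Q_sub by auto
  let ?R = "Q \<inter> {p..r}"
  obtain M :: nat where "\<forall>q\<in>Q. p \<le> q \<longrightarrow> q \<le> r \<longrightarrow> (\<lambda>k. y (idx q k)) \<in> wball (real M)" using y unfolding good_on_def by blast
  then have M: "(\<lambda>k. y (idx q k)) \<in> wball (real M)" if "q \<in> ?R" for q using that by simp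
  have uc: "uniformly_continuous_on ?R (\<lambda>q. y (idx q k))" for k
    unfolding uniformly_continuous_on_def
  proof (intro allI impI)
    fix e :: real assume "e > 0"
    then obtain n where n: "1 / real (Suc n) < e" using nat_approx_posE by blast
    obtain d :: nat where d: "\<forall>q\<in>Q. \<forall>q'\<in>Q. p \<le> q \<longrightarrow> q \<le> r \<longrightarrow> p \<le> q' \<longrightarrow> q' \<le> r \<longrightarrow>
       \<bar>q' - q\<bar> < 1 / real (Suc d) \<longrightarrow> \<bar>y (idx q' k) - y (idx q k)\<bar> \<le> 1 / real (Suc n)"
      using y unfolding good_on_def by blast
    show "\<exists>d>0. \<forall>x\<in>?R. \<forall>x'\<in>?R. dist x' x < d \<longrightarrow> dist (y (idx x' k)) (y (idx x k)) < e"
    proof (intro exI conjI ballI impI)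
      show "1 / real (Suc d) > 0" by simp
      fix x x' assume "x \<in> ?R" "x' \<in> ?R" "dist x' x < 1 / real (Suc d)"
      then have "\<bar>y (idx x' k) - y (idx x k)\<bar> \<le> 1 / real (Suc n)" using d by (simp add: dist_real_def)
      then show "dist (y (idx x' k)) (y (idx x k)) < e" using n by (simp add: dist_real_def)
    qed
  qed
  have "\<exists>g. continuous_on {p..r} g \<and> (\<forall>q\<in>?R. g q = y (idx q k))" for k
  proof -
    obtain g where g: "uniformly_continuous_on (closure ?R) g" "\<And>x. x \<in> ?R \<Longrightarrow> y (idx x k) = g x"
      using uniformly_continuous_on_extension_on_closure[OF uc[of k]] by metis
    have "{p..r} \<subseteq> closure ?R"
    proof
      fix t assume "t \<in> {p..r}"
      then obtain q where "\<And>n. q n \<in> Q" "\<And>n. q n \<in> {p..r}" "q \<longlonglongrightarrow> t" using Q_seq[OF pI pr(3)] by blast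
      then show "t \<in> closure ?R" unfolding closure_sequential by blast
    qed
    then show ?thesis using g uniformly_continuous_imp_continuous continuous_on_subset by metis
  qed
  then obtain g where g: "\<And>k. continuous_on {p..r} (g k)" "\<And>k q. q \<in> ?R \<Longrightarrow> g k q = y (idx q k)" by metis
  have "\<exists>h\<in>Hspace D. nrm h \<le> real M \<and> (\<forall>k. inner_H D h (dense_seq D k) = g k t)" if t: "t \<in> {p..r}" for t
  proof -
    obtain q where q: "\<And>n. q n \<in> Q" "\<And>n. q n \<in> {p..r}" "q \<longlonglongrightarrow> t" using Q_seq[OF pI pr(3) t] by blast
    have "\<forall>n. \<exists>h. h \<in> Hspace D \<and> nrm h \<le> real M \<and> (\<forall>k. inner_H D h (dense_seq D k) = y (idx (q n) k))"
      using M q unfolding wball_def by blast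
    then obtain h where h: "\<And>n. h n \<in> Hspace D" "\<And>n. nrm (h n) \<le> real M" "\<And>n k. inner_H D (h n) (dense_seq D k) = y (idx (q n) k)"
      by metis
    have l: "(\<lambda>n. inner_H D (h n) (dense_seq D k)) \<longlonglongrightarrow> g k t" for k
    proof -
      have "(\<lambda>n. g k (q n)) \<longlonglongrightarrow> g k t"
        by (rule continuous_on_tendsto_compose[OF g(1) q(3) t]) (use q in auto)
      then show ?thesis unfolding h(3) using g(2) q by simp
    qed
    obtain x where x: "x \<in> Hspace D" "nrm x \<le> real M" "\<And>z. z \<in> Hspace D \<Longrightarrow> (\<lambda>n. inner_H D (h n) z) \<longlonglongrightarrow> inner_H D x z"
      using weak_limit[of h "real M"] h(1,2) l unfolding convergent_def by blast
    have "inner_H D x (dense_seq D k) = g k t" for k using LIMSEQ_unique[OF x(3)[OF v_in] l] .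
    then show ?thesis using x by blast
  qed
  then obtain u where u: "\<And>t. t \<in> {p..r} \<Longrightarrow> u t \<in> Hspace D" "\<And>t. t \<in> {p..r} \<Longrightarrow> nrm (u t) \<le> real M"
    "\<And>t k. t \<in> {p..r} \<Longrightarrow> inner_H D (u t) (dense_seq D k) = g k t" by metis
  show ?thesis
  proof (rule that[of u "real M"])
    show "continuous_on {p..r} (\<lambda>t. inner_H D (u t) (dense_seq D k))" for k
      by (rule continuous_on_eq[OF g(1)[of k]]) (simp add: u(3))
    show "inner_H D (u q) (dense_seq D k) = y (idx q k)" if "q \<in> Q" "q \<in> {p..r}" for q k
      using u(3) g(2) that by simp
  qed (use u in auto)
qed

text \<open>A convergent sequence together with its limit is compact and so lies in a single
  [p, r].\<close>

lemma continuous_on_I: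
  assumes "\<And>p r. p \<in> Q \<Longrightarrow> r \<in> Q \<Longrightarrow> p < r \<Longrightarrow> continuous_on {p..r} (f :: real \<Rightarrow> real)"
  shows "continuous_on I f"
proof (rule continuous_on_sequentiallyI)
  fix x a assume x: "\<forall>n. x n \<in> I" "a \<in> I" "x \<longlonglongrightarrow> a"
  have "compact (insert a (range x))" using x(3) by (rule compact_sequence_with_limit)
  then obtain p r where pr: "p \<in> Q" "r \<in> Q" "p < r" "insert a (range x) \<subseteq> {p..r}"
    using Q_cover[of "insert a (range x)"] x by auto
  then show "(\<lambda>n. f (x n)) \<longlonglongrightarrow> f a"
    by (intro continuous_on_tendsto_compose[OF assms[OF pr(1,2,3)] x(3)]) (auto intro!: always_eventually simp: image_subset_iff)
qed

text \<open>The extensions on different intervals are chosen independently and agree only in their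
  inner products. Two of them are compared through an interval containing both, so the path
  assembled from one choice per time is still weakly continuous.\<close>

lemma good_imp_Traj:
  assumes y: "\<And>p r. p \<in> Q \<Longrightarrow> r \<in> Q \<Longrightarrow> p < r \<Longrightarrow> good_on y p r"
  obtains u where "u \<in> Traj D I" "coords u = y"
proof -
  define P where "P p r U M \<longleftrightarrow> (\<forall>t\<in>{p..r}. U t \<in> Hspace D \<and> nrm (U t) \<le> M) \<and>
     (\<forall>k. continuous_on {p..r} (\<lambda>t. inner_H D (U t) (dense_seq D k))) \<and>
     (\<forall>q\<in>Q. q \<in> {p..r} \<longrightarrow> (\<forall>k. inner_H D (U q) (dense_seq D k) = y (idx q k)))" for p r U M
  have "\<exists>U M. P p r U M" if "p \<in> Q" "r \<in> Q" "p < r" for p r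
    using good_on_extend[OF y[OF that] that] unfolding P_def by metis
  then obtain U M where U: "\<And>p r. p \<in> Q \<Longrightarrow> r \<in> Q \<Longrightarrow> p < r \<Longrightarrow> P p r (U p r) (M p r)" by metis
  note UD = U[unfolded P_def]
  have agree1: "inner_H D (U p r t) (dense_seq D k) = inner_H D (U p' r' t) (dense_seq D k)"
    if pr: "p \<in> Q" "r \<in> Q" "p < r" "p' \<in> Q" "r' \<in> Q" "p' < r'" "{p..r} \<subseteq> {p'..r'}" "t \<in> {p..r}" for p r p' r' t k
  proof -
    have pI: "p \<in> I" using pr Q_sub by auto
    obtain q where q: "\<And>n. q n \<in> Q" "\<And>n. q n \<in> {p..r}" "q \<longlonglongrightarrow> t" using Q_seq[OF pI pr(3,8)] by blast
    have c1: "continuous_on {p..r} (\<lambda>t. inner_H D (U p r t) (dense_seq D k))" using UD[OF pr(1-3)] by blast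
    have c2: "continuous_on {p'..r'} (\<lambda>t. inner_H D (U p' r' t) (dense_seq D k))" using UD[OF pr(4-6)] by blast
    have l1: "(\<lambda>n. inner_H D (U p r (q n)) (dense_seq D k)) \<longlonglongrightarrow> inner_H D (U p r t) (dense_seq D k)"
      by (rule continuous_on_tendsto_compose[OF c1 q(3) pr(8)]) (use q in auto)
    have l2: "(\<lambda>n. inner_H D (U p' r' (q n)) (dense_seq D k)) \<longlonglongrightarrow> inner_H D (U p' r' t) (dense_seq D k)"
    proof (rule continuous_on_tendsto_compose[OF c2 q(3)])
      show "t \<in> {p'..r'}" using pr(7,8) by blast
      show "\<forall>\<^sub>F n in sequentially. q n \<in> {p'..r'}" using q(2) pr(7) by (intro always_eventually allI) blast
    qed
    have "inner_H D (U p r (q n)) (dense_seq D k) = inner_H D (U p' r' (q n)) (dense_seq D k)" for n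
    proof -
      have "q n \<in> {p'..r'}" using q(2)[of n] pr(7) by blast
      then show ?thesis using UD[OF pr(1-3)] UD[OF pr(4-6)] q(1)[of n] q(2)[of n] by metis
    qed
    then show ?thesis using l1 l2 LIMSEQ_unique by fastforce
  qed
  have "\<exists>p r. p \<in> Q \<and> r \<in> Q \<and> p < r \<and> t \<in> {p..r}" if "t \<in> I" for t
    by (rule Q_cover[of "{t}"]) (use that in auto)
  then obtain a b where ab: "\<And>t. t \<in> I \<Longrightarrow> a t \<in> Q" "\<And>t. t \<in> I \<Longrightarrow> b t \<in> Q" "\<And>t. t \<in> I \<Longrightarrow> a t < b t" "\<And>t. t \<in> I \<Longrightarrow> t \<in> {a t..b t}" by metis
  define u where "u t = U (a t) (b t) t" for t
  have uH: "u t \<in> Hspace D" if "t \<in> I" for t unfolding u_def using UD[OF ab(1-3)[OF that]] ab(4)[OF that] by blast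
  have uU: "inner_H D (u t) z = inner_H D (U p r t) z" if pr: "p \<in> Q" "r \<in> Q" "p < r" "t \<in> {p..r}" and z: "z \<in> Hspace D" for p r t z
  proof (rule ip_eq_of_v[OF _ _ _ z])
    have tI: "t \<in> I" using pr Icc_subset[of p r] Q_sub by blast
    show "u t \<in> Hspace D" using uH[OF tI] .
    show "U p r t \<in> Hspace D" using UD[OF pr(1-3)] pr(4) by blast
    fix k
    define p' where "p' = min p (a t)"
    define r' where "r' = max r (b t)"
    have p'r': "p' \<in> Q" "r' \<in> Q" "p' < r'" "{p..r} \<subseteq> {p'..r'}" "{a t..b t} \<subseteq> {p'..r'}"
      unfolding p'_def r'_def using pr ab[OF tI] by (auto simp: min_def max_def)
    show "inner_H D (u t) (dense_seq D k) = inner_H D (U p r t) (dense_seq D k)"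
      unfolding u_def using agree1[OF ab(1-3)[OF tI] p'r'(1-3) p'r'(5) ab(4)[OF tI], of k] agree1[OF pr(1-3) p'r'(1-3) p'r'(4) pr(4), of k] by simp
  qed
  have cont: "continuous_on I (\<lambda>t. inner_H D (u t) z)" if z: "z \<in> Hspace D" for z
  proof (rule continuous_on_I)
    fix p r assume pr: "p \<in> Q" "r \<in> Q" "p < r"
    have M: "nrm (U p r t) \<le> M p r" "U p r t \<in> Hspace D" if "t \<in> {p..r}" for t using UD[OF pr] that by blast+
    have "\<forall>j. \<exists>k. nrm (df z (dense_seq D k)) < 1 / real (Suc j)" using v_dense[OF z] by simp
    then obtain \<kappa> where \<kappa>: "\<And>j. nrm (df z (dense_seq D (\<kappa> j))) < 1 / real (Suc j)" by metis
    have M0: "M p r \<ge> 0" using M[of p] nrm_nonneg pr(3) by fastforce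
    \<comment> \<open>Continuity is known against the dense sequence only; the bound
      \<open>M p r\<close> makes the approximation of \<open>z\<close> uniform in time.\<close>
    have "uniform_limit {p..r} (\<lambda>j t. inner_H D (U p r t) (dense_seq D (\<kappa> j))) (\<lambda>t. inner_H D (U p r t) z) sequentially"
    proof (rule uniform_limitI)
      fix e :: real assume e: "e > 0"
      have "(\<lambda>j. (M p r) * (1 / real (Suc j))) \<longlonglongrightarrow> 0"
        using tendsto_mult_right_zero[OF LIMSEQ_Suc[OF lim_1_over_n]] by blast
      then have "\<forall>\<^sub>F j in sequentially. (M p r) * (1 / real (Suc j)) < e" using e by (rule order_tendstoD(2))
      then show "\<forall>\<^sub>F j in sequentially. \<forall>t\<in>{p..r}. dist (inner_H D (U p r t) (dense_seq D (\<kappa> j))) (inner_H D (U p r t) z) < e"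
      proof eventually_elim
        case (elim j)
        show ?case
        proof
          fix t assume t: "t \<in> {p..r}"
          have "dist (inner_H D (U p r t) (dense_seq D (\<kappa> j))) (inner_H D (U p r t) z) = \<bar>inner_H D (U p r t) (df z (dense_seq D (\<kappa> j)))\<bar>"
            using M(2)[OF t] z v_in by (simp add: ip_df_right dist_real_def abs_minus_commute)
          also have "\<dots> \<le> nrm (U p r t) * nrm (df z (dense_seq D (\<kappa> j)))" using M(2)[OF t] z v_in by (intro cauchy_schwarz) auto
          also have "\<dots> \<le> (M p r) * (1 / real (Suc j))"
            using M[OF t] \<kappa>[of j] M0 nrm_nonneg[OF df_closed[OF z v_in]] by (intro mult_mono) (auto intro: less_imp_le)
          finally show "dist (inner_H D (U p r t) (dense_seq D (\<kappa> j))) (inner_H D (U p r t) z) < e" using elim by linarith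
        qed
      qed
    qed
    then have "continuous_on {p..r} (\<lambda>t. inner_H D (U p r t) z)"
    proof (rule uniform_limit_theorem[rotated])
      show "\<forall>\<^sub>F j in sequentially. continuous_on {p..r} (\<lambda>t. inner_H D (U p r t) (dense_seq D (\<kappa> j)))"
        using UD[OF pr] by (intro always_eventually allI) blast
    qed simp
    then show "continuous_on {p..r} (\<lambda>t. inner_H D (u t) z)"
      by (rule continuous_on_eq) (simp add: uU[OF pr _ z])
  qed
  have uT: "u \<in> Traj D I" unfolding Traj_def using uH cont by auto
  moreover have "coords u = y"
  proof
    fix n
    obtain q k where q: "q \<in> Q" "n = idx q k" using idx_surj by blast
    have qI: "q \<in> I" using q Q_sub by auto
    show "coords u n = y n"
      unfolding q(2) coords_idx[OF q(1)] u_def using UD[OF ab(1-3)[OF qI]] ab(4)[OF qI] q(1) by blast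
  qed
  ultimately show ?thesis using that by blast
qed

lemma coords_range_measurable: "coords ` Traj D I \<in> sets borel"
proof -
  have eq: "coords ` Traj D I = {y \<in> space borel. \<forall>p\<in>Q. \<forall>r\<in>Q. p < r \<longrightarrow> good_on y p r}"
  proof safe
    fix y assume "\<forall>p\<in>Q. \<forall>r\<in>Q. p < r \<longrightarrow> good_on y p r"
    then show "y \<in> coords ` Traj D I" using good_imp_Traj[of y] by blast
  qed (use good_on_coords in auto)
  have [measurable]: "(\<lambda>y::nat \<Rightarrow> real. y n) \<in> borel_measurable borel" for n by (rule measurable_coord)
  have w[measurable]: "{y \<in> space borel. (\<lambda>k. y (idx q k)) \<in> wball M} \<in> sets borel" for q M
  proof -
    have "(\<lambda>y k. y (idx q k)) \<in> (borel :: (nat \<Rightarrow> real) measure) \<rightarrow>\<^sub>M (borel :: (nat \<Rightarrow> real) measure)"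
      by (rule measurable_coordinatewise_then_product) measurable
    from measurable_sets[OF this borel_closed[OF closed_wball[of M]]] show ?thesis
      by (simp add: vimage_def)
  qed
  show ?thesis
    unfolding eq good_on_def Q_all
    by (intro sets.sets_Collect_countable_All sets.sets_Collect_countable_Ex sets.sets_Collect_imp sets.sets_Collect_conj
       sets.sets_Collect_const w) measurable
qed

text \<open>The preimage is an arbitrary choice, yet decoding is Borel: the target structure only
  sees coordinates, and those of \<open>decode y\<close> are \<open>y\<close> itself on the Borel
  range of \<open>coords\<close> and 0 off it.\<close>

definition decode :: "(nat \<Rightarrow> real) \<Rightarrow> real \<Rightarrow> field" where
  "decode y = (if y \<in> coords ` Traj D I then SOME u. u \<in> Traj D I \<and> coords u = y else (\<lambda>t x. 0))"

lemma zero_Traj: "(\<lambda>t x. 0) \<in> Traj D I"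
  unfolding Traj_def using zero_in_Hspace[OF dom] by auto

lemma decode_good: "y \<in> coords ` Traj D I \<Longrightarrow> decode y \<in> Traj D I \<and> coords (decode y) = y"
  unfolding decode_def using someI_ex[of "\<lambda>u. u \<in> Traj D I \<and> coords u = y"] by auto

lemma decode_Traj: "decode y \<in> Traj D I"
  using decode_good[of y] zero_Traj by (cases "y \<in> coords ` Traj D I") (auto simp: decode_def)

lemma decode_coords: "u \<in> Traj D I \<Longrightarrow> traj_eq (decode (coords u)) u"
  using decode_good[of "coords u"] by (intro traj_eq_of_coords) auto

lemma measurable_decode: "decode \<in> borel \<rightarrow>\<^sub>M borel_of (TrajTop D I)"
proof (rule measurable_TrajI)
  fix t k assume t: "t \<in> Q"
  have "inner_H D (decode y t) (dense_seq D k) = (if y \<in> coords ` Traj D I then y (idx t k) else 0)" for y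
    using decode_good[of y] coords_idx[OF t, of "decode y" k] by (auto simp: decode_def inner_H_def)
  moreover have "(\<lambda>y. if y \<in> coords ` Traj D I then y (idx t k) else 0) \<in> borel_measurable borel"
    using coords_range_measurable by (intro measurable_If_set measurable_coord) auto
  ultimately show "(\<lambda>y. inner_H D (decode y t) (dense_seq D k)) \<in> borel_measurable borel" by simp
qed (rule decode_Traj)

text \<open>A single real in [0, 1] per trajectory, the form in which
  \<open>stationary_chain\<close> takes its states.\<close>

definition code :: "(real \<Rightarrow> field) \<Rightarrow> real" where
  "code u = seq_encode (coords u)"

definition path_of :: "real \<Rightarrow> real \<Rightarrow> field" where
  "path_of z = decode (seq_decode z)"

lemma measurable_code: "code \<in> borel_measurable (borel_of (TrajTop D I))"
  unfolding code_def using measurable_compose[OF measurable_coords measurable_seq_encode] .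

lemma measurable_path_of: "path_of \<in> borel \<rightarrow>\<^sub>M borel_of (TrajTop D I)"
  unfolding path_of_def using measurable_compose[OF measurable_seq_decode measurable_decode] .

lemma path_of_code: "u \<in> Traj D I \<Longrightarrow> traj_eq (path_of (code u)) u"
  unfolding path_of_def code_def seq_decode_encode by (rule decode_coords)

lemma path_of_Traj: "path_of z \<in> Traj D I"
  unfolding path_of_def by (rule decode_Traj)

text \<open>Equal codes mean equality as elements of H, so the matching of endpoints becomes an
  equation between real numbers.\<close>

definition hcode :: "field \<Rightarrow> real" where
  "hcode h = seq_encode (\<lambda>k. inner_H D h (dense_seq D k))"

lemma measurable_hcode: "hcode \<in> borel_measurable (borel_of (Hw D))"
  unfolding hcode_def
  by (rule measurable_compose[OF measurable_coordinatewise_then_product measurable_seq_encode])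
    (rule measurable_inner_Hw[OF v_in])

lemma hcode_inj:
  assumes "hcode h = hcode g" "h \<in> Hspace D" "g \<in> Hspace D" "z \<in> Hspace D"
  shows "inner_H D h z = inner_H D g z"
  by (rule ip_eq_of_v[OF assms(2,3) fun_cong[OF seq_encode_inj[OF assms(1)[unfolded hcode_def]]] assms(4)])

end

section \<open>Weak solutions: congruence, shift and restriction\<close>

lemma integrable_lebesgue_on_iff:
  fixes g :: "real \<Rightarrow> real"
  assumes "S \<in> sets lebesgue"
  shows "integrable (lebesgue_on S) g \<longleftrightarrow> integrable lebesgue (\<lambda>x. indicator S x * g x)"
  using assms by (subst integrable_restrict_space) auto

lemma integral_lebesgue_on_eq:
  fixes g :: "real \<Rightarrow> real"
  assumes "S \<in> sets lebesgue"
  shows "(\<integral>x. g x \<partial>lebesgue_on S) = (\<integral>x. indicator S x * g x \<partial>lebesgue)"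
  using assms by (subst integral_restrict_space) auto

lemma integral_lebesgue_on_combine:
  fixes g :: "real \<Rightarrow> real"
  assumes ab: "integrable (lebesgue_on {a..b}) g" and bc: "integrable (lebesgue_on {b..c}) g" and le: "a \<le> b" "b \<le> c"
  shows "integrable (lebesgue_on {a..c}) g"
    "(\<integral>x. g x \<partial>lebesgue_on {a..c}) = (\<integral>x. g x \<partial>lebesgue_on {a..b}) + (\<integral>x. g x \<partial>lebesgue_on {b..c})"
proof -
  let ?f = "\<lambda>x. indicator {a..b} x * g x + indicator {b..c} x * g x"
  have i1: "integrable lebesgue (\<lambda>x. indicator {a..b} x * g x)" and i2: "integrable lebesgue (\<lambda>x. indicator {b..c} x * g x)"
    using ab bc by (simp_all add: integrable_lebesgue_on_iff)
  then have i: "integrable lebesgue ?f" by simp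
  have ae: "AE x in lebesgue. ?f x = indicator {a..c} x * g x"
  proof -
    have "AE x in lebesgue. x \<noteq> b" by (intro AE_completion AE_lborel_singleton)
    then show ?thesis by eventually_elim (use le in \<open>auto simp: indicator_def\<close>)
  qed
  have eq: "indicator {a..c} x * g x = ?f x - (if x = b then g b else 0)" for x
    using le by (auto simp: indicator_def)
  have ib: "integrable lebesgue (\<lambda>x. if x = b then g b else 0)"
  proof -
    have "(\<lambda>x. if x = b then g b else 0) = (\<lambda>x. indicator {b} x * g b)" by (auto simp: indicator_def)
    moreover have "integrable lebesgue (\<lambda>x. indicator {b} x * g b)"
      by (intro integrable_mult_left integrable_real_indicator) auto
    ultimately show ?thesis by simp
  qed
  have i3: "integrable lebesgue (\<lambda>x. indicator {a..c} x * g x)" unfolding eq using i ib by (rule Bochner_Integration.integrable_diff)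
  then show "integrable (lebesgue_on {a..c}) g" by (simp add: integrable_lebesgue_on_iff)
  have "(\<integral>x. indicator {a..c} x * g x \<partial>lebesgue) = (\<integral>x. ?f x \<partial>lebesgue)"
    using ae borel_measurable_integrable[OF i] borel_measurable_integrable[OF i3] by (intro integral_cong_AE) auto
  then show "(\<integral>x. g x \<partial>lebesgue_on {a..c}) = (\<integral>x. g x \<partial>lebesgue_on {a..b}) + (\<integral>x. g x \<partial>lebesgue_on {b..c})"
    using i1 i2 by (simp add: integral_lebesgue_on_eq)
qed

lemma integrable_lebesgue_on_subset:
  fixes g :: "real \<Rightarrow> real"
  assumes "integrable (lebesgue_on S) g" "T \<subseteq> S" "S \<in> sets lebesgue" "T \<in> sets lebesgue"
  shows "integrable (lebesgue_on T) g"
proof -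
  have "integrable lebesgue (\<lambda>x. indicator T x *\<^sub>R (indicator S x * g x))"
    using assms by (intro integrable_mult_indicator) (auto simp: integrable_lebesgue_on_iff)
  moreover have "(\<lambda>x. indicator T x *\<^sub>R (indicator S x * g x)) = (\<lambda>x. indicator T x * g x)"
    using assms(2) by (auto simp: indicator_def fun_eq_iff)
  ultimately show ?thesis using assms by (simp add: integrable_lebesgue_on_iff)
qed

lemma AE_lebesgue_on_iff:
  "S \<in> sets lebesgue \<Longrightarrow> (AE x in lebesgue_on S. P x) \<longleftrightarrow> (AE x in lebesgue. x \<in> S \<longrightarrow> P x)"
  by (rule AE_restrict_space_iff) simp

lemma AE_lebesgue_on_subset:
  "S \<in> sets lebesgue \<Longrightarrow> T \<in> sets lebesgue \<Longrightarrow> T \<subseteq> S \<Longrightarrow> AE x in lebesgue_on S. P x \<Longrightarrow> AE x in lebesgue_on T. P x"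
  unfolding AE_lebesgue_on_iff by (auto elim!: eventually_mono)

lemma measurable_lebesgue_on_subset:
  "f \<in> borel_measurable (lebesgue_on S) \<Longrightarrow> T \<subseteq> S \<Longrightarrow> f \<in> borel_measurable (lebesgue_on T)"
  using measurable_restrict_mono by blast

lemma shift_measurable_lebesgue: "(\<lambda>t::real. t + \<tau>) \<in> lebesgue \<rightarrow>\<^sub>M lebesgue"
  using lebesgue_affine_measurable[of "\<lambda>_. 1" \<tau>] by (simp add: add.commute)

lemma distr_shift_lebesgue: "distr lebesgue lebesgue (\<lambda>t::real. t + \<tau>) = lebesgue"
proof -
  have "lebesgue = density (distr lebesgue lebesgue (\<lambda>x. \<tau> + 1 * x)) (\<lambda>_. ennreal (abs 1))"
    by (rule lebesgue_real_affine) simp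
  then show ?thesis by (simp add: density_1 add.commute)
qed

lemma shift_measurable_lebesgue_on: "(\<lambda>t::real. t + \<tau>) \<in> lebesgue_on {t. t + \<tau> \<in> S} \<rightarrow>\<^sub>M lebesgue_on S"
  by (rule measurable_restrict_space3[OF shift_measurable_lebesgue]) auto

lemma shift_sets_lebesgue: "S \<in> sets lebesgue \<Longrightarrow> {t::real. t + \<tau> \<in> S} \<in> sets lebesgue"
  using measurable_sets[OF shift_measurable_lebesgue] by (simp add: vimage_def)

lemma distr_shift_lebesgue_on:
  fixes S :: "real set"
  assumes S: "S \<in> sets lebesgue"
  shows "distr (lebesgue_on {t. t + \<tau> \<in> S}) (lebesgue_on S) (\<lambda>t. t + \<tau>) = lebesgue_on S"
proof (rule measure_eqI)
  fix A assume "A \<in> sets (distr (lebesgue_on {t. t + \<tau> \<in> S}) (lebesgue_on S) (\<lambda>t. t + \<tau>))"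
  then have A: "A \<in> sets (lebesgue_on S)" by simp
  then have A': "A \<in> sets lebesgue" "A \<subseteq> S" using S by (auto simp: sets_restrict_space_iff)
  have "emeasure (distr (lebesgue_on {t. t + \<tau> \<in> S}) (lebesgue_on S) (\<lambda>t. t + \<tau>)) A
     = emeasure (lebesgue_on {t. t + \<tau> \<in> S}) {t. t + \<tau> \<in> A}"
    using A A' by (subst emeasure_distr[OF shift_measurable_lebesgue_on])
      (auto intro!: arg_cong[where f="emeasure (lebesgue_on {t. t + \<tau> \<in> S})"] simp: space_restrict_space)
  also have "\<dots> = emeasure lebesgue {t. t + \<tau> \<in> A}"
    using A' S shift_sets_lebesgue[OF S] by (intro emeasure_restrict_space) auto
  also have "\<dots> = emeasure (distr lebesgue lebesgue (\<lambda>t. t + \<tau>)) A"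
    using A' by (subst emeasure_distr[OF shift_measurable_lebesgue]) (auto simp: vimage_def)
  also have "\<dots> = emeasure (lebesgue_on S) A"
    unfolding distr_shift_lebesgue using A' S by (intro emeasure_restrict_space[symmetric]) auto
  finally show "emeasure (distr (lebesgue_on {t. t + \<tau> \<in> S}) (lebesgue_on S) (\<lambda>t. t + \<tau>)) A = emeasure (lebesgue_on S) A" .
qed simp

lemma AE_shift:
  fixes S :: "real set"
  assumes S: "S \<in> sets lebesgue" and "AE t in lebesgue_on S. P t"
  shows "AE t in lebesgue_on {t. t + \<tau> \<in> S}. P (t + \<tau>)"
proof -
  have "AE t in distr (lebesgue_on {t. t + \<tau> \<in> S}) (lebesgue_on S) (\<lambda>t. t + \<tau>). P t"
    unfolding distr_shift_lebesgue_on[OF S] by (rule assms(2))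
  then show ?thesis by (rule AE_distrD[OF shift_measurable_lebesgue_on])
qed

lemma integrable_shift:
  fixes g :: "real \<Rightarrow> real"
  assumes S: "S \<in> sets lebesgue" and "integrable (lebesgue_on S) g"
  shows "integrable (lebesgue_on {t. t + \<tau> \<in> S}) (\<lambda>t. g (t + \<tau>))"
  using assms(2) distr_shift_lebesgue_on[OF S, of \<tau>] integrable_distr[OF shift_measurable_lebesgue_on[of \<tau> S], of g] by simp

lemma integral_shift:
  fixes g :: "real \<Rightarrow> real"
  assumes S: "S \<in> sets lebesgue" and g: "g \<in> borel_measurable (lebesgue_on S)"
  shows "(\<integral>t. g (t + \<tau>) \<partial>lebesgue_on {t. t + \<tau> \<in> S}) = (\<integral>t. g t \<partial>lebesgue_on S)"
  using integral_distr[OF shift_measurable_lebesgue_on g, of \<tau>] distr_shift_lebesgue_on[OF S, of \<tau>] by simp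

lemma nn_integral_shift:
  fixes S :: "real set"
  assumes S: "S \<in> sets lebesgue" and g: "g \<in> borel_measurable (lebesgue_on S)"
  shows "(\<integral>\<^sup>+t. g (t + \<tau>) \<partial>lebesgue_on {t. t + \<tau> \<in> S}) = (\<integral>\<^sup>+t. g t \<partial>lebesgue_on S)"
  using nn_integral_distr[OF shift_measurable_lebesgue_on[of \<tau> S], of g] g distr_shift_lebesgue_on[OF S, of \<tau>] by simp

lemma shift_Icc: "{t. t + \<tau> \<in> {a + \<tau>..b + \<tau>}} = {a..b}" for a b \<tau> :: real
  by auto

lemma Vspace_Hspace: "Vspace D \<subseteq> Hspace D"
  unfolding Vspace_def V_grad_def Hspace_def by auto

lemma V_grad_AE_cong:
  assumes "sq_int D u" "sq_int D w" "AE x in lebesgue_on (Omega D). u x = w x" "V_grad D u G" "admissible_dom D"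
  shows "V_grad D w G"
proof -
  note [measurable] = sq_int_measurable[OF assms(1)] sq_int_measurable[OF assms(2)]
  have "l2dist D \<phi> u = l2dist D \<phi> w" if "test_field D \<phi>" for \<phi>
  proof -
    note [measurable] = sq_int_measurable[OF test_field_sq_int[OF assms(5) that]]
    have "(\<integral>x. (norm (\<phi> x - u x))\<^sup>2 \<partial>lebesgue_on (Omega D)) = (\<integral>x. (norm (\<phi> x - w x))\<^sup>2 \<partial>lebesgue_on (Omega D))"
      by (rule integral_cong_AE) (use assms(3) in \<open>auto elim!: eventually_mono\<close>)
    then show ?thesis by (simp add: l2dist_def)
  qed
  then have "(\<lambda>n. l2dist D (\<phi> n) u) = (\<lambda>n. l2dist D (\<phi> n) w)" if "\<forall>n. test_field D (\<phi> n)" for \<phi> :: "nat \<Rightarrow> field"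
    using that by (simp add: fun_eq_iff)
  then show ?thesis using assms(1,2,4) unfolding V_grad_def by auto
qed

lemma deriv_zero_outside_support:
  fixes \<phi> :: "real \<Rightarrow> real"
  assumes "t \<notin> closure {t. \<phi> t \<noteq> 0}"
  shows "\<phi> t = 0" "deriv \<phi> t = 0"
proof -
  show "\<phi> t = 0" using assms closure_subset[of "{t. \<phi> t \<noteq> 0}"] by auto
  have "((\<lambda>x. 0) has_real_derivative 0) (at t)" by simp
  then have "(\<phi> has_real_derivative 0) (at t)"
  proof (rule has_field_derivative_transform_within_open)
    show "open (- closure {t. \<phi> t \<noteq> 0})" by auto
    show "t \<in> - closure {t. \<phi> t \<noteq> 0}" using assms by simp
    show "\<And>x. x \<in> - closure {t. \<phi> t \<noteq> 0} \<Longrightarrow> 0 = \<phi> x" using closure_subset[of "{t. \<phi> t \<noteq> 0}"] by auto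
  qed
  then show "deriv \<phi> t = 0" by (rule DERIV_imp_deriv)
qed

lemma deriv_shift: "deriv (\<lambda>t. \<phi> (t - \<tau>)) (t + \<tau>) = deriv \<phi> (t::real)"
  if "\<And>x. (\<phi> has_real_derivative deriv \<phi> x) (at x)" for \<phi> :: "real \<Rightarrow> real"
proof (rule DERIV_imp_deriv)
  show "((\<lambda>t. \<phi> (t - \<tau>)) has_real_derivative deriv \<phi> t) (at (t + \<tau>))"
    by (rule DERIV_chain2[where g="\<lambda>t. t - \<tau>" and Db=1, simplified])
      (use that[of t] in \<open>auto intro!: derivative_eq_intros\<close>)
qed

context ns_space
begin

definition fld_eq :: "field \<Rightarrow> field \<Rightarrow> bool" where
  "fld_eq h g \<longleftrightarrow> h \<in> Hspace D \<and> g \<in> Hspace D \<and> (\<forall>z\<in>Hspace D. inner_H D h z = inner_H D g z)"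

text \<open>Almost everywhere equal fields admit the same weak gradients, so the choice
  \<open>grad\<close> returns literally the same function for both.\<close>

lemma fld_eq_obs:
  assumes e: "fld_eq h g"
  shows "norm_H D h = norm_H D g" "h \<in> Vspace D \<longleftrightarrow> g \<in> Vspace D" "norm_V D h = norm_V D g"
    "inner_V D h z = inner_V D g z" "z \<in> Hspace D \<Longrightarrow> inner_H D z h = inner_H D z g"
    "trilin D h h z = trilin D g g z" "resid_dual_norm D \<nu> f h = resid_dual_norm D \<nu> f g"
proof -
  have H: "h \<in> Hspace D" "g \<in> Hspace D" "\<And>z. z \<in> Hspace D \<Longrightarrow> inner_H D h z = inner_H D g z" using e by (auto simp: fld_eq_def)
  have ae: "AE x in lebesgue_on (Omega D). h x = g x" by (rule AE_eq_of_ip[OF H])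
  have sq: "sq_int D h" "sq_int D g" using H Hspace_sq_int by auto
  have ae': "AE x in lebesgue_on (Omega D). g x = h x" using ae by eventually_elim simp
  have V: "V_grad D h = V_grad D g"
    using V_grad_AE_cong[OF sq ae _ dom] V_grad_AE_cong[OF sq(2,1) ae' _ dom] by blast
  then have G: "grad D h = grad D g" by (simp add: grad_def)
  show "norm_H D h = norm_H D g" unfolding norm_H_eq using H by (intro nrm_eq_of_ip) auto
  show "h \<in> Vspace D \<longleftrightarrow> g \<in> Vspace D" by (simp add: Vspace_def V)
  show "norm_V D h = norm_V D g" "inner_V D h z = inner_V D g z" for z by (simp_all add: norm_V_def inner_V_def G)
  then have iV: "inner_V D h z = inner_V D g z" for z by simp
  show "inner_H D z h = inner_H D z g" if "z \<in> Hspace D"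
    using H that ip_sym by metis
  show tri: "trilin D h h z = trilin D g g z" for z
  proof -
    let ?M = "lebesgue_on (Omega D)"
    let ?F = "\<lambda>k x. \<Sum>i\<in>UNIV. \<Sum>j\<in>UNIV. k x $ i * grad D g i x $ j * z x $ j"
    have O: "Omega D \<in> sets lebesgue" using Omega_open_bounded[OF dom] by simp
    \<comment> \<open>\<open>h\<close> need not lie in V and \<open>z\<close> is arbitrary, so the
      integrand may fail to be measurable, and the integral is then 0 by convention. Completeness of
      Lebesgue measure makes both integrands fail together.\<close>
    have mm: "?F h \<in> borel_measurable ?M \<longleftrightarrow> ?F g \<in> borel_measurable ?M"
    proof -
      have imp: "?F k' \<in> borel_measurable ?M" if "?F k \<in> borel_measurable ?M" "AE x in ?M. ?F k x = ?F k' x" for k k'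
      proof -
        have "AE x in lebesgue. x \<in> Omega D \<longrightarrow> ?F k x = ?F k' x"
          using that(2) O by (subst (asm) AE_restrict_space_iff) auto
        then have ae2: "AE x in lebesgue. (if x \<in> Omega D then ?F k x else 0) = (if x \<in> Omega D then ?F k' x else 0)"
          by eventually_elim simp
        have "(\<lambda>x. if x \<in> Omega D then ?F k x else 0) \<in> borel_measurable lebesgue"
          using that(1) O by (simp add: borel_measurable_if)
        then have "(\<lambda>x. if x \<in> Omega D then ?F k' x else 0) \<in> borel_measurable lebesgue"
          using ae2 by (rule borel_measurable_AE)
        then show ?thesis using O by (simp add: borel_measurable_if)
      qed
      have "AE x in ?M. ?F h x = ?F g x" using ae by eventually_elim simp
      moreover have "AE x in ?M. ?F g x = ?F h x" using ae by eventually_elim simp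
      ultimately show ?thesis using imp[of h g] imp[of g h] by blast
    qed
    show ?thesis
    proof (cases "?F h \<in> borel_measurable ?M")
      case True
      then show ?thesis unfolding trilin_def G using mm ae by (intro integral_cong_AE) (auto elim!: eventually_mono)
    next
      case False
      then show ?thesis unfolding trilin_def G using mm by (metis (no_types, lifting) borel_measurable_integrable not_integrable_integral_eq)
    qed
  qed
  show "resid_dual_norm D \<nu> f h = resid_dual_norm D \<nu> f g"
    unfolding resid_dual_norm_def iV tri ..
qed

lemma weak_solutionD:
  assumes "weak_solution D \<nu> f J u"
  shows "t \<in> J \<Longrightarrow> u t \<in> Hspace D"
    "v \<in> Hspace D \<Longrightarrow> continuous_on J (\<lambda>t. inner_H D (u t) v)"
    "{a..b} \<subseteq> J \<Longrightarrow> \<exists>C. AE t in lebesgue_on {a..b}. norm_H D (u t) \<le> C"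
    "AE t in lebesgue_on J. u t \<in> Vspace D"
    "(\<lambda>t. norm_V D (u t)) \<in> borel_measurable (lebesgue_on J)"
    "{a..b} \<subseteq> J \<Longrightarrow> integrable (lebesgue_on {a..b}) (\<lambda>t. (norm_V D (u t))\<^sup>2)"
    "(\<lambda>t. resid_dual_norm D \<nu> f (u t)) \<in> borel_measurable (lebesgue_on J)"
    "AE t in lebesgue_on J. resid_dual_norm D \<nu> f (u t) < \<infinity>"
    "{a..b} \<subseteq> J \<Longrightarrow> (\<integral>\<^sup>+ t. ennreal (enn2real (resid_dual_norm D \<nu> f (u t)) powr (4/3)) \<partial>lebesgue_on {a..b}) < \<infinity>"
    "v' \<in> Vspace D \<Longrightarrow> smooth_on UNIV \<phi> \<Longrightarrow> compact (closure {t. \<phi> t \<noteq> 0}) \<Longrightarrow> closure {t. \<phi> t \<noteq> 0} \<subseteq> J \<Longrightarrow>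
      integrable (lebesgue_on J) (\<lambda>t. - inner_H D (u t) v' * deriv \<phi> t + (\<nu> * inner_V D (u t) v' + trilin D (u t) (u t) v' - inner_H D f v') * \<phi> t)"
    "v' \<in> Vspace D \<Longrightarrow> smooth_on UNIV \<phi> \<Longrightarrow> compact (closure {t. \<phi> t \<noteq> 0}) \<Longrightarrow> closure {t. \<phi> t \<noteq> 0} \<subseteq> J \<Longrightarrow>
      (\<integral>t. - inner_H D (u t) v' * deriv \<phi> t + (\<nu> * inner_V D (u t) v' + trilin D (u t) (u t) v' - inner_H D f v') * \<phi> t \<partial>lebesgue_on J) = 0"
    "AE t' in lebesgue_on J. \<forall>t\<in>J. t' < t \<longrightarrow>
        (norm_H D (u t))\<^sup>2 / 2 + \<nu> * (\<integral>s. (norm_V D (u s))\<^sup>2 \<partial>lebesgue_on {t'..t})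
          \<le> (norm_H D (u t'))\<^sup>2 / 2 + (\<integral>s. inner_H D f (u s) \<partial>lebesgue_on {t'..t})"
  using assms unfolding weak_solution_def Let_def by blast+

text \<open>Decoding and the matching of endpoints reproduce a trajectory only up to a null set at
  each time. That \<open>J\<close> is an interval keeps the time integrals of the energy inequality
  inside \<open>J\<close>.\<close>

lemma weak_solution_cong:
  assumes ws: "weak_solution D \<nu> f J u" and e: "\<And>t. t \<in> J \<Longrightarrow> fld_eq (u t) (w t)" and f: "f \<in> Hspace D"
    and J: "is_interval J"
  shows "weak_solution D \<nu> f J w"
proof -
  note o = fld_eq_obs[OF e]
  have c: "a \<in> J \<Longrightarrow> z \<in> Hspace D \<Longrightarrow> inner_H D (w a) z = inner_H D (u a) z" for a z
    using e by (simp add: fld_eq_def)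
  have spc: "space (lebesgue_on S) = S" for S :: "real set" by (simp add: space_restrict_space)
  note W = weak_solutionD[OF ws]
  show ?thesis unfolding weak_solution_def
  proof (intro conjI)
    show "\<forall>t\<in>J. w t \<in> Hspace D" using e by (auto simp: fld_eq_def)
    show "\<forall>v\<in>Hspace D. continuous_on J (\<lambda>t. inner_H D (w t) v)"
      by (intro ballI continuous_on_eq[OF W(2)]) (use c in auto)
    show "\<forall>a b. {a..b} \<subseteq> J \<longrightarrow> (\<exists>C. AE t in lebesgue_on {a..b}. norm_H D (w t) \<le> C)"
    proof (intro allI impI)
      fix a b :: real assume ab: "{a..b} \<subseteq> J"
      then obtain C where C: "AE t in lebesgue_on {a..b}. norm_H D (u t) \<le> C" using W(3) by blast
      have "AE t in lebesgue_on {a..b}. norm_H D (w t) \<le> C"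
        by (rule AE_mp[OF C AE_I2]) (use o(1) ab in \<open>auto simp: spc subset_iff\<close>)
      then show "\<exists>C. AE t in lebesgue_on {a..b}. norm_H D (w t) \<le> C" ..
    qed
    show "AE t in lebesgue_on J. w t \<in> Vspace D"
      by (rule AE_mp[OF W(4) AE_I2]) (use o(2) in \<open>auto simp: spc\<close>)
    show "(\<lambda>t. norm_V D (w t)) \<in> borel_measurable (lebesgue_on J)"
      by (rule measurable_cong[THEN iffD1, OF _ W(5)]) (use o(3) in \<open>auto simp: spc\<close>)
    show "\<forall>a b. {a..b} \<subseteq> J \<longrightarrow> integrable (lebesgue_on {a..b}) (\<lambda>t. (norm_V D (w t))\<^sup>2)"
    proof (intro allI impI)
      fix a b :: real assume ab: "{a..b} \<subseteq> J"
      have "integrable (lebesgue_on {a..b}) (\<lambda>t. (norm_V D (u t))\<^sup>2)" using W(6)[OF ab] .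
      then show "integrable (lebesgue_on {a..b}) (\<lambda>t. (norm_V D (w t))\<^sup>2)"
        by (rule Bochner_Integration.integrable_cong[THEN iffD1, OF refl, rotated]) (use o(3) ab in \<open>auto simp: spc subset_iff\<close>)
    qed
    show "(\<lambda>t. resid_dual_norm D \<nu> f (w t)) \<in> borel_measurable (lebesgue_on J)"
      by (rule measurable_cong[THEN iffD1, OF _ W(7)]) (use o(7) in \<open>auto simp: spc\<close>)
    show "AE t in lebesgue_on J. resid_dual_norm D \<nu> f (w t) < \<infinity>"
      by (rule AE_mp[OF W(8) AE_I2]) (use o(7) in \<open>auto simp: spc\<close>)
    show "\<forall>a b. {a..b} \<subseteq> J \<longrightarrow> (\<integral>\<^sup>+ t. ennreal (enn2real (resid_dual_norm D \<nu> f (w t)) powr (4/3)) \<partial>lebesgue_on {a..b}) < \<infinity>"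
    proof (intro allI impI)
      fix a b :: real assume ab: "{a..b} \<subseteq> J"
      have "(\<integral>\<^sup>+ t. ennreal (enn2real (resid_dual_norm D \<nu> f (w t)) powr (4/3)) \<partial>lebesgue_on {a..b})
        = (\<integral>\<^sup>+ t. ennreal (enn2real (resid_dual_norm D \<nu> f (u t)) powr (4/3)) \<partial>lebesgue_on {a..b})"
        by (intro nn_integral_cong) (use o(7) ab in \<open>auto simp: spc subset_iff\<close>)
      then show "(\<integral>\<^sup>+ t. ennreal (enn2real (resid_dual_norm D \<nu> f (w t)) powr (4/3)) \<partial>lebesgue_on {a..b}) < \<infinity>"
        using W(9)[OF ab] by simp
    qed
    show "\<forall>v\<in>Vspace D. \<forall>\<phi>::real \<Rightarrow> real. smooth_on UNIV \<phi> \<and> compact (closure {t. \<phi> t \<noteq> 0}) \<and> closure {t. \<phi> t \<noteq> 0} \<subseteq> J \<longrightarrow>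
        (let g = (\<lambda>t. - inner_H D (w t) v * deriv \<phi> t + (\<nu> * inner_V D (w t) v + trilin D (w t) (w t) v - inner_H D f v) * \<phi> t)
         in integrable (lebesgue_on J) g \<and> (\<integral>t. g t \<partial>lebesgue_on J) = 0)"
    proof (intro ballI allI impI)
      fix v and \<phi> :: "real \<Rightarrow> real"
      assume v: "v \<in> Vspace D" and \<phi>: "smooth_on UNIV \<phi> \<and> compact (closure {t. \<phi> t \<noteq> 0}) \<and> closure {t. \<phi> t \<noteq> 0} \<subseteq> J"
      have vH: "v \<in> Hspace D" using v Vspace_Hspace by auto
      define gu where "gu t = - inner_H D (u t) v * deriv \<phi> t + (\<nu> * inner_V D (u t) v + trilin D (u t) (u t) v - inner_H D f v) * \<phi> t" for t
      define gw where "gw t = - inner_H D (w t) v * deriv \<phi> t + (\<nu> * inner_V D (w t) v + trilin D (w t) (w t) v - inner_H D f v) * \<phi> t" for t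
      have eq: "gu t = gw t" if "t \<in> J" for t unfolding gu_def gw_def using c[OF that vH] o(4,6)[OF that] by simp
      have g: "integrable (lebesgue_on J) gu \<and> (\<integral>t. gu t \<partial>lebesgue_on J) = 0"
        using W(10,11)[OF v, of \<phi>] \<phi> unfolding gu_def by blast
      have "integrable (lebesgue_on J) gw" 
        by (rule Bochner_Integration.integrable_cong[THEN iffD1, OF refl, of _ gu]) (use g eq in \<open>auto simp: spc\<close>)
      moreover have "(\<integral>t. gw t \<partial>lebesgue_on J) = (\<integral>t. gu t \<partial>lebesgue_on J)"
        by (rule Bochner_Integration.integral_cong[OF refl]) (use eq in \<open>auto simp: spc\<close>)
      ultimately show "let g = (\<lambda>t. - inner_H D (w t) v * deriv \<phi> t + (\<nu> * inner_V D (w t) v + trilin D (w t) (w t) v - inner_H D f v) * \<phi> t)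
         in integrable (lebesgue_on J) g \<and> (\<integral>t. g t \<partial>lebesgue_on J) = 0"
        using g unfolding gw_def Let_def by simp
    qed
    have ae: "AE t' in lebesgue_on J. \<forall>t\<in>J. t' < t \<longrightarrow>
        (norm_H D (u t))\<^sup>2 / 2 + \<nu> * (\<integral>s. (norm_V D (u s))\<^sup>2 \<partial>lebesgue_on {t'..t})
          \<le> (norm_H D (u t'))\<^sup>2 / 2 + (\<integral>s. inner_H D f (u s) \<partial>lebesgue_on {t'..t})" using W(12) .
    show "AE t' in lebesgue_on J. \<forall>t\<in>J. t' < t \<longrightarrow>
        (norm_H D (w t))\<^sup>2 / 2 + \<nu> * (\<integral>s. (norm_V D (w s))\<^sup>2 \<partial>lebesgue_on {t'..t})
          \<le> (norm_H D (w t'))\<^sup>2 / 2 + (\<integral>s. inner_H D f (w s) \<partial>lebesgue_on {t'..t})"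
    proof (rule AE_mp[OF ae], rule AE_I2, intro impI ballI)
      fix t' t assume t': "t' \<in> space (lebesgue_on J)" and t: "t \<in> J" "t' < t"
        and u: "\<forall>t\<in>J. t' < t \<longrightarrow>
        (norm_H D (u t))\<^sup>2 / 2 + \<nu> * (\<integral>s. (norm_V D (u s))\<^sup>2 \<partial>lebesgue_on {t'..t})
          \<le> (norm_H D (u t'))\<^sup>2 / 2 + (\<integral>s. inner_H D f (u s) \<partial>lebesgue_on {t'..t})"
      have t'J: "t' \<in> J" using t' by (simp add: spc)
      have sub: "s \<in> J" if "s \<in> {t'..t}" for s using mem_is_interval_1_I[OF J t'J t(1)] that by auto
      have 1: "(\<integral>s. (norm_V D (w s))\<^sup>2 \<partial>lebesgue_on {t'..t}) = (\<integral>s. (norm_V D (u s))\<^sup>2 \<partial>lebesgue_on {t'..t})"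
        by (rule Bochner_Integration.integral_cong[OF refl]) (use o(3)[OF sub] in \<open>auto simp: spc\<close>)
      have 2: "(\<integral>s. inner_H D f (w s) \<partial>lebesgue_on {t'..t}) = (\<integral>s. inner_H D f (u s) \<partial>lebesgue_on {t'..t})"
        by (rule Bochner_Integration.integral_cong[OF refl]) (use o(5)[OF sub f] in \<open>auto simp: spc\<close>)
      show "(norm_H D (w t))\<^sup>2 / 2 + \<nu> * (\<integral>s. (norm_V D (w s))\<^sup>2 \<partial>lebesgue_on {t'..t})
          \<le> (norm_H D (w t'))\<^sup>2 / 2 + (\<integral>s. inner_H D f (w s) \<partial>lebesgue_on {t'..t})"
        unfolding 1 2 using u[rule_format, OF t] unfolding o(1)[OF t(1)] o(1)[OF t'J] .
    qed
  qed
qed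

text \<open>Translation invariance of Lebesgue measure, applied clause by clause, with test
  functions translated the other way. Hypothesis \<open>m\<close> permits the change of variables in
  the work of the force.\<close>

lemma weak_solution_shift:
  assumes ws: "weak_solution D \<nu> f J u" and Jo: "open J" and J: "is_interval J"
    and m: "\<And>a b. {a..b} \<subseteq> J \<Longrightarrow> (\<lambda>s. inner_H D f (u s)) \<in> borel_measurable (lebesgue_on {a..b})"
  shows "weak_solution D \<nu> f {t. t + \<tau> \<in> J} (\<lambda>t. u (t + \<tau>))"
proof -
  have JL: "J \<in> sets lebesgue" using Jo by simp
  note W = ws[unfolded weak_solution_def]
  have sh: "{a + \<tau>..b + \<tau>} \<subseteq> J" if "{a..b} \<subseteq> {t. t + \<tau> \<in> J}" for a b
  proof
    fix t assume "t \<in> {a + \<tau>..b + \<tau>}"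
    then have "t - \<tau> \<in> {a..b}" by auto
    then show "t \<in> J" using that by auto
  qed
  have IccL: "{a..b} \<in> sets lebesgue" for a b :: real by simp
  show ?thesis unfolding weak_solution_def
  proof (intro conjI)
    show "\<forall>t\<in>{t. t + \<tau> \<in> J}. u (t + \<tau>) \<in> Hspace D" using W by auto
    show "\<forall>v\<in>Hspace D. continuous_on {t. t + \<tau> \<in> J} (\<lambda>t. inner_H D (u (t + \<tau>)) v)"
    proof
      fix v assume "v \<in> Hspace D"
      then have "continuous_on J (\<lambda>t. inner_H D (u t) v)" using W by blast
      then show "continuous_on {t. t + \<tau> \<in> J} (\<lambda>t. inner_H D (u (t + \<tau>)) v)"
        by (rule continuous_on_compose2) (auto intro!: continuous_intros)
    qed
    show "\<forall>a b. {a..b} \<subseteq> {t. t + \<tau> \<in> J} \<longrightarrow> (\<exists>C. AE t in lebesgue_on {a..b}. norm_H D (u (t + \<tau>)) \<le> C)"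
    proof (intro allI impI)
      fix a b assume "{a..b} \<subseteq> {t. t + \<tau> \<in> J}"
      then obtain C where "AE t in lebesgue_on {a + \<tau>..b + \<tau>}. norm_H D (u t) \<le> C" using W sh by blast
      from AE_shift[OF IccL this, of \<tau>] show "\<exists>C. AE t in lebesgue_on {a..b}. norm_H D (u (t + \<tau>)) \<le> C"
        unfolding shift_Icc by blast
    qed
    show "AE t in lebesgue_on {t. t + \<tau> \<in> J}. u (t + \<tau>) \<in> Vspace D"
      using W by (intro AE_shift[OF JL]) blast
    show "(\<lambda>t. norm_V D (u (t + \<tau>))) \<in> borel_measurable (lebesgue_on {t. t + \<tau> \<in> J})"
      using W by (intro measurable_compose[OF shift_measurable_lebesgue_on]) blast
    show "\<forall>a b. {a..b} \<subseteq> {t. t + \<tau> \<in> J} \<longrightarrow> integrable (lebesgue_on {a..b}) (\<lambda>t. (norm_V D (u (t + \<tau>)))\<^sup>2)"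
    proof (intro allI impI)
      fix a b assume "{a..b} \<subseteq> {t. t + \<tau> \<in> J}"
      then have "integrable (lebesgue_on {a + \<tau>..b + \<tau>}) (\<lambda>t. (norm_V D (u t))\<^sup>2)" using W sh by blast
      from integrable_shift[OF IccL this, of \<tau>] show "integrable (lebesgue_on {a..b}) (\<lambda>t. (norm_V D (u (t + \<tau>)))\<^sup>2)"
        unfolding shift_Icc .
    qed
    show "(\<lambda>t. resid_dual_norm D \<nu> f (u (t + \<tau>))) \<in> borel_measurable (lebesgue_on {t. t + \<tau> \<in> J})"
      using W by (intro measurable_compose[OF shift_measurable_lebesgue_on]) blast
    show "AE t in lebesgue_on {t. t + \<tau> \<in> J}. resid_dual_norm D \<nu> f (u (t + \<tau>)) < \<infinity>"
      using W by (intro AE_shift[OF JL]) blast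
    show "\<forall>a b. {a..b} \<subseteq> {t. t + \<tau> \<in> J} \<longrightarrow>
        (\<integral>\<^sup>+ t. ennreal (enn2real (resid_dual_norm D \<nu> f (u (t + \<tau>))) powr (4/3)) \<partial>lebesgue_on {a..b}) < \<infinity>"
    proof (intro allI impI)
      fix a b assume ab: "{a..b} \<subseteq> {t. t + \<tau> \<in> J}"
      have "(\<lambda>t. resid_dual_norm D \<nu> f (u t)) \<in> borel_measurable (lebesgue_on {a + \<tau>..b + \<tau>})"
        using W sh[OF ab] measurable_lebesgue_on_subset by blast
      then have "(\<lambda>t. ennreal (enn2real (resid_dual_norm D \<nu> f (u t)) powr (4/3))) \<in> borel_measurable (lebesgue_on {a + \<tau>..b + \<tau>})"
        by measurable
      from nn_integral_shift[OF IccL this, of \<tau>]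
      show "(\<integral>\<^sup>+ t. ennreal (enn2real (resid_dual_norm D \<nu> f (u (t + \<tau>))) powr (4/3)) \<partial>lebesgue_on {a..b}) < \<infinity>"
        unfolding shift_Icc using W sh[OF ab] by auto
    qed
    show "\<forall>v\<in>Vspace D. \<forall>\<phi>::real \<Rightarrow> real. smooth_on UNIV \<phi> \<and> compact (closure {t. \<phi> t \<noteq> 0}) \<and> closure {t. \<phi> t \<noteq> 0} \<subseteq> {t. t + \<tau> \<in> J} \<longrightarrow>
        (let g = (\<lambda>t. - inner_H D (u (t + \<tau>)) v * deriv \<phi> t + (\<nu> * inner_V D (u (t + \<tau>)) v + trilin D (u (t + \<tau>)) (u (t + \<tau>)) v - inner_H D f v) * \<phi> t)
         in integrable (lebesgue_on {t. t + \<tau> \<in> J}) g \<and> (\<integral>t. g t \<partial>lebesgue_on {t. t + \<tau> \<in> J}) = 0)"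
    proof (intro ballI allI impI, elim conjE)
      fix v and \<phi> :: "real \<Rightarrow> real"
      assume v: "v \<in> Vspace D" and \<phi>: "smooth_on UNIV \<phi>" "compact (closure {t. \<phi> t \<noteq> 0})" "closure {t. \<phi> t \<noteq> 0} \<subseteq> {t. t + \<tau> \<in> J}"
      define \<psi> where "\<psi> t = \<phi> (t - \<tau>)" for t
      have s: "smooth_on UNIV \<psi>"
        using \<phi>(1) Ck_on_affine[of _ \<phi> 1 "- \<tau>"] unfolding smooth_on_def \<psi>_def by simp
      have supp: "{t. \<psi> t \<noteq> 0} = (\<lambda>t. \<tau> + t) ` {t. \<phi> t \<noteq> 0}"
        unfolding \<psi>_def by (auto simp: image_iff) (metis add_diff_cancel_left' diff_add_cancel add.commute)
      have cl: "closure {t. \<psi> t \<noteq> 0} = (\<lambda>t. \<tau> + t) ` closure {t. \<phi> t \<noteq> 0}"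
        unfolding supp by (rule closure_translation)
      have c: "compact (closure {t. \<psi> t \<noteq> 0})" unfolding cl using \<phi>(2) by (rule compact_translation)
      have sub: "closure {t. \<psi> t \<noteq> 0} \<subseteq> J" unfolding cl using \<phi>(3) by (auto simp: add.commute)
      define g where "g t = - inner_H D (u t) v * deriv \<psi> t + (\<nu> * inner_V D (u t) v + trilin D (u t) (u t) v - inner_H D f v) * \<psi> t" for t
      have g: "integrable (lebesgue_on J) g" "(\<integral>t. g t \<partial>lebesgue_on J) = 0"
        using W v s c sub unfolding g_def Let_def by blast+
      have e: "g (t + \<tau>) = - inner_H D (u (t + \<tau>)) v * deriv \<phi> t + (\<nu> * inner_V D (u (t + \<tau>)) v + trilin D (u (t + \<tau>)) (u (t + \<tau>)) v - inner_H D f v) * \<phi> t" for t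
        unfolding g_def \<psi>_def deriv_shift[OF smooth_on_real_has_derivative(1)[OF \<phi>(1)]] by simp
      show "let g = (\<lambda>t. - inner_H D (u (t + \<tau>)) v * deriv \<phi> t + (\<nu> * inner_V D (u (t + \<tau>)) v + trilin D (u (t + \<tau>)) (u (t + \<tau>)) v - inner_H D f v) * \<phi> t)
         in integrable (lebesgue_on {t. t + \<tau> \<in> J}) g \<and> (\<integral>t. g t \<partial>lebesgue_on {t. t + \<tau> \<in> J}) = 0"
        unfolding Let_def e[symmetric] using integrable_shift[OF JL g(1), of \<tau>] integral_shift[OF JL borel_measurable_integrable[OF g(1)], of \<tau>] g(2) by simp
    qed
    have ae: "AE t' in lebesgue_on J. \<forall>t\<in>J. t' < t \<longrightarrow>
        (norm_H D (u t))\<^sup>2 / 2 + \<nu> * (\<integral>s. (norm_V D (u s))\<^sup>2 \<partial>lebesgue_on {t'..t})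
          \<le> (norm_H D (u t'))\<^sup>2 / 2 + (\<integral>s. inner_H D f (u s) \<partial>lebesgue_on {t'..t})" using W by blast
    show "AE t' in lebesgue_on {t. t + \<tau> \<in> J}. \<forall>t\<in>{t. t + \<tau> \<in> J}. t' < t \<longrightarrow>
        (norm_H D (u (t + \<tau>)))\<^sup>2 / 2 + \<nu> * (\<integral>s. (norm_V D (u (s + \<tau>)))\<^sup>2 \<partial>lebesgue_on {t'..t})
          \<le> (norm_H D (u (t' + \<tau>)))\<^sup>2 / 2 + (\<integral>s. inner_H D f (u (s + \<tau>)) \<partial>lebesgue_on {t'..t})"
    proof (rule AE_mp[OF AE_shift[OF JL ae]], rule AE_I2, intro impI ballI)
      fix t' t assume t': "t' \<in> space (lebesgue_on {t. t + \<tau> \<in> J})" and t: "t \<in> {t. t + \<tau> \<in> J}" "t' < t"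
        and e: "\<forall>t\<in>J. t' + \<tau> < t \<longrightarrow>
        (norm_H D (u t))\<^sup>2 / 2 + \<nu> * (\<integral>s. (norm_V D (u s))\<^sup>2 \<partial>lebesgue_on {t' + \<tau>..t})
          \<le> (norm_H D (u (t' + \<tau>)))\<^sup>2 / 2 + (\<integral>s. inner_H D f (u s) \<partial>lebesgue_on {t' + \<tau>..t})"
      have sub: "{t' + \<tau>..t + \<tau>} \<subseteq> J"
        using mem_is_interval_1_I[OF J, of "t' + \<tau>" "t + \<tau>"] t t' by (auto simp: space_restrict_space)
      have 1: "(\<integral>s. (norm_V D (u (s + \<tau>)))\<^sup>2 \<partial>lebesgue_on {t'..t}) = (\<integral>s. (norm_V D (u s))\<^sup>2 \<partial>lebesgue_on {t' + \<tau>..t + \<tau>})"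
      proof -
        have "integrable (lebesgue_on {t' + \<tau>..t + \<tau>}) (\<lambda>t. (norm_V D (u t))\<^sup>2)" using W sub by blast
        from integral_shift[OF IccL borel_measurable_integrable[OF this], of \<tau>] show ?thesis unfolding shift_Icc .
      qed
      have 2: "(\<integral>s. inner_H D f (u (s + \<tau>)) \<partial>lebesgue_on {t'..t}) = (\<integral>s. inner_H D f (u s) \<partial>lebesgue_on {t' + \<tau>..t + \<tau>})"
        using integral_shift[OF IccL m[OF sub], of \<tau>] unfolding shift_Icc .
      show "(norm_H D (u (t + \<tau>)))\<^sup>2 / 2 + \<nu> * (\<integral>s. (norm_V D (u (s + \<tau>)))\<^sup>2 \<partial>lebesgue_on {t'..t})
          \<le> (norm_H D (u (t' + \<tau>)))\<^sup>2 / 2 + (\<integral>s. inner_H D f (u (s + \<tau>)) \<partial>lebesgue_on {t'..t})"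
        unfolding 1 2 using e t by auto
    qed
  qed
qed

lemma continuous_on_f_inner:
  assumes "f \<in> Hspace D" "\<forall>t\<in>J. u t \<in> Hspace D" "\<forall>v\<in>Hspace D. continuous_on J (\<lambda>t. inner_H D (u t) v)"
  shows "continuous_on J (\<lambda>t. inner_H D f (u t))"
proof (rule continuous_on_eq)
  show "continuous_on J (\<lambda>t. inner_H D (u t) f)" using assms by blast
  show "inner_H D (u t) f = inner_H D f (u t)" if "t \<in> J" for t using assms that ip_sym by blast
qed

text \<open>A test function supported in \<open>J\<close> vanishes off \<open>J\<close> together
  with its derivative, so the equation tested on the line is the one tested on \<open>J\<close>; the
  other clauses are local.\<close>

lemma weak_solution_restrict:
  assumes ws: "weak_solution D \<nu> f UNIV u" and Jo: "open J"
  shows "weak_solution D \<nu> f J u"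
proof -
  have JL: "J \<in> sets lebesgue" using Jo by simp
  note W = weak_solutionD[OF ws]
  have leb: "lebesgue_on UNIV = (lebesgue :: real measure)" by (rule lebesgue_on_UNIV_eq)
  show ?thesis unfolding weak_solution_def
  proof (intro conjI)
    show "\<forall>t\<in>J. u t \<in> Hspace D" using W(1) by simp
    show "\<forall>v\<in>Hspace D. continuous_on J (\<lambda>t. inner_H D (u t) v)"
      using continuous_on_subset[OF W(2) subset_UNIV] by blast
    show "\<forall>a b. {a..b} \<subseteq> J \<longrightarrow> (\<exists>C. AE t in lebesgue_on {a..b}. norm_H D (u t) \<le> C)"
      using W(3)[OF subset_UNIV] by blast
    show "AE t in lebesgue_on J. u t \<in> Vspace D" by (rule AE_lebesgue_on_subset[OF _ JL subset_UNIV W(4)]) simp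
    show "AE t in lebesgue_on J. resid_dual_norm D \<nu> f (u t) < \<infinity>" by (rule AE_lebesgue_on_subset[OF _ JL subset_UNIV W(8)]) simp
    show "(\<lambda>t. norm_V D (u t)) \<in> borel_measurable (lebesgue_on J)" by (rule measurable_lebesgue_on_subset[OF W(5) subset_UNIV])
    show "(\<lambda>t. resid_dual_norm D \<nu> f (u t)) \<in> borel_measurable (lebesgue_on J)" by (rule measurable_lebesgue_on_subset[OF W(7) subset_UNIV])
    show "\<forall>a b. {a..b} \<subseteq> J \<longrightarrow> integrable (lebesgue_on {a..b}) (\<lambda>t. (norm_V D (u t))\<^sup>2)"
      using W(6)[OF subset_UNIV] by blast
    show "\<forall>a b. {a..b} \<subseteq> J \<longrightarrow> (\<integral>\<^sup>+ t. ennreal (enn2real (resid_dual_norm D \<nu> f (u t)) powr (4/3)) \<partial>lebesgue_on {a..b}) < \<infinity>"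
      using W(9)[OF subset_UNIV] by blast
    show "\<forall>v\<in>Vspace D. \<forall>\<phi>::real \<Rightarrow> real. smooth_on UNIV \<phi> \<and> compact (closure {t. \<phi> t \<noteq> 0}) \<and> closure {t. \<phi> t \<noteq> 0} \<subseteq> J \<longrightarrow>
        (let g = (\<lambda>t. - inner_H D (u t) v * deriv \<phi> t + (\<nu> * inner_V D (u t) v + trilin D (u t) (u t) v - inner_H D f v) * \<phi> t)
         in integrable (lebesgue_on J) g \<and> (\<integral>t. g t \<partial>lebesgue_on J) = 0)"
    proof (intro ballI allI impI, elim conjE)
      fix v and \<phi> :: "real \<Rightarrow> real"
      assume v: "v \<in> Vspace D" and \<phi>: "smooth_on UNIV \<phi>" "compact (closure {t. \<phi> t \<noteq> 0})" "closure {t. \<phi> t \<noteq> 0} \<subseteq> J"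
      define g where "g t = - inner_H D (u t) v * deriv \<phi> t + (\<nu> * inner_V D (u t) v + trilin D (u t) (u t) v - inner_H D f v) * \<phi> t" for t
      have g: "integrable lebesgue g" "(\<integral>t. g t \<partial>lebesgue) = 0"
        using W(10,11)[OF v \<phi>(1,2)] unfolding g_def leb by auto
      have z: "indicator J t * g t = g t" for t
      proof (cases "t \<in> J")
        case False
        then have "t \<notin> closure {t. \<phi> t \<noteq> 0}" using \<phi>(3) by blast
        then have z: "\<phi> t = 0" "deriv \<phi> t = 0" by (rule deriv_zero_outside_support)+
        show ?thesis unfolding g_def z by simp
      qed simp
      have "integrable (lebesgue_on J) g" "(\<integral>t. g t \<partial>lebesgue_on J) = 0"
        using g by (simp_all add: integrable_lebesgue_on_iff[OF JL] integral_lebesgue_on_eq[OF JL] z)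
      then show "let g = (\<lambda>t. - inner_H D (u t) v * deriv \<phi> t + (\<nu> * inner_V D (u t) v + trilin D (u t) (u t) v - inner_H D f v) * \<phi> t)
         in integrable (lebesgue_on J) g \<and> (\<integral>t. g t \<partial>lebesgue_on J) = 0"
        unfolding Let_def g_def by simp
    qed
    have ae: "AE t' in lebesgue_on UNIV. \<forall>t\<in>UNIV. t' < t \<longrightarrow>
        (norm_H D (u t))\<^sup>2 / 2 + \<nu> * (\<integral>s. (norm_V D (u s))\<^sup>2 \<partial>lebesgue_on {t'..t})
          \<le> (norm_H D (u t'))\<^sup>2 / 2 + (\<integral>s. inner_H D f (u s) \<partial>lebesgue_on {t'..t})"
      using W(12) .
    from AE_lebesgue_on_subset[OF _ JL subset_UNIV ae]
    show "AE t' in lebesgue_on J. \<forall>t\<in>J. t' < t \<longrightarrow>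
        (norm_H D (u t))\<^sup>2 / 2 + \<nu> * (\<integral>s. (norm_V D (u s))\<^sup>2 \<partial>lebesgue_on {t'..t})
          \<le> (norm_H D (u t'))\<^sup>2 / 2 + (\<integral>s. inner_H D f (u s) \<partial>lebesgue_on {t'..t})"
      by (auto elim!: eventually_mono)
  qed
qed

end

section \<open>The equation on a closed interval\<close>

text \<open>\<open>K n\<close> has height of order n, vanishes beyond distance 1/n from
  \<open>c\<close> and has mass 1 on the interval. The point \<open>c\<close> may be an end of the
  interval, with the whole mass on one side; this is how boundary values are produced.\<close>

lemma integral_delta_limit:
  fixes z :: "real \<Rightarrow> real" and K :: "nat \<Rightarrow> real \<Rightarrow> real"
  assumes ab: "a < b" and c: "c \<in> {a..b}" and z: "continuous_on {a..b} z"
    and K: "\<And>n. continuous_on {a..b} (K n)" "\<And>n t. \<bar>K n t\<bar> \<le> C * real n" "\<And>n t. 1 < real n * \<bar>t - c\<bar> \<Longrightarrow> K n t = 0"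
    and one: "\<forall>\<^sub>F n in sequentially. (\<integral>t. K n t \<partial>lebesgue_on {a..b}) = 1"
  shows "(\<lambda>n. \<integral>t. z t * K n t \<partial>lebesgue_on {a..b}) \<longlonglongrightarrow> z c"
proof (rule tendstoI)
  fix e :: real assume e: "e > 0"
  have C0: "C \<ge> 0" using K(2)[of 1 a] by (simp add: order_trans[OF abs_ge_zero])
  \<comment> \<open>The support has length at most 2/n and the kernel height at most C n, so the
    error is at most \<open>2 * e' * C < e\<close>.\<close>
  define e' where "e' = e / (4 * (C + 1))"
  have e': "e' > 0" unfolding e'_def using e C0 by simp
  obtain d where d: "d > 0" "\<And>t. t \<in> {a..b} \<Longrightarrow> dist t c < d \<Longrightarrow> dist (z t) (z c) < e'"
    using z c e' unfolding continuous_on_iff by meson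
  have "\<forall>\<^sub>F n in sequentially. real n > max 1 (1 / d)" by (rule filterlim_at_top_dense[THEN iffD1, rule_format, OF filterlim_real_sequentially])
  then show "\<forall>\<^sub>F n in sequentially. dist (\<integral>t. z t * K n t \<partial>lebesgue_on {a..b}) (z c) < e"
    using one
  proof eventually_elim
    case (elim n)
    have IL: "{a..b} \<in> sets lebesgue" by simp
    have fe: "(\<lambda>t. indicator {a..b} t * (indicator X t * k)) = (\<lambda>t. indicator (X \<inter> {a..b}) t * k)" for X and k :: real
      by (auto simp: indicator_def fun_eq_iff)
    have n: "real n > 0" "1 < real n * d" using elim d(1) by (auto simp: field_simps)
    have i1: "integrable (lebesgue_on {a..b}) (\<lambda>t. z t * K n t)" "integrable (lebesgue_on {a..b}) (K n)"
      by (auto intro!: continuous_imp_integrable_real continuous_intros z K)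
    have i2: "integrable (lebesgue_on {a..b}) (\<lambda>t. (z t - z c) * K n t)"
      by (auto intro!: continuous_imp_integrable_real continuous_intros z K)
    have "(\<integral>t. (z t - z c) * K n t \<partial>lebesgue_on {a..b}) = (\<integral>t. z t * K n t \<partial>lebesgue_on {a..b}) - z c"
      using elim i1 by (simp add: left_diff_distrib)
    then have "dist (\<integral>t. z t * K n t \<partial>lebesgue_on {a..b}) (z c) = \<bar>\<integral>t. (z t - z c) * K n t \<partial>lebesgue_on {a..b}\<bar>"
      by (simp add: dist_real_def)
    also have "\<dots> \<le> (\<integral>t. \<bar>(z t - z c) * K n t\<bar> \<partial>lebesgue_on {a..b})"
      using integral_norm_bound[of "lebesgue_on {a..b}" "\<lambda>t. (z t - z c) * K n t"] by simp
    also have "\<dots> \<le> (\<integral>t. indicator {c - 1 / real n..c + 1 / real n} t * (e' * (C * real n)) \<partial>lebesgue_on {a..b})"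
    proof (rule integral_mono)
      show "integrable (lebesgue_on {a..b}) (\<lambda>t. \<bar>(z t - z c) * K n t\<bar>)" using i2 by simp
      have m: "{c - 1 / real n..c + 1 / real n} \<inter> {a..b} \<in> lmeasurable" by (intro fmeasurable.Int) auto
      have "integrable lebesgue (\<lambda>t. indicator ({c - 1 / real n..c + 1 / real n} \<inter> {a..b}) t * (e' * (C * real n)))"
        using m by (intro integrable_mult_left integrable_real_indicator) (auto simp: fmeasurable_def)
      then show "integrable (lebesgue_on {a..b}) (\<lambda>t. indicator {c - 1 / real n..c + 1 / real n} t * (e' * (C * real n)))"
        by (simp only: integrable_lebesgue_on_iff[OF IL] fe)
      fix t assume "t \<in> space (lebesgue_on {a..b})"
      then have t: "t \<in> {a..b}" by simp
      show "\<bar>(z t - z c) * K n t\<bar> \<le> indicator {c - 1 / real n..c + 1 / real n} t * (e' * (C * real n))"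
      proof (cases "1 < real n * \<bar>t - c\<bar>")
        case True
        then show ?thesis using K(3)[OF True] e' C0 by (auto simp: indicator_def)
      next
        case False
        then have le: "real n * \<bar>t - c\<bar> \<le> 1" by simp
        then have "\<bar>t - c\<bar> \<le> 1 / real n" using n(1) by (simp add: field_simps)
        then have ind: "t \<in> {c - 1 / real n..c + 1 / real n}" by auto
        have "real n * \<bar>t - c\<bar> < real n * d" using le n(2) by linarith
        then have "dist t c < d" using n(1) by (simp add: dist_real_def)
        then have "\<bar>z t - z c\<bar> \<le> e'" using d(2)[OF t] by (simp add: dist_real_def)
        then have "\<bar>z t - z c\<bar> * \<bar>K n t\<bar> \<le> e' * (C * real n)" using K(2) e' by (intro mult_mono) auto
        then show ?thesis using ind by (simp add: abs_mult)
      qed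
    qed
    also have "\<dots> = measure lebesgue ({c - 1 / real n..c + 1 / real n} \<inter> {a..b}) * (e' * (C * real n))"
    proof -
      have "(\<integral>t. indicator {c - 1 / real n..c + 1 / real n} t * (e' * (C * real n)) \<partial>lebesgue_on {a..b})
        = (\<integral>t. indicator ({c - 1 / real n..c + 1 / real n} \<inter> {a..b}) t * (e' * (C * real n)) \<partial>lebesgue)"
        by (simp only: integral_lebesgue_on_eq[OF IL] fe)
      also have "\<dots> = measure lebesgue ({c - 1 / real n..c + 1 / real n} \<inter> {a..b}) * (e' * (C * real n))"
        by simp
      finally show ?thesis .
    qed
    also have "\<dots> \<le> (2 / real n) * (e' * (C * real n))"
    proof (rule mult_right_mono)
      have "measure lebesgue ({c - 1 / real n..c + 1 / real n} \<inter> {a..b}) \<le> measure lebesgue {c - 1 / real n..c + 1 / real n}"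
        by (intro measure_mono_fmeasurable) auto
      also have "\<dots> = 2 / real n" using n(1) by simp
      finally show "measure lebesgue ({c - 1 / real n..c + 1 / real n} \<inter> {a..b}) \<le> 2 / real n" .
    qed (use e' C0 in simp)
    also have "\<dots> = 2 * e' * C" using n(1) by simp
    also have "\<dots> < e" unfolding e'_def using e C0 by (simp add: field_simps add_pos_nonneg)
    finally show ?case .
  qed
qed

lemma deriv_smooth_step_zero: "x < 0 \<or> 1 < x \<Longrightarrow> deriv smooth_step x = 0"
proof (elim disjE)
  assume x: "x < 0"
  have "((\<lambda>x. 0) has_real_derivative 0) (at x)" by simp
  then have "(smooth_step has_real_derivative 0) (at x)"
    by (rule has_field_derivative_transform_within_open[of _ _ _ "{..<0}"]) (use x in \<open>auto simp: smooth_step_0\<close>)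
  then show ?thesis by (rule DERIV_imp_deriv)
next
  assume x: "1 < x"
  have "((\<lambda>x. 1) has_real_derivative 0) (at x)" by simp
  then have "(smooth_step has_real_derivative 0) (at x)"
    by (rule has_field_derivative_transform_within_open[of _ _ _ "{1<..}"]) (use x in \<open>auto simp: smooth_step_1\<close>)
  then show ?thesis by (rule DERIV_imp_deriv)
qed

lemma DERIV_smooth_step: "(smooth_step has_real_derivative deriv smooth_step x) (at x)"
  and continuous_deriv_smooth_step: "continuous_on UNIV (deriv smooth_step)"
  using smooth_on_real_has_derivative[of smooth_step] Ck_on_smooth_step unfolding smooth_on_def by blast+

lemma deriv_smooth_step_bound: obtains C where "C \<ge> 0" "\<And>x. \<bar>deriv smooth_step x\<bar> \<le> C"
proof -
  have "bounded (deriv smooth_step ` {0..1})"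
    by (intro compact_imp_bounded compact_continuous_image continuous_on_subset[OF continuous_deriv_smooth_step]) auto
  then obtain B where "\<forall>x\<in>{0..1}. \<bar>deriv smooth_step x\<bar> \<le> B" by (auto simp: bounded_iff)
  then have B: "\<bar>deriv smooth_step x\<bar> \<le> B" if "x \<in> {0..1}" for x using that by blast
  have "\<bar>deriv smooth_step x\<bar> \<le> max 0 B" for x
    using B[of x] deriv_smooth_step_zero[of x] by (cases "x \<in> {0..1}") auto
  then show ?thesis using that[of "max 0 B"] by simp
qed

text \<open>For positive \<open>n\<close> it is supported in [a, b] and equals 1 on
  [a + 1/n, b - 1/n]; the two ramps will turn into boundary terms.\<close>

definition cutoff :: "real \<Rightarrow> real \<Rightarrow> real \<Rightarrow> real \<Rightarrow> real" where
  "cutoff a b n t = smooth_step (n * (t - a)) * smooth_step (n * (b - t))"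

lemma smooth_cutoff: "smooth_on UNIV (cutoff a b n)"
proof -
  have "cutoff a b n = (\<lambda>t. smooth_step (n * t + (- n * a)) * smooth_step ((- n) * t + n * b))"
    by (auto simp: cutoff_def algebra_simps fun_eq_iff)
  then show ?thesis 
    using smooth_on_mult[OF smooth_on_smooth_step_affine[of n "- n * a"] smooth_on_smooth_step_affine[of "- n" "n * b"]] by (simp only:)
qed

lemma cutoff_bounds: "0 \<le> cutoff a b n t" "cutoff a b n t \<le> 1"
  unfolding cutoff_def using smooth_step_bounds by (auto intro!: mult_nonneg_nonneg mult_le_one)

lemma cutoff_support:
  assumes "n > 0"
  shows "closure {t. \<phi> t * cutoff a b n t \<noteq> 0} \<subseteq> {a..b}" "compact (closure {t. \<phi> t * cutoff a b n t \<noteq> 0})"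
proof -
  have "{t. \<phi> t * cutoff a b n t \<noteq> 0} \<subseteq> {a..b}"
  proof
    fix t assume "t \<in> {t. \<phi> t * cutoff a b n t \<noteq> 0}"
    then have "smooth_step (n * (t - a)) \<noteq> 0" "smooth_step (n * (b - t)) \<noteq> 0" by (auto simp: cutoff_def)
    then have "n * (t - a) > 0" "n * (b - t) > 0" using smooth_step_0 by (metis not_le)+
    then show "t \<in> {a..b}" using assms by (auto simp: zero_less_mult_iff)
  qed
  then show sub: "closure {t. \<phi> t * cutoff a b n t \<noteq> 0} \<subseteq> {a..b}" by (rule closure_minimal) simp
  then show "compact (closure {t. \<phi> t * cutoff a b n t \<noteq> 0})"
    by (meson bounded_closed_interval bounded_subset closed_closure compact_eq_bounded_closed)
qed

text \<open>Test with \<open>\<phi>\<close> times a cutoff of [a, b] and let the ramps steepen: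
  their derivatives are delta kernels at the two ends and leave boundary values there, since
  \<open>y\<close> is continuous.\<close>

lemma weak_derivative_on_interval:
  fixes y h \<phi> :: "real \<Rightarrow> real"
  assumes J: "open J" and ab: "a < b" "{a..b} \<subseteq> J" and y: "continuous_on J y"
    and test: "\<And>\<phi>. smooth_on UNIV \<phi> \<Longrightarrow> compact (closure {t. \<phi> t \<noteq> 0}) \<Longrightarrow> closure {t. \<phi> t \<noteq> 0} \<subseteq> J \<Longrightarrow>
      integrable (lebesgue_on J) (\<lambda>t. - y t * deriv \<phi> t + h t * \<phi> t) \<and>
      (\<integral>t. - y t * deriv \<phi> t + h t * \<phi> t \<partial>lebesgue_on J) = 0"
    and \<phi>: "smooth_on UNIV \<phi>"
  shows "integrable (lebesgue_on {a..b}) (\<lambda>t. - y t * deriv \<phi> t + h t * \<phi> t)"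
    and "(\<integral>t. - y t * deriv \<phi> t + h t * \<phi> t \<partial>lebesgue_on {a..b}) = y a * \<phi> a - y b * \<phi> b"
proof -
  have JL: "J \<in> sets lebesgue" using J by simp
  have IL: "{a..b} \<in> sets lebesgue" by simp
  have yc: "continuous_on {a..b} y" using y ab(2) continuous_on_subset by blast
  have dc: "continuous_on {a..b} (deriv \<psi>)" if "smooth_on UNIV \<psi>" for \<psi> :: "real \<Rightarrow> real"
    using smooth_on_real_has_derivative(2)[OF that] continuous_on_subset by blast
  have sc: "continuous_on {a..b} \<psi>" if "smooth_on UNIV \<psi>" for \<psi> :: "real \<Rightarrow> real"
    using smooth_on_continuous[OF that] continuous_on_subset by blast
  \<comment> \<open>A cutoff equal to 1 on [a, b] and supported in a slightly larger interval inside
    \<open>J\<close> isolates \<open>h\<close> in the tested integrand; the other term is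
    continuous.\<close>
  have hint: "integrable (lebesgue_on {a..b}) h"
  proof -
    obtain d1 where d1: "d1 > 0" "ball a d1 \<subseteq> J" using J ab open_contains_ball by (metis atLeastAtMost_iff less_imp_le order_refl subsetD)
    obtain d2 where d2: "d2 > 0" "ball b d2 \<subseteq> J" using J ab open_contains_ball by (metis atLeastAtMost_iff less_imp_le order_refl subsetD)
    define d where "d = min d1 d2 / 2"
    have d: "d > 0" "d < d1" "d < d2" unfolding d_def using d1 d2 by auto
    have sub: "{a - d..b + d} \<subseteq> J"
    proof
      fix t assume t: "t \<in> {a - d..b + d}"
      consider "t < a" | "t \<in> {a..b}" | "t > b" by force
      then show "t \<in> J"
      proof cases
        case 1 then have "t \<in> ball a d1" using t d by (auto simp: dist_real_def) then show ?thesis using d1 by blast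
      next
        case 2 then show ?thesis using ab by blast
      next
        case 3 then have "t \<in> ball b d2" using t d by (auto simp: dist_real_def) then show ?thesis using d2 by blast
      qed
    qed
    let ?c = "cutoff (a - d) (b + d) (1 / d)"
    have c1: "?c t = 1" if "t \<in> {a..b}" for t
    proof -
      have "smooth_step (1 / d * (t - (a - d))) = 1" "smooth_step (1 / d * (b + d - t)) = 1"
        by (rule smooth_step_1; use that d in \<open>simp add: field_simps\<close>)+
      then show ?thesis by (simp add: cutoff_def)
    qed
    have supp: "closure {t. ?c t \<noteq> 0} \<subseteq> {a - d..b + d}" "compact (closure {t. ?c t \<noteq> 0})"
      using cutoff_support[of "1 / d" "\<lambda>_. 1" "a - d" "b + d"] d by auto
    have "integrable (lebesgue_on J) (\<lambda>t. - y t * deriv ?c t + h t * ?c t)"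
      using test[OF smooth_cutoff supp(2)] supp(1) sub by blast
    then have "integrable (lebesgue_on {a..b}) (\<lambda>t. - y t * deriv ?c t + h t * ?c t)"
      by (rule integrable_lebesgue_on_subset[OF _ ab(2) JL IL])
    moreover have "integrable (lebesgue_on {a..b}) (\<lambda>t. y t * deriv ?c t)"
      by (intro continuous_imp_integrable_real continuous_on_mult yc dc smooth_cutoff)
    ultimately have "integrable (lebesgue_on {a..b}) (\<lambda>t. (- y t * deriv ?c t + h t * ?c t) + y t * deriv ?c t)"
      by (rule Bochner_Integration.integrable_add)
    then show ?thesis
      by (rule Bochner_Integration.integrable_cong[THEN iffD1, OF refl, rotated]) (use c1 in auto)
  qed
  have hm[measurable]: "h \<in> borel_measurable (lebesgue_on {a..b})" using hint by simp
  have hphi: "integrable (lebesgue_on {a..b}) (\<lambda>t. h t * \<psi> t)" if \<psi>: "continuous_on {a..b} \<psi>" for \<psi>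
  proof -
    have "bounded (\<psi> ` {a..b})" using \<psi> by (intro compact_imp_bounded compact_continuous_image) auto
    then obtain B where "\<forall>t\<in>{a..b}. \<bar>\<psi> t\<bar> \<le> B" by (auto simp: bounded_iff)
    then have B: "\<bar>\<psi> t\<bar> \<le> B" if "t \<in> {a..b}" for t using that by blast
    have [measurable]: "\<psi> \<in> borel_measurable (lebesgue_on {a..b})"
      using borel_measurable_integrable[OF continuous_imp_integrable_real[OF \<psi>]] .
    show ?thesis
    proof (rule Bochner_Integration.integrable_bound)
      show "integrable (lebesgue_on {a..b}) (\<lambda>t. B * h t)" using hint by simp
      show "AE t in lebesgue_on {a..b}. norm (h t * \<psi> t) \<le> norm (B * h t)"
      proof (rule AE_I2)
        fix t assume "t \<in> space (lebesgue_on {a..b})"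
        then have "\<bar>\<psi> t\<bar> \<le> \<bar>B\<bar>" using B[of t] by auto
        then have "\<bar>\<psi> t\<bar> * \<bar>h t\<bar> \<le> \<bar>B\<bar> * \<bar>h t\<bar>" by (rule mult_right_mono) simp
        then show "norm (h t * \<psi> t) \<le> norm (B * h t)" by (simp add: abs_mult mult.commute)
      qed
    qed measurable
  qed
  let ?G = "\<lambda>t. - y t * deriv \<phi> t + h t * \<phi> t"
  show Gint: "integrable (lebesgue_on {a..b}) ?G"
    using dc[OF \<phi>] sc[OF \<phi>] yc by (intro Bochner_Integration.integrable_add hphi continuous_imp_integrable_real continuous_intros) auto
  define S' where "S' = deriv smooth_step"
  obtain C where C: "C \<ge> 0" "\<And>x. \<bar>S' x\<bar> \<le> C" unfolding S'_def using deriv_smooth_step_bound by blast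
  define K1 where "K1 n t = real n * S' (real n * (t - a))" for n :: nat and t
  define K2 where "K2 n t = real n * S' (real n * (b - t))" for n :: nat and t
  let ?c = "\<lambda>n. cutoff a b (real n)"
  have dS1: "((\<lambda>t. smooth_step (real n * (t - a))) has_real_derivative S' (real n * (t - a)) * real n) (at t)" for n t
    unfolding S'_def by (rule DERIV_chain2[OF DERIV_smooth_step]) (auto intro!: derivative_eq_intros)
  have dS2: "((\<lambda>t. smooth_step (real n * (b - t))) has_real_derivative S' (real n * (b - t)) * (- real n)) (at t)" for n t
    unfolding S'_def by (rule DERIV_chain2[OF DERIV_smooth_step]) (auto intro!: derivative_eq_intros)
  have dcut: "(?c n has_real_derivative (K1 n t * smooth_step (real n * (b - t)) - smooth_step (real n * (t - a)) * K2 n t)) (at t)" for n t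
    unfolding cutoff_def[abs_def] K1_def K2_def using DERIV_mult[OF dS1[of n t] dS2[of n t]]
    by (simp add: algebra_simps)
  define z where "z t = y t * \<phi> t" for t
  have zc: "continuous_on {a..b} z" unfolding z_def by (intro continuous_on_mult yc sc[OF \<phi>])
  have S'c: "continuous_on UNIV S'" unfolding S'_def by (rule continuous_deriv_smooth_step)
  have Kc: "continuous_on {a..b} (K1 n)" "continuous_on {a..b} (K2 n)" for n
    unfolding K1_def K2_def by (intro continuous_intros continuous_on_compose2[OF S'c]; auto)+
  have key: "\<forall>\<^sub>F n in sequentially. (\<integral>t. ?G t * ?c n t \<partial>lebesgue_on {a..b}) = (\<integral>t. z t * K1 n t \<partial>lebesgue_on {a..b}) - (\<integral>t. z t * K2 n t \<partial>lebesgue_on {a..b})"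
    and big: "\<forall>\<^sub>F n in sequentially. 2 \<le> real n * (b - a)"
  proof -
    have "\<forall>\<^sub>F n in sequentially. real n > max 1 (2 / (b - a))" by (rule filterlim_at_top_dense[THEN iffD1, rule_format, OF filterlim_real_sequentially])
    then have ev: "\<forall>\<^sub>F n in sequentially. real n > 0 \<and> 2 \<le> real n * (b - a)"
    proof eventually_elim
      case (elim n)
      then have "2 / (b - a) < real n" "0 < real n" by auto
      then show ?case using ab by (simp add: pos_divide_less_eq)
    qed
    then show "\<forall>\<^sub>F n in sequentially. 2 \<le> real n * (b - a)" by eventually_elim simp
    show "\<forall>\<^sub>F n in sequentially. (\<integral>t. ?G t * ?c n t \<partial>lebesgue_on {a..b}) = (\<integral>t. z t * K1 n t \<partial>lebesgue_on {a..b}) - (\<integral>t. z t * K2 n t \<partial>lebesgue_on {a..b})"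
      using ev
    proof eventually_elim
      case (elim n)
      then have n: "real n > 0" "2 \<le> real n * (b - a)" by auto
      define \<psi> where "\<psi> t = \<phi> t * ?c n t" for t
      have sm: "smooth_on UNIV \<psi>" unfolding \<psi>_def by (rule smooth_on_mult[OF \<phi> smooth_cutoff])
      have supp: "closure {t. \<psi> t \<noteq> 0} \<subseteq> {a..b}" "compact (closure {t. \<psi> t \<noteq> 0})"
        unfolding \<psi>_def using cutoff_support[OF n(1)] by auto
      let ?g = "\<lambda>t. - y t * deriv \<psi> t + h t * \<psi> t"
      have g: "integrable (lebesgue_on J) ?g" "(\<integral>t. ?g t \<partial>lebesgue_on J) = 0"
        using test[OF sm supp(2)] supp(1) ab by auto
      have zero: "indicator J t * ?g t = indicator {a..b} t * ?g t" for t
      proof (cases "t \<in> {a..b}")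
        case True then show ?thesis using ab by (auto simp: indicator_def)
      next
        case False
        then have "t \<notin> closure {t. \<psi> t \<noteq> 0}" using supp by blast
        then have "\<psi> t = 0" "deriv \<psi> t = 0" by (rule deriv_zero_outside_support)+
        then show ?thesis by simp
      qed
      have g0: "(\<integral>t. ?g t \<partial>lebesgue_on {a..b}) = 0"
        using g(2) unfolding integral_lebesgue_on_eq[OF JL] integral_lebesgue_on_eq[OF IL] zero .
      have dpsi: "deriv \<psi> t = deriv \<phi> t * ?c n t + \<phi> t * (K1 n t - K2 n t)" if t: "t \<in> {a..b}" for t
      proof -
        have "(\<psi> has_real_derivative deriv \<phi> t * ?c n t + (K1 n t * smooth_step (real n * (b - t)) - smooth_step (real n * (t - a)) * K2 n t) * \<phi> t) (at t)"
          unfolding \<psi>_def by (rule DERIV_mult[OF smooth_on_real_has_derivative(1)[OF \<phi>] dcut])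
        then have deq: "deriv \<psi> t = deriv \<phi> t * ?c n t + (K1 n t * smooth_step (real n * (b - t)) - smooth_step (real n * (t - a)) * K2 n t) * \<phi> t"
          by (rule DERIV_imp_deriv)
        have sum: "real n * (b - t) = real n * (b - a) - real n * (t - a)" by (simp add: algebra_simps)
        \<comment> \<open>For n (b - a) \<ge> 2 the ramps do not interfere: where \<open>K1\<close>
          does not vanish, the falling ramp is still 1. \<open>e2\<close> is the mirror
          image.\<close>
        have e1: "K1 n t * smooth_step (real n * (b - t)) = K1 n t"
        proof (cases "1 < real n * (t - a)")
          case True then show ?thesis unfolding K1_def S'_def by (simp add: deriv_smooth_step_zero)
        next
          case False
          then have "1 \<le> real n * (b - t)" using sum n by linarith
          then show ?thesis by (simp add: smooth_step_1)
        qed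
        have e2: "smooth_step (real n * (t - a)) * K2 n t = K2 n t"
        proof (cases "1 < real n * (b - t)")
          case True then show ?thesis unfolding K2_def S'_def by (simp add: deriv_smooth_step_zero)
        next
          case False
          then have "1 \<le> real n * (t - a)" using sum n by linarith
          then show ?thesis by (simp add: smooth_step_1)
        qed
        show ?thesis unfolding deq e1 e2 by (simp add: algebra_simps)
      qed
      have i1: "integrable (lebesgue_on {a..b}) (\<lambda>t. ?G t * ?c n t)"
      proof -
        have "integrable (lebesgue_on {a..b}) (\<lambda>t. - y t * deriv \<phi> t * ?c n t + h t * (\<phi> t * ?c n t))"
          using dc[OF \<phi>] sc[OF \<phi>] sc[OF smooth_cutoff] yc
          by (intro Bochner_Integration.integrable_add hphi continuous_imp_integrable_real continuous_intros) auto
        then show ?thesis by (simp add: algebra_simps)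
      qed
      have i2: "integrable (lebesgue_on {a..b}) (\<lambda>t. z t * K1 n t)" "integrable (lebesgue_on {a..b}) (\<lambda>t. z t * K2 n t)"
        by (intro continuous_imp_integrable_real continuous_on_mult zc Kc)+
      have "(\<integral>t. ?g t \<partial>lebesgue_on {a..b}) = (\<integral>t. ?G t * ?c n t - (z t * K1 n t - z t * K2 n t) \<partial>lebesgue_on {a..b})"
        by (rule Bochner_Integration.integral_cong[OF refl]) (simp add: dpsi \<psi>_def z_def algebra_simps)
      also have "\<dots> = (\<integral>t. ?G t * ?c n t \<partial>lebesgue_on {a..b}) - ((\<integral>t. z t * K1 n t \<partial>lebesgue_on {a..b}) - (\<integral>t. z t * K2 n t \<partial>lebesgue_on {a..b}))"
        using i1 i2 by (simp add: Bochner_Integration.integral_diff)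
      finally show ?case using g0 by simp
    qed
  qed
  have L1: "(\<lambda>n. \<integral>t. ?G t * ?c n t \<partial>lebesgue_on {a..b}) \<longlonglongrightarrow> (\<integral>t. ?G t \<partial>lebesgue_on {a..b})"
  proof (rule integral_dominated_convergence[where w="\<lambda>t. \<bar>?G t\<bar>"])
    have cm: "?c n \<in> borel_measurable (lebesgue_on {a..b})" for n
      using borel_measurable_integrable[OF continuous_imp_integrable_real[OF sc[OF smooth_cutoff]]] .
    have Gm: "?G \<in> borel_measurable (lebesgue_on {a..b})" using borel_measurable_integrable[OF Gint] .
    show "?G \<in> borel_measurable (lebesgue_on {a..b})" by (rule Gm)
    show "(\<lambda>t. ?G t * ?c n t) \<in> borel_measurable (lebesgue_on {a..b})" for n
      by (rule borel_measurable_times[OF Gm cm])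
    show "integrable (lebesgue_on {a..b}) (\<lambda>t. \<bar>?G t\<bar>)" using Gint by (rule integrable_abs)
    show "AE t in lebesgue_on {a..b}. norm (?G t * ?c n t) \<le> \<bar>?G t\<bar>" for n
      using cutoff_bounds[of a b "real n"] by (intro AE_I2) (simp only: real_norm_def abs_mult, rule mult_right_le_one_le, auto)
    have "AE t in lebesgue. t \<noteq> a \<and> t \<noteq> b" using AE_lborel_singleton[of a] AE_lborel_singleton[of b] by (intro AE_completion) (auto elim: eventually_elim2)
    then have "AE t in lebesgue_on {a..b}. t \<noteq> a \<and> t \<noteq> b" unfolding AE_lebesgue_on_iff[OF IL] by (rule eventually_mono) simp
    then show "AE t in lebesgue_on {a..b}. (\<lambda>n. ?G t * ?c n t) \<longlonglongrightarrow> ?G t"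
    proof (rule AE_mp, intro AE_I2 impI)
      fix t assume "t \<in> space (lebesgue_on {a..b})" "t \<noteq> a \<and> t \<noteq> b"
      then have t: "a < t" "t < b" by auto
      have "\<forall>\<^sub>F n in sequentially. real n > max (1 / (t - a)) (1 / (b - t))" by (rule filterlim_at_top_dense[THEN iffD1, rule_format, OF filterlim_real_sequentially])
      then have "\<forall>\<^sub>F n in sequentially. ?c n t = 1"
      proof eventually_elim
        case (elim n)
        then have "1 / (t - a) < real n" "1 / (b - t) < real n" by auto
        then have "1 \<le> real n * (t - a)" "1 \<le> real n * (b - t)" using t by (auto simp: pos_divide_less_eq)
        then show ?case by (simp add: cutoff_def smooth_step_1)
      qed
      then have "(\<lambda>n. ?c n t) \<longlonglongrightarrow> 1" by (rule tendsto_eventually)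
      from tendsto_mult[OF tendsto_const this] show "(\<lambda>n. ?G t * ?c n t) \<longlonglongrightarrow> ?G t" by simp
    qed
  qed
  have FTC: "(\<integral>t. g' t \<partial>lebesgue_on {a..b}) = g b - g a"
    if "\<And>t. (g has_real_derivative g' t) (at t)" "continuous_on {a..b} g'" for g g' :: "real \<Rightarrow> real"
  proof -
    have "(g' has_integral (g b - g a)) {a..b}"
      using that(1) ab by (intro fundamental_theorem_of_calculus) (auto simp: has_real_derivative_iff_has_vector_derivative[symmetric] intro: has_field_derivative_at_within)
    then show ?thesis
      using lebesgue_integral_eq_integral[OF continuous_imp_integrable_real[OF that(2)]] by (simp add: integral_unique)
  qed
  have L2: "(\<lambda>n. \<integral>t. z t * K1 n t \<partial>lebesgue_on {a..b}) \<longlonglongrightarrow> z a"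
  proof (rule integral_delta_limit[OF ab(1) _ zc Kc(1), where C=C])
    show "\<bar>K1 n t\<bar> \<le> C * real n" for n t 
      unfolding K1_def abs_mult using mult_left_mono[OF C(2)[of "real n * (t - a)"], of "real n"] by (simp add: mult.commute)
    show "K1 n t = 0" if "1 < real n * \<bar>t - a\<bar>" for n t
    proof -
      have "real n * (t - a) < 0 \<or> 1 < real n * (t - a)" using that by (cases "t \<ge> a") (auto simp: abs_if algebra_simps)
      then show ?thesis unfolding K1_def S'_def by (simp add: deriv_smooth_step_zero)
    qed
    show "\<forall>\<^sub>F n in sequentially. (\<integral>t. K1 n t \<partial>lebesgue_on {a..b}) = 1"
      using big
    proof eventually_elim
      case (elim n)
      have "(\<integral>t. K1 n t \<partial>lebesgue_on {a..b}) = smooth_step (real n * (b - a)) - smooth_step (real n * (a - a))"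
      proof (rule FTC[OF _ Kc(1)])
        show "((\<lambda>t. smooth_step (real n * (t - a))) has_real_derivative K1 n t) (at t)" for t
          unfolding K1_def using dS1 by (simp add: mult.commute)
      qed
      then show ?case using elim by (simp add: smooth_step_0 smooth_step_1)
    qed
  qed (use ab in auto)
  have L3: "(\<lambda>n. \<integral>t. z t * K2 n t \<partial>lebesgue_on {a..b}) \<longlonglongrightarrow> z b"
  proof (rule integral_delta_limit[OF ab(1) _ zc Kc(2), where C=C])
    show "\<bar>K2 n t\<bar> \<le> C * real n" for n t 
      unfolding K2_def abs_mult using mult_left_mono[OF C(2)[of "real n * (b - t)"], of "real n"] by (simp add: mult.commute)
    show "K2 n t = 0" if "1 < real n * \<bar>t - b\<bar>" for n t
    proof -
      have "real n * (b - t) < 0 \<or> 1 < real n * (b - t)" 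
      proof (cases "t \<le> b")
        case True then show ?thesis using that by simp
      next
        case False
        then have "real n * (b - t) = - (real n * \<bar>t - b\<bar>)" by (simp add: algebra_simps)
        then show ?thesis using that by simp
      qed
      then show ?thesis unfolding K2_def S'_def by (simp add: deriv_smooth_step_zero)
    qed
    show "\<forall>\<^sub>F n in sequentially. (\<integral>t. K2 n t \<partial>lebesgue_on {a..b}) = 1"
      using big
    proof eventually_elim
      case (elim n)
      have "(\<integral>t. K2 n t \<partial>lebesgue_on {a..b}) = - smooth_step (real n * (b - b)) - (- smooth_step (real n * (b - a)))"
      proof (rule FTC[OF _ Kc(2)])
        show "((\<lambda>t. - smooth_step (real n * (b - t))) has_real_derivative K2 n t) (at t)" for t
          unfolding K2_def using DERIV_minus[OF dS2, of n t] by (simp add: mult.commute)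
      qed
      then show ?case using elim by (simp add: smooth_step_0 smooth_step_1)
    qed
  qed (use ab in auto)
  have "(\<lambda>n. (\<integral>t. z t * K1 n t \<partial>lebesgue_on {a..b}) - (\<integral>t. z t * K2 n t \<partial>lebesgue_on {a..b})) \<longlonglongrightarrow> z a - z b"
    by (rule tendsto_diff[OF L2 L3])
  then have "(\<lambda>n. \<integral>t. ?G t * ?c n t \<partial>lebesgue_on {a..b}) \<longlonglongrightarrow> z a - z b"
    by (rule Lim_transform_eventually) (use key in \<open>auto elim!: eventually_mono\<close>)
  from LIMSEQ_unique[OF L1 this] show "(\<integral>t. ?G t \<partial>lebesgue_on {a..b}) = y a * \<phi> a - y b * \<phi> b"
    by (simp add: z_def)
qed

section \<open>Gluing weak solutions\<close>

lemma unit_cover: "t \<in> {real_of_int \<lfloor>t\<rfloor>..real_of_int \<lfloor>t\<rfloor> + 1}"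
  by (simp add: less_imp_le)

lemma integrable_unit_pieces:
  fixes g :: "real \<Rightarrow> real"
  assumes "\<And>k::int. integrable (lebesgue_on {real_of_int k..real_of_int k + 1}) g"
  shows "integrable (lebesgue_on {real_of_int m..real_of_int m + real n}) g"
    "(\<integral>t. g t \<partial>lebesgue_on {real_of_int m..real_of_int m + real n}) = (\<Sum>i<n. \<integral>t. g t \<partial>lebesgue_on {real_of_int (m + int i)..real_of_int (m + int i) + 1})"
proof -
  have "integrable (lebesgue_on {real_of_int m..real_of_int m + real n}) g \<and>
    (\<integral>t. g t \<partial>lebesgue_on {real_of_int m..real_of_int m + real n}) = (\<Sum>i<n. \<integral>t. g t \<partial>lebesgue_on {real_of_int (m + int i)..real_of_int (m + int i) + 1})"
  proof (induction n)
    case 0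
    have IL: "{real_of_int m..real_of_int m + real 0} \<in> sets lebesgue" by simp
    have "integrable (lebesgue_on {real_of_int m..real_of_int m + real 0}) g"
      by (rule integrable_lebesgue_on_subset[OF assms[of m]]) auto
    moreover have "(\<integral>t. g t \<partial>lebesgue_on {real_of_int m..real_of_int m + real 0}) = 0"
    proof -
      have "AE t in lebesgue. t \<noteq> real_of_int m" by (intro AE_completion AE_lborel_singleton)
      then have "AE t in lebesgue. indicator {real_of_int m..real_of_int m + real 0} t * g t = 0"
        by eventually_elim (auto simp: indicator_def)
      then show ?thesis unfolding integral_lebesgue_on_eq[OF IL] by (rule integral_eq_zero_AE)
    qed
    ultimately show ?case by simp
  next
    case (Suc n)
    have e: "real_of_int m + real (Suc n) = real_of_int (m + int n) + 1" "real_of_int m + real n = real_of_int (m + int n)" by auto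
    note c = integral_lebesgue_on_combine[of "real_of_int m" "real_of_int (m + int n)" g "real_of_int (m + int n) + 1"]
    have 1: "integrable (lebesgue_on {real_of_int m..real_of_int (m + int n)}) g" using Suc unfolding e(2) by blast
    show ?case unfolding e(1) using c[OF 1 assms[of "m + int n"]] Suc unfolding e(2) by simp
  qed
  then show "integrable (lebesgue_on {real_of_int m..real_of_int m + real n}) g"
    "(\<integral>t. g t \<partial>lebesgue_on {real_of_int m..real_of_int m + real n}) = (\<Sum>i<n. \<integral>t. g t \<partial>lebesgue_on {real_of_int (m + int i)..real_of_int (m + int i) + 1})"
    by auto
qed

lemma integrable_from_unit_pieces:
  fixes g :: "real \<Rightarrow> real"
  assumes "\<And>k::int. integrable (lebesgue_on {real_of_int k..real_of_int k + 1}) g"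
  shows "integrable (lebesgue_on {a..b}) g"
proof -
  define m where "m = \<lfloor>a\<rfloor>"
  obtain n :: nat where n: "b - a + 1 \<le> real n" using real_arch_simple by blast
  have "{a..b} \<subseteq> {real_of_int m..real_of_int m + real n}"
  proof
    fix t assume t: "t \<in> {a..b}"
    have "real_of_int m \<le> a" "a < real_of_int m + 1" unfolding m_def by auto
    then show "t \<in> {real_of_int m..real_of_int m + real n}" using t n by auto
  qed
  then show ?thesis by (rule integrable_lebesgue_on_subset[OF integrable_unit_pieces(1)[OF assms]]) auto
qed

lemma AE_from_unit_pieces:
  assumes "\<And>k::int. AE t in lebesgue_on {real_of_int k..real_of_int k + 1}. P k t"
  shows "AE t in lebesgue. P \<lfloor>t\<rfloor> t"
proof -
  have "AE t in lebesgue. \<forall>k::int. t \<in> {real_of_int k..real_of_int k + 1} \<longrightarrow> P k t"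
    using assms by (subst AE_all_countable) (auto simp: AE_lebesgue_on_iff)
  then show ?thesis by eventually_elim (use unit_cover in blast)
qed

lemma measurable_from_unit_pieces:
  fixes g :: "real \<Rightarrow> 'b::topological_space"
  assumes "\<And>k::int. g \<in> borel_measurable (lebesgue_on {real_of_int k..real_of_int k + 1})"
  shows "g \<in> borel_measurable lebesgue"
proof (rule measurable_piecewise_restrict[where C="range (\<lambda>k::int. {real_of_int k..real_of_int k + 1})"])
  show "space lebesgue \<subseteq> \<Union> (range (\<lambda>k::int. {real_of_int k..real_of_int k + 1}))" using unit_cover by blast
qed (use assms in auto)

context ns_space
begin

definition energy_ineq :: "real \<Rightarrow> field \<Rightarrow> (real \<Rightarrow> field) \<Rightarrow> real \<Rightarrow> real \<Rightarrow> bool" where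
  "energy_ineq \<nu> f u s t \<longleftrightarrow> (norm_H D (u t))\<^sup>2 / 2 + \<nu> * (\<integral>r. (norm_V D (u r))\<^sup>2 \<partial>lebesgue_on {s..t})
     \<le> (norm_H D (u s))\<^sup>2 / 2 + (\<integral>r. inner_H D f (u r) \<partial>lebesgue_on {s..t})"

lemma energy_ineq_trans:
  assumes "energy_ineq \<nu> f u s r" "energy_ineq \<nu> f u r t" "s \<le> r" "r \<le> t"
    and "\<And>a b. integrable (lebesgue_on {a..b}) (\<lambda>r. (norm_V D (u r))\<^sup>2)" "\<And>a b. integrable (lebesgue_on {a..b}) (\<lambda>r. inner_H D f (u r))"
  shows "energy_ineq \<nu> f u s t"
  using assms(1,2) integral_lebesgue_on_combine(2)[OF assms(5,5) assms(3,4)] integral_lebesgue_on_combine(2)[OF assms(6,6) assms(3,4)]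
  unfolding energy_ineq_def by (simp add: algebra_simps)

lemma energy_ineq_cong:
  assumes "\<And>r. r \<in> {s..t} \<Longrightarrow> u r = w r" "s \<le> t"
  shows "energy_ineq \<nu> f u s t \<longleftrightarrow> energy_ineq \<nu> f w s t"
proof -
  have "(\<integral>r. (norm_V D (u r))\<^sup>2 \<partial>lebesgue_on {s..t}) = (\<integral>r. (norm_V D (w r))\<^sup>2 \<partial>lebesgue_on {s..t})"
    "(\<integral>r. inner_H D f (u r) \<partial>lebesgue_on {s..t}) = (\<integral>r. inner_H D f (w r) \<partial>lebesgue_on {s..t})"
    by (rule Bochner_Integration.integral_cong[OF refl], use assms in auto)+
  moreover have "u s = w s" "u t = w t" using assms by auto
  ultimately show ?thesis unfolding energy_ineq_def by simp
qed

text \<open>Each cell contributes to the tested equation the difference of boundary values at its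
  ends, and these telescope because \<open>u\<close> has one value at every integer. The energy
  inequality runs from almost every time to the end of its cell by the solution there, and then from
  integer to integer by \<open>en\<close>.\<close>

lemma weak_solution_glue:
  assumes f: "f \<in> Hspace D"
    and Jo: "\<And>k::int. open (J k)" and sub: "\<And>k. {real_of_int k..real_of_int k + 1} \<subseteq> J k"
    and ws: "\<And>k. weak_solution D \<nu> f (J k) (w k)"
    and eq: "\<And>k t. t \<in> {real_of_int k..real_of_int k + 1} \<Longrightarrow> u t = w k t"
    and en: "\<And>k t. t \<in> {real_of_int k<..real_of_int k + 1} \<Longrightarrow> energy_ineq \<nu> f (w k) (real_of_int k) t"
  shows "weak_solution D \<nu> f UNIV u"
proof -
  let ?K = "\<lambda>k::int. {real_of_int k..real_of_int k + 1}"
  note W = weak_solutionD[OF ws]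
  have KL: "?K k \<in> sets lebesgue" for k by simp
  have JL: "J k \<in> sets lebesgue" for k using Jo by simp
  have leb: "lebesgue_on UNIV = (lebesgue :: real measure)" by (rule lebesgue_on_UNIV_eq)
  have spc: "space (lebesgue_on S) = S" for S :: "real set" by (simp add: space_restrict_space)
  have uH: "u t \<in> Hspace D" for t
    using W(1)[of t "\<lfloor>t\<rfloor>"] sub[of "\<lfloor>t\<rfloor>"] eq[OF unit_cover[of t]] unit_cover[of t] by (metis subsetD)
  have cont: "continuous_on UNIV (\<lambda>t. inner_H D (u t) v)" if v: "v \<in> Hspace D" for v
  proof -
    have c: "continuous_on (?K k) (\<lambda>t. inner_H D (u t) v)" for k
      by (rule continuous_on_eq[OF continuous_on_subset[OF W(2)[OF v] sub]]) (simp add: eq)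
    have "isCont (\<lambda>t. inner_H D (u t) v) t" for t
    proof -
      define k where "k = \<lfloor>t\<rfloor>"
      have "continuous_on (?K (k - 1) \<union> ?K k) (\<lambda>t. inner_H D (u t) v)" by (intro continuous_on_closed_Un c) auto
      moreover have "?K (k - 1) \<union> ?K k = {real_of_int k - 1..real_of_int k + 1}" by auto
      ultimately have "continuous_on {real_of_int k - 1..real_of_int k + 1} (\<lambda>t. inner_H D (u t) v)" by simp
      moreover have "t \<in> interior {real_of_int k - 1..real_of_int k + 1}" unfolding k_def by (simp add: interior_atLeastAtMost_real) linarith
      ultimately show ?thesis by (rule continuous_on_interior)
    qed
    then show ?thesis by (simp add: continuous_at_imp_continuous_on)
  qed
  have nVi: "integrable (lebesgue_on {a..b}) (\<lambda>t. (norm_V D (u t))\<^sup>2)" for a b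
  proof (rule integrable_from_unit_pieces)
    fix k
    show "integrable (lebesgue_on (?K k)) (\<lambda>t. (norm_V D (u t))\<^sup>2)"
      by (rule Bochner_Integration.integrable_cong[THEN iffD1, OF refl _ W(6)[OF sub]]) (simp add: eq)
  qed
  have fui: "integrable (lebesgue_on {a..b}) (\<lambda>r. inner_H D f (u r))" for a b
    using continuous_on_f_inner[OF f, of UNIV u] uH cont by (intro continuous_imp_integrable_real) (auto intro: continuous_on_subset)
  have rm: "(\<lambda>t. resid_dual_norm D \<nu> f (u t)) \<in> borel_measurable lebesgue"
  proof (rule measurable_from_unit_pieces)
    fix k
    show "(\<lambda>t. resid_dual_norm D \<nu> f (u t)) \<in> borel_measurable (lebesgue_on (?K k))"
      by (rule measurable_cong[THEN iffD1, OF _ measurable_lebesgue_on_subset[OF W(7) sub]]) (simp add: eq)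
  qed
  show ?thesis unfolding weak_solution_def leb
  proof (intro conjI)
    show "\<forall>t\<in>UNIV. u t \<in> Hspace D" using uH by simp
    show "\<forall>v\<in>Hspace D. continuous_on UNIV (\<lambda>t. inner_H D (u t) v)" using cont by blast
    show "\<forall>a b. {a..b} \<subseteq> UNIV \<longrightarrow> (\<exists>C. AE t in lebesgue_on {a..b}. norm_H D (u t) \<le> C)"
    proof (intro allI impI)
      fix a b :: real
      have "\<forall>k. \<exists>C. AE t in lebesgue_on (?K k). norm_H D (w k t) \<le> C" using W(3)[OF sub] by blast
      then obtain C where C: "\<And>k. AE t in lebesgue_on (?K k). norm_H D (w k t) \<le> C k" by metis
      have "AE t in lebesgue_on (?K k). norm_H D (u t) \<le> C k" for k
        by (rule AE_mp[OF C AE_I2]) (simp add: eq)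
      then have *: "AE t in lebesgue. norm_H D (u t) \<le> C \<lfloor>t\<rfloor>" by (rule AE_from_unit_pieces)
      have "AE t in lebesgue. t \<in> {a..b} \<longrightarrow> norm_H D (u t) \<le> Max (C ` {\<lfloor>a\<rfloor>..\<lfloor>b\<rfloor>})"
        using *
      proof eventually_elim
        case (elim t)
        show ?case
        proof
          assume "t \<in> {a..b}"
          then have "\<lfloor>t\<rfloor> \<in> {\<lfloor>a\<rfloor>..\<lfloor>b\<rfloor>}" by (auto intro: floor_mono)
          then have "C \<lfloor>t\<rfloor> \<le> Max (C ` {\<lfloor>a\<rfloor>..\<lfloor>b\<rfloor>})" by (intro Max_ge) auto
          then show "norm_H D (u t) \<le> Max (C ` {\<lfloor>a\<rfloor>..\<lfloor>b\<rfloor>})" using elim by simp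
        qed
      qed
      then show "\<exists>C. AE t in lebesgue_on {a..b}. norm_H D (u t) \<le> C" by (auto simp: AE_lebesgue_on_iff)
    qed
    show "AE t in lebesgue. u t \<in> Vspace D"
    proof (rule AE_from_unit_pieces)
      fix k
      have "AE t in lebesgue_on (?K k). w k t \<in> Vspace D" by (rule AE_lebesgue_on_subset[OF JL KL sub W(4)])
      then show "AE t in lebesgue_on (?K k). u t \<in> Vspace D" by (rule AE_mp[OF _ AE_I2]) (simp add: eq)
    qed
    show "(\<lambda>t. norm_V D (u t)) \<in> borel_measurable lebesgue"
    proof (rule measurable_from_unit_pieces)
      fix k
      show "(\<lambda>t. norm_V D (u t)) \<in> borel_measurable (lebesgue_on (?K k))"
        by (rule measurable_cong[THEN iffD1, OF _ measurable_lebesgue_on_subset[OF W(5) sub]]) (simp add: eq)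
    qed
    show "\<forall>a b. {a..b} \<subseteq> UNIV \<longrightarrow> integrable (lebesgue_on {a..b}) (\<lambda>t. (norm_V D (u t))\<^sup>2)" using nVi by blast
    show "(\<lambda>t. resid_dual_norm D \<nu> f (u t)) \<in> borel_measurable lebesgue" by (rule rm)
    show "AE t in lebesgue. resid_dual_norm D \<nu> f (u t) < \<infinity>"
    proof (rule AE_from_unit_pieces)
      fix k
      have "AE t in lebesgue_on (?K k). resid_dual_norm D \<nu> f (w k t) < \<infinity>" by (rule AE_lebesgue_on_subset[OF JL KL sub W(8)])
      then show "AE t in lebesgue_on (?K k). resid_dual_norm D \<nu> f (u t) < \<infinity>" by (rule AE_mp[OF _ AE_I2]) (simp add: eq)
    qed
    show "\<forall>a b. {a..b} \<subseteq> UNIV \<longrightarrow> (\<integral>\<^sup>+ t. ennreal (enn2real (resid_dual_norm D \<nu> f (u t)) powr (4/3)) \<partial>lebesgue_on {a..b}) < \<infinity>"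
    proof (intro allI impI)
      fix a b :: real
      define F where "F t = ennreal (enn2real (resid_dual_norm D \<nu> f (u t)) powr (4/3))" for t
      have Fm[measurable]: "F \<in> borel_measurable lebesgue" unfolding F_def using rm by measurable
      have Fk: "(\<integral>\<^sup>+ t. F t * indicator (?K k) t \<partial>lebesgue) < \<infinity>" for k
      proof -
        have "(\<integral>\<^sup>+ t. F t * indicator (?K k) t \<partial>lebesgue) = (\<integral>\<^sup>+ t. F t \<partial>lebesgue_on (?K k))"
          by (rule nn_integral_restrict_space[symmetric]) simp
        also have "\<dots> = (\<integral>\<^sup>+ t. ennreal (enn2real (resid_dual_norm D \<nu> f (w k t)) powr (4/3)) \<partial>lebesgue_on (?K k))"
          by (intro nn_integral_cong) (simp add: F_def eq)
        finally show ?thesis using W(9)[OF sub] by simp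
      qed
      have "(\<integral>\<^sup>+ t. F t \<partial>lebesgue_on {a..b}) = (\<integral>\<^sup>+ t. F t * indicator {a..b} t \<partial>lebesgue)"
        by (rule nn_integral_restrict_space) simp
      also have "\<dots> \<le> (\<integral>\<^sup>+ t. (\<Sum>k\<in>{\<lfloor>a\<rfloor>..\<lfloor>b\<rfloor>}. F t * indicator (?K k) t) \<partial>lebesgue)"
      proof (rule nn_integral_mono)
        fix t
        show "F t * indicator {a..b} t \<le> (\<Sum>k\<in>{\<lfloor>a\<rfloor>..\<lfloor>b\<rfloor>}. F t * indicator (?K k) t)"
        proof (cases "t \<in> {a..b}")
          case True
          then have "\<lfloor>t\<rfloor> \<in> {\<lfloor>a\<rfloor>..\<lfloor>b\<rfloor>}" by (auto intro: floor_mono)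
          then have "F t * indicator (?K \<lfloor>t\<rfloor>) t \<le> (\<Sum>k\<in>{\<lfloor>a\<rfloor>..\<lfloor>b\<rfloor>}. F t * indicator (?K k) t)"
            by (intro member_le_sum) auto
          then show ?thesis using True unit_cover[of t] by simp
        qed simp
      qed
      also have "\<dots> = (\<Sum>k\<in>{\<lfloor>a\<rfloor>..\<lfloor>b\<rfloor>}. \<integral>\<^sup>+ t. F t * indicator (?K k) t \<partial>lebesgue)"
        by (rule nn_integral_sum) (auto intro!: borel_measurable_times_ennreal borel_measurable_indicator Fm)
      also have "\<dots> < \<infinity>" using Fk by (simp add: less_top[symmetric])
      finally show "(\<integral>\<^sup>+ t. ennreal (enn2real (resid_dual_norm D \<nu> f (u t)) powr (4/3)) \<partial>lebesgue_on {a..b}) < \<infinity>"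
        unfolding F_def .
    qed
    show "\<forall>v\<in>Vspace D. \<forall>\<phi>::real \<Rightarrow> real. smooth_on UNIV \<phi> \<and> compact (closure {t. \<phi> t \<noteq> 0}) \<and> closure {t. \<phi> t \<noteq> 0} \<subseteq> UNIV \<longrightarrow>
        (let g = (\<lambda>t. - inner_H D (u t) v * deriv \<phi> t + (\<nu> * inner_V D (u t) v + trilin D (u t) (u t) v - inner_H D f v) * \<phi> t)
         in integrable lebesgue g \<and> (\<integral>t. g t \<partial>lebesgue) = 0)"
    proof (intro ballI allI impI, elim conjE)
      fix v and \<phi> :: "real \<Rightarrow> real"
      assume v: "v \<in> Vspace D" and \<phi>: "smooth_on UNIV \<phi>" "compact (closure {t. \<phi> t \<noteq> 0})"
      have vH: "v \<in> Hspace D" using v Vspace_Hspace by auto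
      define g where "g t = - inner_H D (u t) v * deriv \<phi> t + (\<nu> * inner_V D (u t) v + trilin D (u t) (u t) v - inner_H D f v) * \<phi> t" for t
      have piece: "integrable (lebesgue_on (?K k)) g \<and> (\<integral>t. g t \<partial>lebesgue_on (?K k)) =
          inner_H D (u (real_of_int k)) v * \<phi> (real_of_int k) - inner_H D (u (real_of_int (k + 1))) v * \<phi> (real_of_int (k + 1))" for k
      proof -
        let ?y = "\<lambda>t. inner_H D (w k t) v" and ?h = "\<lambda>t. \<nu> * inner_V D (w k t) v + trilin D (w k t) (w k t) v - inner_H D f v"
        have ge: "g t = - ?y t * deriv \<phi> t + ?h t * \<phi> t" if "t \<in> ?K k" for t unfolding g_def eq[OF that] ..
        have lt: "real_of_int k < real_of_int k + 1" by simp
        have test: "integrable (lebesgue_on (J k)) (\<lambda>t. - ?y t * deriv \<psi> t + ?h t * \<psi> t) \<and> (\<integral>t. - ?y t * deriv \<psi> t + ?h t * \<psi> t \<partial>lebesgue_on (J k)) = 0"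
          if "smooth_on UNIV \<psi>" "compact (closure {t. \<psi> t \<noteq> 0})" "closure {t. \<psi> t \<noteq> 0} \<subseteq> J k" for \<psi>
          using W(10,11)[OF v that] by blast
        note wd = weak_derivative_on_interval[OF Jo lt sub W(2)[OF vH] test \<phi>(1)]
        have "integrable (lebesgue_on (?K k)) g"
          by (rule Bochner_Integration.integrable_cong[THEN iffD1, OF refl _ wd(1)]) (simp_all add: ge)
        moreover have "(\<integral>t. g t \<partial>lebesgue_on (?K k)) = (\<integral>t. - ?y t * deriv \<phi> t + ?h t * \<phi> t \<partial>lebesgue_on (?K k))"
          by (rule Bochner_Integration.integral_cong[OF refl]) (simp add: ge)
        ultimately show ?thesis using wd(2) eq[of "real_of_int k" k] eq[of "real_of_int k + 1" k] by simp
      qed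
      obtain B where B: "\<And>t. t \<in> closure {t. \<phi> t \<noteq> 0} \<Longrightarrow> \<bar>t\<bar> \<le> B" using compact_imp_bounded[OF \<phi>(2)] by (auto simp: bounded_iff)
      \<comment> \<open>From \<open>N\<close> on the test function vanishes, so the two boundary
        terms left by telescoping are zero.\<close>
      obtain N :: nat where N: "B < real N" using reals_Archimedean2 by blast
      have out: "t \<notin> closure {t. \<phi> t \<noteq> 0}" if "real N \<le> \<bar>t\<bar>" for t using B[of t] N that by force
      have z: "g t = 0" if "real N \<le> \<bar>t\<bar>" for t
        unfolding g_def deriv_zero_outside_support[OF out[OF that]] by simp
      let ?I = "{real_of_int (- int N)..real_of_int (- int N) + real (2 * N)}"
      have IL: "?I \<in> sets lebesgue" by simp
      have ind: "indicator ?I t * g t = g t" for t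
        using z[of t] by (cases "t \<in> ?I") auto
      have gi: "integrable (lebesgue_on ?I) g" and gs: "(\<integral>t. g t \<partial>lebesgue_on ?I) =
          (\<Sum>i<2 * N. \<integral>t. g t \<partial>lebesgue_on (?K (- int N + int i)))"
        using integrable_unit_pieces[of g "- int N" "2 * N"] piece by blast+
      define F where "F i = inner_H D (u (real_of_int (- int N + int i))) v * \<phi> (real_of_int (- int N + int i))" for i :: nat
      have pF: "(\<integral>t. g t \<partial>lebesgue_on (?K (- int N + int i))) = F i - F (Suc i)" for i
      proof -
        have e: "- int N + int (Suc i) = - int N + int i + 1" by simp
        show ?thesis unfolding F_def e using piece[of "- int N + int i"] by blast
      qed
      have "(\<integral>t. g t \<partial>lebesgue_on ?I) = (\<Sum>i<2 * N. F i - F (Suc i))" unfolding gs pF ..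
      also have "\<dots> = F 0 - F (2 * N)" by (rule sum_lessThan_telescope')
      also have "\<dots> = inner_H D (u (- real N)) v * \<phi> (- real N) - inner_H D (u (real N)) v * \<phi> (real N)"
        unfolding F_def by simp
      also have "\<dots> = 0" using deriv_zero_outside_support(1)[OF out[of "real N"]] deriv_zero_outside_support(1)[OF out[of "- real N"]] by simp
      finally have "integrable lebesgue g" "(\<integral>t. g t \<partial>lebesgue) = 0"
        using gi unfolding integrable_lebesgue_on_iff[OF IL] integral_lebesgue_on_eq[OF IL] ind by auto
      then show "let g = (\<lambda>t. - inner_H D (u t) v * deriv \<phi> t + (\<nu> * inner_V D (u t) v + trilin D (u t) (u t) v - inner_H D f v) * \<phi> t)
         in integrable lebesgue g \<and> (\<integral>t. g t \<partial>lebesgue) = 0"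
        unfolding g_def Let_def by simp
    qed
    have start: "energy_ineq \<nu> f u (real_of_int k) t" if "t \<in> {real_of_int k<..real_of_int k + 1}" for k t
      using en[OF that] energy_ineq_cong[of "real_of_int k" t u "w k" \<nu> f] eq that by auto
    have "AE t' in lebesgue. \<forall>t. t' < t \<and> t \<le> real_of_int \<lfloor>t'\<rfloor> + 1 \<longrightarrow> energy_ineq \<nu> f u t' t"
    proof (rule AE_from_unit_pieces)
      fix k
      have "AE t' in lebesgue_on (?K k). \<forall>t\<in>J k. t' < t \<longrightarrow> energy_ineq \<nu> f (w k) t' t"
        unfolding energy_ineq_def by (rule AE_lebesgue_on_subset[OF JL KL sub W(12)])
      then show "AE t' in lebesgue_on (?K k). \<forall>t. t' < t \<and> t \<le> real_of_int k + 1 \<longrightarrow> energy_ineq \<nu> f u t' t"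
      proof (rule AE_mp[OF _ AE_I2], intro impI allI, elim conjE)
        fix t' t assume t': "t' \<in> space (lebesgue_on (?K k))" and e: "\<forall>t\<in>J k. t' < t \<longrightarrow> energy_ineq \<nu> f (w k) t' t"
          and t: "t' < t" "t \<le> real_of_int k + 1"
        have tK: "r \<in> ?K k" if "r \<in> {t'..t}" for r using t' t that by auto
        then have "t \<in> J k" using sub t by force
        then have "energy_ineq \<nu> f (w k) t' t" using e t by blast
        then show "energy_ineq \<nu> f u t' t"
          using energy_ineq_cong[of t' t u "w k" \<nu> f] eq[OF tK] t by simp
      qed
    qed
    then show "AE t' in lebesgue. \<forall>t\<in>UNIV. t' < t \<longrightarrow>
        (norm_H D (u t))\<^sup>2 / 2 + \<nu> * (\<integral>s. (norm_V D (u s))\<^sup>2 \<partial>lebesgue_on {t'..t})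
          \<le> (norm_H D (u t'))\<^sup>2 / 2 + (\<integral>s. inner_H D f (u s) \<partial>lebesgue_on {t'..t})"
    proof eventually_elim
      case (elim t')
      define k where "k = \<lfloor>t'\<rfloor>"
      have k: "t' < real_of_int k + 1" unfolding k_def by linarith
      note tr = energy_ineq_trans[OF _ _ _ _ nVi fui]
      have step: "energy_ineq \<nu> f u t' (real_of_int k + 1 + real n)" for n
      proof (induction n)
        case 0 then show ?case using elim k unfolding k_def by simp
      next
        case (Suc n)
        have "energy_ineq \<nu> f u (real_of_int (k + 1 + int n)) (real_of_int (k + 1 + int n) + 1)" by (rule start) simp
        then have "energy_ineq \<nu> f u (real_of_int k + 1 + real n) (real_of_int k + 1 + real (Suc n))" by (simp add: add_ac)
        then show ?case using k by (intro tr[OF Suc]) auto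
      qed
      have "energy_ineq \<nu> f u t' t" if t: "t' < t" for t
      proof (cases "t \<le> real_of_int k + 1")
        case True then show ?thesis using elim t unfolding k_def by blast
      next
        case False
        \<comment> \<open>Chosen so that \<open>k + 1 + n\<close> is the last integer strictly
          before \<open>t\<close>; strictness matters because the cells in \<open>start\<close> are
          open on the left.\<close>
        define n where "n = nat (\<lceil>t\<rceil> - k - 2)"
        have n: "int n = \<lceil>t\<rceil> - k - 2" unfolding n_def using False by (simp add: le_ceiling_iff) linarith
        have "real n = real_of_int (\<lceil>t\<rceil> - k - 2)" using n by (metis of_int_of_nat_eq)
        then have r: "real_of_int k + 1 + real n = real_of_int (\<lceil>t\<rceil> - 1)" by simp
        have tc: "t \<in> {real_of_int (\<lceil>t\<rceil> - 1)<..real_of_int (\<lceil>t\<rceil> - 1) + 1}" by simp linarith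
        have "energy_ineq \<nu> f u t' (real_of_int (\<lceil>t\<rceil> - 1))" using step[of n] unfolding r .
        moreover have "t' \<le> real_of_int (\<lceil>t\<rceil> - 1)" using k r by linarith
        moreover have "real_of_int (\<lceil>t\<rceil> - 1) \<le> t" using tc by auto
        ultimately show ?thesis using tr[OF _ start[OF tc]] by blast
      qed
      then show ?case unfolding energy_ineq_def by blast
    qed
  qed
qed

end

section \<open>Strong continuity in the mean and the energy inequality from a given time\<close>

text \<open>Rounding the second variable down to a multiple of 1/n leaves a measurable function of
  the first variable on each of countably many slabs; continuity gives pointwise
  convergence.\<close>

lemma caratheodory_measurable:
  fixes g :: "'a \<Rightarrow> real \<Rightarrow> real"
  assumes m: "\<And>\<theta>. (\<lambda>u. g u \<theta>) \<in> borel_measurable M" and c: "\<And>u. u \<in> space M \<Longrightarrow> continuous_on UNIV (g u)"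
  shows "(\<lambda>x. g (fst x) (snd x)) \<in> borel_measurable (M \<Otimes>\<^sub>M borel)"
proof (rule borel_measurable_LIMSEQ_real)
  fix x :: "'a \<times> real" assume x: "x \<in> space (M \<Otimes>\<^sub>M borel)"
  let ?r = "\<lambda>n. real_of_int \<lfloor>real (Suc n) * snd x\<rfloor> / real (Suc n)"
  have "?r \<longlonglongrightarrow> snd x"
  proof (rule tendsto_sandwich)
    show "(\<lambda>n. snd x - 1 / real (Suc n)) \<longlonglongrightarrow> snd x" using tendsto_diff[OF tendsto_const LIMSEQ_Suc[OF lim_1_over_n]] by fastforce
    show "\<forall>\<^sub>F n in sequentially. snd x - 1 / real (Suc n) \<le> ?r n"
    proof (rule always_eventually, rule allI)
      fix n
      have "real (Suc n) * snd x - 1 \<le> real_of_int \<lfloor>real (Suc n) * snd x\<rfloor>" by linarith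
      then have "(real (Suc n) * snd x - 1) / real (Suc n) \<le> ?r n" by (rule divide_right_mono) simp
      then show "snd x - 1 / real (Suc n) \<le> ?r n" by (simp add: diff_divide_distrib)
    qed
    show "\<forall>\<^sub>F n in sequentially. ?r n \<le> snd x"
    proof (rule always_eventually, rule allI)
      fix n
      have "real_of_int \<lfloor>real (Suc n) * snd x\<rfloor> \<le> real (Suc n) * snd x" by linarith
      then have "?r n \<le> (real (Suc n) * snd x) / real (Suc n)" by (rule divide_right_mono) simp
      then show "?r n \<le> snd x" by simp
    qed
  qed simp
  moreover have "fst x \<in> space M" using x by (simp add: space_pair_measure mem_Times_iff)
  ultimately show "(\<lambda>n. g (fst x) (?r n)) \<longlonglongrightarrow> g (fst x) (snd x)"
    using continuous_on_tendsto_compose[OF c] by fastforce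
next
  fix n
  have fl: "(\<lambda>x. \<lfloor>real (Suc n) * snd x\<rfloor>) \<in> M \<Otimes>\<^sub>M (borel :: real measure) \<rightarrow>\<^sub>M count_space UNIV" by measurable
  show "(\<lambda>x. g (fst x) (real_of_int \<lfloor>real (Suc n) * snd x\<rfloor> / real (Suc n))) \<in> borel_measurable (M \<Otimes>\<^sub>M borel)"
    by (rule measurable_compose_countable[OF _ fl, where f="\<lambda>i x. g (fst x) (real_of_int i / real (Suc n))"])
      (rule measurable_compose[OF measurable_fst m])
qed

lemma integral_left_limit:
  fixes g :: "real \<Rightarrow> real"
  assumes g: "integrable (lebesgue_on {s..t}) g" and \<tau>: "\<tau> \<longlonglongrightarrow> s" "\<And>j. s \<le> \<tau> j"
  shows "(\<lambda>j::nat. \<integral>x. g x \<partial>lebesgue_on {\<tau> j..t}) \<longlonglongrightarrow> (\<integral>x. g x \<partial>lebesgue_on {s..t})"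
proof -
  have IL: "{a..b} \<in> sets lebesgue" for a b :: real by simp
  have g': "integrable lebesgue (\<lambda>x. indicator {s..t} x * g x)" using g by (simp add: integrable_lebesgue_on_iff)
  have gj: "integrable lebesgue (\<lambda>x. indicator {\<tau> j..t} x * g x)" for j
    using integrable_lebesgue_on_subset[OF g, of "{\<tau> j..t}"] \<tau>(2)[of j] by (simp add: integrable_lebesgue_on_iff)
  have "(\<lambda>j. \<integral>x. indicator {\<tau> j..t} x * g x \<partial>lebesgue) \<longlonglongrightarrow> (\<integral>x. indicator {s..t} x * g x \<partial>lebesgue)"
  proof (rule integral_dominated_convergence[where w="\<lambda>x. \<bar>indicator {s..t} x * g x\<bar>"])
    show "(\<lambda>x. indicator {s..t} x * g x) \<in> borel_measurable lebesgue" using g' by simp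
    show "(\<lambda>x. indicator {\<tau> j..t} x * g x) \<in> borel_measurable lebesgue" for j using gj[of j] by simp
    show "integrable lebesgue (\<lambda>x. \<bar>indicator {s..t} x * g x\<bar>)" using g' by (rule integrable_abs)
    show "AE x in lebesgue. norm (indicator {\<tau> j..t} x * g x) \<le> \<bar>indicator {s..t} x * g x\<bar>" for j
      using \<tau>(2)[of j] by (intro AE_I2) (auto simp: indicator_def)
    have "AE x in lebesgue. x \<noteq> s" by (intro AE_completion AE_lborel_singleton)
    then show "AE x in lebesgue. (\<lambda>j. indicator {\<tau> j..t} x * g x) \<longlonglongrightarrow> indicator {s..t} x * g x"
    proof eventually_elim
      case (elim x)
      show ?case
      proof (rule tendsto_eventually)
        show "\<forall>\<^sub>F j in sequentially. indicator {\<tau> j..t} x * g x = indicator {s..t} x * g x"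
        proof (cases "s < x")
          case True
          from order_tendstoD(2)[OF \<tau>(1) True] show ?thesis
            by eventually_elim (use True in \<open>auto simp: indicator_def\<close>)
        next
          case False
          then have "x \<notin> {\<tau> j..t}" "x \<notin> {s..t}" for j using \<tau>(2)[of j] elim by auto
          then show ?thesis by (intro always_eventually allI) simp
        qed
      qed
    qed
  qed
  then show ?thesis unfolding integral_lebesgue_on_eq[OF IL] .
qed

context ns_traj
begin

lemma interior_up: "t \<in> interior I \<Longrightarrow> t \<le> r \<Longrightarrow> r \<in> interior I"
proof -
  assume t: "t \<in> interior I" "t \<le> r"
  obtain d where d: "d > 0" "ball t d \<subseteq> I" using t(1) by (auto simp: mem_interior)
  have "t - d / 2 \<in> I" using d by (auto simp: subset_iff dist_real_def)
  then have "{t - d / 2<..} \<subseteq> I" using I_up by auto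
  then have "{t - d / 2<..} \<subseteq> interior I" by (intro interior_maximal) auto
  then show "r \<in> interior I" using t d(1) by auto
qed

text \<open>Weak lower semicontinuity in a form suited to dominated convergence: the drop of the
  squared norm is at most its value at \<open>s\<close>. The lower bound is the component of
  \<open>u (t n)\<close> along \<open>u s\<close>, which converges.\<close>

lemma norm_sq_lsc:
  assumes u: "u \<in> Traj D I" and s: "s \<in> I" and t: "\<And>n. t n \<in> I" "t \<longlonglongrightarrow> s"
  shows "(\<lambda>n::nat. max 0 ((norm_H D (u s))\<^sup>2 - (norm_H D (u (t n)))\<^sup>2)) \<longlonglongrightarrow> 0"
proof (cases "nrm (u s) = 0")
  case True
  then show ?thesis by (simp add: norm_H_eq max.absorb1)
next
  case False
  have us: "u s \<in> Hspace D" using TrajD(1)[OF u s] .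
  then have p: "nrm (u s) > 0" using False nrm_nonneg[OF us] by simp
  define l where "l n = inner_H D (u (t n)) (u s) / nrm (u s)" for n
  have "(\<lambda>n. inner_H D (u (t n)) (u s)) \<longlonglongrightarrow> inner_H D (u s) (u s)"
    by (rule continuous_on_tendsto_compose[OF TrajD(2)[OF u us] t(2) s]) (use t in \<open>auto intro!: always_eventually\<close>)
  then have "l \<longlonglongrightarrow> inner_H D (u s) (u s) / nrm (u s)" unfolding l_def using p by (intro tendsto_intros) auto
  also have "inner_H D (u s) (u s) / nrm (u s) = nrm (u s)" using nrm_sq[OF us] p by (simp add: power2_eq_square field_simps)
  finally have l: "l \<longlonglongrightarrow> nrm (u s)" .
  have "(\<lambda>n. max 0 ((nrm (u s))\<^sup>2 - (max 0 (l n))\<^sup>2)) \<longlonglongrightarrow> max 0 ((nrm (u s))\<^sup>2 - (max 0 (nrm (u s)))\<^sup>2)"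
    by (intro tendsto_intros l)
  then have lim: "(\<lambda>n. max 0 ((nrm (u s))\<^sup>2 - (max 0 (l n))\<^sup>2)) \<longlonglongrightarrow> 0" using p by simp
  show ?thesis unfolding norm_H_eq
  proof (rule tendsto_sandwich[OF _ _ tendsto_const lim])
    show "\<forall>\<^sub>F n in sequentially. max 0 ((nrm (u s))\<^sup>2 - (nrm (u (t n)))\<^sup>2) \<le> max 0 ((nrm (u s))\<^sup>2 - (max 0 (l n))\<^sup>2)"
    proof (rule always_eventually, rule allI)
      fix n
      have ut: "u (t n) \<in> Hspace D" using TrajD(1)[OF u t(1)] .
      have "l n \<le> nrm (u (t n))" unfolding l_def using cauchy_schwarz[OF ut us] p by (simp add: field_simps)
      then have "(max 0 (l n))\<^sup>2 \<le> (nrm (u (t n)))\<^sup>2" using nrm_nonneg[OF ut] by (intro power_mono) auto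
      then show "max 0 ((nrm (u s))\<^sup>2 - (nrm (u (t n)))\<^sup>2) \<le> max 0 ((nrm (u s))\<^sup>2 - (max 0 (l n))\<^sup>2)" by simp
    qed
  qed simp
qed

lemma measurable_eval_norm: "t \<in> I \<Longrightarrow> (\<lambda>u. norm_H D (u t)) \<in> borel_measurable (borel_of (TrajTop D I))"
  using measurable_compose[OF measurable_eval measurable_norm_Hw] .

text \<open>The norm need not be continuous in time, but a bound on it is a countable family of
  conditions on weakly continuous coordinates. The clipping \<open>max s\<close> makes these
  coordinates continuous functions of all real times.\<close>

lemma measurable_norm_joint:
  assumes s: "s \<in> I"
  shows "(\<lambda>x. norm_H D (fst x (max s (snd x)))) \<in> borel_measurable (borel_of (TrajTop D I) \<Otimes>\<^sub>M borel)"
proof (rule borel_measurable_iff_le[THEN iffD2], rule allI)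
  fix M :: real
  let ?N = "borel_of (TrajTop D I) \<Otimes>\<^sub>M (borel :: real measure)"
  have sI: "max s \<theta> \<in> I" for \<theta> using I_up[OF s, of "max s \<theta>"] by simp
  have sp: "x \<in> space ?N \<Longrightarrow> fst x \<in> Traj D I" for x by (auto simp: space_pair_measure space_borel_of topspace_TrajTop)
  have ipm: "(\<lambda>x. inner_H D (fst x (max s (snd x))) (dense_seq D k)) \<in> borel_measurable ?N" for k
  proof (rule caratheodory_measurable[where g="\<lambda>u \<theta>. inner_H D (u (max s \<theta>)) (dense_seq D k)"])
    show "(\<lambda>u. inner_H D (u (max s \<theta>)) (dense_seq D k)) \<in> borel_measurable (borel_of (TrajTop D I))" for \<theta>
      by (rule measurable_eval_inner[OF sI v_in])
    fix u assume "u \<in> space (borel_of (TrajTop D I))"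
    then have "u \<in> Traj D I" by (simp add: space_borel_of topspace_TrajTop)
    then show "continuous_on UNIV (\<lambda>\<theta>. inner_H D (u (max s \<theta>)) (dense_seq D k))"
      by (intro continuous_on_compose2[OF TrajD(2)[OF _ v_in]]) (auto intro!: continuous_intros sI)
  qed
  show "{x \<in> space ?N. norm_H D (fst x (max s (snd x))) \<le> M} \<in> sets ?N"
  proof (cases "0 \<le> M")
    case True
    have "{x \<in> space ?N. norm_H D (fst x (max s (snd x))) \<le> M}
      = {x \<in> space ?N. \<forall>k. \<bar>inner_H D (fst x (max s (snd x))) (dense_seq D k)\<bar> \<le> M * nrm (dense_seq D k)}"
      using nrm_le_iff_v[OF TrajD(1)[OF sp sI] True] by (auto simp: norm_H_eq)
    also have "\<dots> \<in> sets ?N" using ipm by measurable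
    finally show ?thesis .
  next
    case False
    then have "{x \<in> space ?N. norm_H D (fst x (max s (snd x))) \<le> M} = {}"
    proof (intro equals0I)
      fix x assume x: "x \<in> {x \<in> space ?N. norm_H D (fst x (max s (snd x))) \<le> M}"
      then have "0 \<le> nrm (fst x (max s (snd x)))" by (intro nrm_nonneg TrajD(1)[OF sp sI]) simp
      then show False using x False by (simp add: norm_H_eq)
    qed
    then show ?thesis using sets.empty_sets by metis
  qed
qed

lemma nn_integral_eval:
  assumes s\<rho>: "sets \<rho> = sets (borel_of (TrajTop D I))" and t: "t \<in> I" and F: "F \<in> borel_measurable (borel_of (Hw D))"
  shows "(\<integral>\<^sup>+u. F (u t) \<partial>\<rho>) = (\<integral>\<^sup>+h. F h \<partial>proj_measure D t \<rho>)"
proof -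
  have "(\<lambda>u. u t) \<in> \<rho> \<rightarrow>\<^sub>M borel_of (Hw D)" using measurable_eval[OF t] measurable_cong_sets[OF s\<rho> refl] by blast
  then show ?thesis unfolding proj_measure_def using F by (subst nn_integral_distr) auto
qed

text \<open>Constancy of the marginals turns weak lower semicontinuity of the norm into strong continuity in the mean:
  \<open>E|X\<^sub>t - X\<^sub>s| = 2 E(X\<^sub>s - X\<^sub>t)\<^sup>+\<close> for \<open>X\<^sub>t = |u(t)|\<^sup>2\<close>.\<close>

lemma norm_sq_mean_continuous:
  assumes s\<rho>: "sets \<rho> = sets (borel_of (TrajTop D I))" and p: "prob_space \<rho>"
    and marg: "\<And>a b. a \<in> I \<Longrightarrow> b \<in> I \<Longrightarrow> proj_measure D a \<rho> = proj_measure D b \<rho>"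
    and fin: "t0 \<in> I" "(\<integral>\<^sup>+u. ennreal ((norm_H D (u t0))\<^sup>2) \<partial>\<rho>) < \<infinity>"
    and s: "s \<in> I" and t: "\<And>n. t n \<in> I" "t \<longlonglongrightarrow> s"
  shows "(\<lambda>n::nat. \<integral>\<^sup>+u. ennreal \<bar>(norm_H D (u (t n)))\<^sup>2 - (norm_H D (u s))\<^sup>2\<bar> \<partial>\<rho>) \<longlonglongrightarrow> 0"
proof -
  interpret prob_space \<rho> by fact
  define X where "X t u = (norm_H D (u t))\<^sup>2" for t and u :: "real \<Rightarrow> field"
  have Xm[measurable]: "X t \<in> borel_measurable \<rho>" if "t \<in> I" for t
    unfolding X_def measurable_cong_sets[OF s\<rho> refl]
    by (rule borel_measurable_power[OF measurable_eval_norm[OF that]])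
  have nm: "(\<lambda>h. ennreal ((norm_H D h)\<^sup>2)) \<in> borel_measurable (borel_of (Hw D))" using measurable_norm_Hw by measurable
  have eq: "(\<integral>\<^sup>+u. ennreal (X a u) \<partial>\<rho>) = (\<integral>\<^sup>+u. ennreal (X t0 u) \<partial>\<rho>)" if "a \<in> I" for a
    unfolding X_def using nn_integral_eval[OF s\<rho> that nm] nn_integral_eval[OF s\<rho> fin(1) nm] marg[OF that fin(1)] by simp
  have Xi: "integrable \<rho> (X a)" if "a \<in> I" for a
  proof (rule integrableI_bounded)
    show "(\<integral>\<^sup>+u. ennreal (norm (X a u)) \<partial>\<rho>) < \<infinity>" using eq[OF that] fin(2) by (simp add: X_def)
  qed (rule Xm[OF that])
  have Xe: "integral\<^sup>L \<rho> (X a) = integral\<^sup>L \<rho> (X s)" if "a \<in> I" for a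
    using eq[OF that] eq[OF s] by (simp add: integral_eq_nn_integral[OF Xm[OF that]] integral_eq_nn_integral[OF Xm[OF s]] X_def)
  have sp: "space \<rho> = Traj D I" using sets_eq_imp_space_eq[OF s\<rho>] by (simp add: space_borel_of topspace_TrajTop)
  \<comment> \<open>The positive part of \<open>X s - X (t n)\<close> is the one dominated by an
    integrable function, \<open>X s\<close>; equality of the means then controls the other
    part.\<close>
  have lim: "(\<lambda>n. \<integral>u. max 0 (X s u - X (t n) u) \<partial>\<rho>) \<longlonglongrightarrow> (\<integral>u. 0 \<partial>\<rho>)"
  proof (rule integral_dominated_convergence[where w="X s"])
    show "AE u in \<rho>. (\<lambda>n. max 0 (X s u - X (t n) u)) \<longlonglongrightarrow> 0"
      unfolding X_def using norm_sq_lsc[OF _ s t] sp by (intro AE_I2) auto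
    show "AE u in \<rho>. norm (max 0 (X s u - X (t n) u)) \<le> X s u" for n
      by (intro AE_I2) (auto simp: X_def)
  qed (use Xi[OF s] Xm[OF s] Xm[OF t(1)] in auto)
  have e: "(\<integral>\<^sup>+u. ennreal \<bar>X (t n) u - X s u\<bar> \<partial>\<rho>) = ennreal (2 * (\<integral>u. max 0 (X s u - X (t n) u) \<partial>\<rho>))" for n
  proof -
    have i: "integrable \<rho> (\<lambda>u. X (t n) u - X s u)" using Xi[OF t(1)[of n]] Xi[OF s] by simp
    have im: "integrable \<rho> (\<lambda>u. max 0 (X s u - X (t n) u))" using Xi[OF t(1)[of n]] Xi[OF s] by simp
    have "(\<integral>\<^sup>+u. ennreal \<bar>X (t n) u - X s u\<bar> \<partial>\<rho>) = ennreal (\<integral>u. \<bar>X (t n) u - X s u\<bar> \<partial>\<rho>)"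
      using i by (intro nn_integral_eq_integral) auto
    also have "(\<integral>u. \<bar>X (t n) u - X s u\<bar> \<partial>\<rho>) = (\<integral>u. 2 * max 0 (X s u - X (t n) u) + (X (t n) u - X s u) \<partial>\<rho>)"
      by (intro Bochner_Integration.integral_cong refl) (simp add: max_def abs_real_def)
    also have "\<dots> = 2 * (\<integral>u. max 0 (X s u - X (t n) u) \<partial>\<rho>) + (\<integral>u. X (t n) u - X s u \<partial>\<rho>)"
      using i im by simp
    also have "(\<integral>u. X (t n) u - X s u \<partial>\<rho>) = 0" using Xi[OF t(1)[of n]] Xi[OF s] Xe[OF t(1)[of n]] by simp
    finally show ?thesis by simp
  qed
  have "(\<lambda>n. ennreal (2 * (\<integral>u. max 0 (X s u - X (t n) u) \<partial>\<rho>))) \<longlonglongrightarrow> ennreal (2 * (\<integral>u. 0 \<partial>\<rho>))"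
    by (intro tendsto_intros lim)
  then have "(\<lambda>n. \<integral>\<^sup>+u. ennreal \<bar>X (t n) u - X s u\<bar> \<partial>\<rho>) \<longlonglongrightarrow> 0" unfolding e by simp
  then show ?thesis unfolding X_def .
qed

text \<open>Mean continuity is averaged over short intervals after \<open>s\<close>, and Fatou
  yields a single null set of trajectories. Off it there are times tending to \<open>s\<close> from
  the right at which the squared norm approaches its value at \<open>s\<close> and from which the
  energy inequality holds, as it does from almost every time; the inequality passes to the limit.
  Membership in \<open>A\<close> does not refer to being a solution, so \<open>A\<close> is
  measurable.\<close>

lemma energy_from_time:
  assumes s\<rho>: "sets \<rho> = sets (borel_of (TrajTop D I))" and p: "prob_space \<rho>"
    and marg: "\<And>a b. a \<in> I \<Longrightarrow> b \<in> I \<Longrightarrow> proj_measure D a \<rho> = proj_measure D b \<rho>"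
    and fin: "t0 \<in> I" "(\<integral>\<^sup>+u. ennreal ((norm_H D (u t0))\<^sup>2) \<partial>\<rho>) < \<infinity>"
    and sJ: "s \<in> interior I" and f: "f \<in> Hspace D"
  obtains A where "A \<in> sets \<rho>" "emeasure \<rho> A = 1"
    "\<And>u t. u \<in> A \<Longrightarrow> weak_solution D \<nu> f (interior I) u \<Longrightarrow> s < t \<Longrightarrow> energy_ineq \<nu> f u s t"
proof -
  interpret prob_space \<rho> by fact
  have s: "s \<in> I" using sJ interior_subset by auto
  have sI: "max s \<theta> \<in> I" for \<theta> using I_up[OF s, of "max s \<theta>"] by simp
  define X where "X u t = (norm_H D (u (max s t)))\<^sup>2" for t and u :: "real \<Rightarrow> field"
  define Y where "Y u t = \<bar>X u t - X u s\<bar>" for u t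
  have s\<rho>2: "sets (\<rho> \<Otimes>\<^sub>M (borel :: real measure)) = sets (borel_of (TrajTop D I) \<Otimes>\<^sub>M borel)" by (intro sets_pair_measure_cong s\<rho> refl)
  have XM: "(\<lambda>x. X (fst x) (snd x)) \<in> borel_measurable (\<rho> \<Otimes>\<^sub>M borel)"
    unfolding X_def measurable_cong_sets[OF s\<rho>2 refl]
    by (rule borel_measurable_power[OF measurable_norm_joint[OF s]])
  have Xs: "(\<lambda>u. X u t) \<in> borel_measurable \<rho>" for t
    unfolding X_def measurable_cong_sets[OF s\<rho> refl]
    by (rule borel_measurable_power[OF measurable_eval_norm[OF sI[of t]]])
  have YM[measurable]: "(\<lambda>x. Y (fst x) (snd x)) \<in> borel_measurable (\<rho> \<Otimes>\<^sub>M borel)"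
    unfolding Y_def using XM measurable_compose[OF measurable_fst Xs[of s]] by measurable
  have YM'[measurable]: "(\<lambda>x. Y (fst x) (snd x)) \<in> borel_measurable (\<rho> \<Otimes>\<^sub>M lborel)"
    using YM measurable_cong_sets[OF sets_pair_measure_cong[OF refl sets_lborel, of \<rho>] refl, of borel] by blast
  define K where "K n = {s..s + 1 / real (Suc n)}" for n
  \<comment> \<open>Mean over \<open>K n\<close>, an interval of length 1/(n + 1), of the deviation
    of the squared norm from its value at \<open>s\<close>.\<close>
  define A where "A n u = (\<integral>\<^sup>+t. ennreal (real (Suc n) * Y u t) * indicator (K n) t \<partial>lborel)" for n u
  have Km[measurable]: "K n \<in> sets borel" for n unfolding K_def by simp
  have intm: "(\<lambda>x. ennreal (real (Suc n) * Y (fst x) (snd x)) * indicator (K n) (snd x)) \<in> borel_measurable (\<rho> \<Otimes>\<^sub>M lborel)" for n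
    by measurable
  have Am[measurable]: "A n \<in> borel_measurable \<rho>" for n
    unfolding A_def using lborel.borel_measurable_nn_integral_fst[OF intm[of n]] by simp
  have EA: "(\<lambda>n. \<integral>\<^sup>+u. A n u \<partial>\<rho>) \<longlonglongrightarrow> 0"
  proof -
    define F where "F t = (\<integral>\<^sup>+u. ennreal (Y u t) \<partial>\<rho>)" for t
    interpret pair_sigma_finite \<rho> lborel ..
    have EAn: "(\<integral>\<^sup>+u. A n u \<partial>\<rho>) = (\<integral>\<^sup>+t. ennreal (real (Suc n)) * F t * indicator (K n) t \<partial>lborel)" for n
    proof -
      have "(\<integral>\<^sup>+u. A n u \<partial>\<rho>) = (\<integral>\<^sup>+t. (\<integral>\<^sup>+u. ennreal (real (Suc n) * Y u t) * indicator (K n) t \<partial>\<rho>) \<partial>lborel)"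
        unfolding A_def using Fubini[OF intm[of n]] by simp
      also have "\<dots> = (\<integral>\<^sup>+t. ennreal (real (Suc n)) * F t * indicator (K n) t \<partial>lborel)"
      proof (rule nn_integral_cong)
        fix t
        have Yt[measurable]: "(\<lambda>u. Y u t) \<in> borel_measurable \<rho>" unfolding Y_def using Xs by measurable
        have "(\<integral>\<^sup>+u. ennreal (real (Suc n) * Y u t) * indicator (K n) t \<partial>\<rho>) = (\<integral>\<^sup>+u. (ennreal (real (Suc n)) * indicator (K n) t) * ennreal (Y u t) \<partial>\<rho>)"
          by (intro nn_integral_cong) (simp add: ennreal_mult Y_def mult_ac)
        also have "\<dots> = (ennreal (real (Suc n)) * indicator (K n) t) * F t"
          unfolding F_def by (rule nn_integral_cmult) measurable
        finally show "(\<integral>\<^sup>+u. ennreal (real (Suc n) * Y u t) * indicator (K n) t \<partial>\<rho>) = ennreal (real (Suc n)) * F t * indicator (K n) t"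
          by (simp add: mult_ac)
      qed
      finally show ?thesis .
    qed
    have F0: "(F \<longlongrightarrow> 0) (at s within {s..})"
      unfolding tendsto_at_iff_sequentially
    proof (intro allI impI)
      fix t assume t: "\<forall>i. t i \<in> {s..} - {s}" "t \<longlonglongrightarrow> s"
      have tI: "t n \<in> I" for n using I_up[OF s, of "t n"] t(1) by auto
      have "(\<lambda>n. \<integral>\<^sup>+u. ennreal \<bar>(norm_H D (u (t n)))\<^sup>2 - (norm_H D (u s))\<^sup>2\<bar> \<partial>\<rho>) \<longlonglongrightarrow> 0"
        by (rule norm_sq_mean_continuous[OF s\<rho> p marg fin s tI t(2)])
      moreover have "F (t n) = (\<integral>\<^sup>+u. ennreal \<bar>(norm_H D (u (t n)))\<^sup>2 - (norm_H D (u s))\<^sup>2\<bar> \<partial>\<rho>)" for n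
      proof -
        have "max s (t n) = t n" using t(1) by auto
        then show ?thesis unfolding F_def Y_def X_def by simp
      qed
      ultimately show "(F \<circ> t) \<longlonglongrightarrow> 0" by (simp add: o_def)
    qed
    have Fs: "F s = 0" unfolding F_def Y_def by simp
    show ?thesis
    proof (rule order_tendstoI)
      fix e :: ennreal assume e: "0 < e"
      obtain e' :: real where e': "0 < e'" "ennreal e' < e"
      proof (cases e)
        case (real r)
        then show ?thesis using that[of "r / 2"] e by (auto simp: ennreal_less_iff)
      next
        case top
        then show ?thesis using that[of 1] by simp
      qed
      have "\<forall>\<^sub>F t in at s within {s..}. F t < ennreal e'" using order_tendstoD(2)[OF F0, of "ennreal e'"] e'(1) by simp
      then obtain d where d: "d > 0" "\<And>t. t \<in> {s..} \<Longrightarrow> t \<noteq> s \<Longrightarrow> dist t s < d \<Longrightarrow> F t < ennreal e'"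
        unfolding eventually_at by blast
      have Fd: "F t \<le> ennreal e'" if "t \<in> {s..}" "dist t s < d" for t
        using d(2)[OF that(1)] that(2) Fs by (cases "t = s") (auto intro: less_imp_le)
      obtain N where N: "1 / real (Suc N) < d" using nat_approx_posE[OF d(1)] by blast
      show "\<forall>\<^sub>F n in sequentially. (\<integral>\<^sup>+u. A n u \<partial>\<rho>) < e"
      proof (rule eventually_sequentiallyI[of N])
        fix n assume n: "N \<le> n"
        have "(\<integral>\<^sup>+u. A n u \<partial>\<rho>) \<le> (\<integral>\<^sup>+t. (ennreal (real (Suc n)) * ennreal e') * indicator (K n) t \<partial>lborel)"
          unfolding EAn
        proof (rule nn_integral_mono)
          fix t
          show "ennreal (real (Suc n)) * F t * indicator (K n) t \<le> ennreal (real (Suc n)) * ennreal e' * indicator (K n) t"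
          proof (cases "t \<in> K n")
            case True
            have "1 / real (Suc n) \<le> 1 / real (Suc N)" using n by (simp add: frac_le)
            then have "F t \<le> ennreal e'" using True N by (intro Fd) (auto simp: K_def dist_real_def)
            then show ?thesis by (intro mult_right_mono mult_left_mono) auto
          qed simp
        qed
        also have "\<dots> = (ennreal (real (Suc n)) * ennreal e') * emeasure lborel (K n)"
          by (rule nn_integral_cmult_indicator) simp
        also have "\<dots> = ennreal (real (Suc n) * e' * (1 / real (Suc n)))"
        proof -
          have "emeasure lborel (K n) = ennreal (1 / real (Suc n))" unfolding K_def by simp
          then show ?thesis using e'(1) by (simp only: ennreal_mult[symmetric] less_imp_le of_nat_0_le_iff mult_nonneg_nonneg zero_le_divide_1_iff)
        qed
        also have "real (Suc n) * e' * (1 / real (Suc n)) = e'" by simp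
        finally show "(\<integral>\<^sup>+u. A n u \<partial>\<rho>) < e" using e'(2) by simp
      qed
    qed simp
  qed
  have "(\<integral>\<^sup>+u. liminf (\<lambda>n. A n u) \<partial>\<rho>) \<le> liminf (\<lambda>n. \<integral>\<^sup>+u. A n u \<partial>\<rho>)" by (rule nn_integral_liminf) measurable
  also have "\<dots> = 0" using lim_imp_Liminf[OF sequentially_bot EA] .
  finally have "AE u in \<rho>. liminf (\<lambda>n. A n u) = 0" by (subst (asm) le_zero_eq, subst (asm) nn_integral_0_iff_AE) auto
  define G where "G = {u \<in> space \<rho>. liminf (\<lambda>n. A n u) = 0}"
  have Gm: "G \<in> sets \<rho>" unfolding G_def by measurable
  have G1: "emeasure \<rho> G = 1"
    by (rule emeasure_eq_1_AE[OF Gm]) (use \<open>AE u in \<rho>. liminf (\<lambda>n. A n u) = 0\<close> AE_space in \<open>auto simp: G_def elim: eventually_elim2\<close>)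
  have "energy_ineq \<nu> f u s t" if u: "u \<in> G" and ws: "weak_solution D \<nu> f (interior I) u" and st: "s < t" for u t
  proof -
    note W = weak_solutionD[OF ws]
    have uT: "u \<in> Traj D I" using u sets_eq_imp_space_eq[OF s\<rho>] by (simp add: G_def space_borel_of topspace_TrajTop)
    note Jup = interior_up[OF sJ]
    have stJ: "{s..t} \<subseteq> interior I" using Jup by auto
    have good: "AE r in lborel. r \<in> interior I \<longrightarrow> energy_ineq \<nu> f u r t \<or> t \<le> r"
    proof -
      have "AE r in lebesgue. r \<in> interior I \<longrightarrow> (\<forall>t\<in>interior I. r < t \<longrightarrow> energy_ineq \<nu> f u r t)"
        using W(12) unfolding energy_ineq_def by (subst (asm) AE_lebesgue_on_iff) auto
      then have "AE r in lborel. r \<in> interior I \<longrightarrow> (\<forall>t\<in>interior I. r < t \<longrightarrow> energy_ineq \<nu> f u r t)"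
        by (simp only: AE_completion_iff)
      then show ?thesis by eventually_elim (use Jup[of t] st in force)
    qed
    \<comment> \<open>Otherwise the deviation is at least \<open>e\<close> at almost every time in
      (s, s + e), and all late averages are at least \<open>e\<close>. The alternative
      \<open>t \<le> r\<close> avoids a case distinction and is excluded in the limit, where
      \<open>r n < t\<close>.\<close>
    have ex: "\<exists>r. s < r \<and> r < s + e \<and> Y u r < e \<and> (energy_ineq \<nu> f u r t \<or> t \<le> r)" if e: "e > 0" for e
    proof (rule ccontr)
      assume no: "\<not> ?thesis"
      obtain N where N: "1 / real (Suc N) < e" using nat_approx_posE[OF e] by blast
      have "ennreal e \<le> A n u" if n: "n \<ge> N" for n
      proof -
        have kn: "1 / real (Suc n) < e" using n N by (meson frac_le le_less_trans of_nat_0_less_iff of_nat_mono order_refl zero_less_Suc zero_le_one Suc_le_mono)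
        have "ennreal e = (ennreal (real (Suc n)) * ennreal e) * emeasure lborel (K n)"
        proof -
          have "emeasure lborel (K n) = ennreal (1 / real (Suc n))" unfolding K_def by simp
          then have "(ennreal (real (Suc n)) * ennreal e) * emeasure lborel (K n) = ennreal (real (Suc n) * e * (1 / real (Suc n)))"
            using e by (simp only: ennreal_mult[symmetric] less_imp_le of_nat_0_le_iff mult_nonneg_nonneg zero_le_divide_1_iff)
          also have "real (Suc n) * e * (1 / real (Suc n)) = e" by simp
          finally show ?thesis by simp
        qed
        also have "\<dots> = (\<integral>\<^sup>+r. (ennreal (real (Suc n)) * ennreal e) * indicator (K n) r \<partial>lborel)"
          by (rule nn_integral_cmult_indicator[symmetric]) simp
        also have "\<dots> \<le> A n u"
          unfolding A_def
        proof (rule nn_integral_mono_AE)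
          have "AE r in lborel. r \<noteq> s" by (rule AE_lborel_singleton)
          then show "AE r in lborel. ennreal (real (Suc n)) * ennreal e * indicator (K n) r \<le> ennreal (real (Suc n) * Y u r) * indicator (K n) r"
            using good
          proof eventually_elim
            case (elim r)
            show ?case
            proof (cases "r \<in> K n")
              case True
              then have r: "s < r" "r < s + e" using elim kn by (auto simp: K_def)
              then have "e \<le> Y u r" using no elim Jup[of r] by force
              then have "real (Suc n) * e \<le> real (Suc n) * Y u r" by (intro mult_left_mono) auto
              then show ?thesis using True e by (simp add: ennreal_mult[symmetric] ennreal_leI del: of_nat_Suc)
            qed simp
          qed
        qed
        finally show ?thesis .
      qed
      then have "ennreal e \<le> liminf (\<lambda>n. A n u)" by (intro Liminf_bounded eventually_sequentiallyI)
      then show False using u e by (auto simp: G_def)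
    qed
    have "\<forall>n. \<exists>r. s < r \<and> r < s + 1 / real (Suc n) \<and> Y u r < 1 / real (Suc n) \<and> (energy_ineq \<nu> f u r t \<or> t \<le> r)" using ex by simp
    then obtain r where r: "\<And>n. s < r n" "\<And>n. r n < s + 1 / real (Suc n)" "\<And>n. Y u (r n) < 1 / real (Suc n)"
      "\<And>n. energy_ineq \<nu> f u (r n) t \<or> t \<le> r n" by metis
    have inv0: "(\<lambda>n. 1 / real (Suc n)) \<longlonglongrightarrow> 0" by (rule LIMSEQ_Suc[OF lim_1_over_n])
    have rs: "r \<longlonglongrightarrow> s"
    proof (rule tendsto_sandwich[OF _ _ tendsto_const])
      show "(\<lambda>n. s + 1 / real (Suc n)) \<longlonglongrightarrow> s" using tendsto_add[OF tendsto_const inv0] by fastforce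
    qed (use r in \<open>auto intro!: always_eventually simp: less_imp_le\<close>)
    have "(\<lambda>n. X u (r n) - X u s) \<longlonglongrightarrow> 0"
      by (rule Lim_null_comparison[OF _ inv0]) (use r(3) in \<open>auto intro!: always_eventually simp: Y_def less_imp_le\<close>)
    then have "(\<lambda>n. X u (r n) - X u s + X u s) \<longlonglongrightarrow> 0 + X u s" by (intro tendsto_intros)
    then have Xl: "(\<lambda>n. (norm_H D (u (r n)))\<^sup>2) \<longlonglongrightarrow> (norm_H D (u s))\<^sup>2"
      using r(1) by (simp add: X_def max_def less_imp_le)
    have c: "continuous_on {s..t} (\<lambda>t. inner_H D f (u t))"
      using continuous_on_f_inner[OF f, of "interior I" u] W(1,2) stJ by (intro continuous_on_subset[OF _ stJ]) auto
    have l1: "(\<lambda>n. \<integral>q. (norm_V D (u q))\<^sup>2 \<partial>lebesgue_on {r n..t}) \<longlonglongrightarrow> (\<integral>q. (norm_V D (u q))\<^sup>2 \<partial>lebesgue_on {s..t})"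
      by (rule integral_left_limit[OF W(6)[OF stJ] rs]) (use r(1) in \<open>simp add: less_imp_le\<close>)
    have l2: "(\<lambda>n. \<integral>q. inner_H D f (u q) \<partial>lebesgue_on {r n..t}) \<longlonglongrightarrow> (\<integral>q. inner_H D f (u q) \<partial>lebesgue_on {s..t})"
      by (rule integral_left_limit[OF continuous_imp_integrable_real[OF c] rs]) (use r(1) in \<open>simp add: less_imp_le\<close>)
    show ?thesis unfolding energy_ineq_def
    proof (rule tendsto_le[OF sequentially_bot])
      show "(\<lambda>n. (norm_H D (u (r n)))\<^sup>2 / 2 + (\<integral>q. inner_H D f (u q) \<partial>lebesgue_on {r n..t})) \<longlonglongrightarrow> (norm_H D (u s))\<^sup>2 / 2 + (\<integral>q. inner_H D f (u q) \<partial>lebesgue_on {s..t})"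
        by (intro tendsto_add tendsto_divide Xl l2 tendsto_const) simp
      show "(\<lambda>n. (norm_H D (u t))\<^sup>2 / 2 + \<nu> * (\<integral>q. (norm_V D (u q))\<^sup>2 \<partial>lebesgue_on {r n..t})) \<longlonglongrightarrow> (norm_H D (u t))\<^sup>2 / 2 + \<nu> * (\<integral>q. (norm_V D (u q))\<^sup>2 \<partial>lebesgue_on {s..t})"
        by (intro tendsto_add tendsto_mult l1 tendsto_const)
      have "\<forall>\<^sub>F n in sequentially. r n < t" using order_tendstoD(2)[OF rs st] .
      then show "\<forall>\<^sub>F n in sequentially. (norm_H D (u t))\<^sup>2 / 2 + \<nu> * (\<integral>q. (norm_V D (u q))\<^sup>2 \<partial>lebesgue_on {r n..t})
          \<le> (norm_H D (u (r n)))\<^sup>2 / 2 + (\<integral>q. inner_H D f (u q) \<partial>lebesgue_on {r n..t})"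
      proof eventually_elim
        case (elim n)
        then show ?case using r(4)[of n] unfolding energy_ineq_def by auto
      qed
    qed
  qed
  then show ?thesis using that Gm G1 by blast
qed

end

section \<open>Random concatenations\<close>

lemma nn_integral_unif:
  assumes [measurable]: "g \<in> borel_measurable borel"
  shows "(\<integral>\<^sup>+\<theta>. g \<theta> \<partial>unif) = (\<integral>\<^sup>+\<theta>. g \<theta> * indicator {0..<1} \<theta> \<partial>lborel)"
proof -
  have "(\<integral>\<^sup>+\<theta>. g \<theta> \<partial>unif) = (\<integral>\<^sup>+\<theta>. indicator {0..1} \<theta> * g \<theta> \<partial>lborel)"
    unfolding uniform_measure_def by (subst nn_integral_density) (auto simp: divide_ennreal_def)
  also have "\<dots> = (\<integral>\<^sup>+\<theta>. g \<theta> * indicator {0..<1} \<theta> \<partial>lborel)"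
  proof (rule nn_integral_cong_AE)
    have "AE \<theta> in lborel. \<theta> \<noteq> (1::real)" by (rule AE_lborel_singleton)
    then show "AE \<theta> in lborel. indicator {0..1} \<theta> * g \<theta> = g \<theta> * indicator {0..<1::real} \<theta>"
      by eventually_elim (auto simp: indicator_def)
  qed
  finally show ?thesis .
qed

lemma nn_integral_translate:
  fixes F :: "real \<Rightarrow> ennreal"
  assumes "F \<in> borel_measurable borel"
  shows "(\<integral>\<^sup>+x. F (x + c) \<partial>lborel) = (\<integral>\<^sup>+x. F x \<partial>lborel)"
  using nn_integral_real_affine[OF assms, of 1 c] by (simp add: add.commute)

text \<open>Reduce \<open>\<tau>\<close> to its fractional part, cut the moved window at 1 and move
  the overhanging piece back by one period. This turns invariance under the unit shift into
  invariance under every shift.\<close>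

lemma nn_integral_unif_periodic:
  fixes g :: "real \<Rightarrow> ennreal"
  assumes g[measurable]: "g \<in> borel_measurable borel" and per: "\<And>r. g (r + 1) = g r"
  shows "(\<integral>\<^sup>+\<theta>. g (\<theta> + \<tau>) \<partial>unif) = (\<integral>\<^sup>+\<theta>. g \<theta> \<partial>unif)"
proof -
  have per_nat: "g (r + real n) = g r" for r n
  proof (induction n)
    case (Suc n)
    then show ?case using per[of "r + real n"] by (simp add: add_ac)
  qed simp
  have per_int: "g (r + real_of_int n) = g r" for r n
  proof (cases "n \<ge> 0")
    case True
    then show ?thesis using per_nat[of r "nat n"] by simp
  next
    case False
    then show ?thesis using per_nat[of "r + real_of_int n" "nat (- n)"] by simp
  qed
  have m: "(\<lambda>x. g x * indicator {p..<q} x) \<in> borel_measurable lborel" for p q :: real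
    using g by (intro borel_measurable_times_ennreal borel_measurable_indicator) simp_all
  define a where "a = \<tau> - real_of_int \<lfloor>\<tau>\<rfloor>"
  have a: "0 \<le> a" "a < 1" unfolding a_def by linarith+
  have "(\<integral>\<^sup>+\<theta>. g (\<theta> + \<tau>) \<partial>unif) = (\<integral>\<^sup>+\<theta>. g (\<theta> + a) \<partial>unif)"
  proof (rule nn_integral_cong)
    fix \<theta>
    show "g (\<theta> + \<tau>) = g (\<theta> + a)" using per_int[of "\<theta> + a" "\<lfloor>\<tau>\<rfloor>"] by (simp add: a_def)
  qed
  also have "\<dots> = (\<integral>\<^sup>+\<theta>. g (\<theta> + a) * indicator {0..<1} \<theta> \<partial>lborel)" by (rule nn_integral_unif) measurable
  also have "\<dots> = (\<integral>\<^sup>+\<theta>. g (\<theta> + a) * indicator {a..<a + 1} (\<theta> + a) \<partial>lborel)"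
    by (intro nn_integral_cong) (auto simp: indicator_def)
  also have "\<dots> = (\<integral>\<^sup>+x. g x * indicator {a..<a + 1} x \<partial>lborel)"
    by (rule nn_integral_translate[where F="\<lambda>x. g x * indicator {a..<a + 1} x"]) measurable
  also have "\<dots> = (\<integral>\<^sup>+x. g x * indicator {a..<1} x + g x * indicator {1..<a + 1} x \<partial>lborel)"
    using a by (intro nn_integral_cong) (auto simp: indicator_def)
  also have "\<dots> = (\<integral>\<^sup>+x. g x * indicator {a..<1} x \<partial>lborel) + (\<integral>\<^sup>+x. g x * indicator {1..<a + 1} x \<partial>lborel)"
    by (rule nn_integral_add[OF m m])
  also have "(\<integral>\<^sup>+x. g x * indicator {1..<a + 1} x \<partial>lborel) = (\<integral>\<^sup>+x. g (x + 1) * indicator {1..<a + 1} (x + 1) \<partial>lborel)"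
    by (rule nn_integral_translate[where F="\<lambda>x. g x * indicator {1..<a + 1} x", symmetric]) measurable
  also have "\<dots> = (\<integral>\<^sup>+x. g x * indicator {0..<a} x \<partial>lborel)"
    by (intro nn_integral_cong) (auto simp: indicator_def per)
  also have "(\<integral>\<^sup>+x. g x * indicator {a..<1} x \<partial>lborel) + \<dots> = (\<integral>\<^sup>+x. g x * indicator {a..<1} x + g x * indicator {0..<a} x \<partial>lborel)"
    by (rule nn_integral_add[OF m m, symmetric])
  also have "\<dots> = (\<integral>\<^sup>+x. g x * indicator {0..<1} x \<partial>lborel)"
    using a by (intro nn_integral_cong) (auto simp: indicator_def)
  also have "\<dots> = (\<integral>\<^sup>+\<theta>. g \<theta> \<partial>unif)" by (rule nn_integral_unif[symmetric]) measurable
  finally show ?thesis .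
qed

lemma up_closed_is_interval: "(\<And>a b. a \<in> S \<Longrightarrow> a \<le> b \<Longrightarrow> b \<in> S) \<Longrightarrow> is_interval (S :: real set)"
  unfolding is_interval_1 by blast

text \<open>The image of a Borel set under a Borel map need not be Borel, but it contains a \<open>\<sigma>\<close>-compact set of full measure:
  project compact subsets of the graph.\<close>

lemma Borel_subset_of_image:
  fixes c :: "'a::{second_countable_topology, complete_space} \<Rightarrow> 'b::{second_countable_topology, complete_space}" and M :: "'a measure"
  assumes sM: "sets M = sets borel" and p: "prob_space M" and c[measurable]: "c \<in> borel_measurable borel"
    and G: "G \<in> sets borel" "emeasure M G = 1"
  obtains C where "C \<in> sets borel" "C \<subseteq> c ` G" "emeasure M {x. c x \<in> C} = 1"
proof -
  interpret prob_space M by fact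
  have [measurable_cong]: "sets M = sets borel" by fact
  note [measurable] = G(1)
  \<comment> \<open>Inner regularity is applied to the law of \<open>(x, c x)\<close> instead of
    \<open>M\<close>: compact subsets of the graph have compact projections, without continuity of
    \<open>c\<close>.\<close>
  define M3 where "M3 = distr M borel (\<lambda>x. (x, c x))"
  have m3: "(\<lambda>x. (x, c x)) \<in> M \<rightarrow>\<^sub>M borel" unfolding borel_prod[symmetric] by measurable
  interpret M3: prob_space M3 unfolding M3_def by (rule prob_space_distr[OF m3])
  have spM: "space M = UNIV" using sets_eq_imp_space_eq[OF sM] by simp
  let ?Gr = "{p :: 'a \<times> 'b. fst p \<in> G \<and> snd p = c (fst p)}"
  have Gr: "?Gr \<in> sets borel"
  proof -
    have "{p \<in> space (borel \<Otimes>\<^sub>M borel). fst p \<in> G \<and> snd p = c (fst p)} \<in> sets (borel \<Otimes>\<^sub>M borel :: ('a \<times> 'b) measure)"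
      by measurable
    then show ?thesis unfolding borel_prod[symmetric] by (simp add: space_pair_measure)
  qed
  have "emeasure M3 ?Gr = emeasure M G"
    unfolding M3_def using Gr by (subst emeasure_distr[OF m3]) (auto simp: spM intro!: arg_cong[where f="emeasure M"])
  moreover have "sets M3 = sets borel" by (simp add: M3_def)
  ultimately have one: "(SUP K\<in>{K. K \<subseteq> ?Gr \<and> compact K}. emeasure M3 K) = 1"
    using inner_regular[of M3, OF _ _ Gr] G(2) M3.emeasure_space_1 by simp
  have "\<exists>K. K \<subseteq> ?Gr \<and> compact K \<and> ennreal (1 - 1 / real (Suc n)) < emeasure M3 K" for n
  proof -
    have "ennreal (1 - 1 / real (Suc n)) < (SUP K\<in>{K. K \<subseteq> ?Gr \<and> compact K}. emeasure M3 K)"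
      unfolding one by (subst ennreal_1[symmetric], subst ennreal_less_iff) auto
    then show ?thesis unfolding less_SUP_iff by blast
  qed
  then have "\<forall>n. \<exists>K. K \<subseteq> ?Gr \<and> compact K \<and> ennreal (1 - 1 / real (Suc n)) < emeasure M3 K" ..
  from choice[OF this] obtain K where
    K: "\<And>n. K n \<subseteq> ?Gr" "\<And>n. compact (K n)" "\<And>n. ennreal (1 - 1 / real (Suc n)) < emeasure M3 (K n)" by blast
  define C where "C = (\<Union>n. snd ` K n)"
  have Cm: "C \<in> sets borel"
    unfolding C_def by (intro sets.countable_UN image_subsetI borel_closed compact_imp_closed compact_continuous_image continuous_on_snd continuous_on_id K(2))
  have sub: "C \<subseteq> c ` G" unfolding C_def using K(1) by fastforce
  have "1 \<le> emeasure M {x. c x \<in> C}"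
  proof (rule LIMSEQ_le_const2)
    have "(\<lambda>n. ennreal (1 - 1 / real (Suc n))) \<longlonglongrightarrow> ennreal (1 - 0)"
      by (intro tendsto_intros LIMSEQ_Suc[OF lim_1_over_n])
    then show "(\<lambda>n. ennreal (1 - 1 / real (Suc n))) \<longlonglongrightarrow> 1" by simp
    have cm: "{x. c x \<in> C} \<in> sets M" using measurable_sets[OF c Cm] by (simp add: sM vimage_def)
    have "ennreal (1 - 1 / real (Suc n)) \<le> emeasure M {x. c x \<in> C}" for n
    proof -
      have "emeasure M3 (K n) = emeasure M ((\<lambda>x. (x, c x)) -` K n \<inter> space M)"
        unfolding M3_def using K(2)[of n] by (intro emeasure_distr[OF m3] borel_closed compact_imp_closed)
      also have "\<dots> \<le> emeasure M {x. c x \<in> C}" by (intro emeasure_mono cm) (force simp: C_def)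
      finally show ?thesis using K(3)[of n] by simp
    qed
    then show "\<exists>N. \<forall>n\<ge>N. ennreal (1 - 1 / real (Suc n)) \<le> emeasure M {x. c x \<in> C}" by blast
  qed
  then have "emeasure M {x. c x \<in> C} = 1" using emeasure_le_1 by (simp add: order_antisym)
  then show ?thesis using that Cm sub by blast
qed

context ns_space
begin

lemma fld_eq_refl: "h \<in> Hspace D \<Longrightarrow> fld_eq h h"
  by (simp add: fld_eq_def)

lemma energy_ineq_fld_cong:
  assumes "\<And>r. r \<in> {s..t} \<Longrightarrow> fld_eq (u r) (w r)" "s \<le> t" "f \<in> Hspace D"
  shows "energy_ineq \<nu> f u s t \<longleftrightarrow> energy_ineq \<nu> f w s t"
proof -
  note o = fld_eq_obs[OF assms(1)]
  have 1: "(\<integral>r. (norm_V D (u r))\<^sup>2 \<partial>lebesgue_on {s..t}) = (\<integral>r. (norm_V D (w r))\<^sup>2 \<partial>lebesgue_on {s..t})"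
    by (rule Bochner_Integration.integral_cong[OF refl]) (use o(3) in auto)
  have 2: "(\<integral>r. inner_H D f (u r) \<partial>lebesgue_on {s..t}) = (\<integral>r. inner_H D f (w r) \<partial>lebesgue_on {s..t})"
    by (rule Bochner_Integration.integral_cong[OF refl]) (use o(5)[OF _ assms(3)] in auto)
  have 3: "norm_H D (u s) = norm_H D (w s)" "norm_H D (u t) = norm_H D (w t)" using o(1) assms(2) by auto
  show ?thesis unfolding energy_ineq_def 1 2 3 ..
qed

lemma energy_ineq_shift:
  assumes "energy_ineq \<nu> f u (a + \<tau>) (b + \<tau>)"
    and m: "(\<lambda>r. (norm_V D (u r))\<^sup>2) \<in> borel_measurable (lebesgue_on {a + \<tau>..b + \<tau>})"
      "(\<lambda>r. inner_H D f (u r)) \<in> borel_measurable (lebesgue_on {a + \<tau>..b + \<tau>})"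
  shows "energy_ineq \<nu> f (\<lambda>t. u (t + \<tau>)) a b"
proof -
  have IL: "{a + \<tau>..b + \<tau>} \<in> sets lebesgue" by simp
  show ?thesis
    using assms(1) integral_shift[OF IL m(1), of \<tau>] integral_shift[OF IL m(2), of \<tau>]
    unfolding energy_ineq_def shift_Icc by simp
qed

end

section \<open>Concatenation of coded segments\<close>

context ns_traj
begin

lemma is_interval_interior: "is_interval (interior I)"
  by (rule up_closed_is_interval) (rule interior_up)

lemma traj_eq_fld_eq: "u \<in> Traj D I \<Longrightarrow> w \<in> Traj D I \<Longrightarrow> traj_eq u w \<Longrightarrow> t \<in> I \<Longrightarrow> fld_eq (u t) (w t)"
  using TrajD(1) by (auto simp: traj_eq_def fld_eq_def)

text \<open>Segment \<open>\<omega> k\<close> runs on [k, k + 1), starting at its own time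
  \<open>s\<close>; at the integer \<open>k + 1\<close> the value is already that of the next
  segment.\<close>

definition concat_path :: "real \<Rightarrow> (int \<Rightarrow> real) \<Rightarrow> real \<Rightarrow> field" where
  "concat_path s \<omega> t = path_of (\<omega> \<lfloor>t\<rfloor>) (s + (t - real_of_int \<lfloor>t\<rfloor>))"

lemma concat_path_shift: "concat_path s (\<lambda>k. \<omega> (k + 1)) t = concat_path s \<omega> (t + 1)"
  unfolding concat_path_def by (simp add: algebra_simps)

lemma weak_solution_concat_path:
  assumes f: "f \<in> Hspace D" and s: "s \<in> interior I"
    and ws: "\<And>k. weak_solution D \<nu> f (interior I) (path_of (\<omega> k))"
    and en: "\<And>k t. s < t \<Longrightarrow> energy_ineq \<nu> f (path_of (\<omega> k)) s t"
    and match: "\<And>k. hcode (path_of (\<omega> k) (s + 1)) = hcode (path_of (\<omega> (k + 1)) s)"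
  shows "weak_solution D \<nu> f UNIV (concat_path s \<omega>)"
proof (rule weak_solution_glue[OF f])
  let ?J = "\<lambda>k::int. {t. t + (s - real_of_int k) \<in> interior I}"
  let ?v = "\<lambda>k t. path_of (\<omega> k) (t + (s - real_of_int k))"
  \<comment> \<open>Gluing asks for literal agreement on the closed cell, while the next segment
    starts at a function that equals the end of this one only up to a null set. The value at
    \<open>k + 1\<close> is therefore overwritten, which \<open>weak_solution_cong\<close>
    permits.\<close>
  let ?w = "\<lambda>k. (?v k)(real_of_int k + 1 := concat_path s \<omega> (real_of_int k + 1))"
  have sI: "s \<in> I" using s interior_subset by blast
  then have s1I: "s + 1 \<in> I" by (rule I_up) simp
  fix k :: int
  have "open ((\<lambda>t. t + (s - real_of_int k)) -` interior I)" by (intro open_vimage continuous_intros) simp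
  then show "open (?J k)" by (simp add: vimage_def)
  show sub: "{real_of_int k..real_of_int k + 1} \<subseteq> ?J k" using interior_up[OF s] by auto
  note W = weak_solutionD[OF ws[of k]]
  have cf: "continuous_on (interior I) (\<lambda>t. inner_H D f (path_of (\<omega> k) t))"
    using continuous_on_f_inner[OF f, of "interior I" "path_of (\<omega> k)"] W(1,2) by blast
  have fm: "(\<lambda>r. inner_H D f (path_of (\<omega> k) r)) \<in> borel_measurable (lebesgue_on {a..b})" if "{a..b} \<subseteq> interior I" for a b
    using borel_measurable_integrable[OF continuous_imp_integrable_real[OF continuous_on_subset[OF cf that]]] .
  have w0: "weak_solution D \<nu> f (?J k) (?v k)"
    by (rule weak_solution_shift[OF ws open_interior is_interval_interior fm])
  have obs: "fld_eq (?v k t) (?w k t)" if "t \<in> ?J k" for t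
  proof (cases "t = real_of_int k + 1")
    case True
    have "concat_path s \<omega> (real_of_int k + 1) = path_of (\<omega> (k + 1)) s"
      unfolding concat_path_def by (simp add: algebra_simps)
    moreover have "fld_eq (path_of (\<omega> k) (s + 1)) (path_of (\<omega> (k + 1)) s)"
      unfolding fld_eq_def using TrajD(1)[OF path_of_Traj] sI s1I hcode_inj[OF match] by blast
    ultimately show ?thesis using True by (simp add: add.commute)
  next
    case False
    then show ?thesis using weak_solutionD(1)[OF w0 that] by (simp add: fld_eq_refl)
  qed
  show wk: "weak_solution D \<nu> f (?J k) (?w k)"
  proof (rule weak_solution_cong[OF w0 obs f])
    show "is_interval (?J k)" using interior_up by (intro up_closed_is_interval) auto
  qed
  show "concat_path s \<omega> t = ?w k t" if "t \<in> {real_of_int k..real_of_int k + 1}" for t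
  proof (cases "t = real_of_int k + 1")
    case False
    then have "\<lfloor>t\<rfloor> = k" using that by (auto intro!: floor_unique)
    then show ?thesis using False unfolding concat_path_def by (simp add: algebra_simps)
  qed simp
  show "energy_ineq \<nu> f (?w k) (real_of_int k) t" if t: "t \<in> {real_of_int k<..real_of_int k + 1}" for t
  proof -
    let ?\<tau> = "s - real_of_int k"
    have e: "real_of_int k + ?\<tau> = s" by simp
    have sub': "{real_of_int k + ?\<tau>..t + ?\<tau>} \<subseteq> interior I" using interior_up[OF s] by auto
    have "energy_ineq \<nu> f (path_of (\<omega> k)) (real_of_int k + ?\<tau>) (t + ?\<tau>)" unfolding e using en t by auto
    then have "energy_ineq \<nu> f (?v k) (real_of_int k) t"
      by (rule energy_ineq_shift[OF _ borel_measurable_integrable[OF W(6)[OF sub']] fm[OF sub']])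
    then show ?thesis
      by (rule energy_ineq_fld_cong[THEN iffD1, rotated -1]) (use obs sub t f in \<open>auto simp: subset_iff\<close>)
  qed
qed

end

context ns_traj
begin

lemma measurable_TrajTop_cong:
  "sets \<rho> = sets (borel_of (TrajTop D I)) \<Longrightarrow> F \<in> borel_of (TrajTop D I) \<rightarrow>\<^sub>M M \<Longrightarrow> F \<in> \<rho> \<rightarrow>\<^sub>M M"
  using measurable_cong_sets[of \<rho> "borel_of (TrajTop D I)" M M] by blast

lemma space_TrajTop_measure: "sets \<rho> = sets (borel_of (TrajTop D I)) \<Longrightarrow> space \<rho> = Traj D I"
  by (drule sets_eq_imp_space_eq) (simp add: space_borel_of topspace_TrajTop)

text \<open>\<open>path_of (code u)\<close> may differ from \<open>u\<close>, but by saturation no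
  Borel set notices.\<close>

lemma distr_code_path_of:
  assumes s\<rho>: "sets \<rho> = sets (borel_of (TrajTop D I))"
  shows "distr (distr \<rho> borel code) (borel_of (TrajTop D I)) path_of = \<rho>"
proof (rule measure_eqI)
  fix E assume "E \<in> sets (distr (distr \<rho> borel code) (borel_of (TrajTop D I)) path_of)"
  then have E: "E \<in> sets (borel_of (TrajTop D I))" by simp
  note cm = measurable_TrajTop_cong[OF s\<rho> measurable_code]
  have pm: "path_of \<in> distr \<rho> borel code \<rightarrow>\<^sub>M borel_of (TrajTop D I)" using measurable_path_of by simp
  have "emeasure (distr (distr \<rho> borel code) (borel_of (TrajTop D I)) path_of) E
      = emeasure \<rho> (code -` (path_of -` E) \<inter> space \<rho>)"
    using measurable_sets[OF measurable_path_of E] by (simp add: emeasure_distr[OF pm E] emeasure_distr[OF cm])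
  also have "code -` (path_of -` E) \<inter> space \<rho> = E"
  proof -
    have "u \<in> E \<longleftrightarrow> path_of (code u) \<in> E" if "u \<in> Traj D I" for u
      using Borel_saturated[OF E path_of_Traj that path_of_code[OF that]] by simp
    moreover have "E \<subseteq> Traj D I" using sets.sets_into_space[OF E] by (simp add: space_borel_of topspace_TrajTop)
    ultimately show ?thesis by (auto simp: space_TrajTop_measure[OF s\<rho>])
  qed
  finally show "emeasure (distr (distr \<rho> borel code) (borel_of (TrajTop D I)) path_of) E = emeasure \<rho> E" .
qed (simp add: s\<rho>)

lemma distr_code_path_of_compose:
  assumes s\<rho>: "sets \<rho> = sets (borel_of (TrajTop D I))" and F: "F \<in> borel_of (TrajTop D I) \<rightarrow>\<^sub>M M"
  shows "distr (distr \<rho> borel code) M (\<lambda>z. F (path_of z)) = distr \<rho> M F"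
proof -
  have pm: "path_of \<in> distr \<rho> borel code \<rightarrow>\<^sub>M borel_of (TrajTop D I)" using measurable_path_of by simp
  show ?thesis using distr_distr[OF F pm] by (simp add: distr_code_path_of[OF s\<rho>] o_def)
qed

text \<open>The states of the chain are codes of whole trajectories; \<open>\<alpha>\<close> and
  \<open>\<beta>\<close> code their positions at \<open>s\<close> and \<open>s + 1\<close>, and the
  laws agree because the marginals of \<open>\<rho>\<close> do. \<open>G\<close> is shift-invariant
  exactly and not just almost surely, so that \<open>glued\<close> commutes with the shift
  pointwise.\<close>

lemma stationary_gluing:
  assumes s\<rho>: "sets \<rho> = sets (borel_of (TrajTop D I))" and p: "prob_space \<rho>"
    and marg: "\<And>a b. a \<in> I \<Longrightarrow> b \<in> I \<Longrightarrow> proj_measure D a \<rho> = proj_measure D b \<rho>"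
    and s: "s \<in> interior I" and f: "f \<in> Hspace D"
    and A: "A \<in> sets \<rho>" "emeasure \<rho> A = 1"
    and ws: "\<And>u. u \<in> A \<Longrightarrow> weak_solution D \<nu> f (interior I) u"
    and en: "\<And>u t. u \<in> A \<Longrightarrow> s < t \<Longrightarrow> energy_ineq \<nu> f u s t"
  obtains P :: "(int \<Rightarrow> real) measure" and G where "prob_space P" "sets P = sets borel"
    "\<And>k. distr P borel (\<lambda>\<omega>. \<omega> k) = distr \<rho> borel code" "distr P borel (\<lambda>\<omega> k. \<omega> (k + 1)) = P"
    "G \<in> sets borel" "emeasure P G = 1" "\<And>\<omega>. (\<lambda>k. \<omega> (k + 1)) \<in> G \<longleftrightarrow> \<omega> \<in> G"
    "\<And>\<omega>. \<omega> \<in> G \<Longrightarrow> weak_solution D \<nu> f UNIV (concat_path s \<omega>)"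
proof -
  interpret prob_space \<rho> by fact
  let ?N = "distr \<rho> borel code"
  define \<alpha> where "\<alpha> = (\<lambda>z. hcode (path_of z s))"
  define \<beta> where "\<beta> = (\<lambda>z. hcode (path_of z (s + 1)))"
  have sI: "s \<in> I" using s interior_subset by blast
  then have s1I: "s + 1 \<in> I" by (rule I_up) simp
  have hm: "(\<lambda>u. hcode (u t)) \<in> borel_measurable (borel_of (TrajTop D I))" if "t \<in> I" for t
    by (rule measurable_compose[OF measurable_eval[OF that] measurable_hcode])
  have \<alpha>m[measurable]: "\<alpha> \<in> borel_measurable borel" unfolding \<alpha>_def by (rule measurable_compose[OF measurable_path_of hm[OF sI]])
  have \<beta>m[measurable]: "\<beta> \<in> borel_measurable borel" unfolding \<beta>_def by (rule measurable_compose[OF measurable_path_of hm[OF s1I]])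
  have Nd: "distr ?N borel (\<lambda>z. hcode (path_of z t)) = distr (proj_measure D t \<rho>) borel hcode" if "t \<in> I" for t
    unfolding proj_measure_def distr_code_path_of_compose[OF s\<rho> hm[OF that]]
    using distr_distr[OF measurable_hcode measurable_TrajTop_cong[OF s\<rho> measurable_eval[OF that]]] by (simp add: o_def)
  have eq: "distr ?N borel \<alpha> = distr ?N borel \<beta>"
    unfolding \<alpha>_def \<beta>_def using Nd[OF sI] Nd[OF s1I] marg[OF sI s1I] by simp
  have N1: "AE z in ?N. z \<in> {0..1}"
    using measurable_TrajTop_cong[OF s\<rho> measurable_code] by (subst AE_distr_iff) (use seq_encode_range in \<open>auto simp: code_def\<close>)
  obtain P :: "(int \<Rightarrow> real) measure" where P: "prob_space P" "sets P = sets borel"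
    "\<And>k. distr P borel (\<lambda>\<omega>. \<omega> k) = ?N" "AE \<omega> in P. \<forall>k. \<beta> (\<omega> k) = \<alpha> (\<omega> (k + 1))"
    "distr P borel (\<lambda>\<omega> k. \<omega> (k + 1)) = P"
    by (rule stationary_chain[OF prob_space_distr[OF measurable_TrajTop_cong[OF s\<rho> measurable_code]] _ N1 \<alpha>m \<beta>m eq]) auto
  interpret P: prob_space P by fact
  note [measurable_cong] = P(2)
  have spP: "space P = UNIV" using sets_eq_imp_space_eq[OF P(2)] by simp
  have A': "A \<in> sets (borel_of (TrajTop D I))" using A(1) s\<rho> by simp
  define W where "W = {z. path_of z \<in> A}"
  have Wm[measurable]: "W \<in> sets borel" using measurable_sets[OF measurable_path_of A'] by (simp add: W_def vimage_def)
  have NW: "emeasure ?N W = 1"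
  proof -
    have pm: "path_of \<in> ?N \<rightarrow>\<^sub>M borel_of (TrajTop D I)" using measurable_path_of by simp
    have "emeasure (distr ?N (borel_of (TrajTop D I)) path_of) A = 1"
      unfolding distr_code_path_of[OF s\<rho>] by (rule A(2))
    then show ?thesis unfolding emeasure_distr[OF pm A'] by (simp add: W_def vimage_def)
  qed
  have AEW: "AE \<omega> in P. \<forall>k. \<omega> k \<in> W"
    unfolding AE_all_countable
  proof
    fix k
    interpret N: prob_space ?N by (rule prob_space_distr[OF measurable_TrajTop_cong[OF s\<rho> measurable_code]])
    have "AE z in distr P borel (\<lambda>\<omega>. \<omega> k). z \<in> W"
      unfolding P(3) using N.AE_in_set_eq_1[of W] NW by (simp add: N.emeasure_eq_measure)
    then show "AE \<omega> in P. \<omega> k \<in> W" by (subst (asm) AE_distr_iff) auto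
  qed
  define G :: "(int \<Rightarrow> real) set" where "G = {\<omega>. \<forall>k. \<omega> k \<in> W \<and> \<beta> (\<omega> k) = \<alpha> (\<omega> (k + 1))}"
  have Gm: "G \<in> sets borel"
  proof -
    have [measurable]: "Measurable.pred borel (\<lambda>\<omega>. \<beta> (\<omega> k) = \<alpha> (\<omega> (k + 1)))" for k :: int
      unfolding pred_def
      by (rule borel_measurable_eq[OF measurable_compose[OF measurable_coord \<beta>m] measurable_compose[OF measurable_coord \<alpha>m]])
    have "{\<omega> \<in> space borel. \<forall>k. \<omega> k \<in> W \<and> \<beta> (\<omega> k) = \<alpha> (\<omega> (k + 1))} \<in> sets (borel :: (int \<Rightarrow> real) measure)" by measurable
    then show ?thesis by (simp add: G_def)
  qed
  have GP: "G \<in> sets P" using Gm P(2) by simp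
  have "AE \<omega> in P. \<omega> \<in> G" using AEW P(4) by eventually_elim (simp add: G_def)
  then have G1: "emeasure P G = 1" by (rule P.emeasure_eq_1_AE[OF GP])
  have Gs: "(\<lambda>k. \<omega> (k + 1)) \<in> G \<longleftrightarrow> \<omega> \<in> G" for \<omega>
  proof
    assume 1: "(\<lambda>k. \<omega> (k + 1)) \<in> G"
    show "\<omega> \<in> G" unfolding G_def
    proof (intro CollectI allI)
      fix k
      show "\<omega> k \<in> W \<and> \<beta> (\<omega> k) = \<alpha> (\<omega> (k + 1))" using 1[unfolded G_def, THEN CollectD, THEN spec, of "k - 1"] by simp
    qed
  qed (simp add: G_def)
  have "weak_solution D \<nu> f UNIV (concat_path s \<omega>)" if "\<omega> \<in> G" for \<omega>
  proof (rule weak_solution_concat_path[OF f s])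
    have Ak: "path_of (\<omega> k) \<in> A" for k using that by (simp add: G_def W_def)
    show "weak_solution D \<nu> f (interior I) (path_of (\<omega> k))" for k by (rule ws[OF Ak])
    show "energy_ineq \<nu> f (path_of (\<omega> k)) s t" if "s < t" for k t by (rule en[OF Ak that])
    show "hcode (path_of (\<omega> k) (s + 1)) = hcode (path_of (\<omega> (k + 1)) s)" for k
      using that by (simp add: G_def \<alpha>_def \<beta>_def)
  qed
  then show ?thesis by (rule that[OF P(1,2,3,5) Gm G1 Gs])
qed

text \<open>Off the good set \<open>G\<close> the concatenation may be discontinuous, so it is replaced by zero there.\<close>

definition glued :: "real \<Rightarrow> (int \<Rightarrow> real) set \<Rightarrow> (int \<Rightarrow> real) \<Rightarrow> real \<Rightarrow> field" where
  "glued s G \<omega> t = (if \<omega> \<in> G then concat_path s \<omega> t else (\<lambda>x. 0))"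

lemma glued_shift:
  assumes "\<And>\<omega>. (\<lambda>k. \<omega> (k + 1)) \<in> G \<longleftrightarrow> \<omega> \<in> G"
  shows "glued s G (\<lambda>k. \<omega> (k + 1)) t = glued s G \<omega> (t + 1)"
  unfolding glued_def assms concat_path_shift ..

lemma glued_Hspace:
  assumes "\<And>\<omega>. \<omega> \<in> G \<Longrightarrow> weak_solution D \<nu> f UNIV (concat_path s \<omega>)"
  shows "glued s G \<omega> t \<in> Hspace D" "v \<in> Hspace D \<Longrightarrow> continuous_on UNIV (\<lambda>t. inner_H D (glued s G \<omega> t) v)"
  using weak_solutionD(1,2)[OF assms] zero_in_Hspace[OF dom] by (cases "\<omega> \<in> G"; simp add: glued_def)+

lemma glued_Traj:
  assumes "\<And>\<omega>. \<omega> \<in> G \<Longrightarrow> weak_solution D \<nu> f UNIV (concat_path s \<omega>)"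
  shows "(\<lambda>t. glued s G \<omega> (t + \<theta>)) \<in> Traj D I"
proof -
  have "continuous_on I (\<lambda>t. inner_H D (glued s G \<omega> (t + \<theta>)) v)" if "v \<in> Hspace D" for v
    using continuous_on_compose2[OF glued_Hspace(2)[where G=G and \<nu>=\<nu> and f=f and s=s, OF assms that], of I "\<lambda>t. t + \<theta>"]
    by (simp add: continuous_on_add)
  then show ?thesis using glued_Hspace(1)[where G=G and \<nu>=\<nu> and f=f and s=s, OF assms] by (simp add: Traj_def)
qed

lemma measurable_glued:
  assumes G[measurable]: "G \<in> sets borel" and s: "s \<in> I"
  shows "(\<lambda>\<omega>. glued s G \<omega> r) \<in> borel \<rightarrow>\<^sub>M borel_of (Hw D)"
  unfolding glued_def concat_path_def
proof (rule measurable_If)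
  have r: "s + (r - real_of_int \<lfloor>r\<rfloor>) \<in> I" by (rule I_up[OF s]) simp
  show "(\<lambda>\<omega>. path_of (\<omega> \<lfloor>r\<rfloor>) (s + (r - real_of_int \<lfloor>r\<rfloor>))) \<in> borel \<rightarrow>\<^sub>M borel_of (Hw D)"
    by (rule measurable_compose[OF measurable_coord measurable_compose[OF measurable_path_of measurable_eval[OF r]]])
  show "(\<lambda>\<omega>. \<lambda>x. 0) \<in> borel \<rightarrow>\<^sub>M borel_of (Hw D)"
    by (rule measurable_const) (simp add: space_borel_of topspace_Hw zero_in_Hspace[OF dom])
qed (use G in simp)

lemma distr_glued:
  assumes s\<rho>: "sets \<rho> = sets (borel_of (TrajTop D I))" and P: "prob_space P" "sets P = sets borel"
    and marg: "distr P borel (\<lambda>\<omega>. \<omega> \<lfloor>r\<rfloor>) = distr \<rho> borel code"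
    and G: "G \<in> sets borel" "emeasure P G = 1" and s: "s \<in> I"
  shows "distr P (borel_of (Hw D)) (\<lambda>\<omega>. glued s G \<omega> r) = proj_measure D (s + (r - real_of_int \<lfloor>r\<rfloor>)) \<rho>"
proof -
  interpret P: prob_space P by fact
  let ?r = "s + (r - real_of_int \<lfloor>r\<rfloor>)"
  have r: "?r \<in> I" by (rule I_up[OF s]) simp
  have em: "(\<lambda>z. path_of z ?r) \<in> borel \<rightarrow>\<^sub>M borel_of (Hw D)"
    by (rule measurable_compose[OF measurable_path_of measurable_eval[OF r]])
  have cm: "(\<lambda>\<omega>. \<omega> \<lfloor>r\<rfloor>) \<in> borel_measurable P" using P(2) measurable_coord measurable_cong_sets[OF P(2) refl] by blast
  have "distr P (borel_of (Hw D)) (\<lambda>\<omega>. glued s G \<omega> r) = distr P (borel_of (Hw D)) (\<lambda>\<omega>. path_of (\<omega> \<lfloor>r\<rfloor>) ?r)"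
  proof (rule distr_cong_AE[OF refl refl])
    have "AE \<omega> in P. \<omega> \<in> G" using P.AE_in_set_eq_1[of G] G P(2) by (simp add: P.emeasure_eq_measure)
    then show "AE \<omega> in P. glued s G \<omega> r = path_of (\<omega> \<lfloor>r\<rfloor>) ?r" by eventually_elim (simp add: glued_def concat_path_def)
    show "(\<lambda>\<omega>. glued s G \<omega> r) \<in> P \<rightarrow>\<^sub>M borel_of (Hw D)"
      using measurable_glued[OF G(1) s] measurable_cong_sets[OF P(2) refl] by blast
    show "(\<lambda>\<omega>. path_of (\<omega> \<lfloor>r\<rfloor>) ?r) \<in> P \<rightarrow>\<^sub>M borel_of (Hw D)" by (rule measurable_compose[OF cm em])
  qed
  also have "\<dots> = distr (distr P borel (\<lambda>\<omega>. \<omega> \<lfloor>r\<rfloor>)) (borel_of (Hw D)) (\<lambda>z. path_of z ?r)"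
    using distr_distr[OF em cm] by (simp add: o_def)
  also have "\<dots> = proj_measure D ?r \<rho>"
    unfolding marg proj_measure_def by (rule distr_code_path_of_compose[OF s\<rho> measurable_eval[OF r]])
  finally show ?thesis .
qed

text \<open>For each \<open>\<omega>\<close> the path is weakly continuous on the whole line, being
  zero off \<open>G\<close> and a solution on \<open>G\<close>; so joint measurability in chain and
  phase follows by the Caratheodory argument.\<close>

lemma measurable_glued_shift:
  assumes G: "G \<in> sets borel" and s: "s \<in> I"
    and ws: "\<And>\<omega>. \<omega> \<in> G \<Longrightarrow> weak_solution D \<nu> f UNIV (concat_path s \<omega>)"
  shows "(\<lambda>x t. glued s G (fst x) (t + snd x)) \<in> borel \<Otimes>\<^sub>M borel \<rightarrow>\<^sub>M borel_of (TrajTop D I)"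
proof (rule measurable_TrajI)
  show "(\<lambda>t. glued s G (fst x) (t + snd x)) \<in> Traj D I" for x by (rule glued_Traj[OF ws])
  fix t k
  show "(\<lambda>x. inner_H D (glued s G (fst x) (t + snd x)) (dense_seq D k)) \<in> borel_measurable (borel \<Otimes>\<^sub>M borel)"
  proof (rule caratheodory_measurable[where g="\<lambda>\<omega> \<theta>. inner_H D (glued s G \<omega> (t + \<theta>)) (dense_seq D k)"])
    show "(\<lambda>\<omega>. inner_H D (glued s G \<omega> (t + \<theta>)) (dense_seq D k)) \<in> borel_measurable borel" for \<theta>
      by (rule measurable_compose[OF measurable_glued[OF G s] measurable_inner_Hw[OF v_in]])
    show "continuous_on UNIV (\<lambda>\<theta>. inner_H D (glued s G \<omega> (t + \<theta>)) (dense_seq D k))" for \<omega>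
      using continuous_on_compose2[OF glued_Hspace(2)[where G=G and \<nu>=\<nu> and f=f and s=s, OF ws v_in], of UNIV "\<lambda>\<theta>. t + \<theta>"]
      by (simp add: continuous_on_add)
  qed
qed

end

section \<open>The stationary measure and its carrier\<close>

lemma admissible_psi_measurable:
  assumes "admissible_psi \<psi>"
  shows "(\<lambda>x. \<psi> (max 0 x)) \<in> borel_measurable borel"
proof (rule borel_measurable_continuous_onI)
  obtain \<psi>' where "\<And>x. x \<ge> 0 \<Longrightarrow> (\<psi> has_real_derivative \<psi>' x) (at x within {0..})"
    using assms unfolding admissible_psi_def by blast
  then have "continuous_on {0..} \<psi>" by (intro DERIV_continuous_on) auto
  then show "continuous_on UNIV (\<lambda>x. \<psi> (max 0 x))"
    by (rule continuous_on_compose2) (auto intro!: continuous_intros)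
qed

context ns_traj
begin

text \<open>Conditions (ii) and (iii) integrate functions of \<open>u t\<close> at one time each, so
  they are inherited with the marginals; only a carrier of weak solutions has to be supplied
  anew.\<close>

lemma VF_measure_marginal_cong:
  assumes VF: "VF_measure D \<nu> f I \<rho>" and s\<rho>: "sets \<rho>' = sets (borel_of (TrajTop D I))" and p: "prob_space \<rho>'"
    and E: "E \<in> sets \<rho>'" "E \<subseteq> Usharp D \<nu> f I" "emeasure \<rho>' E = 1"
    and marg: "\<And>t. t \<in> I \<Longrightarrow> proj_measure D t \<rho>' = proj_measure D t \<rho>"
  shows "VF_measure D \<nu> f I \<rho>'"
proof -
  note V = VF[unfolded VF_measure_def]
  have s\<rho>0: "sets \<rho> = sets (borel_of (TrajTop D I))" using V by blast
  have eq: "(\<integral>\<^sup>+u. F (u t) \<partial>\<rho>') = (\<integral>\<^sup>+u. F (u t) \<partial>\<rho>)" if "t \<in> I" "F \<in> borel_measurable (borel_of (Hw D))" for F t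
    using nn_integral_eval[OF s\<rho> that] nn_integral_eval[OF s\<rho>0 that] marg[OF that(1)] by simp
  have nm: "(\<lambda>h. ennreal ((norm_H D h)\<^sup>2)) \<in> borel_measurable (borel_of (Hw D))" using measurable_norm_Hw by measurable
  show ?thesis unfolding VF_measure_def
  proof (intro conjI)
    show "\<exists>E\<in>sets \<rho>'. E \<subseteq> Usharp D \<nu> f I \<and> emeasure \<rho>' E = 1" using E by blast
    show "(\<lambda>t. \<integral>\<^sup>+ u. ennreal ((norm_H D (u t))\<^sup>2) \<partial>\<rho>') \<in> borel_measurable (lebesgue_on I)"
      by (subst measurable_cong[where g="\<lambda>t. \<integral>\<^sup>+ u. ennreal ((norm_H D (u t))\<^sup>2) \<partial>\<rho>"])
        (use eq[OF _ nm] V in \<open>auto simp: space_restrict_space\<close>)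
    show "\<forall>K. compact K \<and> K \<subseteq> I \<longrightarrow> (\<exists>C. AE t in lebesgue_on K. (\<integral>\<^sup>+ u. ennreal ((norm_H D (u t))\<^sup>2) \<partial>\<rho>') \<le> ennreal C)"
    proof (intro allI impI)
      fix K assume K: "compact K \<and> K \<subseteq> I"
      obtain C where C: "AE t in lebesgue_on K. (\<integral>\<^sup>+ u. ennreal ((norm_H D (u t))\<^sup>2) \<partial>\<rho>) \<le> ennreal C"
        using V[THEN conjunct2, THEN conjunct2, THEN conjunct2, THEN conjunct2, THEN conjunct1, THEN spec, THEN mp, OF K] ..
      have "AE t in lebesgue_on K. (\<integral>\<^sup>+ u. ennreal ((norm_H D (u t))\<^sup>2) \<partial>\<rho>') \<le> ennreal C"
        using C AE_space
      proof eventually_elim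
        case (elim t)
        then have "t \<in> I" using K by (auto simp: space_restrict_space)
        then show ?case using elim eq[OF _ nm, of t] by simp
      qed
      then show "\<exists>C. AE t in lebesgue_on K. (\<integral>\<^sup>+ u. ennreal ((norm_H D (u t))\<^sup>2) \<partial>\<rho>') \<le> ennreal C" ..
    qed
    show "\<forall>t0\<in>I. (\<forall>t\<in>I. t0 \<le> t) \<longrightarrow> (\<forall>\<psi>. admissible_psi \<psi> \<longrightarrow>
        ((\<lambda>t. \<integral>\<^sup>+ u. ennreal (\<psi> ((norm_H D (u t))\<^sup>2)) \<partial>\<rho>')
           \<longlongrightarrow> (\<integral>\<^sup>+ u. ennreal (\<psi> ((norm_H D (u t0))\<^sup>2)) \<partial>\<rho>')) (at_right t0) \<and>
        (\<integral>\<^sup>+ u. ennreal (\<psi> ((norm_H D (u t0))\<^sup>2)) \<partial>\<rho>') < \<infinity>)"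
    proof (rule ballI, rule impI, rule allI, rule impI)
      fix t0 \<psi> assume t0: "t0 \<in> I" "\<forall>t\<in>I. t0 \<le> t" and \<psi>: "admissible_psi \<psi>"
      have "(\<lambda>h. ennreal (\<psi> (max 0 ((norm_H D h)\<^sup>2)))) \<in> borel_measurable (borel_of (Hw D))"
        by (intro measurable_compose[OF _ measurable_ennreal] measurable_compose[OF _ admissible_psi_measurable[OF \<psi>]]
            borel_measurable_power measurable_norm_Hw)
      then have pm: "(\<lambda>h. ennreal (\<psi> ((norm_H D h)\<^sup>2))) \<in> borel_measurable (borel_of (Hw D))" by simp
      have l: "((\<lambda>t. \<integral>\<^sup>+ u. ennreal (\<psi> ((norm_H D (u t))\<^sup>2)) \<partial>\<rho>)
           \<longlongrightarrow> (\<integral>\<^sup>+ u. ennreal (\<psi> ((norm_H D (u t0))\<^sup>2)) \<partial>\<rho>)) (at_right t0)"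
        and fin: "(\<integral>\<^sup>+ u. ennreal (\<psi> ((norm_H D (u t0))\<^sup>2)) \<partial>\<rho>) < \<infinity>"
        using V t0 \<psi> by blast+
      have ev: "\<forall>\<^sub>F t in at_right t0. (\<integral>\<^sup>+ u. ennreal (\<psi> ((norm_H D (u t))\<^sup>2)) \<partial>\<rho>') = (\<integral>\<^sup>+ u. ennreal (\<psi> ((norm_H D (u t))\<^sup>2)) \<partial>\<rho>)"
        using eventually_at_right_less[of t0]
      proof eventually_elim
        case (elim t)
        then show ?case using I_up[OF t0(1), of t] by (intro eq[OF _ pm]) auto
      qed
      show "((\<lambda>t. \<integral>\<^sup>+ u. ennreal (\<psi> ((norm_H D (u t))\<^sup>2)) \<partial>\<rho>')
           \<longlongrightarrow> (\<integral>\<^sup>+ u. ennreal (\<psi> ((norm_H D (u t0))\<^sup>2)) \<partial>\<rho>')) (at_right t0) \<and>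
        (\<integral>\<^sup>+ u. ennreal (\<psi> ((norm_H D (u t0))\<^sup>2)) \<partial>\<rho>') < \<infinity>"
        unfolding tendsto_cong[OF ev] eq[OF t0(1) pm] using l fin by blast
    qed
  qed (use s\<rho> p in auto)
qed

text \<open>Condition (ii) bounds the mean energy at almost every time only. An interval of positive
  length contains a good time, and constant marginals make one such time enough.\<close>

lemma VF_finite_energy:
  assumes VF: "VF_measure D \<nu> f I \<rho>"
  obtains t where "t \<in> I" "(\<integral>\<^sup>+u. ennreal ((norm_H D (u t))\<^sup>2) \<partial>\<rho>) < \<infinity>"
proof -
  obtain a where a: "a \<in> I" using I_nonempty by blast
  have sub: "{a..a + 1} \<subseteq> I" by (rule Icc_subset[OF a])
  obtain C where C: "AE t in lebesgue_on {a..a + 1}. (\<integral>\<^sup>+u. ennreal ((norm_H D (u t))\<^sup>2) \<partial>\<rho>) \<le> ennreal C"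
    using VF sub unfolding VF_measure_def by blast
  have "emeasure (lebesgue_on {a..a + 1}) (space (lebesgue_on {a..a + 1})) = 1"
    by (simp add: space_restrict_space emeasure_restrict_space)
  then have "ae_filter (lebesgue_on {a..a + 1}) \<noteq> bot" unfolding Measure_Space.ae_filter_eq_bot_iff by simp
  moreover have "AE t in lebesgue_on {a..a + 1}. t \<in> I \<and> (\<integral>\<^sup>+u. ennreal ((norm_H D (u t))\<^sup>2) \<partial>\<rho>) < \<infinity>"
    using C AE_space
  proof eventually_elim
    case (elim t)
    then show ?case using sub by (auto simp: space_restrict_space intro: le_less_trans)
  qed
  ultimately show ?thesis using eventually_happens' that by blast
qed

lemma stationary_VF_measure:
  assumes f: "f \<in> Hspace D" and VF: "VF_measure D \<nu> f I \<rho>"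
    and marg: "\<And>a b. a \<in> I \<Longrightarrow> b \<in> I \<Longrightarrow> proj_measure D a \<rho> = proj_measure D b \<rho>"
  shows "\<exists>\<rho>'. VF_measure D \<nu> f I \<rho>' \<and> invariant_measure \<rho>' \<and> (\<forall>t\<in>I. proj_measure D t \<rho> = proj_measure D t \<rho>')"
proof -
  obtain E0 where s\<rho>: "sets \<rho> = sets (borel_of (TrajTop D I))" and p: "prob_space \<rho>"
    and E0: "E0 \<in> sets \<rho>" "E0 \<subseteq> Usharp D \<nu> f I" "emeasure \<rho> E0 = 1"
    using VF unfolding VF_measure_def by blast
  interpret \<rho>: prob_space \<rho> by (rule p)
  obtain a where a: "a \<in> I" using I_nonempty by blast
  \<comment> \<open>Gluing needs an interior time, since the trajectories are known to be solutions
    only on the interior of \<open>I\<close>.\<close>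
  define s where "s = a + 1"
  have s: "s \<in> interior I"
  proof -
    have "{a<..} \<subseteq> interior I" using I_up[OF a] by (intro interior_maximal) auto
    then show ?thesis by (auto simp: s_def)
  qed
  have sI: "s \<in> I" using s interior_subset by blast
  obtain t0 where fin: "t0 \<in> I" "(\<integral>\<^sup>+u. ennreal ((norm_H D (u t0))\<^sup>2) \<partial>\<rho>) < \<infinity>" using VF_finite_energy[OF VF] .
  obtain A where A: "A \<in> sets \<rho>" "emeasure \<rho> A = 1"
    "\<And>u t. u \<in> A \<Longrightarrow> weak_solution D \<nu> f (interior I) u \<Longrightarrow> s < t \<Longrightarrow> energy_ineq \<nu> f u s t"
    using energy_from_time[OF s\<rho> p marg fin s f] by metis
  have "AE u in \<rho>. u \<in> E0" "AE u in \<rho>. u \<in> A"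
    using \<rho>.AE_in_set_eq_1[of E0] \<rho>.AE_in_set_eq_1[of A] A E0 by (simp_all add: \<rho>.emeasure_eq_measure)
  then have "AE u in \<rho>. u \<in> E0 \<inter> A" by eventually_elim simp
  then have A1: "E0 \<inter> A \<in> sets \<rho>" "emeasure \<rho> (E0 \<inter> A) = 1"
    using A(1) E0(1) by (auto intro: \<rho>.emeasure_eq_1_AE)
  have A2: "weak_solution D \<nu> f (interior I) u" if "u \<in> E0 \<inter> A" for u using that E0(2) by (auto simp: Usharp_def)
  have A3: "energy_ineq \<nu> f u s t" if "u \<in> E0 \<inter> A" "s < t" for u t using A(3) A2 that by blast
  obtain P :: "(int \<Rightarrow> real) measure" and G where P: "prob_space P" "sets P = sets borel"
    "\<And>k. distr P borel (\<lambda>\<omega>. \<omega> k) = distr \<rho> borel code" "distr P borel (\<lambda>\<omega> k. \<omega> (k + 1)) = P"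
    and G: "G \<in> sets borel" "emeasure P G = 1" "\<And>\<omega>. (\<lambda>k. \<omega> (k + 1)) \<in> G \<longleftrightarrow> \<omega> \<in> G"
    and ws: "\<And>\<omega>. \<omega> \<in> G \<Longrightarrow> weak_solution D \<nu> f UNIV (concat_path s \<omega>)"
  proof (rule stationary_gluing[OF s\<rho> p marg s f A1 A2 A3], goal_cases)
    case (6 P G)
    from 6(2-) show ?case by (rule 6(1))
  qed assumption+
  interpret P: prob_space P by (rule P(1))
  interpret U: prob_space unif by (rule prob_space_unif)
  interpret PU: pair_prob_space P unif ..
  let ?M = "P \<Otimes>\<^sub>M unif"
  have spP: "space P = UNIV" using sets_eq_imp_space_eq[OF P(2)] by simp
  have sM: "sets ?M = sets (borel \<Otimes>\<^sub>M borel)" by (intro sets_pair_measure_cong P(2)) simp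
  have spM: "space ?M = UNIV" by (simp add: space_pair_measure spP)
  define \<Phi> where "\<Phi> = (\<lambda>(x :: (int \<Rightarrow> real) \<times> real) t. glued s G (fst x) (t + snd x))"
  have \<Phi>B: "\<Phi> \<in> borel \<Otimes>\<^sub>M borel \<rightarrow>\<^sub>M borel_of (TrajTop D I)"
    unfolding \<Phi>_def by (rule measurable_glued_shift[OF G(1) sI ws])
  have \<Phi>m: "\<Phi> \<in> ?M \<rightarrow>\<^sub>M borel_of (TrajTop D I)" using \<Phi>B measurable_cong_sets[OF sM refl] by blast
  have gT: "(\<lambda>t. glued s G \<omega> (t + \<theta>)) \<in> Traj D I" for \<omega> \<theta> by (rule glued_Traj[OF ws])
  then have \<Phi>T: "\<Phi> x \<in> Traj D I" for x unfolding \<Phi>_def .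
  define \<rho>' where "\<rho>' = distr ?M (borel_of (TrajTop D I)) \<Phi>"
  have s\<rho>': "sets \<rho>' = sets (borel_of (TrajTop D I))" by (simp add: \<rho>'_def)
  have p': "prob_space \<rho>'" unfolding \<rho>'_def by (rule PU.prob_space_distr[OF \<Phi>m])
  \<comment> \<open>Probability that the glued path with fixed phase \<open>r\<close> lies in
    \<open>E\<close>; \<open>\<rho>'\<close> is its mean over the phase.\<close>
  define g where "g E r = emeasure P {\<omega>. (\<lambda>t. glued s G \<omega> (t + r)) \<in> E}" for E r
  have vim: "{x. \<Phi> x \<in> E} \<in> sets ?M" if "E \<in> sets (borel_of (TrajTop D I))" for E
    using measurable_sets[OF \<Phi>m that] by (simp add: spM vimage_def)
  have gint: "emeasure \<rho>' E = (\<integral>\<^sup>+\<theta>. g E \<theta> \<partial>unif)" if E: "E \<in> sets (borel_of (TrajTop D I))" for E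
  proof -
    have "emeasure \<rho>' E = emeasure ?M {x. \<Phi> x \<in> E}"
      unfolding \<rho>'_def emeasure_distr[OF \<Phi>m E] by (simp add: spM vimage_def)
    also have "\<dots> = (\<integral>\<^sup>+\<theta>. g E \<theta> \<partial>unif)"
      using PU.emeasure_pair_measure_alt2[OF vim[OF E]] by (simp add: g_def \<Phi>_def vimage_def)
    finally show ?thesis .
  qed
  have gm: "g E \<in> borel_measurable borel" if E: "E \<in> sets (borel_of (TrajTop D I))" for E
  proof -
    have "(\<lambda>\<theta>. emeasure P ((\<lambda>\<omega>. (\<omega>, \<theta>)) -` {x. \<Phi> x \<in> E})) \<in> borel_measurable unif"
      by (rule PU.measurable_emeasure_Pair2[OF vim[OF E]])
    moreover have "(\<lambda>\<theta>. emeasure P ((\<lambda>\<omega>. (\<omega>, \<theta>)) -` {x. \<Phi> x \<in> E})) = g E" by (simp add: g_def \<Phi>_def vimage_def fun_eq_iff)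
    ultimately show ?thesis by simp
  qed
  \<comment> \<open>Moving the phase by one amounts to moving the chain by one index, under which
    \<open>P\<close> is invariant.\<close>
  have gper: "g E (r + 1) = g E r" if E: "E \<in> sets (borel_of (TrajTop D I))" for E r
  proof -
    have sh: "(\<lambda>\<omega> k. \<omega> (k + 1)) \<in> P \<rightarrow>\<^sub>M (borel :: (int \<Rightarrow> real) measure)"
      unfolding measurable_cong_sets[OF P(2) refl]
      by (rule measurable_coordinatewise_then_product) (rule measurable_coord)
    have S: "{\<omega>. (\<lambda>t. glued s G \<omega> (t + r)) \<in> E} \<in> sets borel"
    proof -
      have "(\<lambda>\<omega>. (\<omega>, r)) \<in> borel \<rightarrow>\<^sub>M (borel :: (int \<Rightarrow> real) measure) \<Otimes>\<^sub>M borel" by measurable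
      from measurable_sets[OF measurable_compose[OF this \<Phi>B] E] show ?thesis by (simp add: \<Phi>_def vimage_def)
    qed
    have "g E r = emeasure (distr P borel (\<lambda>\<omega> k. \<omega> (k + 1))) {\<omega>. (\<lambda>t. glued s G \<omega> (t + r)) \<in> E}"
      unfolding P(4) g_def ..
    also have "\<dots> = g E (r + 1)"
      unfolding emeasure_distr[OF sh S] g_def by (simp add: vimage_def spP glued_shift[OF G(3)] add.assoc)
    finally show ?thesis by simp
  qed
  have inv: "invariant_measure \<rho>'"
    unfolding invariant_measure_def
  proof (intro allI impI ballI)
    fix \<tau> :: real and E assume \<tau>: "\<tau> \<ge> 0" and "E \<in> sets \<rho>'"
    then have E: "E \<in> sets (borel_of (TrajTop D I))" by (simp add: s\<rho>')
    let ?E = "{u \<in> space \<rho>'. (\<lambda>t. u (t + \<tau>)) \<in> E}"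
    have E': "?E \<in> sets (borel_of (TrajTop D I))"
      using measurable_sets[OF measurable_TrajTop_cong[OF s\<rho>' measurable_shift[OF \<tau>]] E]
      by (simp add: s\<rho>' vimage_def Int_def conj_commute)
    have "g ?E \<theta> = g E (\<theta> + \<tau>)" for \<theta>
      using gT unfolding g_def space_TrajTop_measure[OF s\<rho>'] by (simp add: add.assoc add.commute[of \<tau> \<theta>])
    then have "emeasure \<rho>' ?E = (\<integral>\<^sup>+\<theta>. g E (\<theta> + \<tau>) \<partial>unif)" by (simp add: gint[OF E'])
    also have "\<dots> = emeasure \<rho>' E" unfolding gint[OF E] by (rule nn_integral_unif_periodic[OF gm[OF E] gper[OF E]])
    finally show "emeasure \<rho>' ?E = emeasure \<rho>' E" .
  qed
  have marg': "proj_measure D t \<rho>' = proj_measure D t \<rho>" if t: "t \<in> I" for t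
  proof (rule measure_eqI)
    fix B assume "B \<in> sets (proj_measure D t \<rho>')"
    then have B: "B \<in> sets (borel_of (Hw D))" by (simp add: proj_measure_def)
    let ?E = "(\<lambda>u. u t) -` B \<inter> Traj D I"
    have E: "?E \<in> sets (borel_of (TrajTop D I))"
      using measurable_sets[OF measurable_eval[OF t] B] by (simp add: space_borel_of topspace_TrajTop)
    \<comment> \<open>For every phase the position at \<open>t\<close> has the marginal law of
      \<open>\<rho>\<close> at some time of [s, s + 1), which by constancy is the one at
      \<open>t\<close>.\<close>
    have "g ?E \<theta> = emeasure (proj_measure D t \<rho>) B" for \<theta>
    proof -
      let ?r = "s + (t + \<theta> - real_of_int \<lfloor>t + \<theta>\<rfloor>)"
      have r: "?r \<in> I" by (rule I_up[OF sI]) simp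
      have gm': "(\<lambda>\<omega>. glued s G \<omega> (t + \<theta>)) \<in> P \<rightarrow>\<^sub>M borel_of (Hw D)"
        using measurable_glued[OF G(1) sI] measurable_cong_sets[OF P(2) refl] by blast
      have "g ?E \<theta> = emeasure P {\<omega>. glued s G \<omega> (t + \<theta>) \<in> B}"
        unfolding g_def using gT by simp
      also have "\<dots> = emeasure (distr P (borel_of (Hw D)) (\<lambda>\<omega>. glued s G \<omega> (t + \<theta>))) B"
        unfolding emeasure_distr[OF gm' B] by (simp add: spP vimage_def)
      also have "\<dots> = emeasure (proj_measure D t \<rho>) B"
        unfolding distr_glued[OF s\<rho> P(1,2,3) G(1,2) sI] marg[OF r t] ..
      finally show ?thesis .
    qed
    then have "(\<integral>\<^sup>+\<theta>. g ?E \<theta> \<partial>unif) = (\<integral>\<^sup>+\<theta>. emeasure (proj_measure D t \<rho>) B \<partial>unif)" by (intro nn_integral_cong)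
    also have "\<dots> = emeasure (proj_measure D t \<rho>) B" using U.emeasure_space_1 by simp
    finally have "emeasure \<rho>' ?E = emeasure (proj_measure D t \<rho>) B" unfolding gint[OF E] .
    then show "emeasure (proj_measure D t \<rho>') B = emeasure (proj_measure D t \<rho>) B"
      unfolding proj_measure_def
      by (subst emeasure_distr[OF measurable_TrajTop_cong[OF s\<rho>' measurable_eval[OF t]] B])
        (simp add: space_TrajTop_measure[OF s\<rho>'])
  qed (simp add: proj_measure_def)
  \<comment> \<open>Neither the image of \<open>G\<close> under gluing nor \<open>Usharp\<close> is
    known to be Borel. A Borel set \<open>C\<close> of full measure inside the image in coordinate
    space is pulled back instead; each trajectory with coordinates in \<open>C\<close> agrees up to
    null sets with a shifted concatenation over a point of \<open>G\<close>, hence is a weak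
    solution.\<close>
  obtain E where E: "E \<in> sets \<rho>'" "E \<subseteq> Usharp D \<nu> f I" "emeasure \<rho>' E = 1"
  proof -
    have sM': "sets ?M = sets borel" unfolding sM borel_prod ..
    have cm: "(\<lambda>x. coords (\<Phi> x)) \<in> borel_measurable borel"
      using measurable_compose[OF \<Phi>B measurable_coords] unfolding borel_prod .
    have GU: "G \<times> UNIV \<in> sets (borel :: ((int \<Rightarrow> real) \<times> real) measure)"
      unfolding borel_prod[symmetric] using G(1) by (intro pair_measureI) auto
    have GP: "G \<in> sets P" using G(1) P(2) by simp
    have "emeasure ?M (G \<times> UNIV) = emeasure P G * emeasure unif UNIV"
      by (rule U.emeasure_pair_measure_Times[OF GP]) simp
    then have GU1: "emeasure ?M (G \<times> UNIV) = 1" using G(2) U.emeasure_space_1 by simp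
    obtain C where C: "C \<in> sets borel" "C \<subseteq> (\<lambda>x. coords (\<Phi> x)) ` (G \<times> UNIV)" "emeasure ?M {x. coords (\<Phi> x) \<in> C} = 1"
      by (rule Borel_subset_of_image[OF sM' prob_space_pair[OF P(1) prob_space_unif] cm GU GU1])
    let ?E = "coords -` C \<inter> Traj D I"
    have Em: "?E \<in> sets (borel_of (TrajTop D I))"
      using measurable_sets[OF measurable_coords C(1)] by (simp add: space_borel_of topspace_TrajTop)
    have "emeasure \<rho>' ?E = emeasure ?M {x. coords (\<Phi> x) \<in> C}"
      unfolding \<rho>'_def emeasure_distr[OF \<Phi>m Em] using \<Phi>T by (simp add: vimage_def spM)
    then have E1: "emeasure \<rho>' ?E = 1" using C(3) by simp
    have "u \<in> Usharp D \<nu> f I" if u: "u \<in> ?E" for u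
    proof -
      obtain \<omega> \<theta> where x: "\<omega> \<in> G" "coords u = coords (\<Phi> (\<omega>, \<theta>))" using u C(2) by fastforce
      have uT: "u \<in> Traj D I" using u by simp
      note W = weak_solutionD[OF ws[OF x(1)]]
      have cf: "continuous_on UNIV (\<lambda>t. inner_H D f (concat_path s \<omega> t))"
        using continuous_on_f_inner[OF f, of UNIV "concat_path s \<omega>"] W(1,2) by blast
      have "weak_solution D \<nu> f {t. t + \<theta> \<in> UNIV} (\<lambda>t. concat_path s \<omega> (t + \<theta>))"
        by (rule weak_solution_shift[OF ws[OF x(1)] open_UNIV is_interval_univ])
          (rule borel_measurable_integrable[OF continuous_imp_integrable_real[OF continuous_on_subset[OF cf subset_UNIV]]])
      then have "weak_solution D \<nu> f UNIV (\<Phi> (\<omega>, \<theta>))" using x(1) by (simp add: \<Phi>_def glued_def)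
      then have "weak_solution D \<nu> f (interior I) (\<Phi> (\<omega>, \<theta>))" by (rule weak_solution_restrict) simp
      then have "weak_solution D \<nu> f (interior I) u"
      proof (rule weak_solution_cong[OF _ _ f is_interval_interior])
        fix t assume "t \<in> interior I"
        then have t: "t \<in> I" using interior_subset by blast
        show "fld_eq (\<Phi> (\<omega>, \<theta>) t) (u t)"
          by (rule traj_eq_fld_eq[OF \<Phi>T uT traj_eq_of_coords[OF \<Phi>T uT x(2)[symmetric]] t])
      qed
      then show ?thesis using uT by (simp add: Usharp_def)
    qed
    then show ?thesis using that[of ?E] Em E1 s\<rho>' by blast
  qed
  have "VF_measure D \<nu> f I \<rho>'" by (rule VF_measure_marginal_cong[OF VF s\<rho>' p' E marg'])
  then show ?thesis using inv marg' by metis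
qed

end

theorem theorem4p1:
  fixes D :: ns_dom and \<nu> :: real and f :: field and I :: "real set"
    and \<rho> :: "(real \<Rightarrow> field) measure"
  assumes "admissible_dom D" and "\<nu> > 0" and "f \<in> Hspace D"
    and "is_interval I" and "I \<noteq> {}" and "\<forall>t\<in>I. \<forall>s. t \<le> s \<longrightarrow> s \<in> I"
    and "VF_measure D \<nu> f I \<rho>"
    and "\<forall>s\<in>I. \<forall>t\<in>I. proj_measure D s \<rho> = proj_measure D t \<rho>"
  shows "\<exists>\<rho>'. VF_measure D \<nu> f I \<rho>' \<and> invariant_measure \<rho>' \<and>
           (\<forall>t\<in>I. proj_measure D t \<rho> = proj_measure D t \<rho>')"
proof -
  interpret ns_traj D I by unfold_locales (use assms in auto)
  show ?thesis by (rule stationary_VF_measure[OF assms(3,7)]) (use assms(8) in blast)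
qed

end
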